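(* Let $k$ be a field of characteristic $0$, $M$ a finite étale commutative $k$-group scheme, and $$1\to M\to F\to P\to 1$$ an exact sequence of $k$-group schemes with $F$ a flasque $k$-torus and $P$ a quasi-trivial $k$-torus. Set $K:=k(t)$ and let $T$ be a set of discrete valuations of $K$ coming from rational points of $\mathbf{P}^1_k$. Then the quotient $$\Big(\prod_{v \in T} H^1(K_v,M)\Big)\Big/\overline{H^1(K,M)}$$ is infinite under either of the following conditions: (1) the group $H^1(k, F)$ is infinite and $T$ has at least $2$ elements; (2) the group $H^1(k, F)$ is nontrivial and $T$ is infinite.
   Context: A $k$-torus $F$ is flasque if, for a finite Galois extension $L|k$ splitting $F$, its cocharacter group $\check F$ satisfies $H^1(H,\check F)=0$ for every subgroup $H$ of $\mathrm{Gal}(L|k)$. A $k$-torus $P$ is quasi-trivial if its character module is a permutation Galois module. (The group $H^1(k,F)$ does not depend on the choice of such a resolution.) $M$ is regarded over $K$ by base change. $K_v$ is the completion of $K$ at $v$. Each $H^1(K_v,M)$ carries the discrete topology, the product carries the product topology, and $\overline{H^1(K,M)}$ is the closure of the image of $H^1(K,M)$ under the product of restriction maps; equivalently, it is the set of $(\alpha_v)_{v\in T}$ such that for every finite $S\subset T$, $(\alpha_v)_{v\in S}$ lies in the image of $H^1(K,M)\to\prod_{v\in S}H^1(K_v,M)$. *)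

theory Defs
  imports
    "HOL-Computational_Algebra.Computational_Algebra"
    "HOL-Algebra.Algebra"
    "HOL-Algebra.Algebraic_Closure_Type"
    "HOL-Analysis.Function_Topology"
begin

section \<open>Tensor products over a field\<close>

text \<open>
  A commutative algebra over a field (a type \<open>'k\<close>) is a type \<open>'a :: comm_ring_1\<close> together with a
  ring homomorphism \<open>s :: 'k \<Rightarrow> 'a\<close>, its structure map.
\<close>

definition is_ring_hom :: "('a::comm_ring_1 \<Rightarrow> 'b::comm_ring_1) \<Rightarrow> bool" where
  "is_ring_hom f \<longleftrightarrow> f 1 = 1 \<and> (\<forall>x y. f (x + y) = f x + f y) \<and> (\<forall>x y. f (x * y) = f x * f y)"

definition is_alg_hom :: "('k::comm_ring_1 \<Rightarrow> 'a::comm_ring_1) \<Rightarrow> ('k \<Rightarrow> 'b::comm_ring_1) \<Rightarrow> ('a \<Rightarrow> 'b) \<Rightarrow> bool" where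
  "is_alg_hom s s' f \<longleftrightarrow> is_ring_hom f \<and> (\<forall>c. f (s c) = s' c)"

text \<open>
  An element of a tensor product is represented by a formal \<open>\<int>\<close>-linear combination of pairs;
  \<open>A \<otimes> B\<close> is the free abelian group on pairs modulo the following subgroup. The second factor
  may be a subalgebra \<open>Y\<close> of its type (needed for subfields of an algebraic closure); then only
  formal sums supported on \<open>UNIV \<times> Y\<close> are considered.
\<close>

definition tensor_rel ::
  "('k \<Rightarrow> 'a::comm_ring_1) \<Rightarrow> ('k \<Rightarrow> 'b::comm_ring_1) \<Rightarrow> 'b set \<Rightarrow> (('a \<times> 'b) \<Rightarrow>\<^sub>0 int) set" where
  "tensor_rel s s' Y = group_closure
     ({frag_of (x + x', y) - frag_of (x, y) - frag_of (x', y) |x x' y. y \<in> Y} \<union>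
      {frag_of (x, y + y') - frag_of (x, y) - frag_of (x, y') |x y y'. y \<in> Y \<and> y' \<in> Y} \<union>
      {frag_of (s c * x, y) - frag_of (x, s' c * y) |c x y. y \<in> Y})"

definition tensor3_rel ::
  "('k \<Rightarrow> 'a::comm_ring_1) \<Rightarrow> ('k \<Rightarrow> 'b::comm_ring_1) \<Rightarrow> ('k \<Rightarrow> 'c::comm_ring_1) \<Rightarrow>
   (('a \<times> 'b \<times> 'c) \<Rightarrow>\<^sub>0 int) set" where
  "tensor3_rel s s' s'' = group_closure
     ({frag_of (x + x', y, z) - frag_of (x, y, z) - frag_of (x', y, z) |x x' y z. True} \<union>
      {frag_of (x, y + y', z) - frag_of (x, y, z) - frag_of (x, y', z) |x y y' z. True} \<union>
      {frag_of (x, y, z + z') - frag_of (x, y, z) - frag_of (x, y, z') |x y z z'. True} \<union>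
      {frag_of (s c * x, y, z) - frag_of (x, s' c * y, z) |c x y z. True} \<union>
      {frag_of (x, s' c * y, z) - frag_of (x, y, s'' c * z) |c x y z. True})"

definition tensor_mult ::
  "(('a::comm_ring_1 \<times> 'b::comm_ring_1) \<Rightarrow>\<^sub>0 int) \<Rightarrow> (('a \<times> 'b) \<Rightarrow>\<^sub>0 int) \<Rightarrow> (('a \<times> 'b) \<Rightarrow>\<^sub>0 int)" where
  "tensor_mult u v = frag_extend (\<lambda>(a, b). frag_extend (\<lambda>(c, d). frag_of (a * c, b * d)) v) u"

text \<open>The map \<open>\<Sum> a\<^sub>i \<otimes> b\<^sub>i \<mapsto> \<Sum> \<beta> a\<^sub>i b\<^sub>i\<close>.\<close>

definition tensor_eval :: "('a \<Rightarrow> 'b \<Rightarrow> 'c::comm_ring_1) \<Rightarrow> (('a \<times> 'b) \<Rightarrow>\<^sub>0 int) \<Rightarrow> 'c" where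
  "tensor_eval \<beta> u = (\<Sum>p\<in>Poly_Mapping.keys u. of_int (Poly_Mapping.lookup u p) * \<beta> (fst p) (snd p))"


section \<open>Affine group schemes\<close>

text \<open>
  An affine group scheme over \<open>k\<close> is given by its coordinate ring, a commutative Hopf algebra.
  \<open>comul a\<close> is a formal sum representing the comultiplication of \<open>a\<close> in \<open>A \<otimes>\<^sub>k A\<close>; all
  conditions are imposed modulo \<open>tensor_rel\<close>.
\<close>

record ('k, 'a) hopf =
  strct :: "'k \<Rightarrow> 'a"
  comul :: "'a \<Rightarrow> (('a \<times> 'a) \<Rightarrow>\<^sub>0 int)"
  counit :: "'a \<Rightarrow> 'k"
  antip :: "'a \<Rightarrow> 'a"

definition affine_group_scheme :: "('k::field, 'a::comm_ring_1) hopf \<Rightarrow> bool" where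
  "affine_group_scheme G \<longleftrightarrow>
     (let s = strct G; \<Delta> = comul G; \<epsilon> = counit G; R = tensor_rel s s UNIV in
      is_ring_hom s \<and>
      (\<forall>a b. \<Delta> (a + b) - (\<Delta> a + \<Delta> b) \<in> R) \<and>
      (\<forall>a b. \<Delta> (a * b) - tensor_mult (\<Delta> a) (\<Delta> b) \<in> R) \<and>
      (\<forall>c. \<Delta> (s c) - frag_of (s c, 1) \<in> R) \<and>
      is_alg_hom s id \<epsilon> \<and>
      is_alg_hom s s (antip G) \<and>
      (\<forall>a. frag_extend (\<lambda>(x, y). frag_extend (\<lambda>(x1, x2). frag_of (x1, x2, y)) (\<Delta> x)) (\<Delta> a)
         - frag_extend (\<lambda>(x, y). frag_extend (\<lambda>(y1, y2). frag_of (x, y1, y2)) (\<Delta> y)) (\<Delta> a)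
         \<in> tensor3_rel s s s) \<and>
      (\<forall>a. tensor_eval (\<lambda>x y. s (\<epsilon> x) * y) (\<Delta> a) = a) \<and>
      (\<forall>a. tensor_eval (\<lambda>x y. x * s (\<epsilon> y)) (\<Delta> a) = a) \<and>
      (\<forall>a. tensor_eval (\<lambda>x y. antip G x * y) (\<Delta> a) = s (\<epsilon> a)) \<and>
      (\<forall>a. tensor_eval (\<lambda>x y. x * antip G y) (\<Delta> a) = s (\<epsilon> a)))"

definition commutative_group_scheme :: "('k::field, 'a::comm_ring_1) hopf \<Rightarrow> bool" where
  "commutative_group_scheme G \<longleftrightarrow> affine_group_scheme G \<and>
     (\<forall>a. frag_extend (\<lambda>(x, y). frag_of (y, x)) (comul G a) - comul G a
            \<in> tensor_rel (strct G) (strct G) UNIV)"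

text \<open>A homomorphism \<open>H \<rightarrow> G\<close>, given by the map \<open>\<phi>\<close> from the coordinate ring of \<open>G\<close> to that of \<open>H\<close>.\<close>

definition group_scheme_hom ::
  "('k::field, 'b::comm_ring_1) hopf \<Rightarrow> ('k, 'a::comm_ring_1) hopf \<Rightarrow> ('a \<Rightarrow> 'b) \<Rightarrow> bool" where
  "group_scheme_hom H G \<phi> \<longleftrightarrow> is_alg_hom (strct G) (strct H) \<phi> \<and>
     (\<forall>a. frag_extend (\<lambda>(x, y). frag_of (\<phi> x, \<phi> y)) (comul G a) - comul H (\<phi> a)
            \<in> tensor_rel (strct H) (strct H) UNIV)"

text \<open>
  \<open>1 \<rightarrow> M \<rightarrow> F \<rightarrow> P \<rightarrow> 1\<close> is exact: \<open>F \<rightarrow> P\<close> is a quotient map, i.e. injective on coordinate rings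
  (over a field this is faithful flatness), and \<open>M \<rightarrow> F\<close> is a closed immersion whose image is the
  scheme-theoretic kernel of \<open>F \<rightarrow> P\<close>, cut out in \<open>F\<close> by the augmentation ideal of \<open>P\<close>.
\<close>

definition short_exact ::
  "('k::field, 'm::comm_ring_1) hopf \<Rightarrow> ('k, 'f::comm_ring_1) hopf \<Rightarrow> ('k, 'p::comm_ring_1) hopf \<Rightarrow>
   ('f \<Rightarrow> 'm) \<Rightarrow> ('p \<Rightarrow> 'f) \<Rightarrow> bool" where
  "short_exact M F P i p \<longleftrightarrow>
     group_scheme_hom M F i \<and> group_scheme_hom F P p \<and>
     inj p \<and> surj i \<and>
     {a. i a = 0} = module.span (*) (p ` {b. counit P b = 0})"

text \<open>
  The group of points of \<open>G\<close> in an algebra with structure map \<open>j\<close>. For a field \<open>E\<close> with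
  \<open>\<iota> : k \<rightarrow> E\<close>, the \<open>B\<close>-points of the base change of \<open>G\<close> to \<open>E\<close> are the points of \<open>G\<close> in \<open>B\<close>
  viewed as a \<open>k\<close>-algebra, so base change does not need a separate construction.
\<close>

definition points ::
  "('k::field, 'a::comm_ring_1) hopf \<Rightarrow> ('k \<Rightarrow> 'b::comm_ring_1) \<Rightarrow> ('a \<Rightarrow> 'b) monoid" where
  "points G j =
     \<lparr>carrier = {\<phi>. is_alg_hom (strct G) j \<phi>},
      monoid.mult = (\<lambda>\<phi> \<psi> a. tensor_eval (\<lambda>x y. \<phi> x * \<psi> y) (comul G a)),
      one = (\<lambda>a. j (counit G a))\<rparr>"


section \<open>Galois groups and continuous cohomology in degree one\<close>

text \<open>
  Automorphisms over \<open>k\<close> of a subset \<open>L\<close> (in practice a subfield containing \<open>k\<close>) of the algebraic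
  closure; the absolute Galois group of a field of characteristic \<open>0\<close> is the case \<open>L = UNIV\<close>.
\<close>

definition gal :: "'k::field alg_closure set \<Rightarrow> ('k alg_closure \<Rightarrow> 'k alg_closure) monoid" where
  "gal L = (BijGroup L)
     \<lparr>carrier := {\<sigma> \<in> Bij L.
        (\<forall>x\<in>L. \<forall>y\<in>L. \<sigma> (x + y) = \<sigma> x + \<sigma> y \<and> \<sigma> (x * y) = \<sigma> x * \<sigma> y) \<and>
        (\<forall>c. \<sigma> (to_ac c) = to_ac c)}\<rparr>"

definition krull_topology ::
  "'k::field alg_closure set \<Rightarrow> ('k alg_closure \<Rightarrow> 'k alg_closure) topology" where
  "krull_topology L =
     subtopology (product_topology (\<lambda>_. discrete_topology L) L) (carrier (gal L))"

definition finite_galois :: "'k::field alg_closure set \<Rightarrow> bool" where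
  "finite_galois L \<longleftrightarrow>
     range to_ac \<subseteq> L \<and>
     (\<forall>x\<in>L. \<forall>y\<in>L. x + y \<in> L \<and> x * y \<in> L) \<and> (\<forall>x\<in>L. - x \<in> L \<and> inverse x \<in> L) \<and>
     (\<exists>B. finite B \<and> module.span (\<lambda>c x. to_ac c * x) B = L) \<and>
     {x \<in> L. \<forall>\<sigma>\<in>carrier (gal L). \<sigma> x = x} = range to_ac"

text \<open>Continuous 1-cocycles of a topological group with values in a discrete abelian group.\<close>

definition Z1 ::
  "'g monoid \<Rightarrow> 'g topology \<Rightarrow> 'a monoid \<Rightarrow> ('g \<Rightarrow> 'a \<Rightarrow> 'a) \<Rightarrow> ('g \<Rightarrow> 'a) monoid" where
  "Z1 \<Gamma> \<tau> A act =
     \<lparr>carrier = {c \<in> carrier \<Gamma> \<rightarrow>\<^sub>E carrier A.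
        continuous_map \<tau> (discrete_topology (carrier A)) c \<and>
        (\<forall>g\<in>carrier \<Gamma>. \<forall>h\<in>carrier \<Gamma>. c (g \<otimes>\<^bsub>\<Gamma>\<^esub> h) = c g \<otimes>\<^bsub>A\<^esub> act g (c h))},
      monoid.mult = (\<lambda>c d. \<lambda>g\<in>carrier \<Gamma>. c g \<otimes>\<^bsub>A\<^esub> d g),
      one = (\<lambda>g\<in>carrier \<Gamma>. \<one>\<^bsub>A\<^esub>)\<rparr>"

definition B1 :: "'g monoid \<Rightarrow> 'a monoid \<Rightarrow> ('g \<Rightarrow> 'a \<Rightarrow> 'a) \<Rightarrow> ('g \<Rightarrow> 'a) set" where
  "B1 \<Gamma> A act = {\<lambda>g\<in>carrier \<Gamma>. inv\<^bsub>A\<^esub> a \<otimes>\<^bsub>A\<^esub> act g a |a. a \<in> carrier A}"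

definition H1 ::
  "'g monoid \<Rightarrow> 'g topology \<Rightarrow> 'a monoid \<Rightarrow> ('g \<Rightarrow> 'a \<Rightarrow> 'a) \<Rightarrow> ('g \<Rightarrow> 'a) set monoid" where
  "H1 \<Gamma> \<tau> A act = Z1 \<Gamma> \<tau> A act Mod B1 \<Gamma> A act"

text \<open>Galois cohomology \<open>H\<^sup>1(E, G)\<close> for a field \<open>E\<close> with embedding \<open>\<iota> : k \<rightarrow> E\<close>.\<close>

definition galZ1 ::
  "('k::field \<Rightarrow> 'e::field) \<Rightarrow> ('k, 'a::comm_ring_1) hopf \<Rightarrow>
   (('e alg_closure \<Rightarrow> 'e alg_closure) \<Rightarrow> ('a \<Rightarrow> 'e alg_closure)) monoid" where
  "galZ1 \<iota> G = Z1 (gal UNIV) (krull_topology UNIV) (points G (to_ac \<circ> \<iota>)) (\<lambda>\<sigma> \<phi>. \<sigma> \<circ> \<phi>)"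

definition galB1 ::
  "('k::field \<Rightarrow> 'e::field) \<Rightarrow> ('k, 'a::comm_ring_1) hopf \<Rightarrow>
   (('e alg_closure \<Rightarrow> 'e alg_closure) \<Rightarrow> ('a \<Rightarrow> 'e alg_closure)) set" where
  "galB1 \<iota> G = B1 (gal UNIV) (points G (to_ac \<circ> \<iota>)) (\<lambda>\<sigma> \<phi>. \<sigma> \<circ> \<phi>)"

definition galH1 ::
  "('k::field \<Rightarrow> 'e::field) \<Rightarrow> ('k, 'a::comm_ring_1) hopf \<Rightarrow>
   (('e alg_closure \<Rightarrow> 'e alg_closure) \<Rightarrow> ('a \<Rightarrow> 'e alg_closure)) set monoid" where
  "galH1 \<iota> G = H1 (gal UNIV) (krull_topology UNIV) (points G (to_ac \<circ> \<iota>)) (\<lambda>\<sigma> \<phi>. \<sigma> \<circ> \<phi>)"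

text \<open>
  Restriction \<open>H\<^sup>1(E, G) \<rightarrow> H\<^sup>1(E', G)\<close> along a field embedding \<open>e : E \<rightarrow> E'\<close>, computed with a chosen
  extension of \<open>e\<close> to the algebraic closures. On \<open>H\<^sup>1\<close> the result does not depend on that choice.
\<close>

definition ac_extension :: "('e::field \<Rightarrow> 'f::field) \<Rightarrow> 'e alg_closure \<Rightarrow> 'f alg_closure" where
  "ac_extension e = (SOME t. is_ring_hom t \<and> (\<forall>x. t (to_ac x) = to_ac (e x)))"

definition res_cocycle ::
  "('e::field \<Rightarrow> 'f::field) \<Rightarrow> (('e alg_closure \<Rightarrow> 'e alg_closure) \<Rightarrow> ('a \<Rightarrow> 'e alg_closure)) \<Rightarrow>
   (('f alg_closure \<Rightarrow> 'f alg_closure) \<Rightarrow> ('a \<Rightarrow> 'f alg_closure))" where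
  "res_cocycle e c =
     (\<lambda>\<sigma>\<in>carrier (gal UNIV).
        ac_extension e \<circ> c (inv_into UNIV (ac_extension e) \<circ> \<sigma> \<circ> ac_extension e))"

definition res_H1 ::
  "('e::field \<Rightarrow> 'f::field) \<Rightarrow> ('k::field \<Rightarrow> 'e) \<Rightarrow> ('k, 'a::comm_ring_1) hopf \<Rightarrow>
   (('e alg_closure \<Rightarrow> 'e alg_closure) \<Rightarrow> ('a \<Rightarrow> 'e alg_closure)) set \<Rightarrow>
   (('f alg_closure \<Rightarrow> 'f alg_closure) \<Rightarrow> ('a \<Rightarrow> 'f alg_closure)) set" where
  "res_H1 e \<iota> G C = (\<Union>c\<in>C. galB1 (e \<circ> \<iota>) G #>\<^bsub>galZ1 (e \<circ> \<iota>) G\<^esub> res_cocycle e c)"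


section \<open>Finite etale group schemes, tori, flasque and quasi-trivial tori\<close>

text \<open>A finite algebra is etale if it becomes isomorphic to a power of the algebraic closure.\<close>

definition finite_etale :: "('k::field, 'a::comm_ring_1) hopf \<Rightarrow> bool" where
  "finite_etale G \<longleftrightarrow>
     (\<exists>B. finite B \<and> module.span (\<lambda>c a. strct G c * a) B = UNIV) \<and>
     (\<exists>(n::nat) (\<phi> :: nat \<Rightarrow> 'a \<Rightarrow> 'k alg_closure).
        (\<forall>i<n. is_alg_hom (strct G) to_ac (\<phi> i)) \<and>
        (\<forall>u. (\<forall>i<n. tensor_eval (\<lambda>a l. \<phi> i a * l) u = 0) \<longrightarrow> u \<in> tensor_rel (strct G) to_ac UNIV) \<and>
        (\<forall>y :: nat \<Rightarrow> 'k alg_closure. \<exists>u. \<forall>i<n. tensor_eval (\<lambda>a l. \<phi> i a * l) u = y i))"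

text \<open>
  \<open>S \<Rightarrow>\<^sub>0 R\<close> is the group algebra of \<open>S\<close> over \<open>R\<close>, whose basis elements \<open>x\<^sup>e\<close>, \<open>e \<in> S\<close>, are
  group-like. So a homomorphism of algebras \<open>\<Phi>\<close> from \<open>A\<close> to it respects comultiplications iff,
  comparing the coefficients of \<open>x\<^sup>d \<otimes> x\<^sup>e\<close>, the following holds.
\<close>

definition comul_compatible ::
  "('k::field, 'a::comm_ring_1) hopf \<Rightarrow> ('a \<Rightarrow> ('s \<Rightarrow>\<^sub>0 'r::comm_ring_1)) \<Rightarrow> bool" where
  "comul_compatible G \<Phi> \<longleftrightarrow>
     (\<forall>a d e. tensor_eval (\<lambda>x y. Poly_Mapping.lookup (\<Phi> x) d * Poly_Mapping.lookup (\<Phi> y) e) (comul G a)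
        = (if d = e then Poly_Mapping.lookup (\<Phi> a) d else 0))"

text \<open>Coordinate ring of \<open>G\<^sub>m\<^sup>n\<close> over \<open>L\<close>, i.e. the group algebra \<open>L[\<int>\<^sup>n]\<close>.\<close>

definition split_torus_ring ::
  "nat \<Rightarrow> 'l::comm_ring_1 set \<Rightarrow> ((nat \<Rightarrow>\<^sub>0 int) \<Rightarrow>\<^sub>0 'l) set" where
  "split_torus_ring n L =
     {f. (\<forall>e\<in>Poly_Mapping.keys f. Poly_Mapping.keys e \<subseteq> {..<n}) \<and> range (Poly_Mapping.lookup f) \<subseteq> L}"

text \<open>
  The base change of \<open>G\<close> to \<open>L\<close> is isomorphic to \<open>G\<^sub>m\<^sup>n\<close> for some \<open>n\<close>. An isomorphism
  \<open>A \<otimes>\<^sub>k L \<rightarrow> L[\<int>\<^sup>n]\<close> is given by its restriction \<open>\<Phi>\<close> to \<open>A\<close>.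
\<close>

definition splits_over :: "('k::field, 'a::comm_ring_1) hopf \<Rightarrow> 'k alg_closure set \<Rightarrow> bool" where
  "splits_over G L \<longleftrightarrow>
     (\<exists>n (\<Phi> :: 'a \<Rightarrow> (nat \<Rightarrow>\<^sub>0 int) \<Rightarrow>\<^sub>0 'k alg_closure).
        is_alg_hom (strct G) (\<lambda>c. Poly_Mapping.single 0 (to_ac c)) \<Phi> \<and>
        comul_compatible G \<Phi> \<and>
        range \<Phi> \<subseteq> split_torus_ring n L \<and>
        (\<forall>u. Poly_Mapping.keys u \<subseteq> UNIV \<times> L \<and>
             tensor_eval (\<lambda>a l. \<Phi> a * Poly_Mapping.single 0 l) u = 0 \<longrightarrow>
             u \<in> tensor_rel (strct G) to_ac L) \<and>
        (\<forall>f\<in>split_torus_ring n L. \<exists>u. Poly_Mapping.keys u \<subseteq> UNIV \<times> L \<and>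
             tensor_eval (\<lambda>a l. \<Phi> a * Poly_Mapping.single 0 l) u = f))"

definition torus :: "('k::field, 'a::comm_ring_1) hopf \<Rightarrow> bool" where
  "torus G \<longleftrightarrow> affine_group_scheme G \<and> splits_over G UNIV"

text \<open>
  Cocharacters over \<open>L\<close>: the homomorphisms \<open>G\<^sub>m \<rightarrow> G\<close> over \<open>L\<close>, i.e. the \<open>k\<close>-algebra homomorphisms
  \<open>A \<rightarrow> L[x, x\<^sup>-\<^sup>1]\<close> respecting comultiplications, with the group law induced by that of \<open>G\<close>.
  The Galois group acts on coefficients.
\<close>

definition cocharacters ::
  "('k::field, 'a::comm_ring_1) hopf \<Rightarrow> 'k alg_closure set \<Rightarrow> ('a \<Rightarrow> (int \<Rightarrow>\<^sub>0 'k alg_closure)) monoid" where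
  "cocharacters G L = (points G (\<lambda>c. Poly_Mapping.single 0 (to_ac c)))
     \<lparr>carrier := {\<gamma>. is_alg_hom (strct G) (\<lambda>c. Poly_Mapping.single 0 (to_ac c)) \<gamma> \<and>
        comul_compatible G \<gamma> \<and> (\<forall>a. range (Poly_Mapping.lookup (\<gamma> a)) \<subseteq> L)}\<rparr>"

definition flasque_torus :: "('k::field, 'a::comm_ring_1) hopf \<Rightarrow> bool" where
  "flasque_torus G \<longleftrightarrow> torus G \<and>
     (\<exists>L. finite_galois L \<and> splits_over G L \<and>
        (\<forall>H. subgroup H (gal L) \<longrightarrow>
           trivial_group
             (H1 ((gal L)\<lparr>carrier := H\<rparr>) (discrete_topology H) (cocharacters G L)
               (\<lambda>\<sigma> \<gamma>. Poly_Mapping.map \<sigma> \<circ> \<gamma>))))"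

text \<open>
  Characters: the homomorphisms \<open>G \<rightarrow> G\<^sub>m\<close> over the algebraic closure \<open>k'\<close>, i.e. the group-like elements
  of \<open>A \<otimes>\<^sub>k k'\<close>, which are treated as classes of formal sums.
\<close>

definition ac_class ::
  "('k::field, 'a::comm_ring_1) hopf \<Rightarrow> (('a \<times> 'k alg_closure) \<Rightarrow>\<^sub>0 int) \<Rightarrow>
   (('a \<times> 'k alg_closure) \<Rightarrow>\<^sub>0 int) set" where
  "ac_class G u = {w. w - u \<in> tensor_rel (strct G) to_ac UNIV}"

definition group_like ::
  "('k::field, 'a::comm_ring_1) hopf \<Rightarrow> (('a \<times> 'k alg_closure) \<Rightarrow>\<^sub>0 int) \<Rightarrow> bool" where
  "group_like G u \<longleftrightarrow>
     frag_extend (\<lambda>(a, l). frag_extend (\<lambda>(x, y). frag_of (x, y, l)) (comul G a)) u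
       - frag_extend (\<lambda>(a, l). frag_extend (\<lambda>(b, m). frag_of (a, b, l * m)) u) u
       \<in> tensor3_rel (strct G) (strct G) to_ac \<and>
     tensor_eval (\<lambda>a l. to_ac (counit G a) * l) u = 1"

definition characters ::
  "('k::field, 'a::comm_ring_1) hopf \<Rightarrow> (('a \<times> 'k alg_closure) \<Rightarrow>\<^sub>0 int) set monoid" where
  "characters G =
     \<lparr>carrier = ac_class G ` {u. group_like G u},
      monoid.mult = (\<lambda>C D. \<Union>u\<in>C. \<Union>v\<in>D. ac_class G (tensor_mult u v)),
      one = ac_class G (frag_of (1, 1))\<rparr>"

definition character_act ::
  "('k::field, 'a::comm_ring_1) hopf \<Rightarrow> ('k alg_closure \<Rightarrow> 'k alg_closure) \<Rightarrow>
   (('a \<times> 'k alg_closure) \<Rightarrow>\<^sub>0 int) set \<Rightarrow> (('a \<times> 'k alg_closure) \<Rightarrow>\<^sub>0 int) set" where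
  "character_act G \<sigma> C = (\<Union>u\<in>C. ac_class G (frag_extend (\<lambda>(a, l). frag_of (a, \<sigma> l)) u))"

text \<open>The character module has a \<open>\<int>\<close>-basis \<open>B\<close> that is stable under the Galois group.\<close>

definition quasi_trivial_torus :: "('k::field, 'a::comm_ring_1) hopf \<Rightarrow> bool" where
  "quasi_trivial_torus G \<longleftrightarrow> torus G \<and>
     (\<exists>B \<subseteq> carrier (characters G).
        (\<exists>h \<in> iso (free_Abelian_group B) (characters G). \<forall>b\<in>B. h (frag_of b) = b) \<and>
        (\<forall>\<sigma>\<in>carrier (gal (UNIV :: 'k alg_closure set)). character_act G \<sigma> ` B = B))"


section \<open>The field \<open>k(t)\<close>, valuations at rational points, and completions\<close>

text \<open>
  Discrete valuations are integer-valued functions whose value at \<open>0\<close> is irrelevant.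
  \<open>val_completion v w e\<close>: via \<open>e\<close>, the valued field with valuation \<open>w\<close> is a completion of the one
  with valuation \<open>v\<close>, i.e. \<open>e\<close> is an isometric embedding with dense image into a complete field.
\<close>

definition val_completion ::
  "('e::field \<Rightarrow> int) \<Rightarrow> ('f::field \<Rightarrow> int) \<Rightarrow> ('e \<Rightarrow> 'f) \<Rightarrow> bool" where
  "val_completion v w e \<longleftrightarrow>
     is_ring_hom e \<and> (\<forall>x. x \<noteq> 0 \<longrightarrow> w (e x) = v x) \<and>
     (\<forall>y N. \<exists>x. y = e x \<or> w (y - e x) \<ge> N) \<and>
     (\<forall>s :: nat \<Rightarrow> 'f. (\<forall>N. \<exists>n0. \<forall>m\<ge>n0. \<forall>n\<ge>n0. s m = s n \<or> w (s m - s n) \<ge> N) \<longrightarrow>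
        (\<exists>l. \<forall>N. \<exists>n0. \<forall>n\<ge>n0. s n = l \<or> w (s n - l) \<ge> N))"

text \<open>
  Rational points of the projective line: \<open>Some c\<close> is the point \<open>t = c\<close>, and \<open>None\<close> is the point
  at infinity.
\<close>

fun poly_val :: "'k::field option \<Rightarrow> 'k poly \<Rightarrow> int" where
  "poly_val (Some c) f = int (order c f)"
| "poly_val None f = - int (degree f)"

lemma poly_val_mult:
  assumes "f \<noteq> 0" "g \<noteq> 0" shows "poly_val p (f * g) = poly_val p f + poly_val p g"
  using assms by (cases p) (auto simp: order_mult degree_mult_eq)

definition rational_val :: "'k::field option \<Rightarrow> 'k poly fract \<Rightarrow> int" where
  "rational_val p x = (if x = 0 then 0 else
     THE n. \<exists>f g. f \<noteq> 0 \<and> g \<noteq> 0 \<and> x = Fract f g \<and> n = poly_val p f - poly_val p g)"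

lemma rational_val_Fract:
  assumes "f \<noteq> 0" "g \<noteq> 0"
  shows "rational_val p (Fract f g) = poly_val p f - poly_val p g"
proof -
  have "poly_val p f' - poly_val p g' = poly_val p f - poly_val p g"
    if "f' \<noteq> 0" "g' \<noteq> 0" "Fract f g = Fract f' g'" for f' g'
  proof -
    have "f * g' = f' * g" using that assms by (simp add: eq_fract)
    then have "poly_val p f + poly_val p g' = poly_val p f' + poly_val p g"
      using that assms by (metis poly_val_mult)
    then show ?thesis by simp
  qed
  then have "(THE n. \<exists>f' g'. f' \<noteq> 0 \<and> g' \<noteq> 0 \<and> Fract f g = Fract f' g' \<and> n = poly_val p f' - poly_val p g')
      = poly_val p f - poly_val p g"
    using assms by (intro the_equality) blast+
  moreover have "Fract f g \<noteq> 0" using assms by (simp add: Zero_fract_def eq_fract)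
  ultimately show ?thesis by (simp only: rational_val_def if_False)
qed

text \<open>
  The completion of \<open>k(t)\<close> at a rational point is the field of Laurent series in the local
  parameter \<open>t - c\<close>, respectively \<open>1 / t\<close>; this is lemma \<open>laurent_expansion_completion\<close> below.
\<close>

fun expansion_of_t :: "'k::field option \<Rightarrow> 'k fls" where
  "expansion_of_t (Some c) = fls_const c + fls_X"
| "expansion_of_t None = fls_X_inv"

definition poly_expansion :: "'k::field option \<Rightarrow> 'k poly \<Rightarrow> 'k fls" where
  "poly_expansion p f = poly (map_poly fls_const f) (expansion_of_t p)"

lemma poly_expansion_0 [simp]: "poly_expansion p 0 = 0"
  by (simp add: poly_expansion_def)

lemma poly_expansion_pCons:
  "poly_expansion p (pCons a f) = fls_const a + expansion_of_t p * poly_expansion p f"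
  by (cases "a = 0 \<and> f = 0") (auto simp: poly_expansion_def map_poly_pCons)

lemma poly_expansion_add: "poly_expansion p (f + g) = poly_expansion p f + poly_expansion p g"
  by (induction f g rule: poly_induct2) (auto simp: poly_expansion_pCons fls_plus_const algebra_simps)

lemma poly_expansion_const [simp]: "poly_expansion p [:a:] = fls_const a"
  by (simp add: poly_expansion_pCons)

lemma poly_expansion_smult: "poly_expansion p (smult a g) = fls_const a * poly_expansion p g"
  by (induction g) (auto simp: poly_expansion_pCons fls_const_mult_const algebra_simps)

lemma poly_expansion_mult: "poly_expansion p (f * g) = poly_expansion p f * poly_expansion p g"
proof (induction f)
  case (pCons a f)
  have "poly_expansion p (pCons a f * g)
      = poly_expansion p (smult a g) + poly_expansion p (pCons 0 (f * g))"
    by (simp add: poly_expansion_add)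
  also have "\<dots> = fls_const a * poly_expansion p g + expansion_of_t p * poly_expansion p (f * g)"
    by (simp add: poly_expansion_smult poly_expansion_pCons[of p 0])
  finally show ?case
    using pCons by (simp add: poly_expansion_pCons algebra_simps)
qed auto

lemma poly_expansion_power: "poly_expansion p (f ^ n) = poly_expansion p f ^ n"
  by (induction n) (auto simp: poly_expansion_mult one_pCons)

lemma subdegree_expansion_regular: "fls_subdegree (poly_expansion (Some c) f) \<ge> 0"
proof (induction f)
  case (pCons a f)
  have "poly_expansion (Some c) f = fps_to_fls (fls_regpart (poly_expansion (Some c) f))"
    using pCons(2) by simp
  then obtain g where g: "poly_expansion (Some c) f = fps_to_fls g" by blast
  have "poly_expansion (Some c) (pCons a f) = fps_to_fls (fps_const a + (fps_const c + fps_X) * g)"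
    by (simp add: poly_expansion_pCons g fls_plus_const fls_times_fps_to_fls)
  then show ?case by (simp only: fls_subdegree_fls_to_fps_gt0)
qed auto

lemma subdegree_poly_expansion_Some:
  assumes "f \<noteq> 0" shows "poly_expansion (Some c) f \<noteq> 0 \<and> fls_subdegree (poly_expansion (Some c) f) = int (order c f)"
proof -
  obtain q where q: "f = [:-c, 1:] ^ order c f * q" "\<not> [:-c, 1:] dvd q"
    using order_decomp[OF assms] by blast
  have "poly q c \<noteq> 0" using q(2) by (simp add: poly_eq_0_iff_dvd)
  define r where "r = synthetic_div q c"
  have qr: "q = [:-c, 1:] * r + [:poly q c:]"
    using synthetic_div_correct'[of c q] by (simp add: r_def)
  have X: "poly_expansion (Some c) [:-c, 1:] = fls_X"
    by (simp add: poly_expansion_pCons fls_plus_const) 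
  have eq: "poly_expansion (Some c) q = fls_X * poly_expansion (Some c) r + fls_const (poly q c)"
    by (subst qr) (simp only: poly_expansion_add poly_expansion_mult X poly_expansion_const)
  have reg: "fls_nth (poly_expansion (Some c) r) k = 0" if "k < 0" for k
    using subdegree_expansion_regular[of c r] that by auto
  have "fls_nth (poly_expansion (Some c) q) 0 = poly q c"
    unfolding eq by (simp add: reg fls_X_times_conv_shift)
  moreover have "fls_nth (poly_expansion (Some c) q) k = 0" if "k < 0" for k
    using subdegree_expansion_regular[of c q] that by auto
  ultimately have s0: "fls_subdegree (poly_expansion (Some c) q) = 0" and n0: "poly_expansion (Some c) q \<noteq> 0"
    using \<open>poly q c \<noteq> 0\<close> by (auto intro!: fls_subdegree_eqI)
  have "poly_expansion (Some c) f = fls_X ^ order c f * poly_expansion (Some c) q"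
    by (subst q(1)) (simp only: poly_expansion_mult poly_expansion_power X)
  then show ?thesis using n0 s0 by simp
qed

lemma subdegree_poly_expansion_None:
  "f \<noteq> 0 \<Longrightarrow> poly_expansion None f \<noteq> 0 \<and> fls_subdegree (poly_expansion None f) = - int (degree f)"
proof (induction f)
  case (pCons a f)
  show ?case
  proof (cases "f = 0")
    case True
    then show ?thesis using pCons by (auto simp: poly_expansion_pCons)
  next
    case False
    let ?g = "fls_X_inv * poly_expansion None f"
    have nz: "?g \<noteq> 0" and g: "fls_subdegree ?g = - 1 - int (degree f)"
      using pCons(2)[OF False] by auto
    have "fls_nth (fls_const a + ?g) (fls_subdegree ?g) \<noteq> 0"
      using nz g nth_fls_subdegree_nonzero[OF nz] by (simp add: g)
    moreover have "fls_nth (fls_const a + ?g) k = 0" if "k < fls_subdegree ?g" for k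
      using that g by (simp del: fls_subdegree_mult)
    ultimately have "fls_subdegree (fls_const a + ?g) = fls_subdegree ?g" "fls_const a + ?g \<noteq> 0"
      by (metis fls_subdegree_eqI) (metis \<open>fls_nth (fls_const a + ?g) (fls_subdegree ?g) \<noteq> 0\<close> fls_zero_nth)
    then show ?thesis using False g by (simp add: poly_expansion_pCons)
  qed
qed auto

lemma subdegree_poly_expansion:
  assumes "f \<noteq> 0"
  shows "poly_expansion p f \<noteq> 0" "fls_subdegree (poly_expansion p f) = poly_val p f"
  using subdegree_poly_expansion_Some[OF assms] subdegree_poly_expansion_None[OF assms]
  by (cases p; auto)+

definition laurent_expansion :: "'k::field option \<Rightarrow> 'k poly fract \<Rightarrow> 'k fls" where
  "laurent_expansion p x =
     (THE y. \<exists>f g. g \<noteq> 0 \<and> x = Fract f g \<and> y = poly_expansion p f / poly_expansion p g)"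

lemma laurent_expansion_Fract:
  assumes "g \<noteq> 0"
  shows "laurent_expansion p (Fract f g) = poly_expansion p f / poly_expansion p g"
proof -
  have "poly_expansion p f' / poly_expansion p g' = poly_expansion p f / poly_expansion p g"
    if "g' \<noteq> 0" "Fract f g = Fract f' g'" for f' g'
  proof -
    have "f * g' = f' * g" using that assms by (simp add: eq_fract)
    then have "poly_expansion p f * poly_expansion p g' = poly_expansion p f' * poly_expansion p g"
      by (metis poly_expansion_mult)
    then show ?thesis using that assms by (simp add: frac_eq_eq subdegree_poly_expansion)
  qed
  then show ?thesis
    unfolding laurent_expansion_def using assms by (intro the_equality) blast+
qed

lemma laurent_expansion_0: "laurent_expansion p 0 = 0"
  by (simp add: Zero_fract_def laurent_expansion_Fract)

lemma laurent_expansion_ring_hom: "is_ring_hom (laurent_expansion p)"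
  unfolding is_ring_hom_def
proof (intro conjI allI)
  show "laurent_expansion p 1 = 1"
    by (simp add: One_fract_def laurent_expansion_Fract subdegree_poly_expansion)
  fix x y :: "'a poly fract"
  obtain a b c d where "x = Fract a b" "y = Fract c d" "b \<noteq> 0" "d \<noteq> 0"
    by (metis Fract_cases)
  then show "laurent_expansion p (x + y) = laurent_expansion p x + laurent_expansion p y"
    "laurent_expansion p (x * y) = laurent_expansion p x * laurent_expansion p y"
    by (auto simp: laurent_expansion_Fract poly_expansion_add poly_expansion_mult add_frac_eq
        subdegree_poly_expansion)
qed

lemma subdegree_laurent_expansion:
  assumes "x \<noteq> 0" shows "fls_subdegree (laurent_expansion p x) = rational_val p x"
proof -
  obtain a b where ab: "x = Fract a b" "b \<noteq> 0" "a \<noteq> 0"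
    using assms by (metis Fract_cases Fract_cases_nonzero)
  then show ?thesis
    by (simp add: laurent_expansion_Fract rational_val_Fract fls_divide_subdegree subdegree_poly_expansion)
qed

lemma laurent_expansion_const: "laurent_expansion p (to_fract [:a:]) = fls_const a"
  by (simp add: to_fract_def laurent_expansion_Fract one_pCons)

lemma laurent_expansion_X: "\<exists>x. x \<noteq> 0 \<and> laurent_expansion p x = fls_X"
proof (cases p)
  case None
  have "laurent_expansion p (Fract 1 [:0, 1:]) = 1 / fls_X_inv"
    by (simp add: None laurent_expansion_Fract poly_expansion_pCons one_pCons)
  moreover have "1 / fls_X_inv = (fls_X :: 'a fls)"
    by (simp add: divide_inverse fls_inverse_X_inv)
  ultimately have "laurent_expansion p (Fract 1 [:0, 1:]) = fls_X" by simp
  then show ?thesis using laurent_expansion_0[of p] by (metis fls_X_nonzero)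
next
  case (Some c)
  have "laurent_expansion p (Fract [:-c, 1:] 1) = fls_X"
    by (simp add: Some laurent_expansion_Fract poly_expansion_pCons one_pCons fls_plus_const)
  then show ?thesis using laurent_expansion_0[of p] by (metis fls_X_nonzero)
qed


lemma laurent_expansion_hom_simps:
  "laurent_expansion p 0 = 0" "laurent_expansion p 1 = 1"
  "laurent_expansion p (x + y) = laurent_expansion p x + laurent_expansion p y"
  "laurent_expansion p (x * y) = laurent_expansion p x * laurent_expansion p y"
  "laurent_expansion p (x ^ n) = laurent_expansion p x ^ n"
proof -
  show *: "laurent_expansion p 1 = 1"
    "laurent_expansion p (x + y) = laurent_expansion p x + laurent_expansion p y"
    "laurent_expansion p (x * y) = laurent_expansion p x * laurent_expansion p y" for x y
    using laurent_expansion_ring_hom[of p] by (auto simp: is_ring_hom_def)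
  show "laurent_expansion p 0 = 0"
    by (rule laurent_expansion_0)
  show "laurent_expansion p (x ^ n) = laurent_expansion p x ^ n"
    by (induction n) (auto simp: *)
qed

lemma laurent_expansion_sum:
  "laurent_expansion p (sum f A) = (\<Sum>i\<in>A. laurent_expansion p (f i))"
  by (induction A rule: infinite_finite_induct) (auto simp: laurent_expansion_hom_simps)

lemma laurent_expansion_dense:
  "\<exists>x. y = laurent_expansion p x \<or> fls_subdegree (y - laurent_expansion p x) \<ge> N"
proof -
  obtain t where t: "laurent_expansion p t = fls_X" "t \<noteq> 0"
    using laurent_expansion_X by blast
  define d where "d = nat (- fls_subdegree y)"
  have "fls_subdegree (y * fls_X ^ d) \<ge> 0"
    by (cases "y = 0") (auto simp: d_def)
  then obtain h where h: "y * fls_X ^ d = fps_to_fls h"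
    by (metis fls_regpart_to_fls_trivial)
  define n where "n = nat (N + int d)"
  define q where "q = (\<Sum>i<n. to_fract [:fps_nth h i:] * t ^ i)"
  have q: "laurent_expansion p q = (\<Sum>i<n. fls_const (fps_nth h i) * fls_X ^ i)"
    by (simp add: q_def laurent_expansion_sum laurent_expansion_hom_simps laurent_expansion_const t)
  define z where "z = y * fls_X ^ d - laurent_expansion p q"
  have nth: "fls_nth z k = 0" if "k < int n" for k
  proof -
    have "fls_nth (fls_const a * fls_X ^ i) k = (if k = int i then a else 0)" for a :: 'a and i
      by (simp add: fls_X_power_nth)
    then have "fls_nth (laurent_expansion p q) k = (\<Sum>i<n. if k = int i then fps_nth h i else 0)"
      unfolding q by (simp add: fls_nth_sum)
    also have "\<dots> = (if k < 0 then 0 else fps_nth h (nat k))"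
    proof (cases "k < 0")
      case False
      then have "(\<Sum>i<n. if k = int i then fps_nth h i else 0) = (\<Sum>i<n. if i = nat k then fps_nth h i else 0)"
        by (intro sum.cong) auto
      also have "\<dots> = fps_nth h (nat k)" using that False by auto
      finally show ?thesis using False by simp
    qed auto
    finally show ?thesis by (simp add: z_def h)
  qed
  define x where "x = q * inverse t ^ d"
  have inv: "laurent_expansion p (inverse t ^ d) * fls_X ^ d = 1"
    using t(2) by (metis laurent_expansion_hom_simps(2,4,5) t(1) power_mult_distrib left_inverse power_one)
  have eq: "(y - laurent_expansion p x) * fls_X ^ d = z"
    using inv by (simp add: x_def z_def laurent_expansion_hom_simps(4) algebra_simps)
  show ?thesis
  proof (cases "y = laurent_expansion p x")
    case False
    then have nz: "y - laurent_expansion p x \<noteq> 0" by simp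
    then have "z \<noteq> 0" by (metis eq fls_X_nonzero mult_eq_0_iff power_not_zero)
    then have "int n \<le> fls_subdegree z" using nth by (intro fls_subdegree_geI) auto
    also have "fls_subdegree z = fls_subdegree (y - laurent_expansion p x) + int d"
      using nz by (simp flip: eq)
    finally have "N \<le> fls_subdegree (y - laurent_expansion p x)" by (simp add: n_def split: if_splits)
    then show ?thesis by blast
  qed auto
qed

lemma fls_val_complete:
  fixes s :: "nat \<Rightarrow> 'k::field fls"
  assumes "\<forall>N. \<exists>n0. \<forall>m\<ge>n0. \<forall>n\<ge>n0. s m = s n \<or> fls_subdegree (s m - s n) \<ge> N"
  shows "\<exists>l. \<forall>N. \<exists>n0. \<forall>n\<ge>n0. s n = l \<or> fls_subdegree (s n - l) \<ge> N"
proof -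
  from assms obtain b where b: "\<And>N m n. m \<ge> b N \<Longrightarrow> n \<ge> b N \<Longrightarrow> s m = s n \<or> fls_subdegree (s m - s n) \<ge> N"
    by metis
  have stab: "fls_nth (s m) k = fls_nth (s n) k" if "m \<ge> b N" "n \<ge> b N" "k < N" for m n N k
  proof (cases "s m = s n")
    case False
    then have "fls_nth (s m - s n) k = 0"
      using b[of N m n] that by (intro fls_eq0_below_subdegree) auto
    then show ?thesis by simp
  qed auto
  define c where "c k = fls_nth (s (b (k + 1))) k" for k
  have c: "fls_nth (s n) k = c k" if "n \<ge> b N" "k < N" for n k N
  proof -
    define m where "m = max n (b (k + 1))"
    have "fls_nth (s n) k = fls_nth (s m) k" using that by (intro stab[of N]) (auto simp: m_def)
    also have "\<dots> = c k" unfolding c_def by (intro stab[of "k + 1"]) (auto simp: m_def)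
    finally show ?thesis .
  qed
  define l where "l = Abs_fls c"
  have "c k = 0" if "k < min 0 (fls_subdegree (s (b 0)))" for k
    using c[of 0 "b 0" k] that by auto
  then have "\<exists>N. \<forall>n<N. c n = 0" by blast
  then have l: "fls_nth l k = c k" for k
    unfolding l_def by (rule nth_Abs_fls_ex_lower_bound)
  show ?thesis
  proof (intro exI[of _ l] allI)
    fix N
    show "\<exists>n0. \<forall>n\<ge>n0. s n = l \<or> N \<le> fls_subdegree (s n - l)"
    proof (intro exI[of _ "b N"] allI impI)
      fix n assume "b N \<le> n"
      then show "s n = l \<or> N \<le> fls_subdegree (s n - l)"
        using c[of N n] l by (cases "s n = l") (auto intro!: fls_subdegree_geI)
    qed
  qed
qed

lemma laurent_expansion_completion:
  "val_completion (rational_val p) fls_subdegree (laurent_expansion p)"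
  unfolding val_completion_def
proof (intro conjI allI impI)
  show "is_ring_hom (laurent_expansion p)" by (rule laurent_expansion_ring_hom)
  show "fls_subdegree (laurent_expansion p x) = rational_val p x" if "x \<noteq> 0" for x
    using that by (rule subdegree_laurent_expansion)
  show "\<exists>x. y = laurent_expansion p x \<or> N \<le> fls_subdegree (y - laurent_expansion p x)" for y N
    by (rule laurent_expansion_dense)
  show "\<exists>l. \<forall>N. \<exists>n0. \<forall>n\<ge>n0. s n = l \<or> N \<le> fls_subdegree (s n - l)"
    if "\<forall>N. \<exists>n0. \<forall>m\<ge>n0. \<forall>n\<ge>n0. s m = s n \<or> N \<le> fls_subdegree (s m - s n)" for s :: "nat \<Rightarrow> 'a fls"
    using that by (rule fls_val_complete)
qed


definition completion_map :: "('k::field poly fract \<Rightarrow> int) \<Rightarrow> 'k poly fract \<Rightarrow> 'k fls" where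
  "completion_map v = laurent_expansion (inv_into UNIV rational_val v)"

lemma completion_map_completion:
  assumes "v \<in> range rational_val"
  shows "val_completion v fls_subdegree (completion_map v)"
  using laurent_expansion_completion[of "inv_into UNIV rational_val v"] assms
  by (simp add: completion_map_def f_inv_into_f)

definition ratfun_const :: "'k::field \<Rightarrow> 'k poly fract" where
  "ratfun_const c = to_fract [:c:]"


section \<open>The closure of global classes in the product of local ones\<close>

definition local_H1 ::
  "('k::field, 'a::comm_ring_1) hopf \<Rightarrow> ('k poly fract \<Rightarrow> int) \<Rightarrow>
   (('k fls alg_closure \<Rightarrow> 'k fls alg_closure) \<Rightarrow> ('a \<Rightarrow> 'k fls alg_closure)) set monoid" where
  "local_H1 M v = galH1 (completion_map v \<circ> ratfun_const) M"

definition global_closure ::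
  "('k::field, 'a::comm_ring_1) hopf \<Rightarrow> ('k poly fract \<Rightarrow> int) set \<Rightarrow>
   (('k poly fract \<Rightarrow> int) \<Rightarrow>
     (('k fls alg_closure \<Rightarrow> 'k fls alg_closure) \<Rightarrow> ('a \<Rightarrow> 'k fls alg_closure)) set) set" where
  "global_closure M T =
     product_topology (\<lambda>v. discrete_topology (carrier (local_H1 M v))) T closure_of
       ((\<lambda>\<alpha>. \<lambda>v\<in>T. res_H1 (completion_map v) ratfun_const M \<alpha>) ` carrier (galH1 ratfun_const M))"

end

theory Submission
  imports Defs
begin

text \<open>
  Classes in \<open>H\<^sup>1(k(t), M)\<close> and \<open>H\<^sup>1(k((s)), M)\<close> are compared with \<open>H = H\<^sup>1(k, F)\<close> through their images
  in the cohomology of \<open>F\<close>. A local class \<open>g\<close> at \<open>v\<close> corresponds to \<open>h \<in> H\<close> if both have the same image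
  in \<open>H\<^sup>1(K\<^sub>v, F)\<close>.
  (a) \<open>g\<close> determines \<open>h\<close>, because \<open>H\<^sup>1(k, F) \<rightarrow> H\<^sup>1(k((s)), F)\<close> is injective: Laurent series over the
  algebraic closure retract onto the constants by their leading coefficients.
  (b) Every \<open>h\<close> corresponds to some \<open>g\<close>, because \<open>H\<^sup>1(k, P) = 0\<close> by Hilbert 90 and Shapiro's lemma, so
  that \<open>H\<^sup>1(k, M) \<rightarrow> H\<^sup>1(k, F)\<close> is surjective.
  (c) The localizations of a global class correspond to one and the same \<open>h\<close> at all \<open>v\<close>, because for
  flasque \<open>F\<close> every class in \<open>H\<^sup>1(k(t), F)\<close> is constant. Here a cocycle over \<open>k(t)\<close> is first made to factor
  through the compositum of \<open>k(t)\<close> with the algebraic closure of \<open>k\<close>; its orders at the zeros and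
  poles form cocycles with values in cocharacters of \<open>F\<close> on a permutation set, which are coboundaries by
  flasqueness, and this allows to remove all zeros and poles.
  Hence two families over \<open>T\<close> in \<open>H\<close>, lifted to local classes by (b), can only agree modulo the closure of the
  global classes if they differ by a constant element of \<open>H\<close>. There are infinitely many families up to
  constants if \<open>H\<close> is infinite and \<open>T\<close> has two elements, or if \<open>H\<close> is nontrivial and \<open>T\<close> is infinite.
\<close>

section \<open>Subfields of the algebraic closure\<close>

text \<open>Tori are handled through character values only: after a choice of splitting, a point
  over a field is a function on exponent vectors that turns sums into products, and Galois moves the
  exponents by \<open>act\<close>. Every cohomological claim becomes a family of multiplicative
  identities in a field. This is why leading coefficients suffice for (a): they are not additive,
  but a splitting of a torus cocycle involves products alone. It is also why orders suffice in (c):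
  a nonzero element of the compositum is determined up to a constant by its orders at the finite
  points of the line. The obstacle in (c) is that the stabilizers of such points may be infinite,
  while flasqueness speaks of finite groups; it is overcome since a cocycle has finite image and the
  cocharacter lattice is torsion-free. \<open>M\<close> is not a torus and has no such coordinates;
  its points are treated as a subgroup of those of \<open>F\<close>. In the final count two places
  are compared at a time, and equality of cosets is used in cross-multiplied form, so that the
  closure enters as a mere set.\<close>

lemma ring_hom_add: "is_ring_hom f \<Longrightarrow> f (x + y) = f x + f y"
  and ring_hom_mult: "is_ring_hom f \<Longrightarrow> f (x * y) = f x * f y"
  and ring_hom_1: "is_ring_hom f \<Longrightarrow> f 1 = 1"
  by (auto simp: is_ring_hom_def)

lemma ring_hom_0: "is_ring_hom f \<Longrightarrow> f 0 = 0"
  using ring_hom_add[of f 0 0] by simp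

lemma ring_hom_uminus: "is_ring_hom f \<Longrightarrow> f (- x) = - f x"
  using ring_hom_add[of f x "- x"] ring_hom_0[of f] by (simp add: eq_neg_iff_add_eq_0 add.commute)

lemma ring_hom_diff: "is_ring_hom f \<Longrightarrow> f (x - y) = f x - f y"
  using ring_hom_add[of f x "- y"] ring_hom_uminus[of f y] by simp

lemma ring_hom_sum: "is_ring_hom f \<Longrightarrow> f (sum g A) = (\<Sum>x\<in>A. f (g x))"
  by (induction A rule: infinite_finite_induct) (auto simp: ring_hom_0 ring_hom_add)

lemma ring_hom_power: "is_ring_hom f \<Longrightarrow> f (x ^ n) = f x ^ n"
  by (induction n) (auto simp: ring_hom_1 ring_hom_mult)

lemma ring_hom_of_nat: "is_ring_hom f \<Longrightarrow> f (of_nat n) = of_nat n"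
  by (induction n) (auto simp: ring_hom_1 ring_hom_add ring_hom_0)

lemma ring_hom_of_int: "is_ring_hom f \<Longrightarrow> f (of_int n) = of_int n"
  by (cases n) (auto simp: ring_hom_of_nat ring_hom_uminus ring_hom_add ring_hom_diff ring_hom_1)

lemma ring_hom_eq_0_iff:
  fixes f :: "'a::field \<Rightarrow> 'b::field"
  assumes "is_ring_hom f" shows "f x = 0 \<longleftrightarrow> x = 0"
proof (cases "x = 0")
  case False
  have "f x * f (inverse x) = 1"
    using False assms by (simp flip: ring_hom_mult add: ring_hom_1)
  then show ?thesis using False by auto
qed (simp add: assms ring_hom_0)

lemma ring_hom_inj:
  fixes f :: "'a::field \<Rightarrow> 'b::field"
  assumes "is_ring_hom f" shows "inj f"
  by (rule injI) (metis assms eq_iff_diff_eq_0 ring_hom_diff ring_hom_eq_0_iff)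

lemma ring_hom_inverse:
  fixes f :: "'a::field \<Rightarrow> 'b::field"
  assumes "is_ring_hom f" shows "f (inverse x) = inverse (f x)"
proof (cases "x = 0")
  case False
  have "f x * f (inverse x) = 1"
    using False assms by (simp flip: ring_hom_mult add: ring_hom_1)
  then show ?thesis using inverse_unique by metis
qed (simp add: assms ring_hom_0)

lemma ring_hom_comp: "is_ring_hom f \<Longrightarrow> is_ring_hom g \<Longrightarrow> is_ring_hom (f \<circ> g)"
  by (simp add: is_ring_hom_def)

lemma ring_hom_id: "is_ring_hom id" "is_ring_hom (\<lambda>x. x)"
  by (simp_all add: is_ring_hom_def)

lemma ring_hom_to_ac: "is_ring_hom to_ac"
  by (simp add: is_ring_hom_def)

lemma ring_hom_map_poly:
  assumes "is_ring_hom f"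
  shows "map_poly f (p + q) = map_poly f p + map_poly f q"
    "map_poly f (p * q) = map_poly f p * map_poly f q"
  using assms
  by (auto intro!: poly_eqI simp: coeff_map_poly ring_hom_0 ring_hom_add ring_hom_sum ring_hom_mult coeff_mult)

lemma ring_hom_poly:
  assumes "is_ring_hom f"
  shows "f (poly p x) = poly (map_poly f p) (f x)"
  using assms
  by (induction p) (auto simp: ring_hom_0 map_poly_pCons ring_hom_add ring_hom_mult)

section \<open>Homomorphisms defined on subfields of the algebraic closure\<close>

definition intermediate :: "'e::field alg_closure set \<Rightarrow> bool" where
  "intermediate S \<longleftrightarrow> range to_ac \<subseteq> S \<and> (\<forall>x\<in>S. \<forall>y\<in>S. x + y \<in> S \<and> x * y \<in> S)"

definition hom_on :: "'e::field alg_closure set \<Rightarrow> ('e alg_closure \<Rightarrow> 'w::field) \<Rightarrow> bool" where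
  "hom_on S f \<longleftrightarrow> f 1 = 1 \<and> (\<forall>x\<in>S. \<forall>y\<in>S. f (x + y) = f x + f y \<and> f (x * y) = f x * f y)"

definition coeffs_in :: "'a::zero set \<Rightarrow> 'a poly \<Rightarrow> bool" where
  "coeffs_in S p \<longleftrightarrow> (\<forall>i. coeff p i \<in> S)"

context
  fixes S :: "'e::field alg_closure set"
  assumes S: "intermediate S"
begin

lemma intermediate_to_ac: "to_ac c \<in> S"
  using S by (auto simp: intermediate_def)

lemma intermediate_0: "0 \<in> S" and intermediate_1: "1 \<in> S"
  using intermediate_to_ac[of 0] intermediate_to_ac[of 1] by auto

lemma intermediate_add: "x \<in> S \<Longrightarrow> y \<in> S \<Longrightarrow> x + y \<in> S"
  and intermediate_mult: "x \<in> S \<Longrightarrow> y \<in> S \<Longrightarrow> x * y \<in> S"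
  using S by (auto simp: intermediate_def)

lemma intermediate_uminus: "x \<in> S \<Longrightarrow> - x \<in> S"
  using intermediate_mult[OF intermediate_to_ac[of "- 1"], of x] by simp

lemma intermediate_diff: "x \<in> S \<Longrightarrow> y \<in> S \<Longrightarrow> x - y \<in> S"
  using intermediate_add[of x "- y"] intermediate_uminus[of y] by simp

lemma intermediate_sum: "(\<And>i. i \<in> A \<Longrightarrow> f i \<in> S) \<Longrightarrow> sum f A \<in> S"
  by (induction A rule: infinite_finite_induct) (auto simp: intermediate_0 intermediate_add)

lemma intermediate_poly: "coeffs_in S p \<Longrightarrow> x \<in> S \<Longrightarrow> poly p x \<in> S"
proof (induction p)
  case (pCons a p)
  then have "a \<in> S" "coeffs_in S p"
    unfolding coeffs_in_def by (metis coeff_pCons_0) (metis coeff_pCons_Suc pCons.prems(1) coeffs_in_def)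
  then show ?case using pCons by (auto intro: intermediate_add intermediate_mult)
qed (auto simp: intermediate_0)

text \<open>An element is algebraic over the base, so a relation \<open>a + x * q(x) = 0\<close>
  with \<open>a \<noteq> 0\<close>, reached after cancelling powers of \<open>x\<close>, exhibits
  its inverse as a polynomial in it. Hence the subrings called \<open>intermediate\<close> are
  fields, although only sums and products appear in the definition.\<close>

lemma intermediate_inverse:
  assumes "x \<in> S" shows "inverse x \<in> S"
proof (cases "x = 0")
  case False
  obtain p where "p \<noteq> 0" "poly (map_poly to_ac p) x = 0"
    by (rule alg_closure_algebraic)
  then show ?thesis
  proof (induction p)
    case (pCons a p)
    have eq: "to_ac a + x * poly (map_poly to_ac p) x = 0"
      using pCons.prems by (simp add: map_poly_pCons)
    show ?case
    proof (cases "a = 0")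
      case True
      then show ?thesis using pCons eq False by auto
    next
      case a: False
      have "x * (- poly (map_poly to_ac p) x * to_ac (inverse a)) = 1"
        using eq a by (simp add: field_simps) (metis add.commute add_eq_0_iff)
      then have "inverse x = - poly (map_poly to_ac p) x * to_ac (inverse a)"
        by (rule inverse_unique)
      also have "\<dots> \<in> S"
        by (intro intermediate_mult intermediate_uminus intermediate_to_ac intermediate_poly assms)
          (auto simp: coeffs_in_def coeff_map_poly intermediate_to_ac)
      finally show ?thesis .
    qed
  qed auto
qed (auto simp: intermediate_0)

lemma intermediate_divide: "x \<in> S \<Longrightarrow> y \<in> S \<Longrightarrow> x / y \<in> S"
  by (simp add: divide_inverse intermediate_inverse intermediate_mult)

lemma coeffs_in_monom: "c \<in> S \<Longrightarrow> coeffs_in S (monom c n)"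
  by (auto simp: coeffs_in_def intermediate_0)

lemma coeffs_in_add: "coeffs_in S p \<Longrightarrow> coeffs_in S q \<Longrightarrow> coeffs_in S (p + q)"
  and coeffs_in_diff: "coeffs_in S p \<Longrightarrow> coeffs_in S q \<Longrightarrow> coeffs_in S (p - q)"
  and coeffs_in_mult: "coeffs_in S p \<Longrightarrow> coeffs_in S q \<Longrightarrow> coeffs_in S (p * q)"
  by (auto simp: coeffs_in_def coeff_mult intermediate_add intermediate_diff intermediate_mult intro!: intermediate_sum)

lemma coeffs_in_const: "c \<in> S \<Longrightarrow> coeffs_in S [:c:]"
  by (auto simp: coeffs_in_def coeff_pCons intermediate_0 split: nat.splits)

lemma coeffs_in_X: "coeffs_in S [:0, 1:]"
  by (auto simp: coeffs_in_def coeff_pCons intermediate_0 intermediate_1 split: nat.splits)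

lemma coeffs_in_pderiv: "coeffs_in S p \<Longrightarrow> coeffs_in S (pderiv p)"
proof -
  have "of_nat n \<in> S" for n
    by (induction n) (auto simp: intermediate_0 intermediate_1 intermediate_add)
  then show "coeffs_in S p \<Longrightarrow> coeffs_in S (pderiv p)"
    unfolding coeffs_in_def coeff_pderiv by (metis intermediate_mult)
qed

context
  fixes f :: "'e alg_closure \<Rightarrow> 'w::field"
  assumes f: "hom_on S f"
begin

lemma hom_on_1: "f 1 = 1"
  and hom_on_add: "x \<in> S \<Longrightarrow> y \<in> S \<Longrightarrow> f (x + y) = f x + f y"
  and hom_on_mult: "x \<in> S \<Longrightarrow> y \<in> S \<Longrightarrow> f (x * y) = f x * f y"
  using f by (auto simp: hom_on_def)

lemma hom_on_0: "f 0 = 0"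
  using hom_on_add[OF intermediate_0 intermediate_0] by (metis add.right_neutral add_left_cancel)

lemma hom_on_diff: "x \<in> S \<Longrightarrow> y \<in> S \<Longrightarrow> f (x - y) = f x - f y"
  using hom_on_add[of "x - y" y] intermediate_diff[of x y] by simp

lemma hom_on_sum: "(\<And>i. i \<in> A \<Longrightarrow> g i \<in> S) \<Longrightarrow> f (sum g A) = (\<Sum>i\<in>A. f (g i))"
  by (induction A rule: infinite_finite_induct) (auto simp: hom_on_0 hom_on_add intermediate_sum)

lemma hom_on_inverse: "x \<in> S \<Longrightarrow> x \<noteq> 0 \<Longrightarrow> f (inverse x) * f x = 1"
  using hom_on_mult[of "inverse x" x] intermediate_inverse[of x] hom_on_1 by simp

lemma hom_on_nonzero: "x \<in> S \<Longrightarrow> x \<noteq> 0 \<Longrightarrow> f x \<noteq> 0"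
  using hom_on_inverse[of x] by auto

lemma map_poly_on:
  assumes "coeffs_in S p" "coeffs_in S q"
  shows "map_poly f (p + q) = map_poly f p + map_poly f q"
    "map_poly f (p - q) = map_poly f p - map_poly f q"
    "map_poly f (p * q) = map_poly f p * map_poly f q"
proof -
  have "coeff (map_poly f (p * q)) i = coeff (map_poly f p * map_poly f q) i" for i
    using assms unfolding coeff_mult coeff_map_poly[where f = f, OF hom_on_0] coeffs_in_def
    by (subst hom_on_sum) (auto simp: intermediate_mult hom_on_mult coeff_map_poly[where f = f, OF hom_on_0] intro!: sum.cong)
  then show "map_poly f (p * q) = map_poly f p * map_poly f q" by (rule poly_eqI)
qed (use assms in \<open>auto intro!: poly_eqI simp: coeff_map_poly hom_on_0 hom_on_add hom_on_diff coeffs_in_def\<close>)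

end

text \<open>Of minimal degree but not normalised to be monic: division can use the leading
  coefficient, which is invertible in \<open>S\<close>.\<close>

definition minpoly_on :: "'e alg_closure \<Rightarrow> 'e alg_closure poly \<Rightarrow> bool" where
  "minpoly_on x q \<longleftrightarrow> coeffs_in S q \<and> q \<noteq> 0 \<and> poly q x = 0 \<and>
     (\<forall>p. coeffs_in S p \<longrightarrow> p \<noteq> 0 \<longrightarrow> poly p x = 0 \<longrightarrow> degree q \<le> degree p)"

lemma minpoly_on_exists: "\<exists>q. minpoly_on x q"
proof -
  obtain p where p: "p \<noteq> 0" "poly (map_poly to_ac p) x = 0"
    by (rule alg_closure_algebraic)
  have "map_poly to_ac p \<noteq> 0" using p(1) by (simp add: map_poly_eq_0_iff)
  then have "\<exists>q. coeffs_in S q \<and> q \<noteq> 0 \<and> poly q x = 0"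
    using p(2) by (intro exI[of _ "map_poly to_ac p"]) (auto simp: coeffs_in_def coeff_map_poly intermediate_to_ac)
  from ex_has_least_nat[of "\<lambda>q. coeffs_in S q \<and> q \<noteq> 0 \<and> poly q x = 0" _ degree] this
  show ?thesis unfolding minpoly_on_def by blast
qed

text \<open>Division with remainder by \<open>q\<close>, one leading term at a time, is compatible
  with \<open>f\<close>. The outcome makes the substitution of \<open>y\<close> for \<open>x\<close>
  well defined in \<open>adjoin_root\<close>.\<close>

lemma minpoly_on_root:
  assumes f: "hom_on S f" and q: "minpoly_on x q" and y: "poly (map_poly f q) y = 0"
    and p: "coeffs_in S p" "poly p x = 0"
  shows "poly (map_poly f p) y = 0"
  using p
proof (induction "degree p" arbitrary: p rule: less_induct)
  case less
  show ?case
  proof (cases "p = 0")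
    case False
    have q': "coeffs_in S q" "q \<noteq> 0" "poly q x = 0" "degree q \<le> degree p"
      using q less False by (auto simp: minpoly_on_def)
    define c where "c = lead_coeff p / lead_coeff q"
    define m where "m = monom c (degree p - degree q)"
    define r where "r = p - m * q"
    have c: "c \<in> S" unfolding c_def
      using less.prems(1) q'(1) by (auto simp: coeffs_in_def intro: intermediate_divide)
    have m: "coeffs_in S m" unfolding m_def using c by (rule coeffs_in_monom)
    have r: "coeffs_in S r" "poly r x = 0"
      unfolding r_def using m q' less.prems by (auto intro: coeffs_in_diff coeffs_in_mult)
    have pq: "map_poly f p = map_poly f r + map_poly f m * map_poly f q"
      using map_poly_on(1)[OF f r(1) coeffs_in_mult[OF m q'(1)]] map_poly_on(3)[OF f m q'(1)]
      by (simp add: r_def)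
    have "poly (map_poly f r) y = 0"
    proof (cases "r = 0")
      case False
      have "c \<noteq> 0" using \<open>p \<noteq> 0\<close> q' by (simp add: c_def)
      then have deg: "degree (m * q) = degree p"
        using q' \<open>c \<noteq> 0\<close> by (simp add: m_def degree_mult_eq degree_monom_eq)
      have "lead_coeff (m * q) = lead_coeff p"
        using q' \<open>c \<noteq> 0\<close> by (simp only: lead_coeff_mult) (simp add: m_def degree_monom_eq, simp add: c_def)
      then have "coeff r (degree p) = 0" "degree r \<le> degree p"
        using deg by (auto simp: r_def intro: degree_diff_le)
      then have "degree r < degree p"
        using False by (metis le_neq_implies_less leading_coeff_0_iff)
      then show ?thesis using less.hyps r by blast
    qed auto
    then show ?thesis using y by (simp add: pq)
  qed auto
qed

text \<open>The extension to \<open>S[x]\<close> evaluates some polynomial expression of an element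
  at \<open>y\<close>; two expressions differ by a polynomial vanishing at \<open>x\<close>, to
  which \<open>minpoly_on_root\<close> applies.\<close>

lemma adjoin_root:
  fixes f :: "'e alg_closure \<Rightarrow> 'w::field"
  assumes f: "hom_on S f" and q: "minpoly_on x q" and y: "poly (map_poly f q) y = 0"
  shows "\<exists>S' f'. intermediate S' \<and> S \<subseteq> S' \<and> x \<in> S' \<and> hom_on S' f' \<and> (\<forall>s\<in>S. f' s = f s) \<and> f' x = y"
proof -
  define S' where "S' = {poly p x | p. coeffs_in S p}"
  define f' where "f' z = poly (map_poly f (SOME p. coeffs_in S p \<and> poly p x = z)) y" for z
  have f': "f' (poly p x) = poly (map_poly f p) y" if p: "coeffs_in S p" for p
  proof -
    define r where "r = (SOME r. coeffs_in S r \<and> poly r x = poly p x)"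
    have r: "coeffs_in S r \<and> poly r x = poly p x"
      unfolding r_def by (rule someI[of _ p]) (use p in auto)
    then have "poly (map_poly f (r - p)) y = 0"
      by (intro minpoly_on_root[OF f q y]) (auto simp: p coeffs_in_diff)
    then show ?thesis using map_poly_on(2)[OF f, of r p] r p by (simp add: f'_def r_def)
  qed
  have S'E: "z \<in> S' \<Longrightarrow> \<exists>p. coeffs_in S p \<and> z = poly p x" for z
    unfolding S'_def by auto
  have S'I: "coeffs_in S p \<Longrightarrow> poly p x \<in> S'" for p
    unfolding S'_def by auto
  have const: "f' s = f s" "s \<in> S'" if "s \<in> S" for s
    using f'[OF coeffs_in_const[OF that]] S'I[OF coeffs_in_const[OF that]]
    by (auto simp: map_poly_pCons hom_on_0[OF f])
  have X: "f' x = y" "x \<in> S'"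
    using f'[OF coeffs_in_X] S'I[OF coeffs_in_X]
    by (auto simp: map_poly_pCons hom_on_0[OF f] hom_on_1[OF f])
  have "intermediate S'"
    unfolding intermediate_def
  proof (intro conjI ballI subsetI)
    fix z :: "'e alg_closure" assume "z \<in> range to_ac" then show "z \<in> S'" using const(2) intermediate_to_ac by auto
  next
    fix z w assume "z \<in> S'" "w \<in> S'"
    then obtain p r where pr: "coeffs_in S p" "z = poly p x" "coeffs_in S r" "w = poly r x"
      using S'E by meson
    show "z + w \<in> S'" using S'I[OF coeffs_in_add[of p r]] pr by simp
    show "z * w \<in> S'" using S'I[OF coeffs_in_mult[of p r]] pr by simp
  qed
  moreover have "hom_on S' f'"
    unfolding hom_on_def
  proof (intro conjI ballI)
    show "f' 1 = 1" using const(1)[OF intermediate_1] hom_on_1[OF f] by simp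
    fix z w assume "z \<in> S'" "w \<in> S'"
    then obtain p r where pr: "coeffs_in S p" "z = poly p x" "coeffs_in S r" "w = poly r x"
      using S'E by meson
    show "f' (z + w) = f' z + f' w"
      using f'[OF coeffs_in_add[of p r]] f'[of p] f'[of r] pr by (simp add: map_poly_on[OF f])
    show "f' (z * w) = f' z * f' w"
      using f'[OF coeffs_in_mult[of p r]] f'[of p] f'[of r] pr by (simp add: map_poly_on[OF f])
  qed
  ultimately show ?thesis using const X by blast
qed

end

text \<open>Zorn's lemma gives a maximal extension. Its domain contains every \<open>x\<close>,
  because the image of the minimal polynomial of \<open>x\<close> keeps positive degree and has a
  root in the algebraically closed target.\<close>

theorem hom_on_extends:
  fixes f :: "'e::field alg_closure \<Rightarrow> 'w::alg_closed_field"
  assumes S: "intermediate S" and f: "hom_on S f"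
  shows "\<exists>g. is_ring_hom g \<and> (\<forall>s\<in>S. g s = f s)"
proof -
  \<comment> \<open>Partial homomorphisms are represented by their graphs, so that an upper bound of
    a chain is simply its union.\<close>
  define good where "good G \<longleftrightarrow> (\<lambda>s. (s, f s)) ` S \<subseteq> G \<and>
     (\<forall>a b a' b'. (a, b) \<in> G \<longrightarrow> (a', b') \<in> G \<longrightarrow> (a + a', b + b') \<in> G \<and> (a * a', b * b') \<in> G) \<and>
     (\<forall>a b b'. (a, b) \<in> G \<longrightarrow> (a, b') \<in> G \<longrightarrow> b = b')" for G :: "('e alg_closure \<times> 'w) set"
  have "good ((\<lambda>s. (s, f s)) ` S)"
    unfolding good_def by (auto simp: intermediate_add[OF S] intermediate_mult[OF S] hom_on_add[OF S f] hom_on_mult[OF S f] image_iff)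
  then have ne: "{G. good G} \<noteq> {}" by blast
  have chain: "\<Union>\<C> \<in> {G. good G}" if \<C>: "\<C> \<noteq> {}" "subset.chain {G. good G} \<C>" for \<C>
  proof -
    have g: "G \<in> \<C> \<Longrightarrow> good G" for G using \<C>(2) by (auto simp: subset.chain_def)
    have joint: "\<exists>G\<in>\<C>. u \<in> G \<and> v \<in> G" if "u \<in> \<Union>\<C>" "v \<in> \<Union>\<C>" for u v
      using \<C>(2) that unfolding subset.chain_def by blast
    have "(\<lambda>s. (s, f s)) ` S \<subseteq> \<Union>\<C>" using \<C>(1) g unfolding good_def by blast
    moreover have "(a + a', b + b') \<in> \<Union>\<C> \<and> (a * a', b * b') \<in> \<Union>\<C>"
      if "(a, b) \<in> \<Union>\<C>" "(a', b') \<in> \<Union>\<C>" for a b a' b'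
      using joint[OF that] g unfolding good_def by (meson UnionI)
    moreover have "b = b'" if "(a, b) \<in> \<Union>\<C>" "(a, b') \<in> \<Union>\<C>" for a b b'
      using joint[OF that] g unfolding good_def by meson
    ultimately show ?thesis unfolding good_def by blast
  qed
  obtain G where G: "good G" and max: "\<And>G'. good G' \<Longrightarrow> G \<subseteq> G' \<Longrightarrow> G' = G"
    using subset_Zorn_nonempty[OF ne chain] by blast
  define D where "D = fst ` G"
  define g where "g a = (THE b. (a, b) \<in> G)" for a
  have g: "g a = b" if "(a, b) \<in> G" for a b
    unfolding g_def using G that unfolding good_def by (intro the_equality) blast+
  have gD: "(a, g a) \<in> G" if "a \<in> D" for a
    using that g by (auto simp: D_def)
  have fG: "(s, f s) \<in> G" if "s \<in> S" for s using G that unfolding good_def by blast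
  have DI: "(a, b) \<in> G \<Longrightarrow> a \<in> D" for a b unfolding D_def by force
  have cl: "(a + a', b + b') \<in> G" "(a * a', b * b') \<in> G" if "(a, b) \<in> G" "(a', b') \<in> G" for a b a' b'
    using G that unfolding good_def by blast+
  have gS: "g s = f s" if "s \<in> S" for s using g fG that by blast
  have D: "intermediate D"
    unfolding intermediate_def
  proof (intro conjI ballI subsetI)
    fix z :: "'e alg_closure" assume "z \<in> range to_ac" then show "z \<in> D" using DI fG intermediate_to_ac[OF S] by blast
  next
    fix z w assume "z \<in> D" "w \<in> D"
    then show "z + w \<in> D" "z * w \<in> D" using cl[OF gD gD] DI by blast+
  qed
  have hom: "hom_on D g"
    unfolding hom_on_def
    using gS[OF intermediate_1[OF S]] hom_on_1[OF S f] cl[OF gD gD] by (auto intro!: g)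
  have "x \<in> D" for x
  proof -
    obtain q where q: "minpoly_on D x q" using minpoly_on_exists[OF D] by blast
    have q': "coeffs_in D q" "q \<noteq> 0" "poly q x = 0"
      using q by (auto simp: minpoly_on_def[OF D])
    have "degree q > 0" using q' by (metis degree_eq_zeroE gr0I mult_zero_right pCons_0_0 poly_pCons add.right_neutral poly_0)
    moreover have "lead_coeff q \<in> D" "lead_coeff q \<noteq> 0" using q' by (auto simp: coeffs_in_def)
    then have "coeff (map_poly g q) (degree q) \<noteq> 0"
      using hom_on_nonzero[OF D hom, of "lead_coeff q"] by (simp add: coeff_map_poly hom_on_0[OF D hom])
    ultimately have "degree (map_poly g q) > 0"
      using le_degree by fastforce
    then obtain y where y: "poly (map_poly g q) y = 0" using alg_closed_imp_poly_has_root by blast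
    obtain S' f' where S': "intermediate S'" "D \<subseteq> S'" "x \<in> S'" "hom_on S' f'" "\<forall>s\<in>D. f' s = g s"
      using adjoin_root[OF D hom q y] by blast
    define G' where "G' = (\<lambda>s. (s, f' s)) ` S'"
    have sub: "G \<subseteq> G'"
    proof
      fix u assume "u \<in> G"
      then have "fst u \<in> D" "u = (fst u, g (fst u))" using DI[of "fst u" "snd u"] g[of "fst u" "snd u"] by auto
      then show "u \<in> G'" using S' unfolding G'_def by (metis image_eqI subsetD)
    qed
    moreover have "good G'"
      unfolding good_def
    proof (intro conjI allI impI)
      show "(\<lambda>s. (s, f s)) ` S \<subseteq> G'" using sub fG by blast
    qed (use S' in \<open>auto simp: G'_def intermediate_add intermediate_mult hom_on_add hom_on_mult image_iff\<close>)
    ultimately have "G' = G" by (intro max)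
    then show ?thesis using DI S'(3) unfolding G'_def by blast
  qed
  then have "is_ring_hom g"
    using hom unfolding is_ring_hom_def hom_on_def by blast
  then show ?thesis using gS by blast
qed

section \<open>Galois groups\<close>

lemma gal_group:
  assumes "\<And>x y. x \<in> L \<Longrightarrow> y \<in> L \<Longrightarrow> x + y \<in> L \<and> x * y \<in> L" and "range to_ac \<subseteq> L"
  shows "group (gal L)"
proof -
  have toL: "to_ac c \<in> L" for c using assms(2) by blast
  have "subgroup (carrier (gal L)) (BijGroup L)"
  proof
    show "carrier (gal L) \<subseteq> carrier (BijGroup L)" by (auto simp: gal_def BijGroup_def)
    show "\<one>\<^bsub>BijGroup L\<^esub> \<in> carrier (gal L)"
      using assms(1) toL by (simp add: gal_def BijGroup_def id_Bij)
  next
    fix f g assume fg: "f \<in> carrier (gal L)" "g \<in> carrier (gal L)"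
    then have "\<And>x. x \<in> L \<Longrightarrow> f x \<in> L" "\<And>x. x \<in> L \<Longrightarrow> g x \<in> L"
      by (auto simp: gal_def Bij_def bij_betw_def)
    then show "f \<otimes>\<^bsub>BijGroup L\<^esub> g \<in> carrier (gal L)"
      using fg assms toL compose_Bij[of f L g] by (simp add: gal_def BijGroup_def compose_def)
  next
    fix f assume f: "f \<in> carrier (gal L)"
    then have fB: "f \<in> Bij L" by (simp add: gal_def)
    then have inv: "inv\<^bsub>BijGroup L\<^esub> f = (\<lambda>x\<in>L. inv_into L f x)" by (rule inv_BijGroup)
    have b: "bij_betw f L L" using fB by (simp add: Bij_def)
    have I: "x \<in> L \<Longrightarrow> inv_into L f x \<in> L" "x \<in> L \<Longrightarrow> f (inv_into L f x) = x" "x \<in> L \<Longrightarrow> inv_into L f (f x) = x" for x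
      using b by (auto simp: bij_betw_def inv_into_into f_inv_into_f)
    have "inv_into L f (x + y) = inv_into L f x + inv_into L f y" "inv_into L f (x * y) = inv_into L f x * inv_into L f y"
      if "x \<in> L" "y \<in> L" for x y
    proof -
      have "f (inv_into L f x + inv_into L f y) = x + y" "f (inv_into L f x * inv_into L f y) = x * y"
        using f that I by (auto simp: gal_def)
      then show "inv_into L f (x + y) = inv_into L f x + inv_into L f y" "inv_into L f (x * y) = inv_into L f x * inv_into L f y"
        using I assms that by metis+
    qed
    moreover have "inv_into L f (to_ac c) = to_ac c" for c
      using I(3)[of "to_ac c"] f assms(2) by (auto simp: gal_def)
    ultimately show "inv\<^bsub>BijGroup L\<^esub> f \<in> carrier (gal L)"
      unfolding inv using fB assms(1) toL by (simp add: gal_def restrict_inv_into_Bij)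
  qed
  then have "group ((BijGroup L)\<lparr>carrier := carrier (gal L)\<rparr>)"
    by (rule group.subgroup_imp_group[OF group_BijGroup])
  moreover have "(BijGroup L)\<lparr>carrier := carrier (gal L)\<rparr> = gal L" by (simp add: gal_def)
  ultimately show ?thesis by simp
qed

abbreviation Gal :: "('e::field alg_closure \<Rightarrow> 'e alg_closure) set" where
  "Gal \<equiv> carrier (gal UNIV)"

lemma group_gal_UNIV: "group (gal (UNIV :: 'e::field alg_closure set))"
  by (rule gal_group) auto

lemma mem_gal_iff: "\<sigma> \<in> Gal \<longleftrightarrow> bij \<sigma> \<and> is_ring_hom \<sigma> \<and> (\<forall>c. \<sigma> (to_ac c) = to_ac c)"
proof
  assume "\<sigma> \<in> Gal"
  then have "bij \<sigma>" "\<forall>x y. \<sigma> (x + y) = \<sigma> x + \<sigma> y \<and> \<sigma> (x * y) = \<sigma> x * \<sigma> y" "\<forall>c. \<sigma> (to_ac c) = to_ac c"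
    by (auto simp: gal_def Bij_def)
  moreover from this(3) have "\<sigma> 1 = 1" by (metis to_ac_1)
  ultimately show "bij \<sigma> \<and> is_ring_hom \<sigma> \<and> (\<forall>c. \<sigma> (to_ac c) = to_ac c)"
    by (auto simp: is_ring_hom_def)
qed (auto simp: gal_def Bij_def is_ring_hom_def)

lemma gal_hom: "\<sigma> \<in> Gal \<Longrightarrow> is_ring_hom \<sigma>"
  and gal_bij: "\<sigma> \<in> Gal \<Longrightarrow> bij \<sigma>"
  and gal_to_ac: "\<sigma> \<in> Gal \<Longrightarrow> \<sigma> (to_ac c) = to_ac c"
  by (auto simp: mem_gal_iff)

lemma gal_mult: "\<sigma> \<in> Gal \<Longrightarrow> \<tau> \<in> Gal \<Longrightarrow> \<sigma> \<otimes>\<^bsub>gal UNIV\<^esub> \<tau> = \<sigma> \<circ> \<tau>"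
  by (auto simp: gal_def BijGroup_def compose_def fun_eq_iff)

lemma gal_one: "\<one>\<^bsub>gal UNIV\<^esub> = id"
  by (auto simp: gal_def BijGroup_def fun_eq_iff)

lemma id_in_gal: "id \<in> Gal"
  by (simp add: mem_gal_iff ring_hom_id)

lemma gal_comp: "\<sigma> \<in> Gal \<Longrightarrow> \<tau> \<in> Gal \<Longrightarrow> \<sigma> \<circ> \<tau> \<in> Gal"
  by (auto simp: mem_gal_iff ring_hom_comp bij_comp)

lemma gal_inv: "\<sigma> \<in> Gal \<Longrightarrow> inv_into UNIV \<sigma> \<in> Gal"
proof -
  assume s: "\<sigma> \<in> Gal"
  have b: "bij \<sigma>" and h: "is_ring_hom \<sigma>" and c: "\<And>c. \<sigma> (to_ac c) = to_ac c" using s by (auto simp: mem_gal_iff)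
  have [simp]: "\<sigma> (inv_into UNIV \<sigma> x) = x" "inv_into UNIV \<sigma> (\<sigma> x) = x" for x
    using b by (simp_all add: bij_is_surj surj_f_inv_f bij_is_inj)
  have eq: "\<sigma> a = b \<Longrightarrow> inv_into UNIV \<sigma> b = a" for a b by auto
  have "is_ring_hom (inv_into UNIV \<sigma>)"
    unfolding is_ring_hom_def by (intro conjI allI eq) (auto simp: h ring_hom_1 ring_hom_add ring_hom_mult)
  moreover have "inv_into UNIV \<sigma> (to_ac c) = to_ac c" for c by (rule eq) (rule c)
  ultimately show ?thesis using b bij_imp_bij_inv by (auto simp: mem_gal_iff)
qed

lemma gal_inv_apply: "\<sigma> \<in> Gal \<Longrightarrow> \<sigma> (inv_into UNIV \<sigma> x) = x" "\<sigma> \<in> Gal \<Longrightarrow> inv_into UNIV \<sigma> (\<sigma> x) = x"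
  using gal_bij[of \<sigma>] by (simp_all add: bij_is_surj surj_f_inv_f bij_is_inj)

lemma gal_inv_comp: "\<sigma> \<in> Gal \<Longrightarrow> \<sigma> \<circ> inv_into UNIV \<sigma> = id" "\<sigma> \<in> Gal \<Longrightarrow> inv_into UNIV \<sigma> \<circ> \<sigma> = id"
  by (auto simp: fun_eq_iff gal_inv_apply)

section \<open>Conjugate embeddings, fixed fields and primitive elements\<close>

lemma hom_fixing_base_image:
  fixes f h :: "'e::field alg_closure \<Rightarrow> 'w::field"
  assumes f: "is_ring_hom f" and h: "is_ring_hom h" and eq: "\<And>c. f (to_ac c) = h (to_ac c)"
  shows "f x \<in> range h"
proof -
  obtain p where p: "p \<noteq> 0" "poly (map_poly to_ac p) x = 0"
    by (rule alg_closure_algebraic)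
  let ?p = "map_poly to_ac p"
  \<comment> \<open>The factorization into linear factors over the closure is carried over by
    \<open>h\<close>. The coefficients come from the base, where \<open>f\<close> and
    \<open>h\<close> agree, so \<open>f x\<close> is a root of the result and hence some
    \<open>h a\<close>.\<close>
  obtain A where A: "size A = degree ?p" "?p = smult (lead_coeff ?p) (\<Prod>a\<in>#A. [:-a, 1:])"
    using alg_closed_imp_factorization[of ?p] p by (auto simp: map_poly_eq_0_iff)
  have nz: "lead_coeff ?p \<noteq> 0" using p by (simp add: map_poly_eq_0_iff)
  have "0 = f (poly ?p x)" using p f by (simp add: ring_hom_0)
  also have "\<dots> = poly (map_poly f ?p) (f x)" using f by (rule ring_hom_poly)
  also have "map_poly f ?p = map_poly h ?p"
    using eq by (auto intro!: poly_eqI simp: coeff_map_poly ring_hom_0 f h)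
  finally have z: "poly (map_poly h ?p) (f x) = 0" by simp
  have m: "map_poly h (\<Prod>a\<in>#A. [:-a, 1:]) = (\<Prod>a\<in>#A. [:-h a, 1:])" for A
    by (induction A) (simp_all only: image_mset_add_mset prod_mset.add_mset ring_hom_map_poly[OF h],
        auto simp: map_poly_pCons ring_hom_0 ring_hom_1 ring_hom_uminus h)
  have "map_poly h ?p = smult (h (lead_coeff ?p)) (\<Prod>a\<in>#A. [:-h a, 1:])"
    by (subst A(2)) (auto intro!: poly_eqI simp: coeff_map_poly ring_hom_0 ring_hom_mult h simp flip: m)
  then have "(\<Prod>a\<in>#A. f x - h a) = 0"
    using z nz by (simp add: ring_hom_eq_0_iff h poly_prod_mset)
  then show ?thesis by (auto simp: prod_mset_zero_iff)
qed

text \<open>Both embeddings have the same image by \<open>hom_fixing_base_image\<close>, so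
  \<open>f\<close> can be followed by the inverse of \<open>h\<close>; surjectivity of the composite
  is that lemma with the roles exchanged. Restrictions and lifts of automorphisms are produced from
  it.\<close>

lemma homs_conjugate:
  fixes f h :: "'e::field alg_closure \<Rightarrow> 'w::field"
  assumes f: "is_ring_hom f" and h: "is_ring_hom h" and eq: "\<And>c. f (to_ac c) = h (to_ac c)"
  shows "\<exists>\<mu>\<in>Gal. \<forall>x. f x = h (\<mu> x)"
proof -
  define \<mu> where "\<mu> = (\<lambda>x. inv_into UNIV h (f x))"
  have hmu: "h (\<mu> x) = f x" for x
    unfolding \<mu>_def using hom_fixing_base_image[OF assms] by (rule f_inv_into_f)
  have inj: "h a = h b \<Longrightarrow> a = b" for a b using ring_hom_inj[OF h] by (rule injD)
  have "is_ring_hom \<mu>"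
    unfolding is_ring_hom_def
    by (intro conjI allI; rule inj) (simp_all add: hmu f h ring_hom_1 ring_hom_add ring_hom_mult)
  moreover have "\<mu> (to_ac c) = to_ac c" for c by (rule inj) (simp add: hmu eq)
  moreover have "surj \<mu>"
  proof (rule surjI)
    fix y
    have "h y \<in> range f" by (rule hom_fixing_base_image) (auto simp: h f eq)
    then show "\<mu> (inv_into UNIV f (h y)) = y" by (intro inj) (simp add: hmu f_inv_into_f)
  qed
  ultimately have "\<mu> \<in> Gal" by (auto simp: mem_gal_iff bij_def intro: ring_hom_inj)
  then show ?thesis using hmu by metis
qed

lemma hom_fixing_in_gal:
  assumes "is_ring_hom f" "\<And>c. f (to_ac c) = to_ac c" shows "f \<in> Gal"
proof -
  obtain \<mu> where "\<mu> \<in> Gal" "\<forall>x. f x = id (\<mu> x)"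
    using homs_conjugate[OF assms(1) ring_hom_id(1)] assms(2) by auto
  then show ?thesis by (metis ext id_apply)
qed

text \<open>The substitution of \<open>y\<close> for \<open>x\<close> over \<open>S\<close> extends
  to the whole closure, and an endomorphism over the base is an automorphism.\<close>

lemma conjugate_root:
  assumes S: "intermediate S" and q: "minpoly_on S x q" and y: "poly q y = 0"
  shows "\<exists>\<sigma>\<in>Gal. (\<forall>s\<in>S. \<sigma> s = s) \<and> \<sigma> x = y"
proof -
  have id: "hom_on S id" by (auto simp: hom_on_def)
  obtain S' f' where S': "intermediate S'" "S \<subseteq> S'" "x \<in> S'" "hom_on S' f'" "\<forall>s\<in>S. f' s = s" "f' x = y"
    using adjoin_root[OF S id q, of y] y by (auto simp: map_poly_id)
  obtain g where g: "is_ring_hom g" "\<forall>s\<in>S'. g s = f' s"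
    using hom_on_extends[OF S'(1,4)] by blast
  have "g \<in> Gal"
    by (rule hom_fixing_in_gal[OF g(1)]) (use g(2) S'(2,5) intermediate_to_ac[OF S] in \<open>metis subsetD\<close>)
  moreover have "\<forall>s\<in>S. g s = s" "g x = y" using g(2) S' by auto
  ultimately show ?thesis by blast
qed

text \<open>The roots of the minimal polynomial \<open>q\<close> are conjugate over
  \<open>S\<close>, so \<open>x\<close> is the only one. In characteristic 0 the derivative would be
  a smaller polynomial vanishing at a multiple root; so \<open>q\<close> is linear and
  \<open>x\<close> is, up to sign, a quotient of its coefficients.\<close>

theorem fixed_field:
  fixes S :: "'e::field_char_0 alg_closure set"
  assumes S: "intermediate S" and x: "\<And>\<sigma>. \<sigma> \<in> Gal \<Longrightarrow> (\<forall>s\<in>S. \<sigma> s = s) \<Longrightarrow> \<sigma> x = x"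
  shows "x \<in> S"
proof -
  obtain q where q: "minpoly_on S x q" using minpoly_on_exists[OF S] by blast
  have q': "coeffs_in S q" "q \<noteq> 0" "poly q x = 0"
    "\<And>p. coeffs_in S p \<Longrightarrow> p \<noteq> 0 \<Longrightarrow> poly p x = 0 \<Longrightarrow> degree q \<le> degree p"
    using q by (auto simp: minpoly_on_def[OF S])
  have uniq: "y = x" if "poly q y = 0" for y
    using conjugate_root[OF S q that] x by auto
  obtain r where r: "q = [:-x, 1:] * r" using q'(3) by (metis dvdE poly_eq_0_iff_dvd)
  have "r \<noteq> 0" using r q' by auto
  then have deg: "degree q = Suc (degree r)" unfolding r by (subst degree_mult_eq) auto
  have "degree r = 0"
  proof (rule ccontr)
    assume d: "degree r \<noteq> 0"
    then obtain y where "poly r y = 0" using alg_closed_imp_poly_has_root by blast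
    then have rx: "poly r x = 0" using uniq[of y] by (auto simp: r)
    have "poly (pderiv q) x = 0" unfolding r pderiv_mult using rx by (simp add: pderiv_pCons)
    moreover have "pderiv q \<noteq> 0" "degree (pderiv q) < degree q"
      using deg by (auto simp: pderiv_eq_0_iff degree_pderiv)
    ultimately show False using q'(4)[OF coeffs_in_pderiv[OF S q'(1)]] by auto
  qed
  then obtain c where c: "r = [:c:]" by (auto elim: degree_eq_zeroE)
  have "c \<noteq> 0" using \<open>r \<noteq> 0\<close> c by auto
  have "coeff q 0 \<in> S" "coeff q 1 \<in> S" using q'(1) by (auto simp: coeffs_in_def)
  then have "- (c * x) \<in> S" "c \<in> S" by (simp_all add: r c mult.commute)
  then have "- ((- (c * x)) / c) \<in> S" using intermediate_uminus[OF S intermediate_divide[OF S]] by blast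
  moreover have "- ((- (c * x)) / c) = x" using \<open>c \<noteq> 0\<close> by simp
  ultimately show ?thesis by simp
qed

lemma finite_orbit: "finite ((\<lambda>\<sigma>. \<sigma> x) ` Gal)"
proof -
  obtain p where p: "p \<noteq> 0" "poly (map_poly to_ac p) x = 0"
    by (rule alg_closure_algebraic)
  have "poly (map_poly to_ac p) (\<sigma> x) = 0" if "\<sigma> \<in> Gal" for \<sigma>
  proof -
    have "map_poly \<sigma> (map_poly to_ac p) = map_poly to_ac p"
      using that by (auto intro!: poly_eqI simp: coeff_map_poly ring_hom_0 gal_hom gal_to_ac)
    then show ?thesis using ring_hom_poly[OF gal_hom[OF that], of "map_poly to_ac p" x] p that
      by (simp add: ring_hom_0 gal_hom)
  qed
  then have "(\<lambda>\<sigma>. \<sigma> x) ` Gal \<subseteq> {y. poly (map_poly to_ac p) y = 0}" by auto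
  moreover have "finite {y. poly (map_poly to_ac p) y = 0}"
    using p by (intro poly_roots_finite) (auto simp: map_poly_eq_0_iff)
  ultimately show ?thesis by (rule finite_subset)
qed

text \<open>Phrased by stabilizers instead of generated fields, which is the form that reduces
  continuity conditions to a single element.\<close>

lemma primitive_element:
  fixes Y :: "'e::field_char_0 alg_closure set"
  assumes "finite Y"
  shows "\<exists>\<zeta>. \<forall>\<sigma>\<in>Gal. \<sigma> \<zeta> = \<zeta> \<longrightarrow> (\<forall>x\<in>Y. \<sigma> x = x)"
  using assms
proof (induction Y)
  case (insert x Y)
  then obtain \<zeta> where \<zeta>: "\<And>\<sigma>. \<sigma> \<in> Gal \<Longrightarrow> \<sigma> \<zeta> = \<zeta> \<Longrightarrow> (\<forall>x\<in>Y. \<sigma> x = x)" by blast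
  \<comment> \<open>The ratios that \<open>n\<close> must avoid, so that no automorphism fixes
    \<open>\<zeta> + n x\<close> while moving \<open>x\<close>; there are finitely many because
    orbits are finite.\<close>
  define A where "A = (\<lambda>(a, b). - (a - \<zeta>) / (b - x)) ` ((\<lambda>\<sigma>. \<sigma> \<zeta>) ` Gal \<times> (\<lambda>\<sigma>. \<sigma> x) ` Gal)"
  have "finite A" unfolding A_def by (intro finite_imageI finite_cartesian_product finite_orbit)
  moreover have "infinite (range (of_nat :: nat \<Rightarrow> 'e alg_closure))"
    by (simp add: finite_image_iff inj_of_nat)
  ultimately obtain n :: nat where n: "of_nat n \<notin> A" by (metis finite_subset image_subsetI)
  show ?case
  proof (intro exI ballI impI)
    fix \<sigma> y assume s: "\<sigma> \<in> Gal" "\<sigma> (\<zeta> + of_nat n * x) = \<zeta> + of_nat n * x" and y: "y \<in> insert x Y"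
    have eq: "\<sigma> \<zeta> + of_nat n * \<sigma> x = \<zeta> + of_nat n * x"
      using s by (simp add: ring_hom_add ring_hom_mult ring_hom_of_nat gal_hom)
    have "\<sigma> x = x"
    proof (rule ccontr)
      assume "\<sigma> x \<noteq> x"
      then have "of_nat n = - (\<sigma> \<zeta> - \<zeta>) / (\<sigma> x - x)" using eq by (simp add: field_simps)
      then show False using n s(1) unfolding A_def by force
    qed
    moreover have "\<sigma> \<zeta> = \<zeta>" using eq calculation by simp
    ultimately show "\<sigma> y = y" using \<zeta> s y by auto
  qed
qed auto

subsection \<open>Restriction of automorphisms along an embedding of algebraic closures\<close>

text \<open>The expression inside \<open>res_cocycle\<close>. Taking a preimage under
  \<open>\<tau>\<close> makes sense because \<open>\<sigma>\<close> maps the image of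
  \<open>\<tau>\<close> into itself, by \<open>homs_conjugate\<close>; the result is a homomorphism
  of Galois groups.\<close>

definition gal_res :: "('e alg_closure \<Rightarrow> 'f alg_closure) \<Rightarrow> ('f::field alg_closure \<Rightarrow> 'f alg_closure) \<Rightarrow> ('e::field alg_closure \<Rightarrow> 'e alg_closure)" where
  "gal_res \<tau> \<sigma> = inv_into UNIV \<tau> \<circ> \<sigma> \<circ> \<tau>"

definition ac_embedding :: "('e::field \<Rightarrow> 'f::field) \<Rightarrow> ('e alg_closure \<Rightarrow> 'f alg_closure) \<Rightarrow> bool" where
  "ac_embedding e \<tau> \<longleftrightarrow> is_ring_hom \<tau> \<and> (\<forall>c. \<tau> (to_ac c) = to_ac (e c))"

context
  fixes e :: "'e::field \<Rightarrow> 'f::field" and \<tau>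
  assumes \<tau>: "ac_embedding e \<tau>"
begin

lemma ac_embedding_hom: "is_ring_hom \<tau>" and ac_embedding_to_ac: "\<tau> (to_ac c) = to_ac (e c)"
  using \<tau> by (auto simp: ac_embedding_def)

lemma ac_embedding_eq_iff: "\<tau> x = \<tau> y \<longleftrightarrow> x = y"
  using ring_hom_inj[OF ac_embedding_hom] by (auto dest: injD)

lemma
  assumes s: "\<sigma> \<in> Gal"
  shows gal_res_in_gal: "gal_res \<tau> \<sigma> \<in> Gal" and gal_res_apply: "\<tau> (gal_res \<tau> \<sigma> x) = \<sigma> (\<tau> x)"
proof -
  have "\<exists>\<mu>\<in>Gal. \<forall>x. (\<sigma> \<circ> \<tau>) x = \<tau> (\<mu> x)"
    using s by (intro homs_conjugate ring_hom_comp ac_embedding_hom gal_hom) (auto simp: ac_embedding_to_ac gal_to_ac)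
  then obtain \<mu> where \<mu>: "\<mu> \<in> Gal" "\<And>x. \<sigma> (\<tau> x) = \<tau> (\<mu> x)" by auto
  have "gal_res \<tau> \<sigma> = \<mu>"
    using ring_hom_inj[OF ac_embedding_hom] by (auto simp: gal_res_def fun_eq_iff \<mu>(2))
  then show "gal_res \<tau> \<sigma> \<in> Gal" "\<tau> (gal_res \<tau> \<sigma> x) = \<sigma> (\<tau> x)" using \<mu> by auto
qed

lemma gal_res_eqI:
  assumes "\<And>x. \<sigma> (\<tau> x) = \<tau> (\<rho> x)" shows "gal_res \<tau> \<sigma> = \<rho>"
  using ring_hom_inj[OF ac_embedding_hom] by (auto simp: gal_res_def fun_eq_iff assms)

lemma gal_res_comp:
  assumes "\<sigma> \<in> Gal" "\<sigma>' \<in> Gal" shows "gal_res \<tau> (\<sigma> \<circ> \<sigma>') = gal_res \<tau> \<sigma> \<circ> gal_res \<tau> \<sigma>'"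
  by (rule gal_res_eqI) (use assms in \<open>simp add: gal_res_apply\<close>)

lemma gal_res_id: "gal_res \<tau> id = id"
  by (rule gal_res_eqI) auto

lemma gal_res_inv: assumes "\<sigma> \<in> Gal" shows "gal_res \<tau> (inv_into UNIV \<sigma>) = inv_into UNIV (gal_res \<tau> \<sigma>)"
proof -
  have "gal_res \<tau> (inv_into UNIV \<sigma>) \<circ> gal_res \<tau> \<sigma> = id"
    using assms by (simp flip: gal_res_comp add: gal_inv gal_inv_comp gal_res_id)
  then show ?thesis using gal_res_in_gal[OF assms] by (metis comp_assoc comp_id gal_inv_comp(1) id_comp)
qed

end

lemma ac_embedding_comp:
  "ac_embedding e \<tau> \<Longrightarrow> ac_embedding e' \<tau>' \<Longrightarrow> ac_embedding (e' \<circ> e) (\<tau>' \<circ> \<tau>)"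
  by (auto simp: ac_embedding_def ring_hom_comp)

lemma gal_res_gal_res:
  assumes "ac_embedding e \<tau>" "ac_embedding e' \<tau>'" "\<sigma> \<in> Gal"
  shows "gal_res (\<tau>' \<circ> \<tau>) \<sigma> = gal_res \<tau> (gal_res \<tau>' \<sigma>)"
  by (rule gal_res_eqI[OF ac_embedding_comp[OF assms(1,2)]])
    (simp add: gal_res_apply[OF assms(1)] gal_res_in_gal[OF assms(2)] gal_res_apply[OF assms(2)] assms(3))

lemma intermediate_range: "intermediate (range to_ac)"
  unfolding intermediate_def by (auto simp flip: to_ac_add to_ac_mult)

lemma ac_embedding_exists:
  fixes e :: "'e::field \<Rightarrow> 'w::alg_closed_field"
  assumes e: "is_ring_hom e"
  shows "\<exists>g. is_ring_hom g \<and> (\<forall>c. g (to_ac c) = e c)"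
proof -
  have "hom_on (range to_ac) (e \<circ> of_ac)"
    unfolding hom_on_def
  proof (intro conjI ballI)
    show "(e \<circ> of_ac) 1 = 1" using of_ac_to_ac[of 1] e by (simp add: ring_hom_1 del: of_ac_to_ac)
  next
    fix x y :: "'e alg_closure" assume "x \<in> range to_ac" "y \<in> range to_ac"
    then obtain a b where "x = to_ac a" "y = to_ac b" by auto
    then show "(e \<circ> of_ac) (x + y) = (e \<circ> of_ac) x + (e \<circ> of_ac) y" "(e \<circ> of_ac) (x * y) = (e \<circ> of_ac) x * (e \<circ> of_ac) y"
      using e by (auto simp flip: to_ac_add to_ac_mult simp: ring_hom_add ring_hom_mult)
  qed
  from hom_on_extends[OF intermediate_range this] show ?thesis by auto
qed

lemma ac_extension_embedding:
  assumes "is_ring_hom e" shows "ac_embedding e (ac_extension e)"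
proof -
  have "\<exists>t. is_ring_hom t \<and> (\<forall>x. t (to_ac x) = to_ac (e x))"
    using ac_embedding_exists[OF ring_hom_comp[OF ring_hom_to_ac assms]] by simp
  then show ?thesis unfolding ac_extension_def ac_embedding_def by (rule someI_ex)
qed

section \<open>Continuous cohomology in degree one\<close>

lemma topspace_krull: "topspace (krull_topology UNIV) = Gal"
  by (simp add: krull_topology_def)

text \<open>A basic neighbourhood in a product of discrete spaces prescribes finitely many
  coordinates, here the images of the elements of \<open>Y\<close>.\<close>

lemma continuous_krull_iff:
  fixes c :: "('e::field alg_closure \<Rightarrow> 'e alg_closure) \<Rightarrow> 'b"
  assumes "c ` Gal \<subseteq> A"
  shows "continuous_map (krull_topology UNIV) (discrete_topology A) c \<longleftrightarrow>
    (\<forall>\<sigma>\<in>Gal. \<exists>Y. finite Y \<and> (\<forall>\<sigma>'\<in>Gal. (\<forall>x\<in>Y. \<sigma>' x = \<sigma> x) \<longrightarrow> c \<sigma>' = c \<sigma>))" (is "?L \<longleftrightarrow> ?R")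
proof
  assume ?L
  show ?R
  proof
    fix \<sigma> :: "'e alg_closure \<Rightarrow> 'e alg_closure" assume s: "\<sigma> \<in> Gal"
    then have "openin (discrete_topology A) {c \<sigma>}" using assms by auto
    with \<open>?L\<close> have "openin (krull_topology UNIV) {x \<in> Gal. c x \<in> {c \<sigma>}}"
      unfolding continuous_map_def topspace_krull by blast
    then obtain W where W: "openin (product_topology (\<lambda>_. discrete_topology UNIV) UNIV) W"
      "{x \<in> Gal. c x \<in> {c \<sigma>}} = W \<inter> Gal"
      unfolding krull_topology_def openin_subtopology by blast
    then have "\<sigma> \<in> W" using s by blast
    then obtain U where U: "finite {i. U i \<noteq> UNIV}" "\<sigma> \<in> Pi\<^sub>E UNIV U" "Pi\<^sub>E UNIV U \<subseteq> W"
      using W(1) unfolding openin_product_topology_alt by simp blast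
    show "\<exists>Y. finite Y \<and> (\<forall>\<sigma>'\<in>Gal. (\<forall>x\<in>Y. \<sigma>' x = \<sigma> x) \<longrightarrow> c \<sigma>' = c \<sigma>)"
    proof (intro exI[of _ "{i. U i \<noteq> UNIV}"] conjI ballI impI U(1))
      fix \<sigma>' assume s': "\<sigma>' \<in> Gal" "\<forall>x\<in>{i. U i \<noteq> UNIV}. \<sigma>' x = \<sigma> x"
      have "\<sigma>' i \<in> U i" for i
        using U(2) s'(2) by (cases "U i = UNIV") (auto simp: PiE_iff)
      then have "\<sigma>' \<in> W" using U(3) by (auto simp: PiE_iff)
      then show "c \<sigma>' = c \<sigma>" using W(2) s'(1) by blast
    qed
  qed
next
  assume R: ?R
  show ?L
    unfolding continuous_map_def topspace_krull
  proof (intro conjI allI impI)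
    fix V assume "openin (discrete_topology A) V"
    obtain N where N: "\<And>\<sigma>. \<sigma> \<in> Gal \<Longrightarrow> finite (N \<sigma>)"
      "\<And>\<sigma> \<sigma>'. \<sigma> \<in> Gal \<Longrightarrow> \<sigma>' \<in> Gal \<Longrightarrow> (\<forall>x\<in>N \<sigma>. \<sigma>' x = \<sigma> x) \<Longrightarrow> c \<sigma>' = c \<sigma>"
      using bchoice[OF R] by blast
    define W where "W = {\<rho>. \<exists>\<sigma>\<in>Gal. c \<sigma> \<in> V \<and> (\<forall>x\<in>N \<sigma>. \<rho> x = \<sigma> x)}"
    have "openin (product_topology (\<lambda>_. discrete_topology UNIV) UNIV) W"
      unfolding openin_product_topology_alt
    proof
      fix \<rho> assume "\<rho> \<in> W"
      then obtain \<sigma> where s: "\<sigma> \<in> Gal" "c \<sigma> \<in> V" "\<And>x. x \<in> N \<sigma> \<Longrightarrow> \<rho> x = \<sigma> x"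
        unfolding W_def by blast
      define U where "U = (\<lambda>i. if i \<in> N \<sigma> then {\<sigma> i} else UNIV)"
      have "{i. U i \<noteq> UNIV} \<subseteq> N \<sigma>" by (auto simp: U_def split: if_splits)
      then have "finite {i. U i \<noteq> UNIV}" using N(1)[OF s(1)] finite_subset by blast
      moreover have "\<rho> \<in> Pi\<^sub>E UNIV U" using s(3) by (auto simp: U_def PiE_iff)
      moreover have "Pi\<^sub>E UNIV U \<subseteq> W"
      proof
        fix \<rho>' assume r: "\<rho>' \<in> Pi\<^sub>E UNIV U"
        have "\<rho>' x = \<sigma> x" if "x \<in> N \<sigma>" for x
          using PiE_mem[OF r, of x] that by (simp add: U_def)
        then show "\<rho>' \<in> W" unfolding W_def using s(1,2) by blast
      qed
      ultimately show "\<exists>U. finite {i \<in> UNIV. U i \<noteq> topspace (discrete_topology UNIV)} \<and>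
          (\<forall>i\<in>UNIV. openin (discrete_topology UNIV) (U i)) \<and> \<rho> \<in> Pi\<^sub>E UNIV U \<and> Pi\<^sub>E UNIV U \<subseteq> W"
        by (intro exI[of _ U]) simp
    qed
    moreover have "{x \<in> Gal. c x \<in> V} = W \<inter> Gal"
    proof (intro equalityI subsetI)
      fix \<sigma> assume "\<sigma> \<in> {x \<in> Gal. c x \<in> V}"
      then show "\<sigma> \<in> W \<inter> Gal" unfolding W_def by blast
    next
      fix \<rho> assume r: "\<rho> \<in> W \<inter> Gal"
      then obtain \<sigma> where s: "\<sigma> \<in> Gal" "c \<sigma> \<in> V" "\<forall>x\<in>N \<sigma>. \<rho> x = \<sigma> x"
        unfolding W_def by blast
      then show "\<rho> \<in> {x \<in> Gal. c x \<in> V}" using N(2)[of \<sigma> \<rho>] r by auto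
    qed
    ultimately show "openin (krull_topology UNIV) {x \<in> Gal. c x \<in> V}"
      unfolding krull_topology_def openin_subtopology by blast
  qed (use assms in auto)
qed

text \<open>The preimage of a set is a union, over the admissible pairs of values, of intersections
  of two preimages of points.\<close>

lemma continuous_map_discrete_binop:
  assumes c: "continuous_map Y (discrete_topology A) c" and d: "continuous_map Y (discrete_topology B) d"
    and m: "\<And>a b. a \<in> A \<Longrightarrow> b \<in> B \<Longrightarrow> m a b \<in> C"
  shows "continuous_map Y (discrete_topology C) (\<lambda>x. m (c x) (d x))"
  unfolding continuous_map_def
proof (intro conjI allI impI)
  have cA: "x \<in> topspace Y \<Longrightarrow> c x \<in> A" and dB: "x \<in> topspace Y \<Longrightarrow> d x \<in> B" for x
    using c d by (auto simp: continuous_map_def)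
  then show "(\<lambda>x. m (c x) (d x)) \<in> topspace Y \<rightarrow> topspace (discrete_topology C)" using m by auto
  fix U
  have o: "openin Y ({x \<in> topspace Y. c x \<in> {a}} \<inter> {x \<in> topspace Y. d x \<in> {b}})" if "a \<in> A" "b \<in> B" for a b
  proof -
    have "openin (discrete_topology A) {a}" "openin (discrete_topology B) {b}" using that by auto
    then show ?thesis using c d unfolding continuous_map_def by (blast intro: openin_Int)
  qed
  have "{x \<in> topspace Y. m (c x) (d x) \<in> U} =
    (\<Union>p\<in>{p \<in> A \<times> B. m (fst p) (snd p) \<in> U}. {x \<in> topspace Y. c x \<in> {fst p}} \<inter> {x \<in> topspace Y. d x \<in> {snd p}})"
    using cA dB by auto
  then show "openin Y {x \<in> topspace Y. m (c x) (d x) \<in> U}"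
    using o by (auto intro!: openin_Union)
qed

lemma continuous_map_discrete_unop:
  assumes "continuous_map Y (discrete_topology A) c" and "\<And>a. a \<in> A \<Longrightarrow> m a \<in> C"
  shows "continuous_map Y (discrete_topology C) (\<lambda>x. m (c x))"
  using continuous_map_discrete_binop[OF assms(1) assms(1), of "\<lambda>a b. m a"] assms(2) by auto

text \<open>A discrete module under a topological group. Continuity of the orbit maps is what makes
  coboundaries continuous, so that \<open>B\<close> is a subgroup of \<open>Z\<close>.\<close>

locale galois_module =
  \<Gamma>: group \<Gamma> + A: comm_group A for \<Gamma> :: "'g monoid" and A :: "'a monoid" +
  fixes T :: "'g topology" and act :: "'g \<Rightarrow> 'a \<Rightarrow> 'a"
  assumes act_closed: "g \<in> carrier \<Gamma> \<Longrightarrow> a \<in> carrier A \<Longrightarrow> act g a \<in> carrier A"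
    and act_mult: "g \<in> carrier \<Gamma> \<Longrightarrow> a \<in> carrier A \<Longrightarrow> b \<in> carrier A \<Longrightarrow> act g (a \<otimes>\<^bsub>A\<^esub> b) = act g a \<otimes>\<^bsub>A\<^esub> act g b"
    and act_comp: "g \<in> carrier \<Gamma> \<Longrightarrow> h \<in> carrier \<Gamma> \<Longrightarrow> a \<in> carrier A \<Longrightarrow> act (g \<otimes>\<^bsub>\<Gamma>\<^esub> h) a = act g (act h a)"
    and topspace_T: "topspace T = carrier \<Gamma>"
    and act_continuous: "a \<in> carrier A \<Longrightarrow> continuous_map T (discrete_topology (carrier A)) (\<lambda>g. act g a)"
begin

abbreviation "Z \<equiv> Z1 \<Gamma> T A act"
abbreviation "B \<equiv> B1 \<Gamma> A act"

lemma cancel: "a \<in> carrier A \<Longrightarrow> b \<in> carrier A \<Longrightarrow> a \<otimes>\<^bsub>A\<^esub> (inv\<^bsub>A\<^esub> a \<otimes>\<^bsub>A\<^esub> b) = b"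
  by (simp flip: A.m_assoc)

lemma act_one: "g \<in> carrier \<Gamma> \<Longrightarrow> act g \<one>\<^bsub>A\<^esub> = \<one>\<^bsub>A\<^esub>"
  using act_mult[of g "\<one>\<^bsub>A\<^esub>" "\<one>\<^bsub>A\<^esub>"] act_closed[of g "\<one>\<^bsub>A\<^esub>"] by simp

lemma act_inv: "g \<in> carrier \<Gamma> \<Longrightarrow> a \<in> carrier A \<Longrightarrow> act g (inv\<^bsub>A\<^esub> a) = inv\<^bsub>A\<^esub> (act g a)"
  using act_mult[of g "inv\<^bsub>A\<^esub> a" a] act_closed[of g] act_one[of g]
  by (intro A.inv_equality[symmetric]) auto

lemma mem_Z: "c \<in> carrier Z \<longleftrightarrow> c \<in> carrier \<Gamma> \<rightarrow>\<^sub>E carrier A \<and>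
   continuous_map T (discrete_topology (carrier A)) c \<and>
   (\<forall>g\<in>carrier \<Gamma>. \<forall>h\<in>carrier \<Gamma>. c (g \<otimes>\<^bsub>\<Gamma>\<^esub> h) = c g \<otimes>\<^bsub>A\<^esub> act g (c h))"
  by (simp add: Z1_def)

lemma Z_closed: "c \<in> carrier Z \<Longrightarrow> g \<in> carrier \<Gamma> \<Longrightarrow> c g \<in> carrier A"
  by (auto simp: mem_Z)

lemma Z_cocycle: "c \<in> carrier Z \<Longrightarrow> g \<in> carrier \<Gamma> \<Longrightarrow> h \<in> carrier \<Gamma> \<Longrightarrow> c (g \<otimes>\<^bsub>\<Gamma>\<^esub> h) = c g \<otimes>\<^bsub>A\<^esub> act g (c h)"
  by (auto simp: mem_Z)

lemma Z_extensional: "c \<in> carrier Z \<Longrightarrow> d \<in> carrier Z \<Longrightarrow> (\<And>g. g \<in> carrier \<Gamma> \<Longrightarrow> c g = d g) \<Longrightarrow> c = d"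
  by (rule PiE_ext[of c "carrier \<Gamma>" "\<lambda>_. carrier A" d]) (auto simp: mem_Z)

lemma mult_Z: "c \<otimes>\<^bsub>Z\<^esub> d = (\<lambda>g\<in>carrier \<Gamma>. c g \<otimes>\<^bsub>A\<^esub> d g)"
  by (simp add: Z1_def)

lemma one_Z: "\<one>\<^bsub>Z\<^esub> = (\<lambda>g\<in>carrier \<Gamma>. \<one>\<^bsub>A\<^esub>)"
  by (simp add: Z1_def)

lemma restrict_continuous:
  assumes "continuous_map T U f" shows "continuous_map T U (\<lambda>g\<in>carrier \<Gamma>. f g)"
  by (rule continuous_map_eq[OF assms]) (simp add: topspace_T)

lemma Z_mult_closed: assumes "c \<in> carrier Z" "d \<in> carrier Z" shows "c \<otimes>\<^bsub>Z\<^esub> d \<in> carrier Z"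
proof -
  have "continuous_map T (discrete_topology (carrier A)) (\<lambda>g\<in>carrier \<Gamma>. c g \<otimes>\<^bsub>A\<^esub> d g)"
    by (rule restrict_continuous[OF continuous_map_discrete_binop[of _ "carrier A" c "carrier A" d]]) (use assms in \<open>auto simp: mem_Z\<close>)
  moreover have "c (g \<otimes>\<^bsub>\<Gamma>\<^esub> h) \<otimes>\<^bsub>A\<^esub> d (g \<otimes>\<^bsub>\<Gamma>\<^esub> h) = (c g \<otimes>\<^bsub>A\<^esub> d g) \<otimes>\<^bsub>A\<^esub> act g (c h \<otimes>\<^bsub>A\<^esub> d h)"
    if "g \<in> carrier \<Gamma>" "h \<in> carrier \<Gamma>" for g h
    using that assms
    by (simp add: Z_cocycle act_mult Z_closed act_closed A.m_ac)
  ultimately show ?thesis unfolding mult_Z using assms by (auto simp: mem_Z Z_closed)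
qed

lemma Z_one_closed: "\<one>\<^bsub>Z\<^esub> \<in> carrier Z"
  unfolding one_Z by (auto simp: mem_Z act_one intro!: restrict_continuous)

lemma Z_inv_closed: assumes "c \<in> carrier Z" shows "(\<lambda>g\<in>carrier \<Gamma>. inv\<^bsub>A\<^esub> (c g)) \<in> carrier Z"
proof -
  have "continuous_map T (discrete_topology (carrier A)) (\<lambda>g\<in>carrier \<Gamma>. inv\<^bsub>A\<^esub> (c g))"
    by (rule restrict_continuous[OF continuous_map_discrete_unop[of _ "carrier A" c]]) (use assms in \<open>auto simp: mem_Z\<close>)
  moreover have "inv\<^bsub>A\<^esub> (c (g \<otimes>\<^bsub>\<Gamma>\<^esub> h)) = inv\<^bsub>A\<^esub> (c g) \<otimes>\<^bsub>A\<^esub> act g (inv\<^bsub>A\<^esub> (c h))"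
    if "g \<in> carrier \<Gamma>" "h \<in> carrier \<Gamma>" for g h
    using that assms by (simp add: Z_cocycle Z_closed act_closed act_inv A.inv_mult)
  ultimately show ?thesis using assms by (auto simp: mem_Z Z_closed)
qed

lemma Z_comm_group: "comm_group Z"
proof (rule comm_groupI)
  show "\<exists>d\<in>carrier Z. d \<otimes>\<^bsub>Z\<^esub> c = \<one>\<^bsub>Z\<^esub>" if "c \<in> carrier Z" for c
    by (rule bexI[OF _ Z_inv_closed[OF that]])
      (use that in \<open>auto simp: mult_Z one_Z Z_closed intro!: restrict_ext\<close>)
  show "\<one>\<^bsub>Z\<^esub> \<otimes>\<^bsub>Z\<^esub> c = c" if "c \<in> carrier Z" for c
    by (rule Z_extensional[OF Z_mult_closed[OF Z_one_closed that] that]) (use that in \<open>simp add: mult_Z one_Z Z_closed\<close>)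
  show "c \<otimes>\<^bsub>Z\<^esub> d \<otimes>\<^bsub>Z\<^esub> e = c \<otimes>\<^bsub>Z\<^esub> (d \<otimes>\<^bsub>Z\<^esub> e)" if "c \<in> carrier Z" "d \<in> carrier Z" "e \<in> carrier Z" for c d e
    unfolding mult_Z using that by (intro restrict_ext) (simp add: Z_closed A.m_assoc)
  show "c \<otimes>\<^bsub>Z\<^esub> d = d \<otimes>\<^bsub>Z\<^esub> c" if "c \<in> carrier Z" "d \<in> carrier Z" for c d
    unfolding mult_Z using that by (intro restrict_ext) (simp add: Z_closed A.m_comm)
  show "\<one>\<^bsub>Z\<^esub> \<in> carrier Z" by (rule Z_one_closed)
  show "c \<otimes>\<^bsub>Z\<^esub> d \<in> carrier Z" if "c \<in> carrier Z" "d \<in> carrier Z" for c d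
    using that by (rule Z_mult_closed)
qed

lemma coboundary_Z: assumes a: "a \<in> carrier A" shows "(\<lambda>g\<in>carrier \<Gamma>. inv\<^bsub>A\<^esub> a \<otimes>\<^bsub>A\<^esub> act g a) \<in> carrier Z"
proof -
  have "continuous_map T (discrete_topology (carrier A)) (\<lambda>g\<in>carrier \<Gamma>. inv\<^bsub>A\<^esub> a \<otimes>\<^bsub>A\<^esub> act g a)"
    by (rule restrict_continuous[OF continuous_map_discrete_unop[of _ "carrier A" "\<lambda>g. act g a"]]) (use a in \<open>auto simp: act_continuous\<close>)
  moreover have "inv\<^bsub>A\<^esub> a \<otimes>\<^bsub>A\<^esub> act (g \<otimes>\<^bsub>\<Gamma>\<^esub> h) a = (inv\<^bsub>A\<^esub> a \<otimes>\<^bsub>A\<^esub> act g a) \<otimes>\<^bsub>A\<^esub> act g (inv\<^bsub>A\<^esub> a \<otimes>\<^bsub>A\<^esub> act h a)"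
    if "g \<in> carrier \<Gamma>" "h \<in> carrier \<Gamma>" for g h
  proof -
    have "(inv\<^bsub>A\<^esub> a \<otimes>\<^bsub>A\<^esub> act g a) \<otimes>\<^bsub>A\<^esub> (inv\<^bsub>A\<^esub> (act g a) \<otimes>\<^bsub>A\<^esub> act g (act h a)) = inv\<^bsub>A\<^esub> a \<otimes>\<^bsub>A\<^esub> ((act g a \<otimes>\<^bsub>A\<^esub> inv\<^bsub>A\<^esub> (act g a)) \<otimes>\<^bsub>A\<^esub> act g (act h a))"
      using that a by (simp add: act_closed A.m_assoc cancel)
    then show ?thesis using that a by (simp add: act_mult act_inv act_closed act_comp)
  qed
  ultimately show ?thesis using a by (auto simp: mem_Z act_closed)
qed

lemma B_subgroup: "subgroup B Z"
proof (rule group.subgroupI)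
  show "group Z" using Z_comm_group by (simp add: comm_group_def)
  show "B \<subseteq> carrier Z" using coboundary_Z by (auto simp: B1_def)
  show "B \<noteq> {}" using A.one_closed by (auto simp: B1_def)
  fix c assume "c \<in> B"
  then obtain a where a: "a \<in> carrier A" "c = (\<lambda>g\<in>carrier \<Gamma>. inv\<^bsub>A\<^esub> a \<otimes>\<^bsub>A\<^esub> act g a)" by (auto simp: B1_def)
  let ?d = "\<lambda>g\<in>carrier \<Gamma>. inv\<^bsub>A\<^esub> (inv\<^bsub>A\<^esub> a) \<otimes>\<^bsub>A\<^esub> act g (inv\<^bsub>A\<^esub> a)"
  have "inv\<^bsub>Z\<^esub> c = ?d"
  proof (rule group.inv_equality[OF \<open>group Z\<close>])
    have "(a \<otimes>\<^bsub>A\<^esub> inv\<^bsub>A\<^esub> b) \<otimes>\<^bsub>A\<^esub> (inv\<^bsub>A\<^esub> a \<otimes>\<^bsub>A\<^esub> b) = \<one>\<^bsub>A\<^esub>" if "b \<in> carrier A" for b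
    proof -
      have "inv\<^bsub>A\<^esub> a \<otimes>\<^bsub>A\<^esub> b = inv\<^bsub>A\<^esub> (a \<otimes>\<^bsub>A\<^esub> inv\<^bsub>A\<^esub> b)" using that a(1) by (simp add: A.inv_mult)
      then show ?thesis using that a(1) by simp
    qed
    then show "?d \<otimes>\<^bsub>Z\<^esub> c = \<one>\<^bsub>Z\<^esub>"
      using a by (auto simp: mult_Z one_Z act_inv act_closed intro!: restrict_ext)
  qed (use a coboundary_Z[of a] coboundary_Z[of "inv\<^bsub>A\<^esub> a"] in simp_all)
  then show "inv\<^bsub>Z\<^esub> c \<in> B" unfolding B1_def using A.inv_closed[OF a(1)] by blast
  fix c' assume "c' \<in> B"
  then obtain b where b: "b \<in> carrier A" "c' = (\<lambda>g\<in>carrier \<Gamma>. inv\<^bsub>A\<^esub> b \<otimes>\<^bsub>A\<^esub> act g b)" by (auto simp: B1_def)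
  have "c \<otimes>\<^bsub>Z\<^esub> c' = (\<lambda>g\<in>carrier \<Gamma>. inv\<^bsub>A\<^esub> (a \<otimes>\<^bsub>A\<^esub> b) \<otimes>\<^bsub>A\<^esub> act g (a \<otimes>\<^bsub>A\<^esub> b))"
    using a b by (auto simp: mult_Z act_mult act_closed A.inv_mult A.m_ac intro!: restrict_ext)
  then show "c \<otimes>\<^bsub>Z\<^esub> c' \<in> B" using a b by (auto simp: B1_def)
qed

sublocale Z: comm_group Z by (rule Z_comm_group)

lemma B_normal: "B \<lhd> Z"
  using B_subgroup Z.subgroup_imp_normal by blast

lemma H1_comm_group: "comm_group (H1 \<Gamma> T A act)"
  unfolding H1_def using Z.abelian_FactGroup B_subgroup by blast

abbreviation cls where "cls c \<equiv> B #>\<^bsub>Z\<^esub> c"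

lemma cls_closed: "c \<in> carrier Z \<Longrightarrow> cls c \<in> carrier (H1 \<Gamma> T A act)"
  unfolding H1_def FactGroup_def by (auto simp: RCOSETS_def)

lemma H1_cases: assumes "x \<in> carrier (H1 \<Gamma> T A act)" obtains c where "c \<in> carrier Z" "x = cls c"
  using assms unfolding H1_def FactGroup_def by (auto simp: RCOSETS_def)

lemma cls_mult: "c \<in> carrier Z \<Longrightarrow> d \<in> carrier Z \<Longrightarrow> cls c \<otimes>\<^bsub>H1 \<Gamma> T A act\<^esub> cls d = cls (c \<otimes>\<^bsub>Z\<^esub> d)"
  unfolding H1_def FactGroup_def using normal.rcos_sum[OF B_normal] by simp

lemma cls_self: "c \<in> carrier Z \<Longrightarrow> c \<in> cls c"
  by (rule Z.rcos_self[OF _ B_subgroup])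

lemma cls_mem: assumes "d \<in> cls c" "c \<in> carrier Z" shows "d \<in> carrier Z" "cls d = cls c"
proof -
  show "d \<in> carrier Z" using assms B_subgroup Z.r_coset_subset_G subgroup.subset by blast
  show "cls d = cls c" using assms Z.repr_independence[OF _ _ B_subgroup] by metis
qed

text \<open>Coset equality unfolded and multiplied out. Free of inverses, this form survives
  composition with homomorphisms and passage to character values.\<close>

lemma cls_eq_iff:
  assumes c: "c \<in> carrier Z" and d: "d \<in> carrier Z"
  shows "cls c = cls d \<longleftrightarrow> (\<exists>a\<in>carrier A. \<forall>g\<in>carrier \<Gamma>. a \<otimes>\<^bsub>A\<^esub> c g = d g \<otimes>\<^bsub>A\<^esub> act g a)"
proof
  assume "cls c = cls d"
  then have "c \<in> cls d" using cls_self[OF c] by simp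
  then obtain a where a: "a \<in> carrier A" "c = (\<lambda>g\<in>carrier \<Gamma>. inv\<^bsub>A\<^esub> a \<otimes>\<^bsub>A\<^esub> act g a) \<otimes>\<^bsub>Z\<^esub> d"
    by (auto simp: r_coset_def B1_def)
  have "a \<otimes>\<^bsub>A\<^esub> c g = d g \<otimes>\<^bsub>A\<^esub> act g a" if "g \<in> carrier \<Gamma>" for g
  proof -
    have "a \<otimes>\<^bsub>A\<^esub> c g = (a \<otimes>\<^bsub>A\<^esub> inv\<^bsub>A\<^esub> a) \<otimes>\<^bsub>A\<^esub> (act g a \<otimes>\<^bsub>A\<^esub> d g)"
      using that a by (simp add: mult_Z Z_closed d act_closed A.m_assoc cancel)
    also have "\<dots> = d g \<otimes>\<^bsub>A\<^esub> act g a" using that a by (simp add: Z_closed d act_closed A.m_comm)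
    finally show ?thesis .
  qed
  then show "\<exists>a\<in>carrier A. \<forall>g\<in>carrier \<Gamma>. a \<otimes>\<^bsub>A\<^esub> c g = d g \<otimes>\<^bsub>A\<^esub> act g a" using a by blast
next
  assume "\<exists>a\<in>carrier A. \<forall>g\<in>carrier \<Gamma>. a \<otimes>\<^bsub>A\<^esub> c g = d g \<otimes>\<^bsub>A\<^esub> act g a"
  then obtain a where a: "a \<in> carrier A" "\<And>g. g \<in> carrier \<Gamma> \<Longrightarrow> a \<otimes>\<^bsub>A\<^esub> c g = d g \<otimes>\<^bsub>A\<^esub> act g a" by blast
  let ?b = "\<lambda>g\<in>carrier \<Gamma>. inv\<^bsub>A\<^esub> a \<otimes>\<^bsub>A\<^esub> act g a"
  have "c = ?b \<otimes>\<^bsub>Z\<^esub> d"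
  proof (rule Z_extensional[OF c Z_mult_closed[OF coboundary_Z[OF a(1)] d]])
    fix g assume g: "g \<in> carrier \<Gamma>"
    have "c g = inv\<^bsub>A\<^esub> a \<otimes>\<^bsub>A\<^esub> (a \<otimes>\<^bsub>A\<^esub> c g)" using g a(1) by (simp add: Z_closed c flip: A.m_assoc)
    also have "\<dots> = (?b \<otimes>\<^bsub>Z\<^esub> d) g"
      unfolding a(2)[OF g] using g a(1)
      by (simp add: mult_Z Z_closed d act_closed A.m_assoc) (simp add: Z_closed d act_closed A.m_comm[of "d g"] flip: A.m_assoc)
    finally show "c g = (?b \<otimes>\<^bsub>Z\<^esub> d) g" .
  qed
  moreover have "?b \<in> B" using a(1) by (auto simp: B1_def)
  ultimately have "c \<in> cls d" by (auto simp: r_coset_def)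
  then show "cls c = cls d" using cls_mem d by metis
qed

end

section \<open>Hilbert 90 and induced modules\<close>

text \<open>By linearity the vanishing extends from powers to all polynomials, and a polynomial
  vanishing on \<open>I\<close> except at \<open>x0\<close> isolates one term. This Vandermonde
  argument plays the role of independence of characters in Hilbert 90, and it detects monomials in
  group algebras.\<close>

lemma power_sums_zero_imp_zero:
  fixes F :: "'a::field \<Rightarrow> 'a"
  assumes I: "finite I" and z: "\<And>m. (\<Sum>x\<in>I. F x * x ^ m) = 0" and x0: "x0 \<in> I"
  shows "F x0 = 0"
proof -
  have p: "(\<Sum>x\<in>I. F x * poly p x) = 0" for p
  proof -
    have "(\<Sum>x\<in>I. F x * poly p x) = (\<Sum>x\<in>I. \<Sum>i\<le>degree p. coeff p i * (F x * x ^ i))"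
      by (simp add: poly_altdef sum_distrib_left algebra_simps)
    also have "\<dots> = (\<Sum>i\<le>degree p. coeff p i * (\<Sum>x\<in>I. F x * x ^ i))"
      by (subst sum.swap) (simp add: sum_distrib_left)
    finally show ?thesis by (simp add: z)
  qed
  define p where "p = (\<Prod>a\<in>I - {x0}. [:-a, 1:])"
  have "(\<Sum>x\<in>I. F x * poly p x) = F x0 * poly p x0 + (\<Sum>x\<in>I - {x0}. F x * poly p x)"
    using I x0 by (simp add: sum.remove)
  also have "(\<Sum>x\<in>I - {x0}. F x * poly p x) = 0"
    using I by (intro sum.neutral) (auto simp: p_def poly_prod intro!: prod_zero)
  finally have "F x0 * poly p x0 = 0" using p by simp
  moreover have "poly p x0 \<noteq> 0" using I by (auto simp: p_def poly_prod)
  ultimately show ?thesis by simp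
qed

text \<open>The classical sum of \<open>f \<sigma> * \<sigma> (\<zeta> ^ m)\<close> over the orbit
  of a primitive element is nonzero for some \<open>m\<close> by
  \<open>power_sums_zero_imp_zero\<close>. The subgroup \<open>N\<close> is arbitrary because the
  uses are for the kernel of restriction to the constants and for stabilizers of characters.\<close>

theorem hilbert90:
  fixes f :: "('e::field_char_0 alg_closure \<Rightarrow> 'e alg_closure) \<Rightarrow> 'e alg_closure"
  assumes N: "N \<subseteq> Gal" "id \<in> N" "\<And>\<sigma> \<tau>. \<sigma> \<in> N \<Longrightarrow> \<tau> \<in> N \<Longrightarrow> \<sigma> \<circ> \<tau> \<in> N" "\<And>\<sigma>. \<sigma> \<in> N \<Longrightarrow> inv_into UNIV \<sigma> \<in> N"
    and nz: "\<And>\<sigma>. \<sigma> \<in> N \<Longrightarrow> f \<sigma> \<noteq> 0"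
    and coc: "\<And>\<sigma> \<tau>. \<sigma> \<in> N \<Longrightarrow> \<tau> \<in> N \<Longrightarrow> f (\<sigma> \<circ> \<tau>) = f \<sigma> * \<sigma> (f \<tau>)"
    and Y: "finite Y" "\<And>\<sigma>. \<sigma> \<in> N \<Longrightarrow> (\<forall>x\<in>Y. \<sigma> x = x) \<Longrightarrow> f \<sigma> = 1"
  shows "\<exists>y. y \<noteq> 0 \<and> (\<forall>\<sigma>\<in>N. f \<sigma> * \<sigma> y = y)"
proof -
  obtain \<zeta> where th: "\<And>\<sigma>. \<sigma> \<in> Gal \<Longrightarrow> \<sigma> \<zeta> = \<zeta> \<Longrightarrow> (\<forall>x\<in>Y. \<sigma> x = x)"
    using primitive_element[OF Y(1)] by blast
  define I where "I = (\<lambda>\<sigma>. \<sigma> \<zeta>) ` N"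
  have fin: "finite I" unfolding I_def using N(1) finite_orbit[of \<zeta>] by (meson finite_subset image_mono)
  \<comment> \<open>Elements of \<open>N\<close> with the same effect on \<open>\<zeta>\<close>
    differ by one on which \<open>f\<close> is 1, so \<open>f\<close> is a function on the
    orbit.\<close>
  define F where "F x = f (SOME \<sigma>. \<sigma> \<in> N \<and> \<sigma> \<zeta> = x)" for x
  have F: "F (\<sigma> \<zeta>) = f \<sigma>" if s: "\<sigma> \<in> N" for \<sigma>
  proof -
    define \<sigma>' where "\<sigma>' = (SOME \<sigma>'. \<sigma>' \<in> N \<and> \<sigma>' \<zeta> = \<sigma> \<zeta>)"
    have s': "\<sigma>' \<in> N" "\<sigma>' \<zeta> = \<sigma> \<zeta>"
      using someI[of "\<lambda>\<sigma>'. \<sigma>' \<in> N \<and> \<sigma>' \<zeta> = \<sigma> \<zeta>" \<sigma>] s by (auto simp: \<sigma>'_def)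
    define u where "u = inv_into UNIV \<sigma> \<circ> \<sigma>'"
    have u: "u \<in> N" using s s' N by (auto simp: u_def)
    have "u \<zeta> = \<zeta>" using s' s N(1) by (simp add: u_def gal_inv_apply subset_iff)
    then have "f u = 1" using th u N(1) Y(2) by blast
    moreover have "\<sigma>' = \<sigma> \<circ> u" using s N(1) by (simp add: u_def subset_iff gal_inv_comp flip: comp_assoc)
    ultimately have "f \<sigma>' = f \<sigma>" using coc[OF s u] s N(1) by (simp add: gal_hom ring_hom_1 subset_iff)
    then show ?thesis by (simp add: F_def \<sigma>'_def)
  qed
  have "\<zeta> \<in> I" unfolding I_def using N(2) by (intro image_eqI[of _ _ id]) auto
  moreover have "F \<zeta> \<noteq> 0" using F[OF N(2)] nz[OF N(2)] by simp
  ultimately obtain m where m: "(\<Sum>x\<in>I. F x * x ^ m) \<noteq> 0"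
    using power_sums_zero_imp_zero[OF fin, of F \<zeta>] by blast
  define y where "y = (\<Sum>x\<in>I. F x * x ^ m)"
  have "f \<sigma> * \<sigma> y = y" if s: "\<sigma> \<in> N" for \<sigma>
  proof -
    have sG: "\<sigma> \<in> Gal" using s N(1) by blast
    have "f \<sigma> * \<sigma> y = (\<Sum>x\<in>I. f \<sigma> * \<sigma> (F x) * \<sigma> x ^ m)"
      using gal_hom[OF sG] by (simp add: y_def ring_hom_sum ring_hom_mult ring_hom_power sum_distrib_left mult.assoc)
    also have "\<dots> = (\<Sum>x\<in>I. F (\<sigma> x) * \<sigma> x ^ m)"
    proof (intro sum.cong refl)
      fix x assume "x \<in> I"
      then obtain \<tau> where t: "\<tau> \<in> N" "x = \<tau> \<zeta>" by (auto simp: I_def)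
      have "F (\<sigma> x) = f (\<sigma> \<circ> \<tau>)" using F[OF N(3)[OF s t(1)]] t by simp
      then show "f \<sigma> * \<sigma> (F x) * \<sigma> x ^ m = F (\<sigma> x) * \<sigma> x ^ m"
        using coc[OF s t(1)] F[OF t(1)] t by simp
    qed
    also have "\<dots> = y" unfolding y_def
    proof (rule sum.reindex_bij_betw)
      show "bij_betw \<sigma> I I"
        unfolding bij_betw_def
      proof
        show "inj_on \<sigma> I" using gal_bij[OF sG] by (meson bij_is_inj inj_on_subset subset_UNIV)
        show "\<sigma> ` I = I"
        proof
          show "\<sigma> ` I \<subseteq> I" 
          proof
            fix x assume "x \<in> \<sigma> ` I"
            then obtain \<tau> where t: "\<tau> \<in> N" "x = (\<sigma> \<circ> \<tau>) \<zeta>" by (auto simp: I_def)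
            then show "x \<in> I" using N(3)[OF s t(1)] unfolding I_def by blast
          qed
          show "I \<subseteq> \<sigma> ` I"
          proof
            fix x assume "x \<in> I"
            then obtain \<tau> where t: "\<tau> \<in> N" "x = \<tau> \<zeta>" by (auto simp: I_def)
            then have "x = \<sigma> ((inv_into UNIV \<sigma> \<circ> \<tau>) \<zeta>)" using sG by (simp add: gal_inv_apply)
            moreover have "(inv_into UNIV \<sigma> \<circ> \<tau>) \<zeta> \<in> I" unfolding I_def using N(3)[OF N(4)[OF s] t(1)] by blast
            ultimately show "x \<in> \<sigma> ` I" by blast
          qed
        qed
      qed
    qed
    finally show ?thesis .
  qed
  then show ?thesis using m by (auto simp: y_def)
qed

text \<open>\<open>f g s\<close> is the component at \<open>s\<close> of a cocycle with values in
  functions on \<open>S\<close>. Transport from one representative per orbit reduces a splitting to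
  the stabilizers. The groups are abstract, since the values are cocharacters in one use and nonzero
  field elements in the other.\<close>

lemma shapiro:
  fixes \<Gamma> :: "'g monoid" and Y :: "'x monoid" and act :: "'g \<Rightarrow> 'x \<Rightarrow> 'x" and mv :: "'g \<Rightarrow> 's \<Rightarrow> 's" and f :: "'g \<Rightarrow> 's \<Rightarrow> 'x"
  assumes \<Gamma>: "group \<Gamma>" and Y: "comm_group Y"
    and mv: "\<And>g s. g \<in> carrier \<Gamma> \<Longrightarrow> s \<in> S \<Longrightarrow> mv g s \<in> S"
      "\<And>g h s. g \<in> carrier \<Gamma> \<Longrightarrow> h \<in> carrier \<Gamma> \<Longrightarrow> s \<in> S \<Longrightarrow> mv (g \<otimes>\<^bsub>\<Gamma>\<^esub> h) s = mv g (mv h s)"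
      "\<And>s. s \<in> S \<Longrightarrow> mv \<one>\<^bsub>\<Gamma>\<^esub> s = s"
    and act: "\<And>g x. g \<in> carrier \<Gamma> \<Longrightarrow> x \<in> carrier Y \<Longrightarrow> act g x \<in> carrier Y"
      "\<And>g h x. g \<in> carrier \<Gamma> \<Longrightarrow> h \<in> carrier \<Gamma> \<Longrightarrow> x \<in> carrier Y \<Longrightarrow> act (g \<otimes>\<^bsub>\<Gamma>\<^esub> h) x = act g (act h x)"
      "\<And>g x y. g \<in> carrier \<Gamma> \<Longrightarrow> x \<in> carrier Y \<Longrightarrow> y \<in> carrier Y \<Longrightarrow> act g (x \<otimes>\<^bsub>Y\<^esub> y) = act g x \<otimes>\<^bsub>Y\<^esub> act g y"
    and f: "\<And>g s. g \<in> carrier \<Gamma> \<Longrightarrow> s \<in> S \<Longrightarrow> f g s \<in> carrier Y"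
      "\<And>g h s. g \<in> carrier \<Gamma> \<Longrightarrow> h \<in> carrier \<Gamma> \<Longrightarrow> s \<in> S \<Longrightarrow> f (g \<otimes>\<^bsub>\<Gamma>\<^esub> h) (mv g s) = f g (mv g s) \<otimes>\<^bsub>Y\<^esub> act g (f h s)"
    and stab: "\<And>s. s \<in> S \<Longrightarrow> \<exists>w\<in>carrier Y. \<forall>g\<in>carrier \<Gamma>. mv g s = s \<longrightarrow> w \<otimes>\<^bsub>Y\<^esub> f g s = act g w"
  shows "\<exists>W. (\<forall>s\<in>S. W s \<in> carrier Y) \<and> (\<forall>g\<in>carrier \<Gamma>. \<forall>s\<in>S. W (mv g s) \<otimes>\<^bsub>Y\<^esub> f g (mv g s) = act g (W s))"
proof -
  interpret \<Gamma>: group \<Gamma> by fact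
  interpret Y: comm_group Y by fact
  define orb where "orb s = {mv g s |g. g \<in> carrier \<Gamma>}" for s
  \<comment> \<open>Chosen from the orbit as a set, hence the same for all members of the
    orbit.\<close>
  define rep where "rep s = (SOME r. r \<in> orb s)" for s
  have orbS: "orb s \<subseteq> S" if "s \<in> S" for s using that mv by (auto simp: orb_def)
  have self: "s \<in> orb s" if "s \<in> S" for s using that mv(3) by (force simp: orb_def)
  have repo: "rep s \<in> orb s" if "s \<in> S" for s unfolding rep_def using self[OF that] by (rule someI)
  have bk: "mv (inv\<^bsub>\<Gamma>\<^esub> g) (mv g s) = s" if "g \<in> carrier \<Gamma>" "s \<in> S" for g s
    using that mv by (simp flip: mv(2))
  have orbeq: "orb (mv g s) = orb s" if "g \<in> carrier \<Gamma>" "s \<in> S" for g s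
  proof
    show "orb (mv g s) \<subseteq> orb s" 
    proof
      fix x assume "x \<in> orb (mv g s)"
      then obtain h where "h \<in> carrier \<Gamma>" "x = mv h (mv g s)" by (auto simp: orb_def)
      then have "x = mv (h \<otimes>\<^bsub>\<Gamma>\<^esub> g) s" "h \<otimes>\<^bsub>\<Gamma>\<^esub> g \<in> carrier \<Gamma>" using that mv(2) by simp_all
      then show "x \<in> orb s" by (auto simp: orb_def)
    qed
    show "orb s \<subseteq> orb (mv g s)"
    proof
      fix x assume "x \<in> orb s"
      then obtain h where h: "h \<in> carrier \<Gamma>" "x = mv h s" by (auto simp: orb_def)
      then have "x = mv (h \<otimes>\<^bsub>\<Gamma>\<^esub> inv\<^bsub>\<Gamma>\<^esub> g) (mv g s)" using that mv by (simp add: bk)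
      then show "x \<in> orb (mv g s)" unfolding orb_def using h that by auto
    qed
  qed
  have "\<exists>t\<in>carrier \<Gamma>. mv t (rep s) = s" if s: "s \<in> S" for s
  proof -
    obtain g where g: "g \<in> carrier \<Gamma>" "rep s = mv g s" using repo[OF s] by (auto simp: orb_def)
    then show ?thesis using bk[OF g(1) s] by (intro bexI[of _ "inv\<^bsub>\<Gamma>\<^esub> g"]) auto
  qed
  then obtain t where t: "\<And>s. s \<in> S \<Longrightarrow> t s \<in> carrier \<Gamma>" "\<And>s. s \<in> S \<Longrightarrow> mv (t s) (rep s) = s" by metis
  have repS: "rep s \<in> S" if "s \<in> S" for s using repo[OF that] orbS[OF that] by blast
  obtain w where w: "\<And>s. s \<in> S \<Longrightarrow> w s \<in> carrier Y"
    "\<And>s g. s \<in> S \<Longrightarrow> g \<in> carrier \<Gamma> \<Longrightarrow> mv g s = s \<Longrightarrow> w s \<otimes>\<^bsub>Y\<^esub> f g s = act g (w s)" using stab by metis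
  \<comment> \<open>The value forced by the required identity for the group element
    \<open>t s\<close> and the representative of \<open>s\<close>.\<close>
  define W where "W s = act (t s) (w (rep s)) \<otimes>\<^bsub>Y\<^esub> inv\<^bsub>Y\<^esub> (f (t s) s)" for s
  have Wc: "W s \<in> carrier Y" if "s \<in> S" for s unfolding W_def using that t w repS act f by simp
  moreover have "W (mv g s) \<otimes>\<^bsub>Y\<^esub> f g (mv g s) = act g (W s)" if g: "g \<in> carrier \<Gamma>" and s: "s \<in> S" for g s
  proof -
    define r where "r = rep s"
    define s1 where "s1 = mv g s"
    have s1: "s1 \<in> S" and r: "r \<in> S" and rep1: "rep s1 = r"
      using g s mv repS orbeq[OF g s] by (auto simp: s1_def r_def rep_def)
    have ts: "t s \<in> carrier \<Gamma>" "mv (t s) r = s" and ts1: "t s1 \<in> carrier \<Gamma>" "mv (t s1) r = s1"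
      using t[OF s] t[OF s1] rep1 unfolding r_def by simp_all
    \<comment> \<open>The product of \<open>g\<close> and \<open>t s\<close> carries
      \<open>r\<close> to \<open>s1\<close>, and so does \<open>t s1\<close>; they differ by
      \<open>h\<close>, which stabilizes \<open>r\<close>.\<close>
    define h where "h = inv\<^bsub>\<Gamma>\<^esub> (t s1) \<otimes>\<^bsub>\<Gamma>\<^esub> (g \<otimes>\<^bsub>\<Gamma>\<^esub> t s)"
    have h: "h \<in> carrier \<Gamma>" using ts ts1 g by (simp add: h_def)
    have gt: "g \<otimes>\<^bsub>\<Gamma>\<^esub> t s = t s1 \<otimes>\<^bsub>\<Gamma>\<^esub> h"
      unfolding h_def using ts ts1 g by (simp flip: \<Gamma>.m_assoc)
    have "mv h r = r"
      unfolding h_def using ts ts1 g s r bk[OF ts1(1) r] by (simp add: mv s1_def)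
    then have wr: "w r \<otimes>\<^bsub>Y\<^esub> f h r = act h (w r)" using w(2)[OF r h] by simp
    let ?a = "act (t s1) (w r)" and ?b = "act (t s1) (f h r)" and ?c = "f (t s1) s1" and ?d = "f g s1" and ?e = "act g (f (t s) s)"
    have cl: "?a \<in> carrier Y" "?b \<in> carrier Y" "?c \<in> carrier Y" "?d \<in> carrier Y" "?e \<in> carrier Y" "f (t s) s \<in> carrier Y"
      "act (t s) (w r) \<in> carrier Y"
      using ts ts1 g s s1 r h w act f by simp_all
    have e1: "?d \<otimes>\<^bsub>Y\<^esub> ?e = ?c \<otimes>\<^bsub>Y\<^esub> ?b"
    proof -
      have "f (g \<otimes>\<^bsub>\<Gamma>\<^esub> t s) s1 = ?d \<otimes>\<^bsub>Y\<^esub> ?e"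
        using f(2)[OF g ts(1) s] by (simp add: s1_def)
      moreover have "f (t s1 \<otimes>\<^bsub>\<Gamma>\<^esub> h) s1 = ?c \<otimes>\<^bsub>Y\<^esub> ?b"
        using f(2)[OF ts1(1) h r] ts1 by simp
      ultimately show ?thesis by (simp add: gt)
    qed
    have ainv: "act g (inv\<^bsub>Y\<^esub> x) = inv\<^bsub>Y\<^esub> (act g x)" if "x \<in> carrier Y" for x
    proof (rule Y.inv_equality[symmetric])
      have "act g \<one>\<^bsub>Y\<^esub> = \<one>\<^bsub>Y\<^esub>" using act(3)[of g "\<one>\<^bsub>Y\<^esub>" "\<one>\<^bsub>Y\<^esub>"] act(1)[OF g, of "\<one>\<^bsub>Y\<^esub>"] g by simp
      then show "act g (inv\<^bsub>Y\<^esub> x) \<otimes>\<^bsub>Y\<^esub> act g x = \<one>\<^bsub>Y\<^esub>" using that g by (simp flip: act(3))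
    qed (use that g act in auto)
    have "act g (W s) = act g (act (t s) (w r)) \<otimes>\<^bsub>Y\<^esub> inv\<^bsub>Y\<^esub> ?e"
      unfolding W_def r_def[symmetric] using cl g by (simp add: act(3) ainv)
    also have "act g (act (t s) (w r)) = act (t s1) (act h (w r))"
      using g ts ts1 h w r by (simp flip: act(2) gt)
    also have "\<dots> = ?a \<otimes>\<^bsub>Y\<^esub> ?b" using ts1 w r f h by (simp flip: wr add: act(3))
    also have "?a \<otimes>\<^bsub>Y\<^esub> ?b \<otimes>\<^bsub>Y\<^esub> inv\<^bsub>Y\<^esub> ?e = ?a \<otimes>\<^bsub>Y\<^esub> inv\<^bsub>Y\<^esub> ?c \<otimes>\<^bsub>Y\<^esub> ?d"
    proof -
      have "?b = inv\<^bsub>Y\<^esub> ?c \<otimes>\<^bsub>Y\<^esub> (?d \<otimes>\<^bsub>Y\<^esub> ?e)" unfolding e1 using cl by (simp flip: Y.m_assoc)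
      then show ?thesis using cl by (simp add: Y.m_assoc)
    qed
    finally show ?thesis by (simp add: W_def rep1 s1_def[symmetric])
  qed
  ultimately show ?thesis by blast
qed

section \<open>Evaluation of formal tensors\<close>

text \<open>\<open>tensor_eval\<close> freed from pairs, so that the same rules serve the triples of
  \<open>tensor3_rel\<close>.\<close>

definition feval :: "('p \<Rightarrow> 'c::comm_ring_1) \<Rightarrow> ('p \<Rightarrow>\<^sub>0 int) \<Rightarrow> 'c" where
  "feval g u = (\<Sum>p\<in>Poly_Mapping.keys u. of_int (Poly_Mapping.lookup u p) * g p)"

lemma tensor_eval_feval: "tensor_eval \<beta> u = feval (\<lambda>p. \<beta> (fst p) (snd p)) u"
  by (simp add: tensor_eval_def feval_def)

lemma feval_superset:
  assumes "finite D" "Poly_Mapping.keys u \<subseteq> D"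
  shows "feval g u = (\<Sum>p\<in>D. of_int (Poly_Mapping.lookup u p) * g p)"
  unfolding feval_def using assms by (intro sum.mono_neutral_left) (auto simp: in_keys_iff)

lemma feval_0 [simp]: "feval g 0 = 0"
  by (simp add: feval_def)

lemma feval_frag_of [simp]: "feval g (frag_of p) = g p"
  by (simp add: feval_def)

lemma feval_diff: "feval g (u - v) = feval g u - feval g v"
proof -
  let ?D = "Poly_Mapping.keys u \<union> Poly_Mapping.keys v"
  have "Poly_Mapping.keys (u - v) \<subseteq> ?D" by (rule keys_diff)
  then show ?thesis
    by (simp add: feval_superset[of ?D] lookup_minus left_diff_distrib sum_subtractf)
qed

lemma feval_minus: "feval g (- u) = - feval g u"
  using feval_diff[of g 0 u] by simp

lemma feval_add: "feval g (u + v) = feval g u + feval g v"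
  using feval_diff[of g u "- v"] feval_minus[of g v] by simp

lemma feval_sum: "feval g (sum f A) = (\<Sum>x\<in>A. feval g (f x))"
  by (induction A rule: infinite_finite_induct) (auto simp: feval_add)

lemma feval_cong: "(\<And>p. p \<in> Poly_Mapping.keys u \<Longrightarrow> g p = h p) \<Longrightarrow> feval g u = feval h u"
  by (simp add: feval_def)

lemma feval_extend: "feval g (frag_extend f u) = feval (\<lambda>p. feval g (f p)) u"
proof -
  have "u \<in> {u. Poly_Mapping.keys u \<subseteq> UNIV}" by simp
  then have "Poly_Mapping.keys u \<subseteq> UNIV" by simp
  then show ?thesis
    by (induction u rule: frag_induction) (auto simp: frag_extend_diff feval_diff)
qed

lemma feval_mult_right: "feval g u * c = feval (\<lambda>p. g p * c) u"
  by (simp add: feval_def sum_distrib_right mult.assoc)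

lemma feval_mult_left: "c * feval g u = feval (\<lambda>p. c * g p) u"
  by (simp add: feval_def sum_distrib_left mult.left_commute)

lemma feval_sum_fun: "feval (\<lambda>p. \<Sum>x\<in>A. g x p) u = (\<Sum>x\<in>A. feval (g x) u)"
  unfolding feval_def by (simp add: sum_distrib_left) (rule sum.swap)

lemma feval_hom: "is_ring_hom f \<Longrightarrow> f (feval g u) = feval (\<lambda>p. f (g p)) u"
  by (simp add: feval_def ring_hom_sum ring_hom_mult ring_hom_of_int)

lemma feval_group_closure:
  assumes "\<And>u. u \<in> U \<Longrightarrow> feval g u = 0" and "u \<in> group_closure U"
  shows "feval g u = 0"
  using assms(2) by induction (auto simp: assms(1) feval_diff)

lemma tensor_eval_frag_of [simp]: "tensor_eval \<beta> (frag_of (x, y)) = \<beta> x y"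
  by (simp add: tensor_eval_feval)

lemma tensor_eval_diff: "tensor_eval \<beta> (u - v) = tensor_eval \<beta> u - tensor_eval \<beta> v"
  by (simp add: tensor_eval_feval feval_diff)

lemma tensor_eval_rel:
  assumes "\<And>x x' y. y \<in> Y \<Longrightarrow> \<beta> (x + x') y = \<beta> x y + \<beta> x' y"
    and "\<And>x y y'. y \<in> Y \<Longrightarrow> y' \<in> Y \<Longrightarrow> \<beta> x (y + y') = \<beta> x y + \<beta> x y'"
    and "\<And>c x y. y \<in> Y \<Longrightarrow> \<beta> (s c * x) y = \<beta> x (s' c * y)"
    and "u \<in> tensor_rel s s' Y"
  shows "tensor_eval \<beta> u = 0"
  unfolding tensor_eval_feval
proof (rule feval_group_closure)
  show "u \<in> group_closure
     ({frag_of (x + x', y) - frag_of (x, y) - frag_of (x', y) |x x' y. y \<in> Y} \<union>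
      {frag_of (x, y + y') - frag_of (x, y) - frag_of (x, y') |x y y'. y \<in> Y \<and> y' \<in> Y} \<union>
      {frag_of (s c * x, y) - frag_of (x, s' c * y) |c x y. y \<in> Y})"
    using assms(4) by (simp add: tensor_rel_def)
qed (auto simp: feval_diff assms(1-3))

lemma feval_tensor3_rel:
  assumes "\<And>x x' y z. \<beta> (x + x', y, z) = \<beta> (x, y, z) + \<beta> (x', y, z)"
    and "\<And>x y y' z. \<beta> (x, y + y', z) = \<beta> (x, y, z) + \<beta> (x, y', z)"
    and "\<And>x y z z'. \<beta> (x, y, z + z') = \<beta> (x, y, z) + \<beta> (x, y, z')"
    and "\<And>c x y z. \<beta> (s c * x, y, z) = \<beta> (x, s' c * y, z)"
    and "\<And>c x y z. \<beta> (x, s' c * y, z) = \<beta> (x, y, s'' c * z)"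
    and "u \<in> tensor3_rel s s' s''"
  shows "feval \<beta> u = 0"
  using assms(6) unfolding tensor3_rel_def
  by (rule feval_group_closure[rotated]) (auto simp: feval_diff assms(1-5))

lemma tensor_eval_mult:
  assumes "\<And>a b c d. \<beta> (a * c) (b * d) = \<beta> a b * \<beta> c d"
  shows "tensor_eval \<beta> (tensor_mult u v) = tensor_eval \<beta> u * tensor_eval \<beta> v"
proof -
  let ?g = "\<lambda>p. \<beta> (fst p) (snd p)"
  have g: "feval ?g (frag_extend (\<lambda>(c, d). frag_of (a * c, b * d)) v) = \<beta> a b * feval ?g v" for a b
    unfolding feval_extend feval_mult_left by (rule feval_cong) (auto simp: assms)
  have "tensor_eval \<beta> (tensor_mult u v) =
      feval (\<lambda>p. feval ?g (case p of (a, b) \<Rightarrow> frag_extend (\<lambda>(c, d). frag_of (a * c, b * d)) v)) u"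
    by (simp only: tensor_eval_feval tensor_mult_def feval_extend[of ?g _ u])
  also have "\<dots> = feval (\<lambda>p. ?g p * feval ?g v) u"
    by (rule feval_cong) (simp add: g split: prod.splits)
  finally show ?thesis by (simp add: tensor_eval_feval feval_mult_right)
qed

lemma keys_tensor_mult:
  assumes "Poly_Mapping.keys u \<subseteq> UNIV \<times> L" "Poly_Mapping.keys v \<subseteq> UNIV \<times> L"
    "\<And>x y. x \<in> L \<Longrightarrow> y \<in> L \<Longrightarrow> x * y \<in> L"
  shows "Poly_Mapping.keys (tensor_mult u v) \<subseteq> UNIV \<times> L"
proof -
  have "Poly_Mapping.keys (tensor_mult u v) \<subseteq>
      (\<Union>p\<in>Poly_Mapping.keys u. \<Union>q\<in>Poly_Mapping.keys v. {(fst p * fst q, snd p * snd q)})"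
    unfolding tensor_mult_def
    by (rule order_trans[OF keys_frag_extend] UN_mono subset_refl | simp add: case_prod_beta)+
  also have "\<dots> \<subseteq> UNIV \<times> L"
  proof (intro UN_least)
    fix p q assume "p \<in> Poly_Mapping.keys u" "q \<in> Poly_Mapping.keys v"
    then have "snd p \<in> L" "snd q \<in> L" using assms by auto
    then show "{(fst p * fst q, snd p * snd q)} \<subseteq> UNIV \<times> L" using assms(3) by auto
  qed
  finally show ?thesis .
qed

section \<open>Group algebras\<close>

lemma sum_single: "(\<Sum>e\<in>Poly_Mapping.keys f. Poly_Mapping.single e (Poly_Mapping.lookup f e)) = f"
proof (rule poly_mapping_eqI)
  fix k
  have "(\<Sum>e\<in>Poly_Mapping.keys f. Poly_Mapping.lookup f e when e = k) = Poly_Mapping.lookup f k"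
    by (simp add: when_def in_keys_iff)
  then show "Poly_Mapping.lookup (\<Sum>e\<in>Poly_Mapping.keys f. Poly_Mapping.single e (Poly_Mapping.lookup f e)) k = Poly_Mapping.lookup f k"
    by (simp add: lookup_sum lookup_single)
qed

text \<open>Evaluation of an element of a group algebra at a function \<open>h\<close> on exponents.
  Multiplicativity of \<open>h\<close> is demanded in \<open>ev_hom\<close> only; indicator
  functions serve to extract coefficients, as in \<open>lookup_cochar\<close>.\<close>

definition ev :: "('l::comm_ring_1 \<Rightarrow> 'b) \<Rightarrow> ('s \<Rightarrow> 'b) \<Rightarrow> ('s \<Rightarrow>\<^sub>0 'l) \<Rightarrow> 'b::comm_ring_1" where
  "ev j h f = (\<Sum>e\<in>Poly_Mapping.keys f. j (Poly_Mapping.lookup f e) * h e)"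

lemma ev_superset:
  assumes "is_ring_hom j" "finite D" "Poly_Mapping.keys f \<subseteq> D"
  shows "ev j h f = (\<Sum>e\<in>D. j (Poly_Mapping.lookup f e) * h e)"
  unfolding ev_def using assms by (intro sum.mono_neutral_left) (auto simp: in_keys_iff ring_hom_0)

lemma ev_add: "is_ring_hom j \<Longrightarrow> ev j h (f + g) = ev j h f + ev j h g"
  using keys_add[of f g]
  by (simp add: ev_superset[of j "Poly_Mapping.keys f \<union> Poly_Mapping.keys g"] lookup_add ring_hom_add distrib_right sum.distrib)

lemma ev_0 [simp]: "ev j h 0 = 0"
  by (simp add: ev_def)

lemma ev_single: "is_ring_hom j \<Longrightarrow> ev j h (Poly_Mapping.single e l) = j l * h e"
  by (cases "l = 0") (auto simp: ev_def ring_hom_0)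

lemma ev_sum: "is_ring_hom j \<Longrightarrow> ev j h (sum g A) = (\<Sum>x\<in>A. ev j h (g x))"
  by (induction A rule: infinite_finite_induct) (auto simp: ev_add)

lemma ev_hom:
  fixes h :: "'s::comm_monoid_add \<Rightarrow> 'b::comm_ring_1"
  assumes j: "is_ring_hom j" and h: "h 0 = 1" "\<And>d e. h (d + e) = h d * h e"
  shows "is_ring_hom (ev j h)"
  unfolding is_ring_hom_def
proof (intro conjI allI)
  show "ev j h 1 = 1"
    using ev_single[OF j, of h 0 1] h j by (simp add: ring_hom_1)
  show "ev j h (f + g) = ev j h f + ev j h g" for f g using j by (rule ev_add)
  show "ev j h (f * g) = ev j h f * ev j h g" for f g
  proof -
    have "ev j h (f * g) = ev j h ((\<Sum>d\<in>Poly_Mapping.keys f. Poly_Mapping.single d (Poly_Mapping.lookup f d)) *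
        (\<Sum>e\<in>Poly_Mapping.keys g. Poly_Mapping.single e (Poly_Mapping.lookup g e)))"
      by (simp add: sum_single)
    also have "\<dots> = (\<Sum>d\<in>Poly_Mapping.keys f. \<Sum>e\<in>Poly_Mapping.keys g.
        (j (Poly_Mapping.lookup f d) * h d) * (j (Poly_Mapping.lookup g e) * h e))"
      by (simp add: sum_product mult_single ev_sum ev_single j h ring_hom_mult algebra_simps)
    also have "\<dots> = ev j h f * ev j h g" by (simp add: ev_def sum_product)
    finally show ?thesis .
  qed
qed

text \<open>The powers of one character separating the support determine the element.\<close>

lemma group_like_is_single:
  fixes f :: "'s \<Rightarrow>\<^sub>0 'w::field"
  assumes inj: "inj_on h (Poly_Mapping.keys f)"
    and pow: "\<And>m::nat. (\<Sum>e\<in>Poly_Mapping.keys f. Poly_Mapping.lookup f e * h e ^ m) = y ^ m"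
  shows "\<exists>d. f = Poly_Mapping.single d 1"
proof -
  let ?K = "Poly_Mapping.keys f"
  define g where "g = inv_into ?K h"
  \<comment> \<open>The coefficients of \<open>f\<close> placed at the points \<open>h e\<close>,
    minus a unit mass at \<open>y\<close>. By \<open>pow\<close> all moments of this function
    vanish.\<close>
  define F where "F x = (if x \<in> h ` ?K then Poly_Mapping.lookup f (g x) else 0) - (if x = y then 1 else 0)" for x
  define I where "I = insert y (h ` ?K)"
  have fin: "finite I" by (simp add: I_def)
  have gh: "g (h e) = e" if "e \<in> ?K" for e using inj that by (simp add: g_def)
  have "(\<Sum>x\<in>I. F x * x ^ m) = 0" for m
  proof -
    have "(\<Sum>x\<in>I. F x * x ^ m) = (\<Sum>x\<in>I. (if x \<in> h ` ?K then Poly_Mapping.lookup f (g x) else 0) * x ^ m)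
        - (\<Sum>x\<in>I. (if x = y then 1 else 0) * x ^ m)"
      by (simp add: F_def left_diff_distrib sum_subtractf)
    also have "(\<Sum>x\<in>I. (if x = y then 1 else 0) * x ^ m) = (\<Sum>x\<in>I. if x = y then x ^ m else 0)"
      by (intro sum.cong) auto
    also have "\<dots> = y ^ m" using fin by (simp add: I_def)
    also have "(\<Sum>x\<in>I. (if x \<in> h ` ?K then Poly_Mapping.lookup f (g x) else 0) * x ^ m)
        = (\<Sum>x\<in>h ` ?K. Poly_Mapping.lookup f (g x) * x ^ m)"
      using fin by (intro sum.mono_neutral_cong_right) (auto simp: I_def)
    also have "\<dots> = (\<Sum>e\<in>?K. Poly_Mapping.lookup f e * h e ^ m)"
      by (simp add: sum.reindex inj gh)
    finally show ?thesis by (simp add: pow)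
  qed
  then have F0: "F x = 0" if "x \<in> I" for x using power_sums_zero_imp_zero[OF fin] that by blast
  have "F y = 0" using F0 by (simp add: I_def)
  then have yK: "y \<in> h ` ?K" and gy: "Poly_Mapping.lookup f (g y) = 1" by (auto simp: F_def split: if_splits)
  have "Poly_Mapping.lookup f e = Poly_Mapping.lookup (Poly_Mapping.single (g y) 1) e" for e
  proof (cases "e \<in> ?K \<and> e \<noteq> g y")
    case True
    then have "h e \<noteq> y" using gh by auto
    moreover have "F (h e) = 0" using True by (intro F0) (auto simp: I_def)
    ultimately show ?thesis using True gh by (auto simp: F_def)
  next
    case False
    then show ?thesis using gy by (cases "e = g y") (auto simp: in_keys_iff lookup_single_not_eq)
  qed
  then show ?thesis by (intro exI poly_mapping_eqI)
qed

text \<open>Exponents of all ranks share one type, and \<open>trunc n\<close> is the projection to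
  rank \<open>n\<close>. Functions on the lattice of rank \<open>n\<close> are represented by
  functions invariant under it.\<close>

definition trunc :: "nat \<Rightarrow> (nat \<Rightarrow>\<^sub>0 int) \<Rightarrow> (nat \<Rightarrow>\<^sub>0 int)" where
  "trunc n e = (\<Sum>i<n. Poly_Mapping.single i (Poly_Mapping.lookup e i))"

lemma lookup_trunc: "Poly_Mapping.lookup (trunc n e) i = (if i < n then Poly_Mapping.lookup e i else 0)"
  by (simp add: trunc_def lookup_sum lookup_single when_def)

lemma trunc_add: "trunc n (d + e) = trunc n d + trunc n e"
  by (rule poly_mapping_eqI) (simp add: lookup_trunc lookup_add)

lemma trunc_0 [simp]: "trunc n 0 = 0"
  by (rule poly_mapping_eqI) (simp add: lookup_trunc)

lemma trunc_trunc [simp]: "trunc n (trunc n e) = trunc n e"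
  by (rule poly_mapping_eqI) (simp add: lookup_trunc)

lemma trunc_eq_iff: "trunc n e = e \<longleftrightarrow> Poly_Mapping.keys e \<subseteq> {..<n}"
proof
  assume "trunc n e = e"
  then have "Poly_Mapping.lookup e i = (if i < n then Poly_Mapping.lookup e i else 0)" for i
    using lookup_trunc[of n e i] by simp
  then show "Poly_Mapping.keys e \<subseteq> {..<n}" by (auto simp: in_keys_iff) (metis not_less)
next
  assume "Poly_Mapping.keys e \<subseteq> {..<n}"
  then show "trunc n e = e"
    by (intro poly_mapping_eqI) (auto simp: lookup_trunc in_keys_iff)
qed

text \<open>Pairing with the vector \<open>(1, b, b^2, ...)\<close>, a Kronecker substitution: the
  weight of a difference of exponents is a polynomial evaluated at \<open>b\<close>.\<close>

definition wt :: "nat \<Rightarrow> nat \<Rightarrow> (nat \<Rightarrow>\<^sub>0 int) \<Rightarrow> int" where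
  "wt n b e = (\<Sum>i<n. Poly_Mapping.lookup e i * int b ^ i)"

lemma wt_add: "wt n b (d + e) = wt n b d + wt n b e"
  by (simp add: wt_def lookup_add distrib_right sum.distrib)

lemma wt_trunc: "wt n b (trunc n e) = wt n b e"
  by (simp add: wt_def lookup_trunc)

text \<open>Two distinct exponents share a weight only if \<open>b\<close> is a root of a nonzero
  polynomial; the finitely many bad \<open>b\<close> can be avoided.\<close>

lemma wt_separates:
  assumes D: "finite D" "\<And>d. d \<in> D \<Longrightarrow> trunc n d = d"
  shows "\<exists>b. inj_on (wt n b) D"
proof -
  define q where "q d e = (\<Sum>i<n. monom (Poly_Mapping.lookup d i - Poly_Mapping.lookup e i) i)" for d e :: "nat \<Rightarrow>\<^sub>0 int"
  define A where "A = (\<Union>d\<in>D. \<Union>e\<in>D - {d}. {x. poly (q d e) x = 0})"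
  have q0: "q d e \<noteq> 0" if "d \<in> D" "e \<in> D - {d}" for d e
  proof
    assume "q d e = 0"
    moreover have "coeff (q d e) i = Poly_Mapping.lookup d i - Poly_Mapping.lookup e i" if "i < n" for i
      using that by (simp add: q_def coeff_sum)
    ultimately have "Poly_Mapping.lookup d i = Poly_Mapping.lookup e i" if "i < n" for i
      using that by (metis coeff_0 eq_iff_diff_eq_0)
    then have "trunc n d = trunc n e"
      by (intro poly_mapping_eqI) (auto simp: lookup_trunc)
    then show False using that D by auto
  qed
  have "finite A" unfolding A_def using D q0 by (intro finite_UN_I finite_Diff poly_roots_finite) auto
  moreover have "infinite (range int)" by (simp add: finite_image_iff)
  ultimately obtain b where b: "int b \<notin> A" by (metis finite_subset image_subsetI)
  have "inj_on (wt n b) D"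
  proof (rule inj_onI)
    fix d e assume de: "d \<in> D" "e \<in> D" "wt n b d = wt n b e"
    have "poly (q d e) (int b) = wt n b d - wt n b e"
      by (simp add: q_def wt_def poly_sum poly_monom left_diff_distrib sum_subtractf)
    then show "d = e" using b de by (auto simp: A_def)
  qed
  then show ?thesis ..
qed

text \<open>In characteristic 0 the number 2 has infinite order, so its powers turn integer weights
  into distinct field elements.\<close>

lemma two_powi_eq_iff: "(2::'w::field_char_0) powi a = 2 powi b \<longleftrightarrow> a = b"
proof
  assume eq: "(2::'w) powi a = 2 powi b"
  have pos: "c = 0" if "(2::'w) powi c = 1" "c \<ge> 0" for c
  proof -
    have "(of_nat (2 ^ nat c) :: 'w) = of_nat 1" using that by (simp add: power_int_def)
    then have "(2::nat) ^ nat c = 1" by (subst (asm) of_nat_eq_iff)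
    then show ?thesis using that by simp
  qed
  have "(2::'w) powi (a - b) = 1" "(2::'w) powi (b - a) = 1"
    using eq by (simp_all add: power_int_diff)
  then show "a = b" using pos[of "a - b"] pos[of "b - a"] by linarith
qed auto

section \<open>Tori and their character lattices\<close>

lemma tensor_eval_sum: "tensor_eval \<beta> (sum f A) = (\<Sum>x\<in>A. tensor_eval \<beta> (f x))"
  by (simp add: tensor_eval_feval feval_sum)

text \<open>Monomials are group-like, so evaluation at \<open>h\<close> convolved with evaluation at
  \<open>h'\<close> is evaluation at the product. The hypothesis compares single coefficients, hence
  the expansion over a common finite support \<open>?D\<close>.\<close>

lemma comul_ev:
  assumes \<gamma>: "comul_compatible G \<gamma>" and j: "is_ring_hom j"
  shows "tensor_eval (\<lambda>x y. ev j h (\<gamma> x) * ev j h' (\<gamma> y)) (comul G a) = ev j (\<lambda>e. h e * h' e) (\<gamma> a)"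
proof -
  let ?D = "Poly_Mapping.keys (\<gamma> a) \<union> (\<Union>p\<in>Poly_Mapping.keys (comul G a). Poly_Mapping.keys (\<gamma> (fst p)) \<union> Poly_Mapping.keys (\<gamma> (snd p)))"
  have fin: "finite ?D" by auto
  have pt: "ev j g (\<gamma> x) = (\<Sum>d\<in>?D. j (Poly_Mapping.lookup (\<gamma> x) d) * g d)" if "Poly_Mapping.keys (\<gamma> x) \<subseteq> ?D" for g x
    using that by (intro ev_superset j) auto
  have "tensor_eval (\<lambda>x y. ev j h (\<gamma> x) * ev j h' (\<gamma> y)) (comul G a) = feval (\<lambda>p. ev j h (\<gamma> (fst p)) * ev j h' (\<gamma> (snd p))) (comul G a)"
    by (simp add: tensor_eval_feval)
  also have "\<dots> = feval (\<lambda>p. \<Sum>d\<in>?D. \<Sum>e\<in>?D. (h d * h' e) * j (Poly_Mapping.lookup (\<gamma> (fst p)) d * Poly_Mapping.lookup (\<gamma> (snd p)) e)) (comul G a)"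
  proof (rule feval_cong)
    fix p assume p: "p \<in> Poly_Mapping.keys (comul G a)"
    have "ev j h (\<gamma> (fst p)) = (\<Sum>d\<in>?D. j (Poly_Mapping.lookup (\<gamma> (fst p)) d) * h d)"
      "ev j h' (\<gamma> (snd p)) = (\<Sum>e\<in>?D. j (Poly_Mapping.lookup (\<gamma> (snd p)) e) * h' e)"
      using p by (intro pt; auto)+
    then show "ev j h (\<gamma> (fst p)) * ev j h' (\<gamma> (snd p)) = (\<Sum>d\<in>?D. \<Sum>e\<in>?D. (h d * h' e) * j (Poly_Mapping.lookup (\<gamma> (fst p)) d * Poly_Mapping.lookup (\<gamma> (snd p)) e))"
      by (simp add: sum_product ring_hom_mult j mult.assoc mult.left_commute mult.commute)
  qed
  also have "\<dots> = (\<Sum>d\<in>?D. \<Sum>e\<in>?D. (h d * h' e) * j (tensor_eval (\<lambda>x y. Poly_Mapping.lookup (\<gamma> x) d * Poly_Mapping.lookup (\<gamma> y) e) (comul G a)))"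
    by (simp add: feval_sum_fun tensor_eval_feval feval_hom[OF j] feval_mult_left)
  also have "\<dots> = (\<Sum>d\<in>?D. \<Sum>e\<in>?D. if d = e then (h d * h' d) * j (Poly_Mapping.lookup (\<gamma> a) d) else 0)"
    using \<gamma> by (intro sum.cong refl) (auto simp: comul_compatible_def ring_hom_0 j)
  also have "\<dots> = (\<Sum>d\<in>?D. j (Poly_Mapping.lookup (\<gamma> a) d) * (h d * h' d))"
    using fin by (simp add: mult.commute)
  also have "\<dots> = ev j (\<lambda>e. h e * h' e) (\<gamma> a)" by (rule pt[symmetric]) auto
  finally show ?thesis .
qed

text \<open>Points of a split torus correspond to their values on characters: functions on exponent
  vectors (cut off at the rank) that turn sums into products.\<close>

definition thom :: "nat \<Rightarrow> ((nat \<Rightarrow>\<^sub>0 int) \<Rightarrow> 'b::comm_ring_1) \<Rightarrow> bool" where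
  "thom n h \<longleftrightarrow> h 0 = 1 \<and> (\<forall>d e. h (d + e) = h d * h e) \<and> (\<forall>e. h (trunc n e) = h e)"

lemma thom_0: "thom n h \<Longrightarrow> h 0 = 1"
  and thom_add: "thom n h \<Longrightarrow> h (d + e) = h d * h e"
  and thom_trunc: "thom n h \<Longrightarrow> h (trunc n e) = h e"
  by (auto simp: thom_def)

lemma thom_mult: "thom n h \<Longrightarrow> thom n h' \<Longrightarrow> thom n (\<lambda>e. h e * h' e)"
  by (simp add: thom_def algebra_simps)

lemma thom_one: "thom n (\<lambda>_. 1)"
  by (simp add: thom_def)

lemma thom_power: "thom n h \<Longrightarrow> thom n (\<lambda>e. h e ^ m)"
  by (simp add: thom_def power_mult_distrib)

lemma thom_minus: "thom n h \<Longrightarrow> h (- e) * h e = 1"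
  using thom_add[of n h "- e" e] by (simp add: thom_0)

lemma thom_nonzero: "thom n h \<Longrightarrow> h e \<noteq> 0"
  using thom_minus[of n h e] by auto

lemma thom_inverse: "thom n h \<Longrightarrow> thom n (\<lambda>e. inverse (h e))" for h :: "_ \<Rightarrow> 'b::field"
  by (simp add: thom_def)

lemma thom_hom: "is_ring_hom f \<Longrightarrow> thom n h \<Longrightarrow> thom n (\<lambda>e. f (h e))"
  by (simp add: thom_def ring_hom_1 ring_hom_mult)

lemma thom_two_powi: "thom n (\<lambda>e. (2::'b::field_char_0) powi wt n b e)"
  by (simp add: thom_def wt_add wt_trunc power_int_add) (simp add: wt_def)

lemma thom_separating:
  assumes "finite D" "\<And>d. d \<in> D \<Longrightarrow> trunc n d = d"
  shows "\<exists>h :: _ \<Rightarrow> 'b::field_char_0. thom n h \<and> inj_on h D"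
proof -
  obtain b where b: "inj_on (wt n b) D" using wt_separates[OF assms] by blast
  then have "inj_on (\<lambda>e. (2::'b) powi wt n b e) D"
    by (auto simp: inj_on_def two_powi_eq_iff)
  then show ?thesis using thom_two_powi by blast
qed

lemma thom_basis:
  fixes y :: "nat \<Rightarrow> 'b::field"
  assumes "\<And>i. i < n \<Longrightarrow> y i \<noteq> 0"
  shows "thom n (\<lambda>e. \<Prod>i<n. y i powi Poly_Mapping.lookup e i)"
  using assms by (simp add: thom_def lookup_add power_int_add prod.distrib lookup_trunc)

lemma thom_eq_prod:
  fixes h :: "_ \<Rightarrow> 'b::field"
  assumes h: "thom n h"
  shows "h e = (\<Prod>i<n. h (Poly_Mapping.single i 1) powi Poly_Mapping.lookup e i)"
proof -
  have p: "h (Poly_Mapping.single i (int m)) = h (Poly_Mapping.single i 1) ^ m" for i m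
  proof (induction m)
    case (Suc m)
    have "Poly_Mapping.single i (int (Suc m)) = Poly_Mapping.single i 1 + Poly_Mapping.single i (int m)"
      by (rule poly_mapping_eqI) (simp add: lookup_add lookup_single when_def)
    then show ?case using Suc by (simp add: thom_add[OF h])
  qed (simp add: thom_0[OF h])
  have q: "h (Poly_Mapping.single i m) = h (Poly_Mapping.single i 1) powi m" for i m
  proof (cases "m \<ge> 0")
    case True
    then show ?thesis using p[of i "nat m"] by (simp add: power_int_def)
  next
    case False
    then have "h (Poly_Mapping.single i m) * h (Poly_Mapping.single i 1) ^ nat (- m) = 1"
      using thom_minus[OF h, of "Poly_Mapping.single i (- m)"] p[of i "nat (- m)"]
      by (simp add: single_uminus)
    then have "h (Poly_Mapping.single i m) = inverse (h (Poly_Mapping.single i 1) ^ nat (- m))"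
      by (metis inverse_unique mult.commute)
    then show ?thesis using False by (simp add: power_int_def power_inverse)
  qed
  have s: "h (sum f A) = (\<Prod>i\<in>A. h (f i))" for f :: "nat \<Rightarrow> _" and A
    by (induction A rule: infinite_finite_induct) (auto simp: thom_0[OF h] thom_add[OF h])
  have "h e = h (trunc n e)" by (simp add: thom_trunc[OF h])
  also have "\<dots> = (\<Prod>i<n. h (Poly_Mapping.single i (Poly_Mapping.lookup e i)))"
    unfolding trunc_def by (rule s)
  also have "\<dots> = (\<Prod>i<n. h (Poly_Mapping.single i 1) powi Poly_Mapping.lookup e i)"
    by (intro prod.cong refl q)
  finally show ?thesis .
qed

text \<open>Along the powers of one separating point, multiplicativity says that the power sums
  weighted by the coefficients are powers of a single number; \<open>group_like_is_single\<close>
  concludes.\<close>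

lemma group_like_trunc:
  fixes f :: "(nat \<Rightarrow>\<^sub>0 int) \<Rightarrow>\<^sub>0 'w::field_char_0"
  assumes keys: "\<And>e. e \<in> Poly_Mapping.keys f \<Longrightarrow> trunc n e = e"
    and g: "\<And>h. thom n h \<Longrightarrow> ev id h f = g h"
    and g1: "g (\<lambda>_. 1) = 1" and gm: "\<And>h h'. thom n h \<Longrightarrow> thom n h' \<Longrightarrow> g (\<lambda>e. h e * h' e) = g h * g h'"
  shows "\<exists>d. trunc n d = d \<and> f = Poly_Mapping.single d 1"
proof -
  obtain h :: "_ \<Rightarrow> 'w" where h: "thom n h" "inj_on h (Poly_Mapping.keys f)"
    using thom_separating[of "Poly_Mapping.keys f" n] keys by auto
  have pw: "g (\<lambda>e. h e ^ m) = g h ^ m" for m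
    by (induction m) (auto simp: g1 gm[OF h(1) thom_power[OF h(1)]])
  have "(\<Sum>e\<in>Poly_Mapping.keys f. Poly_Mapping.lookup f e * h e ^ m) = g h ^ m" for m
    using g[OF thom_power[OF h(1), of m]] by (simp add: ev_def pw)
  from group_like_is_single[OF h(2) this] obtain d where d: "f = Poly_Mapping.single d 1" by blast
  then show ?thesis using keys[of d] by auto
qed

text \<open>Instantiated with the whole closure as \<open>L\<close> to compare \<open>F\<close> and
  \<open>P\<close>, and with a finite splitting field to use flasqueness. Stability of
  \<open>L\<close> under Galois allows the scalars of formal tensors to be twisted without leaving
  \<open>L\<close>.\<close>

locale torus_splitting =
  fixes G :: "('k::field_char_0, 'a::comm_ring_1) hopf" and L :: "'k alg_closure set" and n :: nat
    and \<Phi> :: "'a \<Rightarrow> (nat \<Rightarrow>\<^sub>0 int) \<Rightarrow>\<^sub>0 'k alg_closure"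
  assumes scheme: "affine_group_scheme G"
    and L: "intermediate L" and L_gal: "\<And>\<rho> x. \<rho> \<in> Gal \<Longrightarrow> x \<in> L \<Longrightarrow> \<rho> x \<in> L"
    and \<Phi>_hom: "is_alg_hom (strct G) (\<lambda>c. Poly_Mapping.single 0 (to_ac c)) \<Phi>"
    and \<Phi>_comul: "comul_compatible G \<Phi>"
    and \<Phi>_range: "range \<Phi> \<subseteq> split_torus_ring n L"
    and \<Phi>_inj: "\<And>u. Poly_Mapping.keys u \<subseteq> UNIV \<times> L \<Longrightarrow>
             tensor_eval (\<lambda>a l. \<Phi> a * Poly_Mapping.single 0 l) u = 0 \<Longrightarrow>
             u \<in> tensor_rel (strct G) to_ac L"
    and \<Phi>_surj: "\<And>f. f \<in> split_torus_ring n L \<Longrightarrow> \<exists>u. Poly_Mapping.keys u \<subseteq> UNIV \<times> L \<and>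
             tensor_eval (\<lambda>a l. \<Phi> a * Poly_Mapping.single 0 l) u = f"
begin

abbreviation T\<Phi> where "T\<Phi> \<equiv> tensor_eval (\<lambda>a l. \<Phi> a * Poly_Mapping.single 0 l)"

definition teval :: "('k alg_closure \<Rightarrow> 'b::comm_ring_1) \<Rightarrow> ('a \<Rightarrow> 'b) \<Rightarrow> (('a \<times> 'k alg_closure) \<Rightarrow>\<^sub>0 int) \<Rightarrow> 'b" where
  "teval j \<phi> = tensor_eval (\<lambda>a l. \<phi> a * j l)"

text \<open>The embedding \<open>j\<close> of the constants is a parameter: it runs through maps to
  the closures of \<open>k\<close>, \<open>k(t)\<close> and \<open>k((s))\<close> and, for
  cocharacters, to Laurent polynomials.\<close>

definition pts :: "('k alg_closure \<Rightarrow> 'b::comm_ring_1) \<Rightarrow> ('a \<Rightarrow> 'b) set" where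
  "pts j = {\<phi>. is_alg_hom (strct G) (j \<circ> to_ac) \<phi>}"

text \<open>A formal tensor that represents the character with exponent \<open>e\<close>. The next
  two definitions evaluate it at a point and recover a point from its character values.\<close>

definition uu :: "(nat \<Rightarrow>\<^sub>0 int) \<Rightarrow> (('a \<times> 'k alg_closure) \<Rightarrow>\<^sub>0 int)" where
  "uu e = (SOME u. Poly_Mapping.keys u \<subseteq> UNIV \<times> L \<and> T\<Phi> u = Poly_Mapping.single (trunc n e) 1)"

definition chi :: "('k alg_closure \<Rightarrow> 'b::comm_ring_1) \<Rightarrow> ('a \<Rightarrow> 'b) \<Rightarrow> (nat \<Rightarrow>\<^sub>0 int) \<Rightarrow> 'b" where
  "chi j \<phi> e = teval j \<phi> (uu e)"

definition pt :: "('k alg_closure \<Rightarrow> 'b::comm_ring_1) \<Rightarrow> ((nat \<Rightarrow>\<^sub>0 int) \<Rightarrow> 'b) \<Rightarrow> 'a \<Rightarrow> 'b" where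
  "pt j h a = ev j h (\<Phi> a)"

lemma ring_\<Phi>: "is_ring_hom \<Phi>" and \<Phi>_strct: "\<Phi> (strct G c) = Poly_Mapping.single 0 (to_ac c)"
  using \<Phi>_hom by (auto simp: is_alg_hom_def)

lemma single_trunc_in: "Poly_Mapping.single (trunc n e) l \<in> split_torus_ring n L" if "l \<in> L"
proof -
  have "Poly_Mapping.keys (trunc n e) \<subseteq> {..<n}" using trunc_eq_iff[of n "trunc n e"] by simp
  then show ?thesis
    using that intermediate_0[OF L] by (auto simp: split_torus_ring_def lookup_single when_def split: if_splits)
qed

lemma uu_keys: "Poly_Mapping.keys (uu e) \<subseteq> UNIV \<times> L" and uu: "T\<Phi> (uu e) = Poly_Mapping.single (trunc n e) 1"
  using someI_ex[OF \<Phi>_surj[OF single_trunc_in[OF intermediate_1[OF L], of e]]] by (auto simp: uu_def)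

lemma \<Phi>_keys: "e \<in> Poly_Mapping.keys (\<Phi> a) \<Longrightarrow> trunc n e = e"
  using \<Phi>_range by (auto simp: split_torus_ring_def trunc_eq_iff)

lemma \<Phi>_lookup: "Poly_Mapping.lookup (\<Phi> a) e \<in> L"
proof -
  have "\<Phi> a \<in> split_torus_ring n L" using \<Phi>_range by blast
  then have "range (Poly_Mapping.lookup (\<Phi> a)) \<subseteq> L" by (simp add: split_torus_ring_def)
  then show ?thesis by blast
qed

lemma teval_feval: "teval j \<phi> u = feval (\<lambda>p. \<phi> (fst p) * j (snd p)) u"
  by (simp add: teval_def tensor_eval_feval)

lemma teval_sum: "teval j \<phi> (sum f A) = (\<Sum>x\<in>A. teval j \<phi> (f x))"
  by (simp add: teval_def tensor_eval_sum)

text \<open>Formal tensors with the same image in the group algebra agree modulo tensor relations,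
  by injectivity of the splitting, and a point respects these relations. Characters may therefore be
  computed on any representative.\<close>

lemma teval_cong:
  assumes j: "is_ring_hom j" and \<phi>: "\<phi> \<in> pts j"
    and u: "Poly_Mapping.keys u \<subseteq> UNIV \<times> L" "Poly_Mapping.keys v \<subseteq> UNIV \<times> L" "T\<Phi> u = T\<Phi> v"
  shows "teval j \<phi> u = teval j \<phi> v"
proof -
  have "Poly_Mapping.keys (u - v) \<subseteq> UNIV \<times> L"
    using keys_diff[of u v] u by blast
  moreover have "T\<Phi> (u - v) = 0" using u by (simp add: tensor_eval_diff)
  ultimately have "u - v \<in> tensor_rel (strct G) to_ac L" by (rule \<Phi>_inj)
  moreover have "is_ring_hom \<phi>" "\<And>c. \<phi> (strct G c) = j (to_ac c)"
    using \<phi> by (auto simp: pts_def is_alg_hom_def)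
  ultimately have "teval j \<phi> (u - v) = 0"
    unfolding teval_def
    by (intro tensor_eval_rel[where Y = L and s = "strct G" and s' = to_ac])
      (auto simp: ring_hom_add ring_hom_mult j algebra_simps)
  then show ?thesis by (simp add: teval_def tensor_eval_diff)
qed

lemma teval_mult:
  assumes "is_ring_hom j" "is_ring_hom \<phi>"
  shows "teval j \<phi> (tensor_mult u v) = teval j \<phi> u * teval j \<phi> v"
  unfolding teval_def by (rule tensor_eval_mult) (simp add: assms ring_hom_mult algebra_simps)

lemma T\<Phi>_mult: "T\<Phi> (tensor_mult u v) = T\<Phi> u * T\<Phi> v"
  by (rule tensor_eval_mult) (simp add: ring_hom_mult ring_\<Phi> mult_single algebra_simps)

context
  fixes j :: "'k alg_closure \<Rightarrow> 'b::comm_ring_1"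
  assumes j: "is_ring_hom j"
begin

lemma chi_thom:
  assumes \<phi>: "\<phi> \<in> pts j" shows "thom n (chi j \<phi>)"
proof -
  have h: "is_ring_hom \<phi>" using \<phi> by (auto simp: pts_def is_alg_hom_def)
  have "chi j \<phi> 0 = teval j \<phi> (frag_of (1, 1))"
    unfolding chi_def
    by (rule teval_cong[OF j \<phi> uu_keys]) (auto simp: uu intermediate_1[OF L] ring_hom_1 ring_\<Phi>)
  then have "chi j \<phi> 0 = 1" by (simp add: teval_def ring_hom_1 h j)
  moreover have "chi j \<phi> (d + e) = chi j \<phi> d * chi j \<phi> e" for d e
  proof -
    have "chi j \<phi> (d + e) = teval j \<phi> (tensor_mult (uu d) (uu e))"
      unfolding chi_def
      by (rule teval_cong[OF j \<phi> uu_keys keys_tensor_mult[OF uu_keys uu_keys intermediate_mult[OF L]]])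
        (simp_all add: T\<Phi>_mult uu mult_single trunc_add)
    then show ?thesis by (simp add: teval_mult h j chi_def)
  qed
  moreover have "chi j \<phi> (trunc n e) = chi j \<phi> e" for e
    by (simp add: chi_def uu_def)
  ultimately show ?thesis by (simp add: thom_def)
qed

lemma pt_chi:
  assumes \<phi>: "\<phi> \<in> pts j" shows "pt j (chi j \<phi>) = \<phi>"
proof
  fix a
  have h: "is_ring_hom \<phi>" using \<phi> by (auto simp: pts_def is_alg_hom_def)
  \<comment> \<open>The expansion of \<open>a\<close> into characters, with the coefficients of
    \<open>\<Phi> a\<close>.\<close>
  define v where "v = (\<Sum>e\<in>Poly_Mapping.keys (\<Phi> a). tensor_mult (frag_of (1, Poly_Mapping.lookup (\<Phi> a) e)) (uu e))"
  have "Poly_Mapping.keys v \<subseteq> UNIV \<times> L"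
    unfolding v_def
    by (rule order_trans[OF keys_sum] UN_least keys_tensor_mult[OF _ uu_keys intermediate_mult[OF L]])+
      (auto simp: \<Phi>_lookup)
  moreover have "T\<Phi> v = \<Phi> a"
  proof -
    have "T\<Phi> v = (\<Sum>e\<in>Poly_Mapping.keys (\<Phi> a). Poly_Mapping.single 0 (Poly_Mapping.lookup (\<Phi> a) e) * Poly_Mapping.single (trunc n e) 1)"
      by (simp add: v_def tensor_eval_sum T\<Phi>_mult uu ring_hom_1 ring_\<Phi>)
    also have "\<dots> = (\<Sum>e\<in>Poly_Mapping.keys (\<Phi> a). Poly_Mapping.single e (Poly_Mapping.lookup (\<Phi> a) e))"
      by (intro sum.cong) (auto simp: mult_single \<Phi>_keys)
    finally show ?thesis by (simp add: sum_single)
  qed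
  ultimately have "teval j \<phi> v = teval j \<phi> (frag_of (a, 1))"
    by (intro teval_cong[OF j \<phi>]) (auto simp: intermediate_1[OF L])
  also have "\<dots> = \<phi> a" by (simp add: teval_def ring_hom_1 j)
  also have "teval j \<phi> v = (\<Sum>e\<in>Poly_Mapping.keys (\<Phi> a). j (Poly_Mapping.lookup (\<Phi> a) e) * chi j \<phi> e)"
    by (simp add: v_def teval_sum teval_mult h j chi_def) (simp add: teval_def ring_hom_1 h)
  finally show "pt j (chi j \<phi>) a = \<phi> a" by (simp add: pt_def ev_def)
qed

lemma pt_in:
  assumes h: "thom n h" shows "pt j h \<in> pts j"
proof -
  have e: "is_ring_hom (ev j h)" using j h by (intro ev_hom) (auto simp: thom_def)
  have "pt j h = ev j h \<circ> \<Phi>" by (auto simp: pt_def)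
  then have "is_ring_hom (pt j h)" using ring_hom_comp[OF e ring_\<Phi>] by simp
  moreover have "pt j h (strct G c) = j (to_ac c)" for c
    by (simp add: pt_def \<Phi>_strct ev_single j thom_0[OF h])
  ultimately show ?thesis by (simp add: pts_def is_alg_hom_def)
qed

lemma teval_pt:
  assumes h: "thom n h" shows "teval j (pt j h) u = ev j h (T\<Phi> u)"
proof -
  have e: "is_ring_hom (ev j h)" using j h by (intro ev_hom) (auto simp: thom_def)
  show ?thesis
    unfolding teval_feval tensor_eval_feval feval_hom[OF e]
    by (rule feval_cong) (simp add: pt_def ring_hom_mult e ev_single j thom_0[OF h])
qed

lemma chi_pt:
  assumes h: "thom n h" shows "chi j (pt j h) = h"
  by (rule ext) (simp add: chi_def teval_pt[OF h] uu ev_single j ring_hom_1 thom_trunc[OF h])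

lemma pts_conv: "\<phi> \<in> pts j \<longleftrightarrow> (\<exists>h. thom n h \<and> \<phi> = pt j h)"
  using chi_thom pt_chi pt_in by metis

lemma pt_inj: "thom n h \<Longrightarrow> thom n h' \<Longrightarrow> pt j h = pt j h' \<Longrightarrow> h = h'"
  by (metis chi_pt)

lemma carrier_points: "carrier (points G (j \<circ> to_ac)) = pts j"
  by (simp add: points_def pts_def)

lemma points_mult_pt:
  "pt j h \<otimes>\<^bsub>points G (j \<circ> to_ac)\<^esub> pt j h' = pt j (\<lambda>e. h e * h' e)"
  by (rule ext) (simp add: points_def pt_def comul_ev[OF \<Phi>_comul j])

text \<open>The counit axiom makes the neutral point idempotent; its character values are invertible
  idempotents, so they equal 1.\<close>

lemma one_point: "\<one>\<^bsub>points G (j \<circ> to_ac)\<^esub> = pt j (\<lambda>_. 1)"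
proof -
  let ?u = "\<one>\<^bsub>points G (j \<circ> to_ac)\<^esub>"
  have c: "is_alg_hom (strct G) id (counit G)"
    and cu: "\<And>a. tensor_eval (\<lambda>x y. strct G (counit G x) * y) (comul G a) = a"
    using scheme by (auto simp: affine_group_scheme_def Let_def)
  have "?u \<in> pts j"
    using c j by (auto simp: points_def pts_def is_alg_hom_def is_ring_hom_def)
  then obtain h where h: "thom n h" "?u = pt j h" by (auto simp: pts_conv)
  have "?u \<otimes>\<^bsub>points G (j \<circ> to_ac)\<^esub> \<phi> = \<phi>" if \<phi>: "\<phi> \<in> pts j" for \<phi>
  proof
    fix a
    have r: "is_ring_hom \<phi>" and s: "\<And>c. \<phi> (strct G c) = j (to_ac c)"
      using \<phi> by (auto simp: pts_def is_alg_hom_def)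
    have "\<phi> a = \<phi> (tensor_eval (\<lambda>x y. strct G (counit G x) * y) (comul G a))" by (simp add: cu)
    also have "\<dots> = tensor_eval (\<lambda>x y. j (to_ac (counit G x)) * \<phi> y) (comul G a)"
      by (simp add: tensor_eval_feval feval_hom[OF r] ring_hom_mult r s)
    finally show "(?u \<otimes>\<^bsub>points G (j \<circ> to_ac)\<^esub> \<phi>) a = \<phi> a" by (simp add: points_def)
  qed
  from this[of ?u] have "pt j (\<lambda>e. h e * h e) = pt j h"
    using h pt_in[OF h(1)] by (simp add: points_mult_pt)
  then have "(\<lambda>e. h e * h e) = h" using pt_inj[OF thom_mult[OF h(1) h(1)] h(1)] by blast
  then have hh: "h e * h e = h e" for e by (rule fun_cong)
  have "h e = 1" for e
  proof -
    have "h (- e) * (h e * h e) = h (- e) * h e" by (simp add: hh)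
    then show ?thesis using thom_minus[OF h(1), of e] by (simp flip: mult.assoc)
  qed
  then have "h = (\<lambda>_. 1)" by auto
  then show ?thesis using h by simp
qed

end

lemma points_comm_group:
  fixes j :: "'k alg_closure \<Rightarrow> 'b::field"
  assumes j: "is_ring_hom j" shows "comm_group (points G (j \<circ> to_ac))"
proof (rule comm_groupI; unfold carrier_points[OF j] one_point[OF j])
  note [simp] = points_mult_pt[OF j]
  fix x assume "x \<in> pts j"
  then obtain h where h: "thom n h" "x = pt j h" by (auto simp: pts_conv[OF j])
  show "pt j (\<lambda>_. 1) \<otimes>\<^bsub>points G (j \<circ> to_ac)\<^esub> x = x" using h by simp
  show "\<exists>y\<in>pts j. y \<otimes>\<^bsub>points G (j \<circ> to_ac)\<^esub> x = pt j (\<lambda>_. 1)"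
    by (rule bexI[OF _ pt_in[OF j thom_inverse[OF h(1)]]]) (simp add: h(2) thom_nonzero[OF h(1)])
  fix y assume "y \<in> pts j"
  then obtain h' where h': "thom n h'" "y = pt j h'" by (auto simp: pts_conv[OF j])
  show "x \<otimes>\<^bsub>points G (j \<circ> to_ac)\<^esub> y \<in> pts j" using h h' by (simp add: pt_in[OF j] thom_mult)
  show "x \<otimes>\<^bsub>points G (j \<circ> to_ac)\<^esub> y = y \<otimes>\<^bsub>points G (j \<circ> to_ac)\<^esub> x" using h h' by (simp add: mult.commute)
  fix z assume "z \<in> pts j"
  then obtain h'' where h'': "thom n h''" "z = pt j h''" by (auto simp: pts_conv[OF j])
  show "x \<otimes>\<^bsub>points G (j \<circ> to_ac)\<^esub> y \<otimes>\<^bsub>points G (j \<circ> to_ac)\<^esub> z = x \<otimes>\<^bsub>points G (j \<circ> to_ac)\<^esub> (y \<otimes>\<^bsub>points G (j \<circ> to_ac)\<^esub> z)"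
    using h h' h'' by (simp add: mult.assoc)
qed (rule pt_in[OF j thom_one])

lemma hom_point:
  assumes "is_ring_hom \<sigma>" "\<And>x. \<sigma> (j x) = j' (\<rho> x)" "\<And>c. \<rho> (to_ac c) = to_ac c" "\<phi> \<in> pts j"
  shows "\<sigma> \<circ> \<phi> \<in> pts j'"
  using assms by (auto simp: pts_def is_alg_hom_def ring_hom_comp)

lemma hom_point_mult:
  assumes "is_ring_hom \<sigma>"
  shows "\<sigma> \<circ> (\<phi> \<otimes>\<^bsub>points G (j \<circ> to_ac)\<^esub> \<psi>) = (\<sigma> \<circ> \<phi>) \<otimes>\<^bsub>points G (j' \<circ> to_ac)\<^esub> (\<sigma> \<circ> \<psi>)"
  by (auto simp: points_def tensor_eval_feval feval_hom[OF assms] ring_hom_mult assms)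

section \<open>Galois action on the character lattice\<close>

definition twist :: "('k alg_closure \<Rightarrow> 'k alg_closure) \<Rightarrow> (('a \<times> 'k alg_closure) \<Rightarrow>\<^sub>0 int) \<Rightarrow> (('a \<times> 'k alg_closure) \<Rightarrow>\<^sub>0 int)" where
  "twist \<rho> u = frag_extend (\<lambda>(a, l). frag_of (a, \<rho> l)) u"

lemma teval_twist: "teval j \<phi> (twist \<rho> u) = teval (j \<circ> \<rho>) \<phi> u"
  unfolding twist_def teval_feval feval_extend by (rule feval_cong) auto

lemma twist_keys:
  assumes "\<rho> \<in> Gal" "Poly_Mapping.keys u \<subseteq> UNIV \<times> L" shows "Poly_Mapping.keys (twist \<rho> u) \<subseteq> UNIV \<times> L"
  unfolding twist_def by (rule order_trans[OF keys_frag_extend]) (use assms L_gal in auto)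

lemma T\<Phi>_keys: "e \<in> Poly_Mapping.keys (T\<Phi> u) \<Longrightarrow> trunc n e = e"
proof -
  let ?R = "{f :: (nat \<Rightarrow>\<^sub>0 int) \<Rightarrow>\<^sub>0 'k alg_closure. \<forall>e\<in>Poly_Mapping.keys f. trunc n e = e}"
  have mult: "f * g \<in> ?R" if "f \<in> ?R" "g \<in> ?R" for f g
  proof (intro CollectI ballI)
    fix e assume "e \<in> Poly_Mapping.keys (f * g)"
    then obtain a b where "a \<in> Poly_Mapping.keys f" "b \<in> Poly_Mapping.keys g" "e = a + b"
      using keys_mult[of f g] by auto
    then show "trunc n e = e" using that by (simp add: trunc_add)
  qed
  have sc: "Poly_Mapping.single 0 l \<in> ?R" for l by (cases "l = 0") auto
  have oi: "of_int m \<in> ?R" for m using sc[of "of_int m"] unfolding single_of_int .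
  have "\<Phi> a \<in> ?R" for a using \<Phi>_keys by blast
  then have R: "of_int m * (\<Phi> a * Poly_Mapping.single 0 l) \<in> ?R" for m a l
    by (intro mult[OF oi] mult[OF _ sc])
  have "Poly_Mapping.keys (T\<Phi> u) \<subseteq> {e. trunc n e = e}"
    unfolding tensor_eval_def by (rule order_trans[OF keys_sum], rule UN_least) (use R in blast)
  then show "e \<in> Poly_Mapping.keys (T\<Phi> u) \<Longrightarrow> trunc n e = e" by auto
qed

text \<open>Multiplicativity in the point characterizes characters among formal tensors. In this way
  Galois twists, group-like elements and pullbacks along \<open>p\<close> are identified with
  exponents.\<close>

lemma multiplicative_is_single:
  assumes one: "teval id (pt id (\<lambda>_. 1)) u = 1"
    and mult: "\<And>h h'. thom n h \<Longrightarrow> thom n h' \<Longrightarrow>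
      teval id (pt id (\<lambda>e. h e * h' e)) u = teval id (pt id h) u * teval id (pt id h') u"
  shows "\<exists>d. trunc n d = d \<and> T\<Phi> u = Poly_Mapping.single d 1"
  by (rule group_like_trunc[where g = "\<lambda>h. teval id (pt id h) u"])
    (auto simp: T\<Phi>_keys teval_pt ring_hom_id one mult)

text \<open>At a point, the twisted character takes the value \<open>\<rho>\<close> of the original
  value at the point moved back by the inverse of \<open>\<rho>\<close>. Moving points is a group
  homomorphism, so multiplicativity persists.\<close>

lemma twist_single:
  assumes \<rho>: "\<rho> \<in> Gal"
  shows "\<exists>d. trunc n d = d \<and> T\<Phi> (twist \<rho> (uu e)) = Poly_Mapping.single d 1"
proof (rule multiplicative_is_single)
  let ?i = "inv_into UNIV \<rho>"
  have i: "?i \<in> Gal" using \<rho> by (rule gal_inv)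
  have eq: "teval id \<phi> (twist \<rho> (uu e)) = \<rho> (chi id (?i \<circ> \<phi>) e)" for \<phi>
  proof -
    have "\<rho> (chi id (?i \<circ> \<phi>) e) = teval \<rho> \<phi> (uu e)"
      unfolding chi_def teval_feval feval_hom[OF gal_hom[OF \<rho>]]
      by (rule feval_cong) (simp add: ring_hom_mult[OF gal_hom[OF \<rho>]] gal_inv_apply[OF \<rho>])
    then show ?thesis by (simp add: teval_twist)
  qed
  have ipt: "?i \<circ> \<phi> \<in> pts id" if "\<phi> \<in> pts id" for \<phi>
    by (rule hom_point[where \<rho> = ?i, OF gal_hom[OF i] _ _ that]) (auto simp: gal_to_ac[OF i])
  have m: "chi id (\<phi> \<otimes>\<^bsub>points G (id \<circ> to_ac)\<^esub> \<psi>) e = chi id \<phi> e * chi id \<psi> e" if "\<phi> \<in> pts id" "\<psi> \<in> pts id" for \<phi> \<psi>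
  proof -
    obtain h h' where "thom n h" "\<phi> = pt id h" "thom n h'" "\<psi> = pt id h'"
      using \<open>\<phi> \<in> pts id\<close> \<open>\<psi> \<in> pts id\<close> unfolding pts_conv[OF ring_hom_id(1)] by blast
    then show ?thesis by (simp only: points_mult_pt[OF ring_hom_id(1)] chi_pt[OF ring_hom_id(1)] thom_mult)
  qed
  have "?i \<circ> pt id (\<lambda>_. 1) = pt id (\<lambda>_. 1)"
    unfolding one_point[OF ring_hom_id(1), symmetric] by (auto simp: points_def gal_to_ac[OF i])
  then show "teval id (pt id (\<lambda>_. 1)) (twist \<rho> (uu e)) = 1"
    using \<rho> by (simp add: eq chi_pt ring_hom_id thom_one ring_hom_1 gal_hom)
  fix h h' :: "(nat \<Rightarrow>\<^sub>0 int) \<Rightarrow> 'k alg_closure" assume h: "thom n h" "thom n h'"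
  have "?i \<circ> pt id (\<lambda>e. h e * h' e) = (?i \<circ> pt id h) \<otimes>\<^bsub>points G (id \<circ> to_ac)\<^esub> (?i \<circ> pt id h')"
    by (simp only: points_mult_pt[OF ring_hom_id(1), symmetric] hom_point_mult[OF gal_hom[OF i]])
  then show "teval id (pt id (\<lambda>e. h e * h' e)) (twist \<rho> (uu e)) =
      teval id (pt id h) (twist \<rho> (uu e)) * teval id (pt id h') (twist \<rho> (uu e))"
    unfolding eq by (simp only: m[OF ipt[OF pt_in[OF ring_hom_id(1) h(1)]] ipt[OF pt_in[OF ring_hom_id(1) h(2)]]]
        ring_hom_mult[OF gal_hom[OF \<rho>]])
qed

definition act :: "('k alg_closure \<Rightarrow> 'k alg_closure) \<Rightarrow> (nat \<Rightarrow>\<^sub>0 int) \<Rightarrow> (nat \<Rightarrow>\<^sub>0 int)" where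
  "act \<rho> e = (SOME d. trunc n d = d \<and> T\<Phi> (twist \<rho> (uu e)) = Poly_Mapping.single d 1)"

lemma act:
  assumes "\<rho> \<in> Gal"
  shows trunc_act: "trunc n (act \<rho> e) = act \<rho> e" and twist_act: "T\<Phi> (twist \<rho> (uu e)) = Poly_Mapping.single (act \<rho> e) 1"
  using someI_ex[OF twist_single[OF assms, of e]] by (auto simp: act_def)

text \<open>Applying \<open>\<sigma>\<close> to an evaluation twists the scalars of
  \<open>uu e\<close> by \<open>\<rho>\<close>, and the twisted tensor represents
  \<open>act \<rho> e\<close>. Later identities are stated at \<open>act \<rho> e\<close> for this
  reason. Here \<open>\<sigma>\<close> is any ring homomorphism lying over \<open>\<rho>\<close>,
  for instance the action on coefficients of Laurent polynomials.\<close>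

lemma chi_galois:
  assumes \<sigma>: "is_ring_hom \<sigma>" and j: "is_ring_hom j" "is_ring_hom j'" and \<rho>: "\<rho> \<in> Gal"
    and eq: "\<And>x. \<sigma> (j x) = j' (\<rho> x)" and \<phi>: "\<phi> \<in> pts j"
  shows "chi j' (\<sigma> \<circ> \<phi>) (act \<rho> e) = \<sigma> (chi j \<phi> e)"
proof -
  have p: "\<sigma> \<circ> \<phi> \<in> pts j'" by (rule hom_point[where \<rho> = \<rho> and j = j]) (simp_all add: \<sigma> eq \<phi> gal_to_ac \<rho>)
  have "\<sigma> (chi j \<phi> e) = teval (j' \<circ> \<rho>) (\<sigma> \<circ> \<phi>) (uu e)"
    unfolding chi_def teval_feval feval_hom[OF \<sigma>] by (rule feval_cong) (simp add: ring_hom_mult[OF \<sigma>] eq)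
  also have "\<dots> = teval j' (\<sigma> \<circ> \<phi>) (twist \<rho> (uu e))" by (simp add: teval_twist)
  also have "\<dots> = teval j' (\<sigma> \<circ> \<phi>) (uu (act \<rho> e))"
    by (rule teval_cong[OF j(2) p twist_keys[OF \<rho> uu_keys] uu_keys]) (simp add: twist_act[OF \<rho>] uu trunc_act[OF \<rho>])
  finally show ?thesis by (simp add: chi_def)
qed

lemma chi_hom:
  assumes "is_ring_hom \<sigma>" shows "chi (\<sigma> \<circ> j) (\<sigma> \<circ> \<phi>) e = \<sigma> (chi j \<phi> e)"
  unfolding chi_def teval_feval feval_hom[OF assms] by (rule feval_cong) (simp add: ring_hom_mult[OF assms])

text \<open>Points over the closure separate exponents. Together with \<open>act_char\<close> this
  yields the rules for \<open>act\<close>.\<close>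

lemma lattice_eqI:
  assumes "trunc n d = d" "trunc n e = e" "\<And>h :: _ \<Rightarrow> 'k alg_closure. thom n h \<Longrightarrow> h d = h e"
  shows "d = e"
proof -
  obtain h :: "_ \<Rightarrow> 'k alg_closure" where "thom n h" "inj_on h {d, e}"
    using thom_separating[of "{d, e}" n] assms(1,2) by auto
  then show ?thesis using assms(3) by (auto simp: inj_on_def)
qed

lemma act_char:
  assumes \<rho>: "\<rho> \<in> Gal" and h: "thom n h"
  shows "h (act \<rho> e) = \<rho> (chi id (inv_into UNIV \<rho> \<circ> pt id h) e)" and "inv_into UNIV \<rho> \<circ> pt id h \<in> pts id"
proof -
  let ?i = "inv_into UNIV \<rho>"
  have i: "?i \<in> Gal" using \<rho> by (rule gal_inv)
  show p: "?i \<circ> pt id h \<in> pts id"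
    by (rule hom_point[where \<rho> = ?i, OF gal_hom[OF i] _ _ pt_in[OF ring_hom_id(1) h]]) (auto simp: gal_to_ac[OF i])
  have "\<rho> (chi id (?i \<circ> pt id h) e) = chi id (\<rho> \<circ> (?i \<circ> pt id h)) (act \<rho> e)"
    by (rule chi_galois[OF gal_hom[OF \<rho>] ring_hom_id(1) ring_hom_id(1) \<rho> _ p, symmetric]) simp
  also have "\<rho> \<circ> (?i \<circ> pt id h) = pt id h" by (simp flip: comp_assoc add: gal_inv_comp[OF \<rho>])
  finally show "h (act \<rho> e) = \<rho> (chi id (?i \<circ> pt id h) e)" by (simp only: chi_pt[OF ring_hom_id(1) h])
qed

lemma act_add: assumes \<rho>: "\<rho> \<in> Gal" shows "act \<rho> (d + e) = act \<rho> d + act \<rho> e"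
proof (rule lattice_eqI)
  fix h :: "_ \<Rightarrow> 'k alg_closure" assume h: "thom n h"
  show "h (act \<rho> (d + e)) = h (act \<rho> d + act \<rho> e)"
    unfolding thom_add[OF h] act_char[OF \<rho> h]
    by (simp add: thom_add[OF chi_thom[OF ring_hom_id(1) act_char(2)[OF \<rho> h]]] ring_hom_mult gal_hom[OF \<rho>])
qed (simp_all add: trunc_act \<rho> trunc_add)

lemma act_0: "\<rho> \<in> Gal \<Longrightarrow> act \<rho> 0 = 0"
  using act_add[of \<rho> 0 0] by simp

lemma act_trunc: "act \<rho> (trunc n e) = act \<rho> e"
  by (simp add: act_def uu_def)

lemma act_id: "act id e = trunc n e"
proof (rule lattice_eqI)
  fix h :: "_ \<Rightarrow> 'k alg_closure" assume h: "thom n h"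
  have "inv_into UNIV id = (id :: 'k alg_closure \<Rightarrow> _)" by (rule inv_id)
  then show "h (act id e) = h (trunc n e)"
    using act_char(1)[OF id_in_gal h, of e] by (simp add: chi_pt ring_hom_id h thom_trunc[OF h])
qed (simp_all add: trunc_act id_in_gal)

lemma act_comp: assumes \<rho>: "\<rho> \<in> Gal" and \<rho>': "\<rho>' \<in> Gal" shows "act (\<rho> \<circ> \<rho>') e = act \<rho> (act \<rho>' e)"
proof (rule lattice_eqI)
  fix h :: "_ \<Rightarrow> 'k alg_closure" assume h: "thom n h"
  let ?i = "inv_into UNIV \<rho>" and ?i' = "inv_into UNIV \<rho>'"
  have inv: "inv_into UNIV (\<rho> \<circ> \<rho>') = ?i' \<circ> ?i"
    using gal_bij[OF \<rho>] gal_bij[OF \<rho>'] by (simp add: o_inv_distrib)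
  define \<phi> where "\<phi> = ?i \<circ> pt id h"
  have p: "\<phi> \<in> pts id" unfolding \<phi>_def by (rule act_char(2)[OF \<rho> h])
  have "\<phi> = pt id (chi id \<phi>)" using pt_chi[OF ring_hom_id(1) p] by simp
  then have "chi id \<phi> (act \<rho>' e) = \<rho>' (chi id (?i' \<circ> \<phi>) e)"
    using act_char(1)[OF \<rho>' chi_thom[OF ring_hom_id(1) p], of e] by simp
  then show "h (act (\<rho> \<circ> \<rho>') e) = h (act \<rho> (act \<rho>' e))"
    using act_char(1)[OF gal_comp[OF \<rho> \<rho>'] h, of e] act_char(1)[OF \<rho> h, of "act \<rho>' e"]
    by (simp add: inv \<phi>_def comp_assoc)
qed (simp_all add: trunc_act gal_comp \<rho> \<rho>')

text \<open>The scalars of \<open>uu e\<close> lie in \<open>L\<close>, so the action on exponents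
  factors through restriction to \<open>L\<close>.\<close>

lemma act_cong: assumes "\<And>x. x \<in> L \<Longrightarrow> \<rho> x = \<rho>' x" shows "act \<rho> e = act \<rho>' e"
proof -
  have "twist \<rho> (uu e) = twist \<rho>' (uu e)"
    unfolding twist_def using uu_keys[of e] by (intro frag_extend_eq) (auto simp: assms)
  then show ?thesis by (simp add: act_def)
qed

lemma act_inv:
  assumes "\<rho> \<in> Gal"
  shows "act \<rho> (act (inv_into UNIV \<rho>) e) = trunc n e" "act (inv_into UNIV \<rho>) (act \<rho> e) = trunc n e"
  using assms by (simp_all flip: act_comp add: gal_inv gal_inv_comp act_id)

end

section \<open>Galois cohomology of group schemes\<close>

lemma carrier_points_iff: "\<phi> \<in> carrier (points G j) \<longleftrightarrow> is_alg_hom (strct G) j \<phi>"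
  by (simp add: points_def)

lemma gal_comp_point:
  assumes "\<sigma> \<in> Gal" "\<phi> \<in> carrier (points G (to_ac \<circ> \<epsilon>))"
  shows "\<sigma> \<circ> \<phi> \<in> carrier (points G (to_ac \<circ> \<epsilon>))"
  using assms by (auto simp: carrier_points_iff is_alg_hom_def gal_hom gal_to_ac ring_hom_comp)

lemma hom_comp_points_mult:
  assumes "is_ring_hom \<sigma>"
  shows "\<sigma> \<circ> (\<phi> \<otimes>\<^bsub>points G j\<^esub> \<psi>) = (\<sigma> \<circ> \<phi>) \<otimes>\<^bsub>points G j'\<^esub> (\<sigma> \<circ> \<psi>)"
  by (auto simp: points_def tensor_eval_feval feval_hom[OF assms] ring_hom_mult assms)

text \<open>The finite set \<open>gens\<close> of coordinates determining a point makes stabilizers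
  open, so that the points in the closure form a discrete Galois module. Tori have such coordinates,
  and closed subgroups inherit them.\<close>

locale galois_points =
  fixes \<epsilon> :: "'k::field \<Rightarrow> 'e::field" and G :: "('k, 'a::comm_ring_1) hopf" and gens :: "'a set"
  assumes points_comm_group: "comm_group (points G (to_ac \<circ> \<epsilon>))"
    and finite_gens: "finite gens"
    and gens: "\<And>\<phi> \<psi>. \<phi> \<in> carrier (points G (to_ac \<circ> \<epsilon>)) \<Longrightarrow> \<psi> \<in> carrier (points G (to_ac \<circ> \<epsilon>)) \<Longrightarrow>
      (\<And>a. a \<in> gens \<Longrightarrow> \<phi> a = \<psi> a) \<Longrightarrow> \<phi> = \<psi>"
begin

abbreviation "Pt \<equiv> points G (to_ac \<circ> \<epsilon>)"

sublocale galois_module "gal (UNIV :: 'e alg_closure set)" Pt "krull_topology UNIV" "\<lambda>\<sigma> \<phi>. \<sigma> \<circ> \<phi>"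
proof (intro galois_module.intro galois_module_axioms.intro)
  show "group (gal (UNIV :: 'e alg_closure set))" by (rule group_gal_UNIV)
  show "comm_group Pt" by (rule points_comm_group)
  show "topspace (krull_topology UNIV) = (Gal :: ('e alg_closure \<Rightarrow> _) set)" by (rule topspace_krull)
  fix \<sigma> :: "'e alg_closure \<Rightarrow> 'e alg_closure" and \<phi> assume s: "\<sigma> \<in> Gal" and p: "\<phi> \<in> carrier Pt"
  show "\<sigma> \<circ> \<phi> \<in> carrier Pt" using s p by (rule gal_comp_point)
  show "\<sigma> \<circ> (\<phi> \<otimes>\<^bsub>Pt\<^esub> \<psi>) = (\<sigma> \<circ> \<phi>) \<otimes>\<^bsub>Pt\<^esub> (\<sigma> \<circ> \<psi>)" for \<psi>
    by (rule hom_comp_points_mult) (rule gal_hom[OF s])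
  show "(\<sigma> \<otimes>\<^bsub>gal UNIV\<^esub> \<sigma>') \<circ> \<phi> = \<sigma> \<circ> (\<sigma>' \<circ> \<phi>)" if "\<sigma>' \<in> Gal" for \<sigma>'
    using s that by (simp add: gal_mult comp_assoc)
next
  fix \<phi> assume p: "\<phi> \<in> carrier Pt"
  show "continuous_map (krull_topology UNIV) (discrete_topology (carrier Pt)) (\<lambda>\<sigma>. \<sigma> \<circ> \<phi>)"
  proof (subst continuous_krull_iff)
    show "(\<lambda>\<sigma>. \<sigma> \<circ> \<phi>) ` Gal \<subseteq> carrier Pt" using gal_comp_point p by blast
    show "\<forall>\<sigma>\<in>Gal. \<exists>Y. finite Y \<and> (\<forall>\<sigma>'\<in>Gal. (\<forall>x\<in>Y. \<sigma>' x = \<sigma> x) \<longrightarrow> \<sigma>' \<circ> \<phi> = \<sigma> \<circ> \<phi>)"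
      using finite_gens by (intro ballI exI[of _ "\<phi> ` gens"]) (auto intro!: gens gal_comp_point p)
  qed
qed

lemma galZ1_eq: "galZ1 \<epsilon> G = Z" and galH1_eq: "galH1 \<epsilon> G = H1 (gal UNIV) (krull_topology UNIV) Pt (\<lambda>\<sigma> \<phi>. \<sigma> \<circ> \<phi>)"
  and galB1_eq: "galB1 \<epsilon> G = B"
  by (simp_all add: galZ1_def galH1_def galB1_def)

lemma point_one_fixed: "\<sigma> \<in> Gal \<Longrightarrow> \<sigma> \<circ> \<one>\<^bsub>Pt\<^esub> = \<one>\<^bsub>Pt\<^esub>"
  using act_one by simp

lemma cocycle_id: assumes "c \<in> carrier Z" shows "c id = \<one>\<^bsub>Pt\<^esub>"
proof -
  have "c (id \<circ> id) = c id \<otimes>\<^bsub>Pt\<^esub> (id \<circ> c id)"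
    using Z_cocycle[OF assms, of id id] by (simp add: gal_mult id_in_gal)
  then show ?thesis using Z_closed[OF assms id_in_gal] by (simp add: A.r_cancel_one')
qed

text \<open>For a cocycle, continuity at the identity suffices: if \<open>\<sigma>'\<close> agrees
  with \<open>\<sigma>\<close> on \<open>Y\<close>, they differ by an automorphism fixing
  \<open>Y\<close>, where the cocycle is neutral.\<close>

lemma mem_galZ1: "c \<in> carrier Z \<longleftrightarrow> c \<in> Gal \<rightarrow>\<^sub>E carrier Pt \<and>
   (\<forall>\<sigma>\<in>Gal. \<forall>\<tau>\<in>Gal. c (\<sigma> \<circ> \<tau>) = c \<sigma> \<otimes>\<^bsub>Pt\<^esub> (\<sigma> \<circ> c \<tau>)) \<and>
   (\<exists>Y. finite Y \<and> (\<forall>\<sigma>\<in>Gal. (\<forall>x\<in>Y. \<sigma> x = x) \<longrightarrow> c \<sigma> = \<one>\<^bsub>Pt\<^esub>))" (is "?L \<longleftrightarrow> ?R")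
proof
  assume c: ?L
  then have c': "c \<in> Gal \<rightarrow>\<^sub>E carrier Pt" by (simp add: mem_Z)
  then have sub: "c ` Gal \<subseteq> carrier Pt" by auto
  have "continuous_map (krull_topology UNIV) (discrete_topology (carrier Pt)) c"
    using c by (simp add: mem_Z)
  then have "\<exists>Y. finite Y \<and> (\<forall>\<sigma>\<in>Gal. (\<forall>x\<in>Y. \<sigma> x = id x) \<longrightarrow> c \<sigma> = c id)"
    unfolding continuous_krull_iff[OF sub] using id_in_gal by blast
  moreover have "c (\<sigma> \<circ> \<tau>) = c \<sigma> \<otimes>\<^bsub>Pt\<^esub> (\<sigma> \<circ> c \<tau>)" if "\<sigma> \<in> Gal" "\<tau> \<in> Gal" for \<sigma> \<tau>
    using Z_cocycle[OF c that] that by (simp add: gal_mult)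
  ultimately show ?R using c' by (simp add: cocycle_id[OF c])
next
  assume R: ?R
  then obtain Y where Y: "finite Y" "\<And>\<sigma>. \<sigma> \<in> Gal \<Longrightarrow> (\<forall>x\<in>Y. \<sigma> x = x) \<Longrightarrow> c \<sigma> = \<one>\<^bsub>Pt\<^esub>" by blast
  have sub: "c ` Gal \<subseteq> carrier Pt" and coc: "\<And>\<sigma> \<tau>. \<sigma> \<in> Gal \<Longrightarrow> \<tau> \<in> Gal \<Longrightarrow> c (\<sigma> \<circ> \<tau>) = c \<sigma> \<otimes>\<^bsub>Pt\<^esub> (\<sigma> \<circ> c \<tau>)"
    using R by auto
  have "continuous_map (krull_topology UNIV) (discrete_topology (carrier Pt)) c"
    unfolding continuous_krull_iff[OF sub]
  proof (intro ballI exI[of _ Y] conjI Y(1) impI)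
    fix \<sigma> \<sigma>' :: "'e alg_closure \<Rightarrow> 'e alg_closure"
    assume s: "\<sigma> \<in> Gal" "\<sigma>' \<in> Gal" and eq: "\<forall>x\<in>Y. \<sigma>' x = \<sigma> x"
    let ?u = "inv_into UNIV \<sigma> \<circ> \<sigma>'"
    have u: "?u \<in> Gal" using s by (simp add: gal_comp gal_inv)
    have "\<forall>x\<in>Y. ?u x = x" using eq s by (simp add: gal_inv_apply)
    then have "c ?u = \<one>\<^bsub>Pt\<^esub>" using Y(2) u by blast
    moreover have "\<sigma>' = \<sigma> \<circ> ?u" using s by (simp add: gal_inv_comp flip: comp_assoc)
    ultimately have "c \<sigma>' = c \<sigma> \<otimes>\<^bsub>Pt\<^esub> \<one>\<^bsub>Pt\<^esub>" using coc[OF s(1) u] point_one_fixed[OF s(1)] by simp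
    then show "c \<sigma>' = c \<sigma>" using sub s by auto
  qed
  then show ?L using R by (auto simp: mem_Z gal_mult)
qed

lemma cls_eq_iff': "c \<in> carrier Z \<Longrightarrow> d \<in> carrier Z \<Longrightarrow>
  cls c = cls d \<longleftrightarrow> (\<exists>a\<in>carrier Pt. \<forall>\<sigma>\<in>Gal. a \<otimes>\<^bsub>Pt\<^esub> c \<sigma> = d \<sigma> \<otimes>\<^bsub>Pt\<^esub> (\<sigma> \<circ> a))"
  by (rule cls_eq_iff)

end

text \<open>Restriction along an arbitrary embedding of closures. This generality is required for
  towers, as a composite of extensions chosen by \<open>ac_extension\<close> need not be the chosen
  one.\<close>

definition res_along :: "('e::field alg_closure \<Rightarrow> 'f::field alg_closure) \<Rightarrow>
    (('e alg_closure \<Rightarrow> 'e alg_closure) \<Rightarrow> ('a \<Rightarrow> 'e alg_closure)) \<Rightarrow>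
    (('f alg_closure \<Rightarrow> 'f alg_closure) \<Rightarrow> ('a \<Rightarrow> 'f alg_closure))" where
  "res_along \<tau> c = (\<lambda>\<sigma>\<in>Gal. \<tau> \<circ> c (gal_res \<tau> \<sigma>))"

lemma res_cocycle_eq: "res_cocycle e c = res_along (ac_extension e) c"
  by (simp add: res_cocycle_def res_along_def gal_res_def)

locale galois_points_res = E: galois_points \<epsilon> G gens + E': galois_points \<epsilon>' G gens'
  for \<epsilon> :: "'k::field \<Rightarrow> 'e::field" and \<epsilon>' :: "'k \<Rightarrow> 'f::field" and G :: "('k, 'a::comm_ring_1) hopf" and gens gens' +
  fixes e :: "'e \<Rightarrow> 'f" and \<tau> :: "'e alg_closure \<Rightarrow> 'f alg_closure"
  assumes \<epsilon>': "\<epsilon>' = e \<circ> \<epsilon>" and \<tau>: "ac_embedding e \<tau>"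
begin

lemma comp_closed: "\<phi> \<in> carrier E.Pt \<Longrightarrow> \<tau> \<circ> \<phi> \<in> carrier E'.Pt"
  using \<tau> by (auto simp: carrier_points_iff is_alg_hom_def \<epsilon>' ac_embedding_def ring_hom_comp)

lemma comp_mult: "\<tau> \<circ> (\<phi> \<otimes>\<^bsub>E.Pt\<^esub> \<psi>) = (\<tau> \<circ> \<phi>) \<otimes>\<^bsub>E'.Pt\<^esub> (\<tau> \<circ> \<psi>)"
  by (rule hom_comp_points_mult) (rule ac_embedding_hom[OF \<tau>])

lemma comp_one: "\<tau> \<circ> \<one>\<^bsub>E.Pt\<^esub> = \<one>\<^bsub>E'.Pt\<^esub>"
  by (auto simp: points_def \<epsilon>' ac_embedding_to_ac[OF \<tau>])

lemma gal_comp_eq: "\<sigma> \<in> Gal \<Longrightarrow> \<tau> \<circ> (gal_res \<tau> \<sigma> \<circ> \<phi>) = \<sigma> \<circ> (\<tau> \<circ> \<phi>)"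
  by (auto simp: gal_res_apply[OF \<tau>])

lemma res_along_closed:
  assumes c: "c \<in> carrier E.Z" shows "res_along \<tau> c \<in> carrier E'.Z"
  unfolding E'.mem_galZ1
proof (intro conjI ballI)
  note c' = c[unfolded E.mem_galZ1]
  note r = gal_res_in_gal[OF \<tau>]
  show "res_along \<tau> c \<in> Gal \<rightarrow>\<^sub>E carrier E'.Pt"
    unfolding res_along_def using c' r by (auto intro!: comp_closed)
  show "res_along \<tau> c (\<sigma> \<circ> \<sigma>') = res_along \<tau> c \<sigma> \<otimes>\<^bsub>E'.Pt\<^esub> (\<sigma> \<circ> res_along \<tau> c \<sigma>')"
    if "\<sigma> \<in> Gal" "\<sigma>' \<in> Gal" for \<sigma> \<sigma>'
  proof -
    have "c (gal_res \<tau> \<sigma> \<circ> gal_res \<tau> \<sigma>') = c (gal_res \<tau> \<sigma>) \<otimes>\<^bsub>E.Pt\<^esub> (gal_res \<tau> \<sigma> \<circ> c (gal_res \<tau> \<sigma>'))"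
      using c' r that by blast
    then show ?thesis
      using that by (simp add: res_along_def gal_comp gal_res_comp[OF \<tau>] comp_mult gal_comp_eq)
  qed
  obtain Y where Y: "finite Y" "\<And>\<sigma>. \<sigma> \<in> Gal \<Longrightarrow> (\<forall>x\<in>Y. \<sigma> x = x) \<Longrightarrow> c \<sigma> = \<one>\<^bsub>E.Pt\<^esub>" using c' by blast
  show "\<exists>Y. finite Y \<and> (\<forall>\<sigma>\<in>Gal. (\<forall>x\<in>Y. \<sigma> x = x) \<longrightarrow> res_along \<tau> c \<sigma> = \<one>\<^bsub>E'.Pt\<^esub>)"
  proof (intro exI[of _ "\<tau> ` Y"] conjI ballI impI)
    fix \<sigma> :: "'f alg_closure \<Rightarrow> 'f alg_closure" assume s: "\<sigma> \<in> Gal" "\<forall>x\<in>\<tau> ` Y. \<sigma> x = x"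
    have "\<forall>x\<in>Y. gal_res \<tau> \<sigma> x = x"
    proof
      fix x assume "x \<in> Y"
      then have "\<tau> (gal_res \<tau> \<sigma> x) = \<tau> x" using s by (simp add: gal_res_apply[OF \<tau>])
      then show "gal_res \<tau> \<sigma> x = x" by (simp add: ac_embedding_eq_iff[OF \<tau>])
    qed
    then have "c (gal_res \<tau> \<sigma>) = \<one>\<^bsub>E.Pt\<^esub>" using Y(2) r[OF s(1)] by blast
    then show "res_along \<tau> c \<sigma> = \<one>\<^bsub>E'.Pt\<^esub>" using s by (simp add: res_along_def comp_one)
  qed (use Y in auto)
qed

lemma res_along_cong:
  assumes c: "c \<in> carrier E.Z" and d: "d \<in> carrier E.Z" and eq: "E.cls c = E.cls d"
  shows "E'.cls (res_along \<tau> c) = E'.cls (res_along \<tau> d)"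
proof -
  obtain a where a: "a \<in> carrier E.Pt" "\<And>\<sigma>. \<sigma> \<in> Gal \<Longrightarrow> a \<otimes>\<^bsub>E.Pt\<^esub> c \<sigma> = d \<sigma> \<otimes>\<^bsub>E.Pt\<^esub> (\<sigma> \<circ> a)"
    using eq unfolding E.cls_eq_iff'[OF c d] by blast
  have "(\<tau> \<circ> a) \<otimes>\<^bsub>E'.Pt\<^esub> res_along \<tau> c \<sigma> = res_along \<tau> d \<sigma> \<otimes>\<^bsub>E'.Pt\<^esub> (\<sigma> \<circ> (\<tau> \<circ> a))" if s: "\<sigma> \<in> Gal" for \<sigma>
    using a(2)[OF gal_res_in_gal[OF \<tau> s]] s
    by (simp add: res_along_def flip: comp_mult gal_comp_eq)
  then show ?thesis
    unfolding E'.cls_eq_iff'[OF res_along_closed[OF c] res_along_closed[OF d]] using comp_closed[OF a(1)] by blast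
qed

lemma res_along_mult: "res_along \<tau> (c \<otimes>\<^bsub>E.Z\<^esub> d) = res_along \<tau> c \<otimes>\<^bsub>E'.Z\<^esub> res_along \<tau> d"
  by (auto simp: E.mult_Z E'.mult_Z res_along_def comp_mult gal_res_in_gal[OF \<tau>])

end

section \<open>Cocycles of tori\<close>

lemma is_ring_hom_of_embedding:
  assumes "ac_embedding \<epsilon> \<tau>" shows "to_ac \<circ> \<epsilon> = \<tau> \<circ> to_ac"
  using assms by (auto simp: ac_embedding_def)

context torus_splitting
begin

text \<open>The values of a point on these elements determine its values on the basis characters,
  hence the point.\<close>

definition torus_gens :: "'a set" where
  "torus_gens = (\<Union>i<n. fst ` Poly_Mapping.keys (uu (Poly_Mapping.single i 1)))"

lemma pts_eqI:
  fixes j :: "'k alg_closure \<Rightarrow> 'b::field"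
  assumes j: "is_ring_hom j" and "\<phi> \<in> pts j" "\<psi> \<in> pts j" and eq: "\<And>a. a \<in> torus_gens \<Longrightarrow> \<phi> a = \<psi> a"
  shows "\<phi> = \<psi>"
proof -
  note t = chi_thom[OF j assms(2)] chi_thom[OF j assms(3)]
  have "chi j \<phi> (Poly_Mapping.single i 1) = chi j \<psi> (Poly_Mapping.single i 1)" if "i < n" for i
    unfolding chi_def teval_feval
  proof (rule feval_cong)
    fix p assume "p \<in> Poly_Mapping.keys (uu (Poly_Mapping.single i 1))"
    then have "fst p \<in> torus_gens" unfolding torus_gens_def using that by blast
    then show "\<phi> (fst p) * j (snd p) = \<psi> (fst p) * j (snd p)" by (simp add: eq)
  qed
  note gen = this
  have "chi j \<phi> e = chi j \<psi> e" for e
  proof -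
    have "chi j \<phi> e = (\<Prod>i<n. chi j \<phi> (Poly_Mapping.single i 1) powi Poly_Mapping.lookup e i)"
      by (rule thom_eq_prod[OF t(1)])
    also have "\<dots> = (\<Prod>i<n. chi j \<psi> (Poly_Mapping.single i 1) powi Poly_Mapping.lookup e i)"
      by (rule prod.cong[OF refl]) (simp add: gen)
    also have "\<dots> = chi j \<psi> e" by (rule thom_eq_prod[OF t(2), symmetric])
    finally show ?thesis .
  qed
  then have "chi j \<phi> = chi j \<psi>" by auto
  then show ?thesis using pt_chi[OF j assms(2)] pt_chi[OF j assms(3)] by metis
qed

text \<open>\<open>act \<rho>\<close> reaches every truncated exponent, so a comparison at arguments
  \<open>act \<rho> e\<close>, where cocycle identities are available, is enough.\<close>

lemma act_surj: "\<rho> \<in> Gal \<Longrightarrow> thom n h \<Longrightarrow> thom n h' \<Longrightarrow> (\<And>e. h (act \<rho> e) = h' (act \<rho> e)) \<Longrightarrow> h = h'"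
proof
  fix e assume \<rho>: "\<rho> \<in> Gal" and h: "thom n h" "thom n h'" and eq: "\<And>e. h (act \<rho> e) = h' (act \<rho> e)"
  have "h (trunc n e) = h' (trunc n e)" using eq[of "act (inv_into UNIV \<rho>) e"] unfolding act_inv(1)[OF \<rho>] .
  then show "h e = h' e" using h by (simp add: thom_trunc)
qed

context
  fixes \<epsilon> :: "'k \<Rightarrow> 'e::field" and \<tau> :: "'k alg_closure \<Rightarrow> 'e alg_closure"
  assumes \<tau>: "ac_embedding \<epsilon> \<tau>"
begin

lemma \<tau>_hom: "is_ring_hom \<tau>" using \<tau> by (rule ac_embedding_hom)

lemma \<tau>_to_ac: "to_ac \<circ> \<epsilon> = \<tau> \<circ> to_ac" using \<tau> by (rule is_ring_hom_of_embedding)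

lemma torus_galois_points: "galois_points \<epsilon> G torus_gens"
proof (rule galois_points.intro)
  show "comm_group (points G (to_ac \<circ> \<epsilon>))"
    unfolding \<tau>_to_ac by (rule points_comm_group[OF \<tau>_hom])
  show "finite torus_gens" by (auto simp: torus_gens_def)
  fix \<phi> \<psi> assume "\<phi> \<in> carrier (points G (to_ac \<circ> \<epsilon>))" "\<psi> \<in> carrier (points G (to_ac \<circ> \<epsilon>))"
    and eq: "\<And>a. a \<in> torus_gens \<Longrightarrow> \<phi> a = \<psi> a"
  then have "\<phi> \<in> pts \<tau>" "\<psi> \<in> pts \<tau>" unfolding \<tau>_to_ac carrier_points[OF \<tau>_hom] by auto
  then show "\<phi> = \<psi>" using eq by (rule pts_eqI[OF \<tau>_hom])
qed

interpretation galois_points \<epsilon> G torus_gens by (rule torus_galois_points)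

text \<open>The cocycle condition read on characters. At the exponent
  \<open>act (gal_res \<tau> \<sigma>) e\<close> the right-hand side contains
  \<open>f \<sigma>' e\<close> itself, without an inverse action on exponents.\<close>

definition lattice_cocycle :: "(('e alg_closure \<Rightarrow> 'e alg_closure) \<Rightarrow> (nat \<Rightarrow>\<^sub>0 int) \<Rightarrow> 'e alg_closure) \<Rightarrow> bool" where
  "lattice_cocycle f \<longleftrightarrow> (\<forall>\<sigma>\<in>Gal. thom n (f \<sigma>)) \<and>
    (\<forall>\<sigma>\<in>Gal. \<forall>\<sigma>'\<in>Gal. \<forall>e. f (\<sigma> \<circ> \<sigma>') (act (gal_res \<tau> \<sigma>) e) = f \<sigma> (act (gal_res \<tau> \<sigma>) e) * \<sigma> (f \<sigma>' e)) \<and>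
    (\<exists>Y. finite Y \<and> (\<forall>\<sigma>\<in>Gal. (\<forall>x\<in>Y. \<sigma> x = x) \<longrightarrow> (\<forall>e. f \<sigma> e = 1)))"

lemma Pt_carrier: "carrier Pt = pts \<tau>" and Pt_mult: "pt \<tau> h \<otimes>\<^bsub>Pt\<^esub> pt \<tau> h' = pt \<tau> (\<lambda>e. h e * h' e)"
  and Pt_one: "\<one>\<^bsub>Pt\<^esub> = pt \<tau> (\<lambda>_. 1)"
  unfolding \<tau>_to_ac by (rule carrier_points[OF \<tau>_hom] points_mult_pt[OF \<tau>_hom] one_point[OF \<tau>_hom])+

lemma chi_gal:
  assumes s: "\<sigma> \<in> Gal" and "\<phi> \<in> pts \<tau>"
  shows "chi \<tau> (\<sigma> \<circ> \<phi>) (act (gal_res \<tau> \<sigma>) e) = \<sigma> (chi \<tau> \<phi> e)"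
  by (rule chi_galois[OF gal_hom[OF s] \<tau>_hom \<tau>_hom gal_res_in_gal[OF \<tau> s] _ assms(2)])
    (simp add: gal_res_apply[OF \<tau> s])

lemma chi_mult: assumes "\<phi> \<in> pts \<tau>" "\<psi> \<in> pts \<tau>" shows "chi \<tau> (\<phi> \<otimes>\<^bsub>Pt\<^esub> \<psi>) e = chi \<tau> \<phi> e * chi \<tau> \<psi> e"
proof -
  obtain h h' where h: "thom n h" "\<phi> = pt \<tau> h" "thom n h'" "\<psi> = pt \<tau> h'"
    using assms unfolding pts_conv[OF \<tau>_hom] by blast
  show ?thesis unfolding h Pt_mult by (simp add: chi_pt[OF \<tau>_hom] thom_mult h)
qed

lemma chi_inj: "\<phi> \<in> pts \<tau> \<Longrightarrow> \<psi> \<in> pts \<tau> \<Longrightarrow> chi \<tau> \<phi> = chi \<tau> \<psi> \<Longrightarrow> \<phi> = \<psi>"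
  using pt_chi[OF \<tau>_hom] by metis

lemma chi_eq_one_iff: "\<phi> \<in> pts \<tau> \<Longrightarrow> (\<forall>e. chi \<tau> \<phi> e = 1) \<longleftrightarrow> \<phi> = \<one>\<^bsub>Pt\<^esub>"
proof
  assume p: "\<phi> \<in> pts \<tau>"
  show "\<forall>e. chi \<tau> \<phi> e = 1" if "\<phi> = \<one>\<^bsub>Pt\<^esub>" using that by (simp add: Pt_one chi_pt[OF \<tau>_hom] thom_one)
  assume "\<forall>e. chi \<tau> \<phi> e = 1"
  then have "chi \<tau> \<phi> = (\<lambda>_. 1)" by auto
  then show "\<phi> = \<one>\<^bsub>Pt\<^esub>" using pt_chi[OF \<tau>_hom p] by (simp add: Pt_one)
qed

lemma act_eq_iff_chi:
  assumes s: "\<sigma> \<in> Gal" and p: "\<phi> \<in> pts \<tau>" "\<psi> \<in> pts \<tau>"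
  shows "\<phi> = \<psi> \<longleftrightarrow> (\<forall>e. chi \<tau> \<phi> (act (gal_res \<tau> \<sigma>) e) = chi \<tau> \<psi> (act (gal_res \<tau> \<sigma>) e))"
  using act_surj[OF gal_res_in_gal[OF \<tau> s] chi_thom[OF \<tau>_hom p(1)] chi_thom[OF \<tau>_hom p(2)]] chi_inj[OF p] by blast

lemma gal_pts: "\<sigma> \<in> Gal \<Longrightarrow> \<phi> \<in> pts \<tau> \<Longrightarrow> \<sigma> \<circ> \<phi> \<in> pts \<tau>"
  using gal_comp_point[of \<sigma> \<phi> G \<epsilon>] by (simp add: Pt_carrier)

lemma mult_pts: "\<phi> \<in> pts \<tau> \<Longrightarrow> \<psi> \<in> pts \<tau> \<Longrightarrow> \<phi> \<otimes>\<^bsub>Pt\<^esub> \<psi> \<in> pts \<tau>"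
  using A.m_closed[of \<phi> \<psi>] by (simp add: Pt_carrier)

lemma cocycle_lattice:
  assumes c: "c \<in> carrier Z" shows "lattice_cocycle (\<lambda>\<sigma>. chi \<tau> (c \<sigma>))"
  unfolding lattice_cocycle_def
proof (intro conjI ballI allI)
  have cp: "c \<sigma> \<in> pts \<tau>" if "\<sigma> \<in> Gal" for \<sigma> using Z_closed[OF c that] by (simp add: Pt_carrier)
  show "thom n (chi \<tau> (c \<sigma>))" if "\<sigma> \<in> Gal" for \<sigma> using chi_thom[OF \<tau>_hom cp[OF that]] .
  show "chi \<tau> (c (\<sigma> \<circ> \<sigma>')) (act (gal_res \<tau> \<sigma>) e) = chi \<tau> (c \<sigma>) (act (gal_res \<tau> \<sigma>) e) * \<sigma> (chi \<tau> (c \<sigma>') e)"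
    if "\<sigma> \<in> Gal" "\<sigma>' \<in> Gal" for \<sigma> \<sigma>' e
  proof -
    have "c (\<sigma> \<circ> \<sigma>') = c \<sigma> \<otimes>\<^bsub>Pt\<^esub> (\<sigma> \<circ> c \<sigma>')" using c that unfolding mem_galZ1 by blast
    then show ?thesis using that by (simp add: chi_mult cp gal_pts chi_gal)
  qed
  obtain Y where Y: "finite Y" "\<And>\<sigma>. \<sigma> \<in> Gal \<Longrightarrow> (\<forall>x\<in>Y. \<sigma> x = x) \<Longrightarrow> c \<sigma> = \<one>\<^bsub>Pt\<^esub>"
    using c unfolding mem_galZ1 by blast
  then show "\<exists>Y. finite Y \<and> (\<forall>\<sigma>\<in>Gal. (\<forall>x\<in>Y. \<sigma> x = x) \<longrightarrow> (\<forall>e. chi \<tau> (c \<sigma>) e = 1))"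
    using cp chi_eq_one_iff by blast
qed

lemma lattice_cocycle_cocycle:
  assumes f: "lattice_cocycle f" shows "(\<lambda>\<sigma>\<in>Gal. pt \<tau> (f \<sigma>)) \<in> carrier Z"
  unfolding mem_galZ1
proof (intro conjI ballI)
  have th: "thom n (f \<sigma>)" if "\<sigma> \<in> Gal" for \<sigma> using f that by (auto simp: lattice_cocycle_def)
  have p: "pt \<tau> (f \<sigma>) \<in> pts \<tau>" if "\<sigma> \<in> Gal" for \<sigma> by (rule pt_in[OF \<tau>_hom th[OF that]])
  show "(\<lambda>\<sigma>\<in>Gal. pt \<tau> (f \<sigma>)) \<in> Gal \<rightarrow>\<^sub>E carrier Pt" using p by (auto simp: Pt_carrier)
  show "(\<lambda>\<sigma>\<in>Gal. pt \<tau> (f \<sigma>)) (\<sigma> \<circ> \<sigma>') = (\<lambda>\<sigma>\<in>Gal. pt \<tau> (f \<sigma>)) \<sigma> \<otimes>\<^bsub>Pt\<^esub> (\<sigma> \<circ> (\<lambda>\<sigma>\<in>Gal. pt \<tau> (f \<sigma>)) \<sigma>')"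
    if s: "\<sigma> \<in> Gal" "\<sigma>' \<in> Gal" for \<sigma> \<sigma>'
  proof -
    have "pt \<tau> (f (\<sigma> \<circ> \<sigma>')) = pt \<tau> (f \<sigma>) \<otimes>\<^bsub>Pt\<^esub> (\<sigma> \<circ> pt \<tau> (f \<sigma>'))"
      unfolding act_eq_iff_chi[OF s(1) p[OF gal_comp[OF s]] mult_pts[OF p[OF s(1)] gal_pts[OF s(1) p[OF s(2)]]]]
      using f s by (simp add: chi_mult p gal_pts chi_gal chi_pt[OF \<tau>_hom] th gal_comp lattice_cocycle_def)
    then show ?thesis using s by (simp add: gal_comp)
  qed
  obtain Y where Y: "finite Y" "\<And>\<sigma>. \<sigma> \<in> Gal \<Longrightarrow> (\<forall>x\<in>Y. \<sigma> x = x) \<Longrightarrow> (\<forall>e. f \<sigma> e = 1)"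
    using f unfolding lattice_cocycle_def by blast
  have "pt \<tau> (f \<sigma>) = \<one>\<^bsub>Pt\<^esub>" if "\<sigma> \<in> Gal" "\<forall>x\<in>Y. \<sigma> x = x" for \<sigma>
    using Y(2)[OF that] chi_eq_one_iff[OF p[OF that(1)]] by (simp add: chi_pt[OF \<tau>_hom] th that)
  then show "\<exists>Y. finite Y \<and> (\<forall>\<sigma>\<in>Gal. (\<forall>x\<in>Y. \<sigma> x = x) \<longrightarrow> (\<lambda>\<sigma>\<in>Gal. pt \<tau> (f \<sigma>)) \<sigma> = \<one>\<^bsub>Pt\<^esub>)"
    using Y(1) by auto
qed

lemma cls_eq_iff_lattice:
  assumes c: "c \<in> carrier Z" and d: "d \<in> carrier Z"
  shows "cls c = cls d \<longleftrightarrow> (\<exists>h. thom n h \<and> (\<forall>\<sigma>\<in>Gal. \<forall>e.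
    h (act (gal_res \<tau> \<sigma>) e) * chi \<tau> (c \<sigma>) (act (gal_res \<tau> \<sigma>) e) = chi \<tau> (d \<sigma>) (act (gal_res \<tau> \<sigma>) e) * \<sigma> (h e)))"
proof -
  have cp: "c \<sigma> \<in> pts \<tau>" "d \<sigma> \<in> pts \<tau>" if "\<sigma> \<in> Gal" for \<sigma>
    using Z_closed[OF c that] Z_closed[OF d that] by (simp_all add: Pt_carrier)
  have eq: "pt \<tau> h \<otimes>\<^bsub>Pt\<^esub> c \<sigma> = d \<sigma> \<otimes>\<^bsub>Pt\<^esub> (\<sigma> \<circ> pt \<tau> h) \<longleftrightarrow> (\<forall>e.
    h (act (gal_res \<tau> \<sigma>) e) * chi \<tau> (c \<sigma>) (act (gal_res \<tau> \<sigma>) e) = chi \<tau> (d \<sigma>) (act (gal_res \<tau> \<sigma>) e) * \<sigma> (h e))"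
    if s: "\<sigma> \<in> Gal" and h: "thom n h" for h \<sigma>
  proof -
    have p: "pt \<tau> h \<in> pts \<tau>" by (rule pt_in[OF \<tau>_hom h])
    show ?thesis
      unfolding act_eq_iff_chi[OF s mult_pts[OF p cp(1)[OF s]] mult_pts[OF cp(2)[OF s] gal_pts[OF s p]]]
      using s by (simp add: chi_mult p cp gal_pts chi_gal chi_pt[OF \<tau>_hom h])
  qed
  have "cls c = cls d \<longleftrightarrow> (\<exists>h. thom n h \<and> (\<forall>\<sigma>\<in>Gal. pt \<tau> h \<otimes>\<^bsub>Pt\<^esub> c \<sigma> = d \<sigma> \<otimes>\<^bsub>Pt\<^esub> (\<sigma> \<circ> pt \<tau> h)))"
    unfolding cls_eq_iff'[OF c d] Pt_carrier Bex_def pts_conv[OF \<tau>_hom] by blast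
  then show ?thesis using eq by (simp cong: conj_cong)
qed

end

end

section \<open>Laurent series over the algebraic closure\<close>

definition map_fls :: "('a::field \<Rightarrow> 'b::field) \<Rightarrow> 'a fls \<Rightarrow> 'b fls" where
  "map_fls \<rho> f = Abs_fls (\<lambda>n. \<rho> (fls_nth f n))"

definition fls_lead :: "'a::field fls \<Rightarrow> 'a" where
  "fls_lead f = fls_nth f (fls_subdegree f)"

lemma fls_lead_mult: "fls_lead (f * g) = fls_lead f * fls_lead g"
  by (cases "f = 0 \<or> g = 0") (auto simp: fls_lead_def)

lemma fls_lead_const: "fls_lead (fls_const c) = c"
  by (simp add: fls_lead_def)

context
  fixes \<rho> :: "'a::field \<Rightarrow> 'b::field"
  assumes \<rho>: "is_ring_hom \<rho>"
begin

lemma nth_map_fls: "fls_nth (map_fls \<rho> f) n = \<rho> (fls_nth f n)"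
  unfolding map_fls_def
  by (rule nth_Abs_fls_ex_lower_bound) (auto simp: ring_hom_0[OF \<rho>] intro!: exI[of _ "fls_subdegree f"])

lemma map_fls_eq_0: "map_fls \<rho> f = 0 \<longleftrightarrow> f = 0"
proof
  assume "map_fls \<rho> f = 0"
  then have "\<rho> (fls_nth f n) = 0" for n using nth_map_fls[of f n] by simp
  then show "f = 0" by (intro fls_eqI) (simp add: ring_hom_eq_0_iff[OF \<rho>])
next
  assume "f = 0" then show "map_fls \<rho> f = 0" by (intro fls_eqI) (simp add: nth_map_fls ring_hom_0[OF \<rho>])
qed

lemma subdegree_map_fls: "fls_subdegree (map_fls \<rho> f) = fls_subdegree f"
proof (cases "f = 0")
  case False
  then show ?thesis
    by (intro fls_subdegree_eqI) (auto simp: nth_map_fls ring_hom_eq_0_iff[OF \<rho>] ring_hom_0[OF \<rho>])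
next
  case True then show ?thesis using map_fls_eq_0[of f] by simp
qed

lemma map_fls_hom: "is_ring_hom (map_fls \<rho>)"
  unfolding is_ring_hom_def
proof (intro conjI allI; rule fls_eqI)
  fix f g :: "'a fls" and n
  show "fls_nth (map_fls \<rho> 1) n = fls_nth 1 n" by (simp add: nth_map_fls ring_hom_0 ring_hom_1 \<rho>)
  show "fls_nth (map_fls \<rho> (f + g)) n = fls_nth (map_fls \<rho> f + map_fls \<rho> g) n"
    by (simp add: nth_map_fls ring_hom_add \<rho>)
  show "fls_nth (map_fls \<rho> (f * g)) n = fls_nth (map_fls \<rho> f * map_fls \<rho> g) n"
    by (simp add: nth_map_fls fls_times_nth(2) subdegree_map_fls ring_hom_sum ring_hom_mult \<rho>)
qed

lemma fls_lead_map: "fls_lead (map_fls \<rho> f) = \<rho> (fls_lead f)"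
  by (simp add: fls_lead_def nth_map_fls subdegree_map_fls)

lemma map_fls_const: "map_fls \<rho> (fls_const c) = fls_const (\<rho> c)"
  by (rule fls_eqI) (simp add: nth_map_fls ring_hom_0[OF \<rho>])

end

lemma map_fls_comp:
  "is_ring_hom \<rho> \<Longrightarrow> is_ring_hom \<rho>' \<Longrightarrow> map_fls \<rho> (map_fls \<rho>' f) = map_fls (\<rho> \<circ> \<rho>') f"
  by (rule fls_eqI) (simp add: nth_map_fls ring_hom_comp)

lemma fls_const_hom: "is_ring_hom fls_const"
  by (simp add: is_ring_hom_def fls_plus_const fls_const_mult_const)

text \<open>The leading coefficient of a Laurent series retracts \<open>S\<^sup>\<times>\<close> onto the constants; here \<open>S\<close>
  consists of the elements of the algebraic closure of \<open>k((t))\<close> that are Laurent series over the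
  algebraic closure of \<open>k\<close>.\<close>

theorem leading_coefficient_retraction:
  fixes \<tau> :: "'k::field alg_closure \<Rightarrow> 'k fls alg_closure"
  assumes \<tau>: "ac_embedding fls_const \<tau>"
  shows "\<exists>S lc. intermediate S \<and> (\<forall>x. \<tau> x \<in> S \<and> lc (\<tau> x) = x) \<and>
    (\<forall>x\<in>S. \<forall>y\<in>S. lc (x * y) = lc x * lc y) \<and>
    (\<forall>\<rho>\<in>Gal. \<exists>\<sigma>\<in>Gal. gal_res \<tau> \<sigma> = \<rho> \<and> (\<forall>x\<in>S. lc (\<sigma> x) = \<rho> (lc x)))"
proof -
  let ?C = "\<lambda>f :: 'k fls. to_ac (map_fls to_ac f) :: 'k alg_closure fls alg_closure"
  let ?h0 = "\<lambda>x :: 'k alg_closure. to_ac (fls_const x) :: 'k alg_closure fls alg_closure"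
  have C: "is_ring_hom ?C"
    using ring_hom_comp[OF ring_hom_to_ac map_fls_hom[OF ring_hom_to_ac]] by (simp add: comp_def)
  have h0: "is_ring_hom ?h0"
    using ring_hom_comp[OF ring_hom_to_ac fls_const_hom] by (simp add: comp_def)
  \<comment> \<open>The constants and the closure of \<open>k((t))\<close> are compared inside the
    closure of the Laurent series field over the constants; \<open>g0\<close> embeds the latter of
    the two.\<close>
  obtain g0 where g0: "is_ring_hom g0" "\<And>f. g0 (to_ac f) = ?C f"
    using ac_embedding_exists[OF C] by blast
  have "\<exists>\<rho>'. is_ring_hom \<rho>' \<and> (\<forall>f. \<rho>' (to_ac f) = (to_ac (map_fls \<rho> f) :: 'k alg_closure fls alg_closure))"
    if "\<rho> \<in> Gal" for \<rho> :: "'k alg_closure \<Rightarrow> 'k alg_closure"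
    using ac_embedding_exists[OF ring_hom_comp[OF ring_hom_to_ac map_fls_hom[OF gal_hom[OF that]]]] by simp
  then obtain ext where ext: "\<And>\<rho>. \<rho> \<in> Gal \<Longrightarrow> is_ring_hom (ext \<rho>)"
    "\<And>\<rho> f. \<rho> \<in> Gal \<Longrightarrow> ext \<rho> (to_ac f) = (to_ac (map_fls \<rho> f) :: 'k alg_closure fls alg_closure)"
    by metis
  have extC: "ext \<rho> (?C f) = ?C f" if "\<rho> \<in> Gal" for \<rho> f
  proof -
    have "\<rho> \<circ> to_ac = to_ac" using gal_to_ac[OF that] by auto
    then show ?thesis by (simp add: ext that map_fls_comp gal_hom ring_hom_to_ac)
  qed
  have "\<exists>\<mu>\<in>Gal. \<forall>x. (g0 \<circ> \<tau>) x = ?h0 (\<mu> x)"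
  proof (rule homs_conjugate[OF ring_hom_comp[OF g0(1) ac_embedding_hom[OF \<tau>]] h0])
    show "(g0 \<circ> \<tau>) (to_ac c) = ?h0 (to_ac c)" for c
      by (simp add: ac_embedding_to_ac[OF \<tau>] g0 map_fls_const[OF ring_hom_to_ac])
  qed
  then obtain \<mu> where \<mu>: "\<mu> \<in> Gal" "\<And>x. g0 (\<tau> x) = ?h0 (\<mu> x)" by auto
  \<comment> \<open>On the constants, \<open>g0\<close> agrees with the standard embedding only up
    to \<open>\<mu>\<close>; composing with an extension of the action of the inverse of
    \<open>\<mu>\<close> on coefficients repairs this.\<close>
  define g where "g = ext (inv_into UNIV \<mu>) \<circ> g0"
  have i: "inv_into UNIV \<mu> \<in> Gal" using \<mu>(1) by (rule gal_inv)
  have g: "is_ring_hom g" unfolding g_def by (rule ring_hom_comp[OF ext(1)[OF i] g0(1)])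
  have g\<tau>: "g (\<tau> x) = ?h0 x" for x
    by (simp add: g_def \<mu> ext i map_fls_const gal_hom gal_inv_apply)
  have gC: "g (to_ac f) = ?C f" for f by (simp add: g_def g0 extC i)
  have g_inj: "g x = g y \<Longrightarrow> x = y" for x y using ring_hom_inj[OF g] by (rule injD)
  define S where "S = {x. g x \<in> range to_ac}"
  define lc where "lc x = fls_lead (of_ac (g x))" for x
  have SE: "\<exists>f. g x = to_ac f" if "x \<in> S" for x using that by (auto simp: S_def)
  have SI: "g x = to_ac f \<Longrightarrow> x \<in> S" for x f by (auto simp: S_def)
  have "intermediate S"
    unfolding intermediate_def
  proof (intro conjI ballI subsetI)
    fix x :: "'k fls alg_closure" assume "x \<in> range to_ac"
    then show "x \<in> S" using gC SI by blast
  next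
    fix x y assume "x \<in> S" "y \<in> S"
    then obtain a b where ab: "g x = to_ac a" "g y = to_ac b" using SE by meson
    show "x + y \<in> S" by (rule SI[of _ "a + b"]) (simp add: ring_hom_add[OF g] ab)
    show "x * y \<in> S" by (rule SI[of _ "a * b"]) (simp add: ring_hom_mult[OF g] ab)
  qed
  moreover have "\<tau> x \<in> S \<and> lc (\<tau> x) = x" for x
    using SI[OF g\<tau>] by (simp add: lc_def g\<tau> fls_lead_const)
  moreover have "lc (x * y) = lc x * lc y" if "x \<in> S" "y \<in> S" for x y
  proof -
    obtain a b where ab: "g x = to_ac a" "g y = to_ac b" using SE \<open>x \<in> S\<close> \<open>y \<in> S\<close> by meson
    then have "g (x * y) = to_ac (a * b)" by (simp add: ring_hom_mult[OF g])
    then show ?thesis using ab by (simp add: lc_def fls_lead_mult del: to_ac_mult)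
  qed
  moreover have "\<exists>\<sigma>\<in>Gal. gal_res \<tau> \<sigma> = \<rho> \<and> (\<forall>x\<in>S. lc (\<sigma> x) = \<rho> (lc x))" if \<rho>: "\<rho> \<in> Gal" for \<rho>
  proof -
    \<comment> \<open>Letting \<open>\<rho>\<close> act on coefficients and pulling this action back
      through \<open>g\<close> provides the lift.\<close>
    have "\<exists>\<sigma>\<in>Gal. \<forall>x. (ext \<rho> \<circ> g) x = g (\<sigma> x)"
      by (rule homs_conjugate[OF ring_hom_comp[OF ext(1)[OF \<rho>] g] g]) (simp add: gC extC \<rho>)
    then obtain \<sigma> where \<sigma>: "\<sigma> \<in> Gal" "\<And>x. g (\<sigma> x) = ext \<rho> (g x)" by auto
    have "\<sigma> (\<tau> x) = \<tau> (\<rho> x)" for x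
      by (rule g_inj) (simp add: \<sigma> g\<tau> ext \<rho> map_fls_const gal_hom)
    then have "gal_res \<tau> \<sigma> = \<rho>" by (rule gal_res_eqI[OF \<tau>])
    moreover have "lc (\<sigma> x) = \<rho> (lc x)" if "x \<in> S" for x
    proof -
      obtain a where "g x = to_ac a" using SE \<open>x \<in> S\<close> by meson
      then show ?thesis by (simp add: lc_def \<sigma> ext \<rho> fls_lead_map gal_hom)
    qed
    ultimately show ?thesis using \<sigma>(1) by blast
  qed
  ultimately show ?thesis by (intro exI[of _ S] exI[of _ lc]) blast
qed

lemma gal_res_surj_fls:
  assumes "ac_embedding fls_const \<tau>" "\<rho> \<in> Gal"
  shows "\<exists>\<sigma>\<in>Gal. gal_res \<tau> \<sigma> = \<rho>"
  using leading_coefficient_retraction[OF assms(1)] assms(2) by blast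

lemma ac_embedding_id: "ac_embedding id id"
  by (simp add: ac_embedding_def ring_hom_id)

lemma gal_res_id_embedding: "gal_res id \<sigma> = \<sigma>"
  by (simp add: gal_res_def)

context torus_splitting
begin

text \<open>An automorphism fixing \<open>S\<close> restricts to the identity on the constants,
  where both cocycles are neutral; so it fixes the splitting \<open>h\<close>, whose values lie in
  \<open>S\<close> by \<open>fixed_field\<close>. The leading coefficients of these values then
  relate \<open>a\<close> and \<open>b\<close> already over \<open>k\<close>.\<close>

theorem inflation_injective:
  fixes \<tau> :: "'k alg_closure \<Rightarrow> 'k fls alg_closure"
  assumes \<tau>: "ac_embedding fls_const \<tau>"
    and a: "a \<in> carrier (galZ1 id G)" and b: "b \<in> carrier (galZ1 id G)"
    and eq: "galB1 fls_const G #>\<^bsub>galZ1 fls_const G\<^esub> res_along \<tau> a = galB1 fls_const G #>\<^bsub>galZ1 fls_const G\<^esub> res_along \<tau> b"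
  shows "galB1 id G #>\<^bsub>galZ1 id G\<^esub> a = galB1 id G #>\<^bsub>galZ1 id G\<^esub> b"
proof -
  interpret k: galois_points "id :: 'k \<Rightarrow> 'k" G torus_gens by (rule torus_galois_points[OF ac_embedding_id])
  interpret E: galois_points fls_const G torus_gens by (rule torus_galois_points[OF \<tau>])
  interpret r: galois_points_res id fls_const G torus_gens torus_gens fls_const \<tau>
    by standard (auto simp: \<tau>)
  note [simp] = gal_res_id_embedding
  have a': "a \<in> carrier k.Z" and b': "b \<in> carrier k.Z" using a b by (simp_all add: k.galZ1_eq)
  define \<alpha> where "\<alpha> \<rho> = chi id (a \<rho>)" for \<rho>
  define \<beta> where "\<beta> \<rho> = chi id (b \<rho>)" for \<rho>
  have chi: "chi \<tau> (res_along \<tau> a \<sigma>) e = \<tau> (\<alpha> (gal_res \<tau> \<sigma>) e)" "chi \<tau> (res_along \<tau> b \<sigma>) e = \<tau> (\<beta> (gal_res \<tau> \<sigma>) e)"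
    if "\<sigma> \<in> Gal" for \<sigma> e
    using that chi_hom[OF ac_embedding_hom[OF \<tau>], of id] by (simp_all add: res_along_def \<alpha>_def \<beta>_def)
  have "E.cls (res_along \<tau> a) = E.cls (res_along \<tau> b)"
    using eq by (simp add: E.galZ1_eq E.galB1_eq)
  then obtain h where h: "thom n h" and heq: "\<And>\<sigma> e. \<sigma> \<in> Gal \<Longrightarrow>
    h (act (gal_res \<tau> \<sigma>) e) * \<tau> (\<alpha> (gal_res \<tau> \<sigma>) (act (gal_res \<tau> \<sigma>) e)) = \<tau> (\<beta> (gal_res \<tau> \<sigma>) (act (gal_res \<tau> \<sigma>) e)) * \<sigma> (h e)"
    unfolding cls_eq_iff_lattice[OF \<tau> r.res_along_closed[OF a'] r.res_along_closed[OF b']] by (auto simp: chi)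
  obtain S lc where S: "intermediate S" and lc: "\<And>x. \<tau> x \<in> S" "\<And>x. lc (\<tau> x) = x"
    "\<And>x y. x \<in> S \<Longrightarrow> y \<in> S \<Longrightarrow> lc (x * y) = lc x * lc y"
    and lift: "\<And>\<rho>. \<rho> \<in> Gal \<Longrightarrow> \<exists>\<sigma>\<in>Gal. gal_res \<tau> \<sigma> = \<rho> \<and> (\<forall>x\<in>S. lc (\<sigma> x) = \<rho> (lc x))"
    using leading_coefficient_retraction[OF \<tau>] by metis
  have one: "chi id \<phi> e = 1" if "\<phi> = \<one>\<^bsub>k.Pt\<^esub>" for \<phi> e
  proof -
    have "\<one>\<^bsub>k.Pt\<^esub> \<in> pts id" using k.A.one_closed Pt_carrier[OF ac_embedding_id] by blast
    then show ?thesis using chi_eq_one_iff[OF ac_embedding_id] that by blast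
  qed
  have hS: "h e \<in> S" for e
  proof (rule fixed_field[OF S])
    fix \<sigma> :: "'k fls alg_closure \<Rightarrow> 'k fls alg_closure" assume s: "\<sigma> \<in> Gal" "\<forall>x\<in>S. \<sigma> x = x"
    have r: "gal_res \<tau> \<sigma> = id" by (rule gal_res_eqI[OF \<tau>]) (use s lc in auto)
    have ab: "a id = \<one>\<^bsub>k.Pt\<^esub>" "b id = \<one>\<^bsub>k.Pt\<^esub>" by (rule k.cocycle_id[OF a'], rule k.cocycle_id[OF b'])
    have "\<alpha> id d = 1" "\<beta> id d = 1" for d
      unfolding \<alpha>_def \<beta>_def by (rule one[OF ab(1)], rule one[OF ab(2)])
    then have "h (act id e) = \<sigma> (h e)"
      using heq[OF s(1), of e] by (simp add: r ring_hom_1 ac_embedding_hom[OF \<tau>])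
    then show "\<sigma> (h e) = h e" by (simp add: act_id thom_trunc[OF h])
  qed
  have "lc 1 = 1" using lc(2)[of 1] by (simp add: ring_hom_1 ac_embedding_hom[OF \<tau>])
  then have th: "thom n (\<lambda>e. lc (h e))"
    using h hS by (simp add: thom_def lc(3))
  have "lc (h (act \<rho> e)) * \<alpha> \<rho> (act \<rho> e) = \<beta> \<rho> (act \<rho> e) * \<rho> (lc (h e))" if \<rho>: "\<rho> \<in> Gal" for \<rho> e
  proof -
    obtain \<sigma> where \<sigma>: "\<sigma> \<in> Gal" "gal_res \<tau> \<sigma> = \<rho>" "\<And>x. x \<in> S \<Longrightarrow> lc (\<sigma> x) = \<rho> (lc x)"
      using lift[OF \<rho>] by blast
    have eq: "h (act \<rho> e) * \<tau> (\<alpha> \<rho> (act \<rho> e)) = \<tau> (\<beta> \<rho> (act \<rho> e)) * \<sigma> (h e)"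
      using heq[OF \<sigma>(1), of e] by (simp add: \<sigma>(2))
    have nz: "\<tau> (\<beta> \<rho> (act \<rho> e)) \<noteq> 0"
    proof -
      have "b \<rho> \<in> pts id" using k.Z_closed[OF b' \<rho>] Pt_carrier[OF ac_embedding_id] by simp
      from thom_nonzero[OF chi_thom[OF ring_hom_id(1) this], of "act \<rho> e"]
      show ?thesis by (simp add: \<beta>_def ring_hom_eq_0_iff ac_embedding_hom[OF \<tau>])
    qed
    have "\<sigma> (h e) = h (act \<rho> e) * \<tau> (\<alpha> \<rho> (act \<rho> e)) / \<tau> (\<beta> \<rho> (act \<rho> e))"
      using eq nz by (simp add: field_simps)
    then have "\<sigma> (h e) \<in> S" using S hS lc(1) by (simp add: intermediate_divide intermediate_mult)
    then have "lc (h (act \<rho> e)) * lc (\<tau> (\<alpha> \<rho> (act \<rho> e))) = lc (\<tau> (\<beta> \<rho> (act \<rho> e))) * lc (\<sigma> (h e))"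
      using eq hS lc(1) by (simp flip: lc(3))
    then show ?thesis by (simp add: lc(2) \<sigma>(3) hS)
  qed
  then have "k.cls a = k.cls b"
    unfolding cls_eq_iff_lattice[OF ac_embedding_id a' b'] using th by (auto simp: \<alpha>_def \<beta>_def)
  then show ?thesis by (simp add: k.galZ1_eq k.galB1_eq)
qed

text \<open>The point with character values \<open>h\<close> provides the coboundary. This is the
  normalisation step that \<open>ratfun_class_constant\<close> performs twice.\<close>

lemma coboundary_modify:
  fixes \<epsilon> :: "'k \<Rightarrow> 'e::field" and \<tau> :: "'k alg_closure \<Rightarrow> 'e alg_closure"
  assumes \<tau>: "ac_embedding \<epsilon> \<tau>" and c: "c \<in> carrier (galZ1 \<epsilon> G)" and h: "thom n h"
  shows "\<exists>c'\<in>carrier (galZ1 \<epsilon> G). galB1 \<epsilon> G #>\<^bsub>galZ1 \<epsilon> G\<^esub> c' = galB1 \<epsilon> G #>\<^bsub>galZ1 \<epsilon> G\<^esub> c \<and>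
    (\<forall>\<sigma>\<in>Gal. \<forall>e. h (act (gal_res \<tau> \<sigma>) e) * chi \<tau> (c' \<sigma>) (act (gal_res \<tau> \<sigma>) e) =
       chi \<tau> (c \<sigma>) (act (gal_res \<tau> \<sigma>) e) * \<sigma> (h e))"
proof -
  interpret E: galois_points \<epsilon> G torus_gens by (rule torus_galois_points[OF \<tau>])
  have c': "c \<in> carrier E.Z" using c by (simp add: E.galZ1_eq)
  have \<tau>h: "is_ring_hom \<tau>" by (rule ac_embedding_hom[OF \<tau>])
  define a where "a = pt \<tau> h"
  have ap: "a \<in> pts \<tau>" unfolding a_def by (rule pt_in[OF \<tau>h h])
  then have a: "a \<in> carrier E.Pt" by (simp add: Pt_carrier[OF \<tau>])
  define b where "b = (\<lambda>\<sigma>\<in>Gal. inv\<^bsub>E.Pt\<^esub> a \<otimes>\<^bsub>E.Pt\<^esub> (\<sigma> \<circ> a))"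
  define d where "d = b \<otimes>\<^bsub>E.Z\<^esub> c"
  have b: "b \<in> carrier E.Z" "b \<in> E.B" unfolding b_def using E.coboundary_Z[OF a] a by (auto simp: B1_def)
  have d: "d \<in> carrier E.Z" unfolding d_def by (rule E.Z_mult_closed[OF b(1) c'])
  have "d \<in> E.cls c" unfolding d_def using b(2) by (auto simp: r_coset_def)
  then have cls: "E.cls d = E.cls c" using E.cls_mem c' by blast
  have "h (act (gal_res \<tau> \<sigma>) e) * chi \<tau> (d \<sigma>) (act (gal_res \<tau> \<sigma>) e) =
       chi \<tau> (c \<sigma>) (act (gal_res \<tau> \<sigma>) e) * \<sigma> (h e)" if s: "\<sigma> \<in> Gal" for \<sigma> e
  proof -
    have cs: "c \<sigma> \<in> carrier E.Pt" "c \<sigma> \<in> pts \<tau>" and ds: "d \<sigma> \<in> pts \<tau>" and sa: "\<sigma> \<circ> a \<in> carrier E.Pt" "\<sigma> \<circ> a \<in> pts \<tau>"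
      using E.Z_closed[OF c' s] E.Z_closed[OF d s] E.act_closed[OF s a] by (simp_all add: Pt_carrier[OF \<tau>])
    have "a \<otimes>\<^bsub>E.Pt\<^esub> d \<sigma> = (\<sigma> \<circ> a) \<otimes>\<^bsub>E.Pt\<^esub> c \<sigma>"
      using s a cs sa by (simp add: d_def b_def E.mult_Z E.A.m_assoc E.cancel)
    then have "chi \<tau> (a \<otimes>\<^bsub>E.Pt\<^esub> d \<sigma>) (act (gal_res \<tau> \<sigma>) e) = chi \<tau> ((\<sigma> \<circ> a) \<otimes>\<^bsub>E.Pt\<^esub> c \<sigma>) (act (gal_res \<tau> \<sigma>) e)" by simp
    then show ?thesis
      unfolding chi_mult[OF \<tau> ap ds] chi_mult[OF \<tau> sa(2) cs(2)] chi_gal[OF \<tau> s ap]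
      by (simp add: a_def chi_pt[OF \<tau>h h] mult.commute)
  qed
  then show ?thesis using d cls by (auto simp: E.galZ1_eq E.galB1_eq)
qed

text \<open>The cocycle depends only on the image of one primitive element, whose orbit is finite.
  Finiteness bounds the zeros and poles to be removed, and it is the form of continuity handed on to
  cocharacter-valued cocycles.\<close>

lemma lattice_cocycle_finite_image:
  fixes \<tau> :: "'k alg_closure \<Rightarrow> 'e::field_char_0 alg_closure"
  assumes f: "lattice_cocycle \<tau> f" and \<tau>: "ac_embedding \<epsilon> \<tau>"
  shows "finite (f ` Gal)"
proof -
  obtain Y where Y: "finite Y" "\<And>\<sigma> e. \<sigma> \<in> Gal \<Longrightarrow> (\<forall>x\<in>Y. \<sigma> x = x) \<Longrightarrow> f \<sigma> e = 1"
    and th: "\<And>\<sigma>. \<sigma> \<in> Gal \<Longrightarrow> thom n (f \<sigma>)"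
    and coc: "\<And>\<sigma> \<sigma>' e. \<sigma> \<in> Gal \<Longrightarrow> \<sigma>' \<in> Gal \<Longrightarrow> f (\<sigma> \<circ> \<sigma>') (act (gal_res \<tau> \<sigma>) e) = f \<sigma> (act (gal_res \<tau> \<sigma>) e) * \<sigma> (f \<sigma>' e)"
    using f unfolding lattice_cocycle_def[OF \<tau>] by blast
  obtain \<zeta> where \<zeta>: "\<And>\<sigma>. \<sigma> \<in> Gal \<Longrightarrow> \<sigma> \<zeta> = \<zeta> \<Longrightarrow> (\<forall>x\<in>Y. \<sigma> x = x)" using primitive_element[OF Y(1)] by blast
  have eq: "f \<sigma>' = f \<sigma>" if s: "\<sigma> \<in> Gal" "\<sigma>' \<in> Gal" "\<sigma>' \<zeta> = \<sigma> \<zeta>" for \<sigma> \<sigma>'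
  proof -
    let ?u = "inv_into UNIV \<sigma> \<circ> \<sigma>'"
    have u: "?u \<in> Gal" using s by (simp add: gal_comp gal_inv)
    have "?u \<zeta> = \<zeta>" using s by (simp add: gal_inv_apply)
    then have "f ?u e = 1" for e using Y(2)[OF u] \<zeta>[OF u] by blast
    moreover have "\<sigma> \<circ> ?u = \<sigma>'" using s by (simp add: gal_inv_comp flip: comp_assoc)
    ultimately have "f \<sigma>' (act (gal_res \<tau> \<sigma>) e) = f \<sigma> (act (gal_res \<tau> \<sigma>) e)" for e
      using coc[OF s(1) u, of e] by (simp add: ring_hom_1 gal_hom s)
    then show ?thesis by (intro act_surj[OF gal_res_in_gal[OF \<tau> s(1)] th[OF s(2)] th[OF s(1)]])
  qed
  define F where "F x = f (SOME \<sigma>. \<sigma> \<in> Gal \<and> \<sigma> \<zeta> = x)" for x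
  have "f \<sigma> = F (\<sigma> \<zeta>)" if "\<sigma> \<in> Gal" for \<sigma>
  proof -
    have "(SOME \<sigma>'. \<sigma>' \<in> Gal \<and> \<sigma>' \<zeta> = \<sigma> \<zeta>) \<in> Gal \<and> (SOME \<sigma>'. \<sigma>' \<in> Gal \<and> \<sigma>' \<zeta> = \<sigma> \<zeta>) \<zeta> = \<sigma> \<zeta>"
      by (rule someI[of "\<lambda>\<sigma>'. \<sigma>' \<in> Gal \<and> \<sigma>' \<zeta> = \<sigma> \<zeta>" \<sigma>]) (use that in auto)
    then show ?thesis unfolding F_def using that by (intro eq[symmetric]) auto
  qed
  then have "f ` Gal \<subseteq> F ` ((\<lambda>\<sigma>. \<sigma> \<zeta>) ` Gal)" by auto
  then show ?thesis by (rule finite_subset[OF _ finite_imageI[OF finite_orbit]])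
qed

end

section \<open>Orders of rational functions over the algebraic closure\<close>

text \<open>Characteristic 0 of \<open>k(t)\<close> makes \<open>fixed_field\<close> and
  \<open>hilbert90\<close> applicable over it.\<close>

instance fract :: ("{idom, ring_char_0}") field_char_0
proof
  have "(of_nat m :: 'a fract) = Fract (of_nat m) 1" for m
    by (induction m) (simp_all add: Zero_fract_def One_fract_def)
  then show "inj (of_nat :: nat \<Rightarrow> 'a fract)"
    by (auto simp: inj_on_def eq_fract)
qed

lemma ratfun_const_hom: "is_ring_hom (ratfun_const :: 'k::field \<Rightarrow> _)"
  unfolding is_ring_hom_def ratfun_const_def
  by (auto simp: to_fract_def One_fract_def one_pCons mult.commute)

lemma order_linear_power_mult:
  fixes q :: "'a::idom poly"
  assumes "poly q a \<noteq> 0" shows "order a ([:-a, 1:] ^ m * q) = m"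
proof -
  have "[:-a, 1:] ^ m * q \<noteq> 0" using assms by auto
  then show ?thesis using assms by (simp add: order_mult order_power_n_n order_0I)
qed

lemma order_map_poly:
  fixes p :: "'a::field poly" and \<rho> :: "'a \<Rightarrow> 'b::field"
  assumes \<rho>: "is_ring_hom \<rho>" and p: "p \<noteq> 0"
  shows "order (\<rho> a) (map_poly \<rho> p) = order a p"
proof -
  obtain q where q: "p = [:- a, 1:] ^ order a p * q" "\<not> [:- a, 1:] dvd q" using order_decomp[OF p] by blast
  have pw: "map_poly \<rho> ([:- a, 1:] ^ m) = [:- \<rho> a, 1:] ^ m" for m
    by (induction m) (simp_all only: power_0 power_Suc ring_hom_map_poly[OF \<rho>],
      simp_all add: ring_hom_0 ring_hom_1 ring_hom_uminus \<rho> map_poly_pCons)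
  have "poly (map_poly \<rho> q) (\<rho> a) \<noteq> 0"
    using q(2) by (simp flip: ring_hom_poly[OF \<rho>] add: ring_hom_eq_0_iff[OF \<rho>] poly_eq_0_iff_dvd)
  moreover have "map_poly \<rho> p = [:- \<rho> a, 1:] ^ order a p * map_poly \<rho> q"
    by (subst q(1)) (simp only: ring_hom_map_poly[OF \<rho>] pw)
  ultimately show ?thesis using order_linear_power_mult[of "map_poly \<rho> q" "\<rho> a" "order a p"] by metis
qed

text \<open>Common roots are split off one at a time; once one side is constant, a root of the other
  would contradict the equality of orders.\<close>

lemma same_orders_imp_proportional:
  fixes p q :: "'a::alg_closed_field poly"
  assumes "p \<noteq> 0" "q \<noteq> 0" "\<And>a. order a p = order a q"
  shows "\<exists>c. c \<noteq> 0 \<and> p = smult c q"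
  using assms
proof (induction "degree p" arbitrary: p q)
  case 0
  have "degree q = 0"
  proof (rule ccontr)
    assume "degree q \<noteq> 0"
    then obtain a where "poly q a = 0" using alg_closed_imp_poly_has_root by blast
    then have "order a p \<noteq> 0" using 0 order_root[of q a] by simp
    then have "poly p a = 0" using order_root[of p a] by simp
    then show False using 0 by (metis degree_eq_zeroE mult_zero_right poly_pCons pCons_0_0 poly_0 add.right_neutral)
  qed
  then obtain a b where "p = [:a:]" "q = [:b:]" using 0 by (metis degree_eq_zeroE)
  then show ?case using 0 by (intro exI[of _ "a / b"]) auto
next
  case (Suc m)
  then have "degree p > 0" by simp
  then obtain a where a: "poly p a = 0" using alg_closed_imp_poly_has_root by blast
  then have "order a q \<noteq> 0" using Suc.prems order_root[of p a] by simp
  then have "poly q a = 0" using order_root[of q a] by simp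
  then obtain p' q' where pq: "p = [:-a, 1:] * p'" "q = [:-a, 1:] * q'" using a by (metis dvdE poly_eq_0_iff_dvd)
  have nz: "p' \<noteq> 0" "q' \<noteq> 0" using Suc.prems pq by auto
  have "order b p' = order b q'" for b
    using Suc.prems(3)[of b] nz Suc.prems(1,2) unfolding pq by (simp add: order_mult del: mult_pCons_left)
  moreover have "m = degree p'" using Suc.hyps(2) nz unfolding pq by (subst (asm) degree_mult_eq) auto
  ultimately obtain c where "c \<noteq> 0" "p' = smult c q'" using Suc.hyps(1) nz by blast
  then show ?case unfolding pq by (intro exI[of _ c]) (simp add: mult_smult_right del: mult_pCons_left)
qed

section \<open>The compositum of k(t) with the constants and orders at finite points\<close>

context
  fixes \<tau> :: "'k::field_char_0 alg_closure \<Rightarrow> 'k poly fract alg_closure"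
  assumes \<tau>: "ac_embedding ratfun_const \<tau>"
begin

definition tt :: "'k poly fract alg_closure" where
  "tt = to_ac (to_fract [:0, 1:])"

text \<open>The embedding of polynomials over the constants. It is injective by
  \<open>pv_eq_0_iff\<close>, and the fractions of its values form the compositum
  \<open>Kt\<close>.\<close>

definition pv :: "'k alg_closure poly \<Rightarrow> 'k poly fract alg_closure" where
  "pv p = poly (map_poly \<tau> p) tt"

lemma emb_hom: "is_ring_hom \<tau>" using \<tau> by (rule ac_embedding_hom)

lemma pv_add: "pv (p + q) = pv p + pv q" and pv_mult: "pv (p * q) = pv p * pv q"
  by (simp_all add: pv_def ring_hom_map_poly[OF emb_hom])

lemma pv_const: "pv [:c:] = \<tau> c"
  by (simp add: pv_def map_poly_pCons ring_hom_0 emb_hom)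

lemma pv_0: "pv 0 = 0" and pv_1: "pv 1 = 1"
  by (simp_all add: pv_def ring_hom_1 emb_hom one_pCons map_poly_pCons ring_hom_0)

lemma pv_pCons: "pv (pCons a p) = \<tau> a + tt * pv p"
  by (simp add: pv_def map_poly_pCons ring_hom_0 emb_hom)

lemma pv_linear: "pv [:-s, 1:] = tt - \<tau> s"
  by (simp add: pv_pCons pv_0 ring_hom_uminus ring_hom_1 emb_hom)

lemma pv_to_ac: "pv (map_poly to_ac p) = to_ac (to_fract p)"
proof (induction p)
  case (pCons a p)
  have "pCons a p = [:a:] + [:0, 1:] * p" by simp
  then have "to_fract (pCons a p) = ratfun_const a + to_fract [:0, 1:] * to_fract p"
    unfolding ratfun_const_def by (metis to_fract_add to_fract_mult)
  then show ?case using pCons by (simp add: map_poly_pCons pv_pCons tt_def ac_embedding_to_ac[OF \<tau>])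
qed (simp add: pv_0)

text \<open>A constant \<open>s\<close> is killed by a nonzero polynomial over \<open>k\<close>; if
  \<open>t\<close> were its image, that polynomial in \<open>t\<close> would vanish.\<close>

lemma tt_transcendental: "tt \<noteq> \<tau> s"
proof
  assume eq: "tt = \<tau> s"
  obtain p where p: "p \<noteq> 0" "poly (map_poly to_ac p) s = 0" by (rule alg_closure_algebraic)
  have "pv (map_poly to_ac p) = \<tau> (poly (map_poly to_ac p) s)"
    unfolding pv_def eq ring_hom_poly[OF emb_hom] ..
  then have "to_ac (to_fract p) = (0 :: 'k poly fract alg_closure)" by (simp add: p pv_to_ac ring_hom_0 emb_hom)
  then show False using p(1) by simp
qed

lemma pv_eq_0_iff: "pv p = 0 \<longleftrightarrow> p = 0"
proof
  assume "pv p = 0"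
  show "p = 0"
  proof (rule ccontr)
    assume "p \<noteq> 0"
    then obtain A where A: "p = smult (lead_coeff p) (\<Prod>a\<in>#A. [:-a, 1:])"
      using alg_closed_imp_factorization[of p] by blast
    have P: "pv (\<Prod>a\<in>#A. [:-a, 1:]) \<noteq> 0" for A
      by (induction A) (use tt_transcendental in \<open>auto simp: pv_1 pv_mult pv_linear simp del: mult_pCons_left\<close>)
    have "p = [:lead_coeff p:] * (\<Prod>a\<in>#A. [:-a, 1:])" by (subst A) simp
    then have "pv p = \<tau> (lead_coeff p) * pv (\<Prod>a\<in>#A. [:-a, 1:])" by (metis pv_mult pv_const)
    then show False using \<open>pv p = 0\<close> P \<open>p \<noteq> 0\<close> by (simp add: ring_hom_eq_0_iff emb_hom)
  qed
qed (simp add: pv_0)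

definition Kt :: "'k poly fract alg_closure set" where
  "Kt = {pv p / pv q | p q. q \<noteq> 0}"

lemma KtI: "q \<noteq> 0 \<Longrightarrow> pv p / pv q \<in> Kt"
  unfolding Kt_def by blast

lemma KtE: assumes "x \<in> Kt" obtains p q where "q \<noteq> 0" "x = pv p / pv q"
  using assms unfolding Kt_def by blast

lemma pv_in_Kt: "pv p \<in> Kt"
  using KtI[of 1 p] by (simp add: pv_1)

lemma emb_in_Kt: "\<tau> c \<in> Kt"
  using pv_in_Kt[of "[:c:]"] by (simp add: pv_const)

lemma Kt_intermediate: "intermediate Kt"
  unfolding intermediate_def
proof (intro conjI ballI subsetI)
  fix x :: "'k poly fract alg_closure" assume "x \<in> range to_ac"
  then obtain f where f: "x = to_ac f" by auto
  obtain p q where "f = Fract p q" "q \<noteq> 0" by (cases f) auto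
  then have "x = pv (map_poly to_ac p) / pv (map_poly to_ac q)"
    by (simp add: f pv_to_ac Fract_conv_to_fract)
  moreover have "map_poly to_ac q \<noteq> 0" using \<open>q \<noteq> 0\<close> by (simp add: map_poly_eq_0_iff)
  ultimately show "x \<in> Kt" by (simp add: KtI)
next
  fix x y assume "x \<in> Kt" "y \<in> Kt"
  then obtain p q p' q' where pq: "q \<noteq> 0" "x = pv p / pv q" "q' \<noteq> 0" "y = pv p' / pv q'" by (metis KtE)
  have "x + y = pv (p * q' + p' * q) / pv (q * q')" "x * y = pv (p * p') / pv (q * q')"
    using pq by (simp_all add: pv_add pv_mult pv_eq_0_iff add_frac_eq)
  then show "x + y \<in> Kt" "x * y \<in> Kt" using pq by (simp_all add: KtI)
qed

text \<open>The order at a finite point \<open>s\<close> of the line over the constants;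
  \<open>kord_pv\<close> shows independence of the fraction. Finite points are enough: by
  \<open>kord_all_zero\<close>, an element without zeros and poles there is constant.\<close>

definition kord :: "'k alg_closure \<Rightarrow> 'k poly fract alg_closure \<Rightarrow> int" where
  "kord s x = (THE m. \<exists>p q. p \<noteq> 0 \<and> q \<noteq> 0 \<and> x = pv p / pv q \<and> m = int (order s p) - int (order s q))"

lemma kord_pv:
  assumes "p \<noteq> 0" "q \<noteq> 0"
  shows "kord s (pv p / pv q) = int (order s p) - int (order s q)"
proof -
  have "int (order s p') - int (order s q') = int (order s p) - int (order s q)"
    if "p' \<noteq> 0" "q' \<noteq> 0" "pv p / pv q = pv p' / pv q'" for p' q'
  proof -
    have "pv (p * q' - p' * q) = pv (p * q') - pv (p' * q)"
      using pv_add[of "p * q' - p' * q" "p' * q"] by simp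
    then have "pv (p * q' - p' * q) = 0"
      using that assms by (simp add: pv_mult frac_eq_eq pv_eq_0_iff)
    then have "p * q' = p' * q" by (simp add: pv_eq_0_iff)
    then have "order s p + order s q' = order s p' + order s q"
      using that assms by (metis order_mult no_zero_divisors)
    then show ?thesis by linarith
  qed
  then show ?thesis unfolding kord_def using assms by (intro the_equality) blast+
qed

lemma Kt_cases:
  assumes "x \<in> Kt" "x \<noteq> 0" obtains p q where "p \<noteq> 0" "q \<noteq> 0" "x = pv p / pv q"
  using assms by (metis KtE pv_0 div_0)

lemma kord_mult:
  assumes "x \<in> Kt" "x \<noteq> 0" "y \<in> Kt" "y \<noteq> 0"
  shows "kord s (x * y) = kord s x + kord s y"
proof -
  obtain p q p' q' where pq: "p \<noteq> 0" "q \<noteq> 0" "x = pv p / pv q" "p' \<noteq> 0" "q' \<noteq> 0" "y = pv p' / pv q'"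
    using assms by (metis Kt_cases)
  have "x * y = pv (p * p') / pv (q * q')" by (simp add: pq pv_mult)
  moreover have "p * p' \<noteq> 0" "q * q' \<noteq> 0" using pq by auto
  ultimately have "kord s (x * y) = int (order s (p * p')) - int (order s (q * q'))" using kord_pv by metis
  also have "\<dots> = kord s x + kord s y" using pq by (simp add: kord_pv order_mult)
  finally show ?thesis .
qed

lemma kord_emb: "c \<noteq> 0 \<Longrightarrow> kord s (\<tau> c) = 0"
proof -
  assume "c \<noteq> 0"
  then have "order s [:c:] = 0" by (intro order_0I) simp
  then show ?thesis using kord_pv[of "[:c:]" 1 s] \<open>c \<noteq> 0\<close> by (simp add: pv_const pv_1)
qed

lemma kord_1: "kord s 1 = 0"
  using kord_emb[of 1 s] by (simp add: ring_hom_1 emb_hom)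

lemma kord_inverse: assumes "x \<in> Kt" "x \<noteq> 0" shows "kord s (inverse x) = - kord s x"
  using kord_mult[of "inverse x" x s] assms intermediate_inverse[OF Kt_intermediate assms(1)] by (simp add: kord_1)

lemma kord_prod:
  assumes "\<And>i. i \<in> I \<Longrightarrow> f i \<in> Kt \<and> f i \<noteq> 0"
  shows "(\<Prod>i\<in>I. f i) \<in> Kt \<and> (\<Prod>i\<in>I. f i) \<noteq> 0 \<and> kord s (\<Prod>i\<in>I. f i) = (\<Sum>i\<in>I. kord s (f i))"
  using assms
  by (induction I rule: infinite_finite_induct)
    (auto simp: kord_1 kord_mult intermediate_1[OF Kt_intermediate] intermediate_mult[OF Kt_intermediate])

lemma kord_powi:
  assumes x: "x \<in> Kt" "x \<noteq> 0"
  shows "x powi m \<in> Kt \<and> x powi m \<noteq> 0 \<and> kord s (x powi m) = m * kord s x"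
proof -
  have p: "y ^ i \<in> Kt \<and> kord s (y ^ i) = int i * kord s y" if "y \<in> Kt" "y \<noteq> 0" for y i
    using kord_prod[of "{..<i}" "\<lambda>_. y" s] that by simp
  show ?thesis
    using p[OF x] p[of "inverse x"] x intermediate_inverse[OF Kt_intermediate x(1)]
    by (auto simp: power_int_def kord_inverse)
qed

lemma kord_linear: "tt - \<tau> a \<in> Kt" "tt - \<tau> a \<noteq> 0" "kord s (tt - \<tau> a) = (if s = a then 1 else 0)"
proof -
  show "tt - \<tau> a \<in> Kt" using pv_in_Kt[of "[:-a, 1:]"] by (simp add: pv_linear)
  show "tt - \<tau> a \<noteq> 0" using tt_transcendental by simp
  have "order s [:-a, 1:] = (if s = a then 1 else 0)"
    using order_power_n_n[of a 1] by (auto intro: order_0I)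
  then show "kord s (tt - \<tau> a) = (if s = a then 1 else 0)"
    using kord_pv[of "[:-a, 1:]" 1 s] by (simp add: pv_linear pv_1)
qed

lemma kord_all_zero:
  assumes x: "x \<in> Kt" "x \<noteq> 0" and z: "\<And>s. kord s x = 0"
  shows "x \<in> range \<tau>"
proof -
  obtain p q where pq: "p \<noteq> 0" "q \<noteq> 0" "x = pv p / pv q" using Kt_cases[OF x] .
  have "order s p = order s q" for s using z[of s] pq by (simp add: kord_pv)
  then obtain c where "p = smult c q" using same_orders_imp_proportional pq by blast
  then have "p = [:c:] * q" by simp
  then have "x = \<tau> c" using pq by (simp add: pv_mult pv_const pv_eq_0_iff del: mult_pCons_left)
  then show ?thesis by simp
qed

lemma kord_finite: assumes "x \<in> Kt" "x \<noteq> 0" shows "finite {s. kord s x \<noteq> 0}"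
proof -
  obtain p q where pq: "p \<noteq> 0" "q \<noteq> 0" "x = pv p / pv q" using Kt_cases[OF assms] .
  have "{s. kord s x \<noteq> 0} \<subseteq> {s. poly p s = 0} \<union> {s. poly q s = 0}"
    using pq by (auto simp: kord_pv order_root)
  moreover have "finite ({s. poly p s = 0} \<union> {s. poly q s = 0})"
    using poly_roots_finite[OF pq(1)] poly_roots_finite[OF pq(2)] by simp
  ultimately show ?thesis by (rule finite_subset)
qed

lemma gal_pv: assumes "\<sigma> \<in> Gal" shows "\<sigma> (pv p) = pv (map_poly (gal_res \<tau> \<sigma>) p)"
  by (induction p) (auto simp: pv_0 pv_pCons map_poly_pCons ring_hom_0 ring_hom_add ring_hom_mult
      gal_hom assms gal_res_in_gal[OF \<tau>] gal_res_apply[OF \<tau>] tt_def gal_to_ac)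

lemma map_poly_gal_eq_0: "\<rho> \<in> Gal \<Longrightarrow> map_poly \<rho> p = 0 \<longleftrightarrow> p = 0" for \<rho> :: "'k alg_closure \<Rightarrow> _"
  by (rule map_poly_eq_0_iff) (auto simp: ring_hom_0 ring_hom_eq_0_iff gal_hom)

lemma gal_Kt: assumes "\<sigma> \<in> Gal" "x \<in> Kt" shows "\<sigma> x \<in> Kt"
proof -
  obtain p q where pq: "q \<noteq> 0" "x = pv p / pv q" using KtE[OF assms(2)] .
  have "\<sigma> x = pv (map_poly (gal_res \<tau> \<sigma>) p) / pv (map_poly (gal_res \<tau> \<sigma>) q)"
    using gal_hom[OF assms(1)] by (simp add: pq divide_inverse ring_hom_mult ring_hom_inverse gal_pv assms)
  then show ?thesis using pq by (simp add: KtI map_poly_gal_eq_0 gal_res_in_gal[OF \<tau>] assms)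
qed

lemma gal_Kt_cong:
  assumes "\<sigma> \<in> Gal" "\<sigma>' \<in> Gal" "gal_res \<tau> \<sigma> = gal_res \<tau> \<sigma>'" "x \<in> Kt" shows "\<sigma> x = \<sigma>' x"
proof -
  obtain p q where pq: "q \<noteq> 0" "x = pv p / pv q" using KtE[OF assms(4)] .
  show ?thesis
    using gal_hom[OF assms(1)] gal_hom[OF assms(2)] assms(3)
    by (simp add: pq divide_inverse ring_hom_mult ring_hom_inverse gal_pv assms(1,2))
qed

lemma kord_gal:
  assumes \<sigma>: "\<sigma> \<in> Gal" and x: "x \<in> Kt" "x \<noteq> 0"
  shows "kord (gal_res \<tau> \<sigma> s) (\<sigma> x) = kord s x"
proof -
  let ?\<rho> = "gal_res \<tau> \<sigma>"
  have \<rho>: "?\<rho> \<in> Gal" by (rule gal_res_in_gal[OF \<tau> \<sigma>])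
  obtain p q where pq: "p \<noteq> 0" "q \<noteq> 0" "x = pv p / pv q" using Kt_cases[OF x] .
  have "\<sigma> x = pv (map_poly ?\<rho> p) / pv (map_poly ?\<rho> q)"
    using gal_hom[OF \<sigma>] by (simp add: pq divide_inverse ring_hom_mult ring_hom_inverse gal_pv \<sigma>)
  then have "kord (?\<rho> s) (\<sigma> x) = int (order (?\<rho> s) (map_poly ?\<rho> p)) - int (order (?\<rho> s) (map_poly ?\<rho> q))"
    using pq by (simp add: kord_pv map_poly_gal_eq_0 \<rho>)
  also have "\<dots> = kord s x" using pq by (simp add: kord_pv order_map_poly gal_hom \<rho>)
  finally show ?thesis .
qed

text \<open>The action on coefficients of Laurent series gives lifts to the closure of a completion,
  here the one at infinity; their restrictions to the closure of \<open>k(t)\<close> are the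
  required lifts.\<close>

lemma gal_res_surj_ratfun:
  assumes "\<rho> \<in> Gal" shows "\<exists>\<sigma>\<in>Gal. gal_res \<tau> \<sigma> = \<rho>"
proof -
  define j where "j = (laurent_expansion None :: 'k poly fract \<Rightarrow> _)"
  have j: "ac_embedding j (ac_extension j)"
    unfolding j_def by (rule ac_extension_embedding[OF laurent_expansion_ring_hom])
  have "j \<circ> ratfun_const = fls_const"
    by (auto simp: j_def ratfun_const_def laurent_expansion_const)
  then have "ac_embedding fls_const (ac_extension j \<circ> \<tau>)"
    using ac_embedding_comp[OF \<tau> j] by simp
  then obtain \<sigma> where "\<sigma> \<in> Gal" "gal_res (ac_extension j \<circ> \<tau>) \<sigma> = \<rho>"
    using gal_res_surj_fls assms by blast
  then show ?thesis using gal_res_gal_res[OF \<tau> j] gal_res_in_gal[OF j] by metis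
qed

end

section \<open>Cocharacters and cocycles induced from stabilizers\<close>

context torus_splitting
begin

text \<open>Cocharacters, as additive functions on the character lattice; \<open>cochar\<close>
  turns them into algebra maps.\<close>

definition lattice_hom :: "((nat \<Rightarrow>\<^sub>0 int) \<Rightarrow> int) \<Rightarrow> bool" where
  "lattice_hom b \<longleftrightarrow> (\<forall>d e. b (d + e) = b d + b e) \<and> (\<forall>e. b (trunc n e) = b e)"

lemma lattice_hom_add: "lattice_hom b \<Longrightarrow> b (d + e) = b d + b e"
  and lattice_hom_trunc: "lattice_hom b \<Longrightarrow> b (trunc n e) = b e"
  by (auto simp: lattice_hom_def)

lemma lattice_hom_thom: "lattice_hom b \<Longrightarrow> x \<noteq> 0 \<Longrightarrow> thom n (\<lambda>e. x powi b e)" for x :: "'b::field"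
proof -
  assume b: "lattice_hom b" and x: "x \<noteq> 0"
  have "b 0 = 0" using lattice_hom_add[OF b, of 0 0] by simp
  then show ?thesis using b x by (simp add: thom_def lattice_hom_def power_int_add)
qed

lemma lattice_hom_zero:
  assumes b: "lattice_hom b" and z: "\<And>i. i < n \<Longrightarrow> b (Poly_Mapping.single i 1) = 0"
  shows "b e = 0"
proof -
  have "(2::rat) powi b e = (\<Prod>i<n. (2 powi b (Poly_Mapping.single i 1)) powi Poly_Mapping.lookup e i)"
    by (rule thom_eq_prod[OF lattice_hom_thom[OF b]]) simp
  also have "\<dots> = 2 powi 0" by (simp add: z)
  finally show ?thesis by (simp only: two_powi_eq_iff)
qed

lemma act_lattice_hom: "\<rho> \<in> Gal \<Longrightarrow> lattice_hom b \<Longrightarrow> lattice_hom (\<lambda>e. b (act \<rho> e))"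
  by (simp add: lattice_hom_def act_add act_trunc)

definition cochar_group :: "((nat \<Rightarrow>\<^sub>0 int) \<Rightarrow> int) monoid" where
  "cochar_group = \<lparr>carrier = {b. lattice_hom b}, monoid.mult = (\<lambda>b b' e. b e + b' e), one = (\<lambda>_. 0)\<rparr>"

lemma cochar_comm_group: "comm_group cochar_group"
proof (rule comm_groupI)
  fix b assume "b \<in> carrier cochar_group"
  then show "\<exists>b'\<in>carrier cochar_group. b' \<otimes>\<^bsub>cochar_group\<^esub> b = \<one>\<^bsub>cochar_group\<^esub>"
    by (intro bexI[of _ "\<lambda>e. - b e"]) (auto simp: cochar_group_def lattice_hom_def)
qed (auto simp: cochar_group_def lattice_hom_def)

text \<open>Vanishing of first cohomology with values in cocharacters for every subgroup of the
  absolute Galois group, in the sign convention of \<open>shapiro\<close>. A finite image takes the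
  place of continuity.\<close>

definition stabilizers_acyclic :: bool where
  "stabilizers_acyclic \<longleftrightarrow> (\<forall>N m. N \<subseteq> Gal \<longrightarrow> id \<in> N \<longrightarrow> (\<forall>\<rho>\<in>N. \<forall>\<rho>'\<in>N. \<rho> \<circ> \<rho>' \<in> N) \<longrightarrow> (\<forall>\<rho>\<in>N. inv_into UNIV \<rho> \<in> N) \<longrightarrow>
     (\<forall>\<rho>\<in>N. lattice_hom (m \<rho>)) \<longrightarrow> finite (m ` N) \<longrightarrow>
     (\<forall>\<rho>\<in>N. \<forall>\<rho>'\<in>N. \<forall>e. m (\<rho> \<circ> \<rho>') (act \<rho> e) = m \<rho> (act \<rho> e) + m \<rho>' e) \<longrightarrow>
     (\<exists>b. lattice_hom b \<and> (\<forall>\<rho>\<in>N. \<forall>e. b (act \<rho> e) + m \<rho> (act \<rho> e) = b e)))"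

lemma stabilizers_acyclicD:
  assumes "stabilizers_acyclic" "N \<subseteq> Gal" "id \<in> N" "\<And>\<rho> \<rho>'. \<rho> \<in> N \<Longrightarrow> \<rho>' \<in> N \<Longrightarrow> \<rho> \<circ> \<rho>' \<in> N"
    "\<And>\<rho>. \<rho> \<in> N \<Longrightarrow> inv_into UNIV \<rho> \<in> N" "\<And>\<rho>. \<rho> \<in> N \<Longrightarrow> lattice_hom (m \<rho>)" "finite (m ` N)"
    "\<And>\<rho> \<rho>' e. \<rho> \<in> N \<Longrightarrow> \<rho>' \<in> N \<Longrightarrow> m (\<rho> \<circ> \<rho>') (act \<rho> e) = m \<rho> (act \<rho> e) + m \<rho>' e"
  shows "\<exists>b. lattice_hom b \<and> (\<forall>\<rho>\<in>N. \<forall>e. b (act \<rho> e) + m \<rho> (act \<rho> e) = b e)"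
  using assms(1)[unfolded stabilizers_acyclic_def, rule_format, of N m] assms(2-) by blast

text \<open>\<open>m\<close> is a cocycle with values in cocharacter-valued functions on a set
  permuted by Galois. \<open>shapiro\<close> reduces it to the stabilizer of each point, where
  acyclicity applies.\<close>

lemma induced_cochar_coboundary:
  fixes m :: "('k alg_closure \<Rightarrow> 'k alg_closure) \<Rightarrow> 'k alg_closure \<Rightarrow> (nat \<Rightarrow>\<^sub>0 int) \<Rightarrow> int"
  assumes acyc: stabilizers_acyclic
    and hom: "\<And>\<rho> s. \<rho> \<in> Gal \<Longrightarrow> lattice_hom (m \<rho> s)" and fin: "\<And>s. finite ((\<lambda>\<rho>. m \<rho> s) ` Gal)"
    and coc: "\<And>\<rho> \<rho>' s e. \<rho> \<in> Gal \<Longrightarrow> \<rho>' \<in> Gal \<Longrightarrow> m (\<rho> \<circ> \<rho>') (\<rho> s) (act \<rho> e) = m \<rho> (\<rho> s) (act \<rho> e) + m \<rho>' s e"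
    and S: "\<And>\<rho> s. \<rho> \<in> Gal \<Longrightarrow> s \<in> S \<Longrightarrow> \<rho> s \<in> S"
  shows "\<exists>W. (\<forall>s\<in>S. lattice_hom (W s)) \<and> (\<forall>\<rho>\<in>Gal. \<forall>s\<in>S. \<forall>e. W (\<rho> s) (act \<rho> e) + m \<rho> (\<rho> s) (act \<rho> e) = W s e)"
proof -
  \<comment> \<open>The action on cocharacters is contragredient to \<open>act\<close>, hence the
    inverse; substituting \<open>act \<rho> e\<close> removes it at the end.\<close>
  let ?X = cochar_group and ?act = "\<lambda>\<rho> b e. b (act (inv_into UNIV \<rho>) e)"
  have mem: "b \<in> carrier ?X \<longleftrightarrow> lattice_hom b" and mult: "b \<otimes>\<^bsub>?X\<^esub> b' = (\<lambda>e. b e + b' e)" for b b'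
    by (simp_all add: cochar_group_def)
  have "\<exists>W. (\<forall>s\<in>S. W s \<in> carrier ?X) \<and>
      (\<forall>\<rho>\<in>Gal. \<forall>s\<in>S. W (\<rho> s) \<otimes>\<^bsub>?X\<^esub> m \<rho> (\<rho> s) = ?act \<rho> (W s))"
  proof (rule shapiro[where \<Gamma> = "gal UNIV" and mv = "\<lambda>\<rho>. \<rho>", OF group_gal_UNIV cochar_comm_group])
    fix g h :: "'k alg_closure \<Rightarrow> 'k alg_closure" assume gh: "g \<in> Gal" "h \<in> Gal"
    show "(g \<otimes>\<^bsub>gal UNIV\<^esub> h) s = g (h s)" for s using gh by (simp add: gal_mult)
    show "?act (g \<otimes>\<^bsub>gal UNIV\<^esub> h) b = ?act g (?act h b)" for b
    proof -
      have "inv_into UNIV (g \<circ> h) = inv_into UNIV h \<circ> inv_into UNIV g"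
        using gh by (simp add: gal_bij o_inv_distrib)
      then show ?thesis using gh by (simp add: gal_mult act_comp gal_inv)
    qed
    show "m (g \<otimes>\<^bsub>gal UNIV\<^esub> h) (g s) = m g (g s) \<otimes>\<^bsub>?X\<^esub> ?act g (m h s)" for s
    proof
      fix e
      show "m (g \<otimes>\<^bsub>gal UNIV\<^esub> h) (g s) e = (m g (g s) \<otimes>\<^bsub>?X\<^esub> ?act g (m h s)) e"
        using coc[OF gh, of s "act (inv_into UNIV g) e"] gh hom
        by (simp add: gal_mult mult act_inv lattice_hom_trunc gal_comp)
    qed
  next
    fix s assume s: "s \<in> S"
    show "\<one>\<^bsub>gal UNIV\<^esub> s = s" by (simp add: gal_one)
    define N where "N = {\<rho> \<in> Gal. \<rho> s = s}"
    have "\<exists>b. lattice_hom b \<and> (\<forall>\<rho>\<in>N. \<forall>e. b (act \<rho> e) + m \<rho> s (act \<rho> e) = b e)"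
    proof (rule stabilizers_acyclicD[OF acyc])
      show "N \<subseteq> Gal" "id \<in> N" by (auto simp: N_def id_in_gal)
      show "\<rho> \<circ> \<rho>' \<in> N" if "\<rho> \<in> N" "\<rho>' \<in> N" for \<rho> \<rho>' using that by (simp add: N_def gal_comp)
      show "inv_into UNIV \<rho> \<in> N" if "\<rho> \<in> N" for \<rho>
        using that gal_inv_apply(2)[of \<rho> s] by (simp add: N_def gal_inv)
      show "lattice_hom (m \<rho> s)" if "\<rho> \<in> N" for \<rho> using that hom by (simp add: N_def)
      show "finite ((\<lambda>\<rho>. m \<rho> s) ` N)" by (rule finite_subset[OF _ fin[of s]]) (auto simp: N_def)
      show "m (\<rho> \<circ> \<rho>') s (act \<rho> e) = m \<rho> s (act \<rho> e) + m \<rho>' s e" if "\<rho> \<in> N" "\<rho>' \<in> N" for \<rho> \<rho>' e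
        using that coc[of \<rho> \<rho>' s e] by (simp add: N_def)
    qed
    then obtain b where b: "lattice_hom b" "\<And>\<rho> e. \<rho> \<in> N \<Longrightarrow> b (act \<rho> e) + m \<rho> s (act \<rho> e) = b e" by blast
    show "\<exists>w\<in>carrier ?X. \<forall>g\<in>Gal. g s = s \<longrightarrow> w \<otimes>\<^bsub>?X\<^esub> m g s = ?act g w"
    proof (intro bexI[of _ b] ballI impI ext)
      fix g :: "'k alg_closure \<Rightarrow> 'k alg_closure" and e assume g: "g \<in> Gal" "g s = s"
      then show "(b \<otimes>\<^bsub>?X\<^esub> m g s) e = b (act (inv_into UNIV g) e)"
        using b(2)[of g "act (inv_into UNIV g) e"] hom[OF g(1)] b(1)
        by (simp add: N_def mult act_inv lattice_hom_trunc)
    qed (simp add: mem b(1))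
  qed (use S hom in \<open>auto simp: mem mult act_lattice_hom gal_inv\<close>)
  then obtain W where W: "\<And>s. s \<in> S \<Longrightarrow> lattice_hom (W s)"
    "\<And>\<rho> s. \<rho> \<in> Gal \<Longrightarrow> s \<in> S \<Longrightarrow> W (\<rho> s) \<otimes>\<^bsub>?X\<^esub> m \<rho> (\<rho> s) = ?act \<rho> (W s)"
    unfolding mem by blast
  have "W (\<rho> s) (act \<rho> e) + m \<rho> (\<rho> s) (act \<rho> e) = W s e" if "\<rho> \<in> Gal" "s \<in> S" for \<rho> s e
    using fun_cong[OF W(2)[OF that], of "act \<rho> e"] that W(1) by (simp add: mult act_inv lattice_hom_trunc)
  then show ?thesis using W(1) by blast
qed

end

section \<open>Classes over k(t) are constant\<close>

context torus_splitting
begin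

theorem ratfun_class_constant:
  fixes \<tau> :: "'k alg_closure \<Rightarrow> 'k poly fract alg_closure"
  assumes \<tau>: "ac_embedding ratfun_const \<tau>" and acyc: stabilizers_acyclic
    and c: "c \<in> carrier (galZ1 ratfun_const G)"
  shows "\<exists>a\<in>carrier (galZ1 id G). galB1 ratfun_const G #>\<^bsub>galZ1 ratfun_const G\<^esub> c =
    galB1 ratfun_const G #>\<^bsub>galZ1 ratfun_const G\<^esub> res_along \<tau> a"
proof -
  interpret k: galois_points "id :: 'k \<Rightarrow> 'k" G torus_gens by (rule torus_galois_points[OF ac_embedding_id])
  interpret E: galois_points ratfun_const G torus_gens by (rule torus_galois_points[OF \<tau>])
  interpret r: galois_points_res id ratfun_const G torus_gens torus_gens ratfun_const \<tau>
    by standard (auto simp: \<tau>)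
  let ?Kt = "Kt \<tau>" and ?r = "gal_res \<tau>"
  note rG = gal_res_in_gal[OF \<tau>] and Kt = Kt_intermediate[OF \<tau>]
  have \<tau>h: "is_ring_hom \<tau>" by (rule ac_embedding_hom[OF \<tau>])

  \<comment> \<open>Hilbert 90 over the compositum of \<open>k(t)\<close> and the constants\<close>
  define f where "f = (\<lambda>\<sigma>. chi \<tau> (c \<sigma>))"
  have f: "lattice_cocycle \<tau> f"
    using cocycle_lattice[OF \<tau>, of c] c by (simp add: E.galZ1_eq f_def)
  obtain Y where Y: "finite Y" "\<And>\<sigma> e. \<sigma> \<in> Gal \<Longrightarrow> (\<forall>x\<in>Y. \<sigma> x = x) \<Longrightarrow> f \<sigma> e = 1"
    and th: "\<And>\<sigma>. \<sigma> \<in> Gal \<Longrightarrow> thom n (f \<sigma>)"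
    and coc: "\<And>\<sigma> \<sigma>' e. \<sigma> \<in> Gal \<Longrightarrow> \<sigma>' \<in> Gal \<Longrightarrow> f (\<sigma> \<circ> \<sigma>') (act (?r \<sigma>) e) = f \<sigma> (act (?r \<sigma>) e) * \<sigma> (f \<sigma>' e)"
    using f unfolding lattice_cocycle_def[OF \<tau>] by blast
  define N where "N = {\<sigma> \<in> Gal. ?r \<sigma> = id}"
  have N: "N \<subseteq> Gal" "id \<in> N" "\<And>\<sigma> \<sigma>'. \<sigma> \<in> N \<Longrightarrow> \<sigma>' \<in> N \<Longrightarrow> \<sigma> \<circ> \<sigma>' \<in> N" "\<And>\<sigma>. \<sigma> \<in> N \<Longrightarrow> inv_into UNIV \<sigma> \<in> N"
    by (auto simp: N_def id_in_gal gal_res_id[OF \<tau>] gal_comp gal_res_comp[OF \<tau>] gal_inv gal_res_inv[OF \<tau>])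
  have cocN: "f (\<sigma> \<circ> \<sigma>') e = f \<sigma> e * \<sigma> (f \<sigma>' e)" if "\<sigma> \<in> N" "\<sigma>' \<in> N" for \<sigma> \<sigma>' e
    using coc[of \<sigma> \<sigma>' e] that N(3)[OF that] by (simp add: N_def act_id thom_trunc[OF th])
  \<comment> \<open>Elements of \<open>N\<close> act trivially on characters, so Hilbert 90 applies
    to each basis character separately.\<close>
  have "\<exists>y. y \<noteq> 0 \<and> (\<forall>\<sigma>\<in>N. f \<sigma> (Poly_Mapping.single i 1) * \<sigma> y = y)" for i
    by (rule hilbert90[OF N _ _ Y(1)])
      (use N(1) Y(2) in \<open>auto simp: cocN thom_nonzero[OF th]\<close>)
  then obtain y where y: "\<And>i. y i \<noteq> 0" "\<And>i \<sigma>. \<sigma> \<in> N \<Longrightarrow> f \<sigma> (Poly_Mapping.single i 1) * \<sigma> (y i) = y i" by metis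
  define h where "h e = (\<Prod>i<n. y i powi Poly_Mapping.lookup e i)" for e
  have h: "thom n h" unfolding h_def by (rule thom_basis) (simp add: y)
  have h_basis: "h (Poly_Mapping.single i 1) = y i" if "i < n" for i
  proof -
    have "h (Poly_Mapping.single i 1) = (\<Prod>j<n. if j = i then y i else 1)"
      unfolding h_def by (intro prod.cong) (auto simp: lookup_single when_def)
    then show ?thesis using that by simp
  qed
  have fN: "f \<sigma> e * \<sigma> (h e) = h e" if s: "\<sigma> \<in> N" for \<sigma> e
  proof -
    have sG: "\<sigma> \<in> Gal" using s N by blast
    have t: "thom n (\<lambda>e. f \<sigma> e * \<sigma> (h e))" by (rule thom_mult[OF th[OF sG] thom_hom[OF gal_hom[OF sG] h]])
    have "f \<sigma> e * \<sigma> (h e) = (\<Prod>i<n. (f \<sigma> (Poly_Mapping.single i 1) * \<sigma> (h (Poly_Mapping.single i 1))) powi Poly_Mapping.lookup e i)"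
      by (rule thom_eq_prod[OF t])
    also have "\<dots> = (\<Prod>i<n. h (Poly_Mapping.single i 1) powi Poly_Mapping.lookup e i)"
      by (intro prod.cong refl) (simp add: h_basis y(2) s)
    also have "\<dots> = h e" by (rule thom_eq_prod[OF h, symmetric])
    finally show ?thesis .
  qed
  obtain c1 where c1: "c1 \<in> carrier E.Z" "E.cls c1 = E.cls c"
    and c1eq: "\<And>\<sigma> e. \<sigma> \<in> Gal \<Longrightarrow> h (act (?r \<sigma>) e) * chi \<tau> (c1 \<sigma>) (act (?r \<sigma>) e) = f \<sigma> (act (?r \<sigma>) e) * \<sigma> (h e)"
    using coboundary_modify[OF \<tau> c h] by (auto simp: E.galZ1_eq E.galB1_eq f_def)
  define f1 where "f1 = (\<lambda>\<sigma>. chi \<tau> (c1 \<sigma>))"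
  have f1_app: "f1 \<sigma> = chi \<tau> (c1 \<sigma>)" for \<sigma> by (simp add: f1_def)
  have f1: "lattice_cocycle \<tau> f1" using cocycle_lattice[OF \<tau> c1(1)] by (simp add: f1_def)
  then have th1: "\<And>\<sigma>. \<sigma> \<in> Gal \<Longrightarrow> thom n (f1 \<sigma>)"
    and coc1: "\<And>\<sigma> \<sigma>' e. \<sigma> \<in> Gal \<Longrightarrow> \<sigma>' \<in> Gal \<Longrightarrow> f1 (\<sigma> \<circ> \<sigma>') (act (?r \<sigma>) e) = f1 \<sigma> (act (?r \<sigma>) e) * \<sigma> (f1 \<sigma>' e)"
    unfolding lattice_cocycle_def[OF \<tau>] by blast+
  have f1N: "f1 \<sigma> e = 1" if s: "\<sigma> \<in> N" for \<sigma> e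
  proof -
    have sG: "\<sigma> \<in> Gal" and r: "?r \<sigma> = id" using s by (auto simp: N_def)
    have "h e * f1 \<sigma> e = h e"
      using c1eq[OF sG, of e, folded f1_app] fN[OF s, of e]
      by (simp add: r act_id thom_trunc[OF h] thom_trunc[OF th[OF sG]] thom_trunc[OF th1[OF sG]])
    then show ?thesis using thom_nonzero[OF h, of e] by simp
  qed

  \<comment> \<open>The modified cocycle factors through the constants and takes values in the compositum\<close>
  have f1_res: "f1 \<sigma>' = f1 \<sigma>" if s: "\<sigma> \<in> Gal" "\<sigma>' \<in> Gal" "?r \<sigma>' = ?r \<sigma>" for \<sigma> \<sigma>'
  proof (rule act_surj[OF rG[OF s(1)] th1[OF s(2)] th1[OF s(1)]])
    fix e
    let ?u = "inv_into UNIV \<sigma> \<circ> \<sigma>'"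
    have u: "?u \<in> N" using s by (simp add: N_def gal_comp gal_inv gal_res_comp[OF \<tau>] gal_res_inv[OF \<tau>] gal_inv_comp rG)
    then have uG: "?u \<in> Gal" using N by blast
    have "\<sigma> \<circ> ?u = \<sigma>'" using s by (simp add: gal_inv_comp flip: comp_assoc)
    then show "f1 \<sigma>' (act (?r \<sigma>) e) = f1 \<sigma> (act (?r \<sigma>) e)"
      using coc1[OF s(1) uG, of e] by (simp add: f1N[OF u] ring_hom_1 gal_hom s)
  qed
  have f1_Kt: "f1 \<sigma>' e \<in> ?Kt" if s': "\<sigma>' \<in> Gal" for \<sigma>' e
  proof (rule fixed_field[OF Kt])
    fix \<sigma> :: "'k poly fract alg_closure \<Rightarrow> 'k poly fract alg_closure" assume s: "\<sigma> \<in> Gal" "\<forall>x\<in>?Kt. \<sigma> x = x"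
    have r: "?r \<sigma> = id" by (rule gal_res_eqI[OF \<tau>]) (use s emb_in_Kt[OF \<tau>] in auto)
    then have sN: "\<sigma> \<in> N" using s by (simp add: N_def)
    have "f1 (\<sigma> \<circ> \<sigma>') = f1 \<sigma>'"
      by (rule f1_res) (use s s' r in \<open>auto simp: gal_comp gal_res_comp[OF \<tau>]\<close>)
    then have "f1 \<sigma>' (trunc n e) = \<sigma> (f1 \<sigma>' e)"
      using coc1[OF s(1) s', of e] by (simp add: r act_id f1N[OF sN])
    then show "\<sigma> (f1 \<sigma>' e) = f1 \<sigma>' e" by (simp add: thom_trunc[OF th1[OF s']])
  qed
  have f1_nz: "f1 \<sigma> e \<noteq> 0" if "\<sigma> \<in> Gal" for \<sigma> e by (rule thom_nonzero[OF th1[OF that]])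

  \<comment> \<open>Orders give a cocycle with values in an induced module\<close>
  define lift where "lift \<rho> = (SOME \<sigma>. \<sigma> \<in> Gal \<and> ?r \<sigma> = \<rho>)" for \<rho>
  have lift: "lift \<rho> \<in> Gal" "?r (lift \<rho>) = \<rho>" if "\<rho> \<in> Gal" for \<rho>
    using someI_ex[of "\<lambda>\<sigma>. \<sigma> \<in> Gal \<and> ?r \<sigma> = \<rho>"] gal_res_surj_ratfun[OF \<tau> that] by (auto simp: lift_def)
  \<comment> \<open>By \<open>f1_res\<close> the order does not depend on the lift, so
    \<open>m\<close> is a function on the Galois group of \<open>k\<close>.\<close>
  define m where "m \<rho> s e = kord \<tau> s (f1 (lift \<rho>) e)" for \<rho> s e
  have m: "m (?r \<sigma>) s e = kord \<tau> s (f1 \<sigma> e)" if s: "\<sigma> \<in> Gal" for \<sigma> s e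
    using f1_res[of \<sigma> "lift (?r \<sigma>)"] lift[OF rG[OF s]] s by (simp add: m_def)
  have m_hom: "lattice_hom (m \<rho> s)" if "\<rho> \<in> Gal" for \<rho> s
    using lift(1)[OF that]
    by (simp add: lattice_hom_def m_def thom_add[OF th1] thom_trunc[OF th1] kord_mult[OF \<tau>] f1_Kt f1_nz)
  have m_coc: "m (\<rho> \<circ> \<rho>') (\<rho> s) (act \<rho> e) = m \<rho> (\<rho> s) (act \<rho> e) + m \<rho>' s e" if "\<rho> \<in> Gal" "\<rho>' \<in> Gal" for \<rho> \<rho>' s e
  proof -
    note l = lift[OF that(1)] and l' = lift[OF that(2)]
    have "m (\<rho> \<circ> \<rho>') (\<rho> s) (act \<rho> e) = kord \<tau> (\<rho> s) (f1 (lift \<rho> \<circ> lift \<rho>') (act \<rho> e))"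
      using m[of "lift \<rho> \<circ> lift \<rho>'"] l l' by (simp add: gal_comp gal_res_comp[OF \<tau>])
    also have "f1 (lift \<rho> \<circ> lift \<rho>') (act \<rho> e) = f1 (lift \<rho>) (act \<rho> e) * lift \<rho> (f1 (lift \<rho>') e)"
      using coc1[OF l(1) l'(1), of e] l by simp
    also have "kord \<tau> (\<rho> s) \<dots> = kord \<tau> (\<rho> s) (f1 (lift \<rho>) (act \<rho> e)) + kord \<tau> (\<rho> s) (lift \<rho> (f1 (lift \<rho>') e))"
      using l l' by (intro kord_mult[OF \<tau>]) (auto simp: f1_Kt f1_nz gal_Kt[OF \<tau>] ring_hom_eq_0_iff gal_hom)
    also have "kord \<tau> (\<rho> s) (lift \<rho> (f1 (lift \<rho>') e)) = kord \<tau> s (f1 (lift \<rho>') e)"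
      using kord_gal[OF \<tau> l(1) f1_Kt[OF l'(1)] f1_nz[OF l'(1)], of s] l by simp
    finally show ?thesis by (simp only: m_def[of \<rho>] m_def[of \<rho>'])
  qed
  have finf1: "finite (f1 ` Gal)" by (rule lattice_cocycle_finite_image[OF f1 \<tau>])
  have m_fin: "finite ((\<lambda>\<rho>. m \<rho> s) ` Gal)" for s
  proof (rule finite_subset)
    show "(\<lambda>\<rho>. m \<rho> s) ` Gal \<subseteq> (\<lambda>g e. kord \<tau> s (g e)) ` (f1 ` Gal)"
    proof (rule image_subsetI)
      fix \<rho> :: "'k alg_closure \<Rightarrow> 'k alg_closure" assume "\<rho> \<in> Gal"
      then have "f1 (lift \<rho>) \<in> f1 ` Gal" using lift(1) by blast
      then show "m \<rho> s \<in> (\<lambda>g e. kord \<tau> s (g e)) ` (f1 ` Gal)"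
        by (rule rev_image_eqI) (rule ext, rule m_def)
    qed
  qed (use finf1 in simp)
  \<comment> \<open>All zeros and poles of all values. The set is finite because \<open>f1\<close>
    has finite image and orders vanish on the lattice once they vanish on the \<open>n\<close> basis
    exponents.\<close>
  define S where "S = {s. \<exists>\<rho>\<in>Gal. \<exists>e. m \<rho> s e \<noteq> 0}"
  have S_fin: "finite S"
  proof (rule finite_subset)
    show "S \<subseteq> (\<Union>g\<in>f1 ` Gal. \<Union>i<n. {s. kord \<tau> s (g (Poly_Mapping.single i 1)) \<noteq> 0})"
    proof
      fix s assume "s \<in> S"
      then obtain \<rho> e where re: "\<rho> \<in> Gal" "m \<rho> s e \<noteq> 0" by (auto simp: S_def)
      then obtain i where "i < n" "m \<rho> s (Poly_Mapping.single i 1) \<noteq> 0" using lattice_hom_zero[OF m_hom] by blast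
      then show "s \<in> (\<Union>g\<in>f1 ` Gal. \<Union>i<n. {s. kord \<tau> s (g (Poly_Mapping.single i 1)) \<noteq> 0})"
        using lift(1)[OF re(1)] unfolding m_def by blast
    qed
    show "finite (\<Union>g\<in>f1 ` Gal. \<Union>i<n. {s. kord \<tau> s (g (Poly_Mapping.single i 1)) \<noteq> 0})"
      using finf1 by (intro finite_UN_I finite_lessThan) (auto intro!: kord_finite[OF \<tau>] simp: f1_Kt f1_nz)
  qed
  have S_stable: "\<rho> s \<in> S" if "\<rho> \<in> Gal" "s \<in> S" for \<rho> s
  proof -
    obtain \<rho>' e where "\<rho>' \<in> Gal" "m \<rho>' s e \<noteq> 0" using \<open>s \<in> S\<close> by (auto simp: S_def)
    then have "m (\<rho> \<circ> \<rho>') (\<rho> s) (act \<rho> e) \<noteq> 0 \<or> m \<rho> (\<rho> s) (act \<rho> e) \<noteq> 0"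
      using m_coc[OF that(1), of \<rho>' s e] by auto
    then show ?thesis unfolding S_def using gal_comp[OF that(1) \<open>\<rho>' \<in> Gal\<close>] that(1) by blast
  qed
  have S_iff: "\<rho> s \<in> S \<longleftrightarrow> s \<in> S" if "\<rho> \<in> Gal" for \<rho> s
    using S_stable[OF that] S_stable[OF gal_inv[OF that], of "\<rho> s"] by (auto simp: gal_inv_apply that)
  obtain W where W: "\<And>s. s \<in> S \<Longrightarrow> lattice_hom (W s)"
    "\<And>\<rho> s e. \<rho> \<in> Gal \<Longrightarrow> s \<in> S \<Longrightarrow> W (\<rho> s) (act \<rho> e) + m \<rho> (\<rho> s) (act \<rho> e) = W s e"
    using induced_cochar_coboundary[OF acyc m_hom m_fin m_coc, of S] S_stable by blast

  \<comment> \<open>The product over \<open>S\<close> of cocharacters evaluated at linear polynomials removes all zeros and poles\<close>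
  define z where "z e = (\<Prod>s\<in>S. (tt - \<tau> s) powi W s e)" for e
  have z_fac: "(tt - \<tau> s) powi w \<in> ?Kt \<and> (tt - \<tau> s) powi w \<noteq> 0" for s w
    using kord_powi[OF \<tau> kord_linear(1,2)[OF \<tau>]] by blast
  have z_Kt: "z e \<in> ?Kt" "z e \<noteq> 0" for e
    using kord_prod[OF \<tau>, of S "\<lambda>s. (tt - \<tau> s) powi W s e"] z_fac by (auto simp: z_def)
  have z_ord: "kord \<tau> s (z e) = (if s \<in> S then W s e else 0)" for s e
  proof -
    have "kord \<tau> s (z e) = (\<Sum>a\<in>S. kord \<tau> s ((tt - \<tau> a) powi W a e))"
      using kord_prod[OF \<tau>, of S "\<lambda>s. (tt - \<tau> s) powi W s e" s] z_fac by (simp add: z_def)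
    also have "\<dots> = (\<Sum>a\<in>S. if a = s then W a e else 0)"
      using kord_powi[OF \<tau> kord_linear(1,2)[OF \<tau>]] by (intro sum.cong refl) (auto simp: kord_linear[OF \<tau>])
    also have "\<dots> = (if s \<in> S then W s e else 0)" using S_fin by simp
    finally show ?thesis .
  qed
  have z: "thom n z"
  proof -
    have "thom n (\<lambda>e. (tt - \<tau> s) powi W s e)" if "s \<in> S" for s
      by (rule lattice_hom_thom[OF W(1)[OF that] kord_linear(2)[OF \<tau>]])
    then show ?thesis by (simp add: thom_def z_def prod.distrib)
  qed
  \<comment> \<open>With the inverse, and exponents suppressed, the order of the new cocycle at
    \<open>\<rho> s\<close> becomes \<open>m \<rho> (\<rho> s) - W s + W (\<rho> s)\<close>, which
    vanishes by the choice of \<open>W\<close>.\<close>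
  define h2 where "h2 e = inverse (z e)" for e
  have h2: "thom n h2" unfolding h2_def by (rule thom_inverse[OF z])
  have h2_Kt: "h2 e \<in> ?Kt" "h2 e \<noteq> 0" for e
    using z_Kt intermediate_inverse[OF Kt z_Kt(1)] by (auto simp: h2_def)
  have h2_ord: "kord \<tau> s (h2 e) = - kord \<tau> s (z e)" for s e unfolding h2_def by (rule kord_inverse[OF \<tau> z_Kt])
  obtain c2 where c2: "c2 \<in> carrier E.Z" "E.cls c2 = E.cls c1"
    and c2eq: "\<And>\<sigma> e. \<sigma> \<in> Gal \<Longrightarrow> h2 (act (?r \<sigma>) e) * chi \<tau> (c2 \<sigma>) (act (?r \<sigma>) e) = f1 \<sigma> (act (?r \<sigma>) e) * \<sigma> (h2 e)"
    using coboundary_modify[OF \<tau> _ h2, of c1] c1(1) by (auto simp: E.galZ1_eq E.galB1_eq f1_def)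
  define f2 where "f2 = (\<lambda>\<sigma>. chi \<tau> (c2 \<sigma>))"
  have f2_app: "f2 \<sigma> = chi \<tau> (c2 \<sigma>)" for \<sigma> by (simp add: f2_def)
  have f2: "lattice_cocycle \<tau> f2" using cocycle_lattice[OF \<tau> c2(1)] by (simp add: f2_def)
  then obtain Y2 where th2: "\<And>\<sigma>. \<sigma> \<in> Gal \<Longrightarrow> thom n (f2 \<sigma>)"
    and coc2: "\<And>\<sigma> \<sigma>' e. \<sigma> \<in> Gal \<Longrightarrow> \<sigma>' \<in> Gal \<Longrightarrow> f2 (\<sigma> \<circ> \<sigma>') (act (?r \<sigma>) e) = f2 \<sigma> (act (?r \<sigma>) e) * \<sigma> (f2 \<sigma>' e)"
    and Y2: "finite Y2" "\<And>\<sigma> e. \<sigma> \<in> Gal \<Longrightarrow> (\<forall>x\<in>Y2. \<sigma> x = x) \<Longrightarrow> f2 \<sigma> e = 1"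
    unfolding lattice_cocycle_def[OF \<tau>] by blast
  have f2eq: "f2 \<sigma> (act (?r \<sigma>) e) = f1 \<sigma> (act (?r \<sigma>) e) * \<sigma> (h2 e) * inverse (h2 (act (?r \<sigma>) e))" if "\<sigma> \<in> Gal" for \<sigma> e
    using c2eq[OF that, of e, folded f2_app] h2_Kt(2)[of "act (?r \<sigma>) e"] by (simp add: field_simps)
  have f2_const: "f2 \<sigma> (act (?r \<sigma>) e) \<in> range \<tau>" if s: "\<sigma> \<in> Gal" for \<sigma> e
  proof (rule kord_all_zero[OF \<tau>])
    let ?\<rho> = "?r \<sigma>"
    have \<rho>: "?\<rho> \<in> Gal" by (rule rG[OF s])
    have K: "f1 \<sigma> (act ?\<rho> e) \<in> ?Kt" "f1 \<sigma> (act ?\<rho> e) \<noteq> 0" "\<sigma> (h2 e) \<in> ?Kt" "\<sigma> (h2 e) \<noteq> 0"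
      "inverse (h2 (act ?\<rho> e)) \<in> ?Kt" "inverse (h2 (act ?\<rho> e)) \<noteq> 0"
      using s f1_Kt f1_nz h2_Kt gal_Kt[OF \<tau> s] intermediate_inverse[OF Kt] by (auto simp: ring_hom_eq_0_iff gal_hom)
    show "f2 \<sigma> (act ?\<rho> e) \<in> ?Kt" "f2 \<sigma> (act ?\<rho> e) \<noteq> 0"
      unfolding f2eq[OF s] using K by (auto intro!: intermediate_mult[OF Kt])
    fix s'
    \<comment> \<open>Every point has the form \<open>\<rho> s0\<close>, the shape in which
      \<open>W\<close> and \<open>m\<close> are related.\<close>
    define s0 where "s0 = inv_into UNIV ?\<rho> s'"
    have s': "s' = ?\<rho> s0" by (simp add: s0_def gal_inv_apply \<rho>)
    have "kord \<tau> (?\<rho> s0) (f2 \<sigma> (act ?\<rho> e)) =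
        kord \<tau> (?\<rho> s0) (f1 \<sigma> (act ?\<rho> e)) + kord \<tau> (?\<rho> s0) (\<sigma> (h2 e)) + kord \<tau> (?\<rho> s0) (inverse (h2 (act ?\<rho> e)))"
      unfolding f2eq[OF s] using K by (simp add: kord_mult[OF \<tau>] intermediate_mult[OF Kt])
    also have "\<dots> = m ?\<rho> (?\<rho> s0) (act ?\<rho> e) - kord \<tau> s0 (z e) + kord \<tau> (?\<rho> s0) (z (act ?\<rho> e))"
      using kord_gal[OF \<tau> s h2_Kt, of s0] by (simp add: m[OF s] kord_inverse[OF \<tau> h2_Kt] h2_ord)
    also have "\<dots> = 0"
    proof (cases "s0 \<in> S")
      case True
      then show ?thesis using W(2)[OF \<rho> True, of e] S_iff[OF \<rho>] by (simp add: z_ord)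
    next
      case False
      then have "?\<rho> s0 \<notin> S" using S_iff[OF \<rho>] by simp
      then have "m ?\<rho> (?\<rho> s0) (act ?\<rho> e) = 0" using \<rho> unfolding S_def by blast
      then show ?thesis using False \<open>?\<rho> s0 \<notin> S\<close> by (simp add: z_ord)
    qed
    finally show "kord \<tau> s' (f2 \<sigma> (act ?\<rho> e)) = 0" by (simp add: s')
  qed
  have f2_res: "f2 \<sigma>' = f2 \<sigma>" if s: "\<sigma> \<in> Gal" "\<sigma>' \<in> Gal" "?r \<sigma>' = ?r \<sigma>" for \<sigma> \<sigma>'
  proof (rule act_surj[OF rG[OF s(1)] th2[OF s(2)] th2[OF s(1)]])
    fix e
    have "\<sigma>' (h2 e) = \<sigma> (h2 e)" by (rule gal_Kt_cong[OF \<tau> s(2,1) s(3) h2_Kt(1)])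
    then show "f2 \<sigma>' (act (?r \<sigma>) e) = f2 \<sigma> (act (?r \<sigma>) e)"
      using f2eq[OF s(1), of e] f2eq[OF s(2), of e] f1_res[OF s] by (simp add: s(3))
  qed

  define \<alpha> where "\<alpha> \<rho> e = inv_into UNIV \<tau> (f2 (lift \<rho>) e)" for \<rho> e
  have \<tau>\<alpha>: "\<tau> (\<alpha> (?r \<sigma>) e) = f2 \<sigma> e" if s: "\<sigma> \<in> Gal" for \<sigma> e
  proof -
    note \<rho> = rG[OF s]
    have "f2 \<sigma> e = f2 \<sigma> (act (?r \<sigma>) (act (inv_into UNIV (?r \<sigma>)) e))"
      by (simp add: act_inv \<rho> thom_trunc[OF th2[OF s]])
    also have "\<dots> \<in> range \<tau>" by (rule f2_const[OF s])
    finally have "f2 \<sigma> e \<in> range \<tau>" .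
    moreover have "f2 (lift (?r \<sigma>)) = f2 \<sigma>" using lift[OF \<rho>] s by (intro f2_res) auto
    ultimately show ?thesis by (simp add: \<alpha>_def f_inv_into_f)
  qed
  have \<tau>inj: "\<tau> x = \<tau> y \<longleftrightarrow> x = y" for x y by (rule ac_embedding_eq_iff[OF \<tau>])
  have "lattice_cocycle id \<alpha>"
    unfolding lattice_cocycle_def[OF ac_embedding_id] gal_res_id_embedding
  proof (intro conjI ballI allI)
    fix \<rho> :: "'k alg_closure \<Rightarrow> 'k alg_closure" assume \<rho>: "\<rho> \<in> Gal"
    note l = lift[OF \<rho>]
    have eq: "\<tau> (\<alpha> \<rho> e) = f2 (lift \<rho>) e" for e using \<tau>\<alpha>[OF l(1)] l(2) by simp
    show "thom n (\<alpha> \<rho>)"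
      unfolding thom_def
    proof (intro conjI allI)
      show "\<alpha> \<rho> 0 = 1" by (rule \<tau>inj[THEN iffD1]) (simp add: eq thom_0[OF th2[OF l(1)]] ring_hom_1 \<tau>h)
      show "\<alpha> \<rho> (d + e) = \<alpha> \<rho> d * \<alpha> \<rho> e" for d e
        by (rule \<tau>inj[THEN iffD1]) (simp add: eq thom_add[OF th2[OF l(1)]] ring_hom_mult \<tau>h)
      show "\<alpha> \<rho> (trunc n e) = \<alpha> \<rho> e" for e
        by (rule \<tau>inj[THEN iffD1]) (simp add: eq thom_trunc[OF th2[OF l(1)]])
    qed
    fix \<rho>' :: "'k alg_closure \<Rightarrow> 'k alg_closure" and e assume \<rho>': "\<rho>' \<in> Gal"
    note l' = lift[OF \<rho>']
    have "\<tau> (\<alpha> (\<rho> \<circ> \<rho>') (act \<rho> e)) = f2 (lift \<rho> \<circ> lift \<rho>') (act \<rho> e)"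
      using \<tau>\<alpha>[of "lift \<rho> \<circ> lift \<rho>'"] l l' by (simp add: gal_comp gal_res_comp[OF \<tau>])
    also have "\<dots> = f2 (lift \<rho>) (act \<rho> e) * lift \<rho> (f2 (lift \<rho>') e)"
      using coc2[OF l(1) l'(1), of e] l by simp
    also have "\<dots> = \<tau> (\<alpha> \<rho> (act \<rho> e)) * lift \<rho> (\<tau> (\<alpha> \<rho>' e))"
      using \<tau>\<alpha>[OF l'(1)] l'(2) by (simp add: eq)
    also have "lift \<rho> (\<tau> (\<alpha> \<rho>' e)) = \<tau> (\<rho> (\<alpha> \<rho>' e))"
      using gal_res_apply[OF \<tau> l(1), of "\<alpha> \<rho>' e"] l(2) by simp
    finally have "\<tau> (\<alpha> (\<rho> \<circ> \<rho>') (act \<rho> e)) = \<tau> (\<alpha> \<rho> (act \<rho> e) * \<rho> (\<alpha> \<rho>' e))"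
      by (simp only: ring_hom_mult[OF \<tau>h])
    then show "\<alpha> (\<rho> \<circ> \<rho>') (act \<rho> e) = \<alpha> \<rho> (act \<rho> e) * \<rho> (\<alpha> \<rho>' e)"
      by (simp only: \<tau>inj)
  next
    \<comment> \<open>Continuity over \<open>k\<close>: \<open>f2\<close> is trivial on the
      stabilizer of \<open>\<zeta>\<close>. If \<open>\<rho>\<close> fixes the coefficients of all
      numerators and denominators in the minimal polynomial of \<open>\<zeta>\<close> over the
      compositum, a lift of \<open>\<rho>\<close> sends \<open>\<zeta>\<close> to another root, and
      an automorphism over the compositum moves that root back; the corrected lift fixes
      \<open>\<zeta>\<close>.\<close>
    obtain \<zeta> where \<zeta>: "\<And>\<sigma>. \<sigma> \<in> Gal \<Longrightarrow> \<sigma> \<zeta> = \<zeta> \<Longrightarrow> (\<forall>x\<in>Y2. \<sigma> x = x)" using primitive_element[OF Y2(1)] by blast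
    obtain q where q: "minpoly_on ?Kt \<zeta> q" using minpoly_on_exists[OF Kt] by blast
    then have q': "coeffs_in ?Kt q" "poly q \<zeta> = 0" by (auto simp: minpoly_on_def[OF Kt])
    have "\<forall>i. \<exists>p r. r \<noteq> 0 \<and> coeff q i = pv \<tau> p / pv \<tau> r"
      using q'(1) KtE[OF \<tau>] unfolding coeffs_in_def by metis
    then obtain p r where pr: "\<And>i. r i \<noteq> 0" "\<And>i. coeff q i = pv \<tau> (p i) / pv \<tau> (r i)" by metis
    define Y' where "Y' = (\<Union>i\<le>degree q. set (coeffs (p i)) \<union> set (coeffs (r i)))"
    show "\<exists>Y. finite Y \<and> (\<forall>\<rho>\<in>Gal. (\<forall>x\<in>Y. \<rho> x = x) \<longrightarrow> (\<forall>e. \<alpha> \<rho> e = 1))"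
    proof (intro exI[of _ Y'] conjI ballI impI allI)
      show "finite Y'" by (auto simp: Y'_def)
      fix \<rho> :: "'k alg_closure \<Rightarrow> 'k alg_closure" and e assume \<rho>: "\<rho> \<in> Gal" and fixY: "\<forall>x\<in>Y'. \<rho> x = x"
      define \<sigma>0 where "\<sigma>0 = lift \<rho>"
      have s0: "\<sigma>0 \<in> Gal" "?r \<sigma>0 = \<rho>" unfolding \<sigma>0_def by (rule lift[OF \<rho>])+
      have map: "map_poly \<rho> u = u" if "set (coeffs u) \<subseteq> Y'" for u
      proof (rule poly_eqI)
        fix i show "coeff (map_poly \<rho> u) i = coeff u i"
        proof (cases "coeff u i = 0")
          case False
          then have "u \<noteq> 0" "i \<le> degree u" by (auto intro: le_degree)
          then have "coeff u i \<in> Y'" using coeff_in_coeffs that by blast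
          then show ?thesis using fixY by (simp add: coeff_map_poly ring_hom_0 gal_hom \<rho>)
        qed (simp add: coeff_map_poly ring_hom_0 gal_hom \<rho>)
      qed
      have "\<sigma>0 (coeff q i) = coeff q i" for i
      proof (cases "i \<le> degree q")
        case True
        then have "map_poly \<rho> (p i) = p i" "map_poly \<rho> (r i) = r i" by (auto intro!: map simp: Y'_def)
        then show ?thesis
          using gal_hom[OF s0(1)] by (simp add: pr(2) divide_inverse ring_hom_mult ring_hom_inverse gal_pv[OF \<tau> s0(1)] s0(2))
      next
        case False
        then show ?thesis by (simp add: coeff_eq_0 ring_hom_0 gal_hom s0)
      qed
      then have "map_poly \<sigma>0 q = q" by (intro poly_eqI) (simp add: coeff_map_poly ring_hom_0 gal_hom s0)
      then have "poly q (\<sigma>0 \<zeta>) = 0"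
        using ring_hom_poly[OF gal_hom[OF s0(1)], of q \<zeta>] q'(2) by (simp add: ring_hom_0 gal_hom s0)
      then obtain \<sigma>1 where s1: "\<sigma>1 \<in> Gal" "\<forall>x\<in>?Kt. \<sigma>1 x = x" "\<sigma>1 \<zeta> = \<sigma>0 \<zeta>"
        using conjugate_root[OF Kt q] by blast
      have r1: "?r \<sigma>1 = id" by (rule gal_res_eqI[OF \<tau>]) (use s1 emb_in_Kt[OF \<tau>] in auto)
      define \<sigma> where "\<sigma> = inv_into UNIV \<sigma>1 \<circ> \<sigma>0"
      have s: "\<sigma> \<in> Gal" using s0 s1 by (simp add: \<sigma>_def gal_comp gal_inv)
      have "\<sigma> \<zeta> = \<zeta>" using s1 by (simp add: \<sigma>_def gal_inv_apply flip: s1(3))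
      then have "f2 \<sigma> e = 1" using Y2(2)[OF s] \<zeta>[OF s] by blast
      moreover have "?r \<sigma> = \<rho>"
        using s0 s1 by (simp add: \<sigma>_def gal_res_comp[OF \<tau>] gal_inv gal_res_inv[OF \<tau>] r1)
      ultimately have "\<tau> (\<alpha> \<rho> e) = \<tau> 1" using \<tau>\<alpha>[OF s, of e] by (simp add: ring_hom_1 \<tau>h)
      then show "\<alpha> \<rho> e = 1" by (simp add: \<tau>inj)
    qed
  qed
  note \<alpha> = this
  define a where "a = (\<lambda>\<rho>\<in>Gal. pt id (\<alpha> \<rho>))"
  have a: "a \<in> carrier k.Z" unfolding a_def by (rule lattice_cocycle_cocycle[OF ac_embedding_id \<alpha>])
  have "c2 = res_along \<tau> a"
  proof (rule E.Z_extensional[OF c2(1) r.res_along_closed[OF a]])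
    fix \<sigma> :: "'k poly fract alg_closure \<Rightarrow> 'k poly fract alg_closure" assume s: "\<sigma> \<in> Gal"
    have \<rho>: "?r \<sigma> \<in> Gal" by (rule rG[OF s])
    have \<alpha>t: "thom n (\<alpha> (?r \<sigma>))" using \<alpha> \<rho> unfolding lattice_cocycle_def[OF ac_embedding_id] by blast
    have p: "c2 \<sigma> \<in> pts \<tau>" "res_along \<tau> a \<sigma> \<in> pts \<tau>"
      using E.Z_closed[OF c2(1) s] E.Z_closed[OF r.res_along_closed[OF a] s] by (simp_all add: Pt_carrier[OF \<tau>])
    have "chi \<tau> (res_along \<tau> a \<sigma>) e = f2 \<sigma> e" for e
      using s \<rho> chi_hom[OF \<tau>h, of id "pt id (\<alpha> (?r \<sigma>))" e]
      by (simp add: res_along_def a_def chi_pt[OF ring_hom_id(1) \<alpha>t] \<tau>\<alpha>)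
    then have "chi \<tau> (res_along \<tau> a \<sigma>) = chi \<tau> (c2 \<sigma>)" by (auto simp: f2_app)
    then show "c2 \<sigma> = res_along \<tau> a \<sigma>" using chi_inj[OF \<tau> p] by simp
  qed
  then have "E.cls c = E.cls (res_along \<tau> a)" using c1(2) c2(2) by simp
  then show ?thesis using a by (auto simp: k.galZ1_eq E.galZ1_eq E.galB1_eq)
qed

end

section \<open>Flasque tori\<close>

lemma single0_hom: "is_ring_hom (Poly_Mapping.single (0 :: 's::comm_monoid_add) :: 'r::comm_ring_1 \<Rightarrow> _)"
  by (simp add: is_ring_hom_def single_add mult_single)

lemma map_eq_ev:
  fixes f :: "'s::comm_monoid_add \<Rightarrow>\<^sub>0 'r::field"
  assumes "is_ring_hom \<rho>"
  shows "Poly_Mapping.map \<rho> f = ev (\<lambda>x. Poly_Mapping.single 0 (\<rho> x)) (\<lambda>i. Poly_Mapping.single i 1) f"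
proof (rule poly_mapping_eqI)
  fix k
  have "Poly_Mapping.lookup (ev (\<lambda>x. Poly_Mapping.single 0 (\<rho> x)) (\<lambda>i. Poly_Mapping.single i 1) f) k
      = (\<Sum>e\<in>Poly_Mapping.keys f. \<rho> (Poly_Mapping.lookup f e) when e = k)"
    by (simp add: ev_def mult_single lookup_sum lookup_single)
  also have "\<dots> = (if k \<in> Poly_Mapping.keys f then \<rho> (Poly_Mapping.lookup f k) else 0)"
    by (simp add: when_def)
  also have "\<dots> = Poly_Mapping.lookup (Poly_Mapping.map \<rho> f) k"
    by (simp add: Poly_Mapping.map.rep_eq in_keys_iff when_def)
  finally show "Poly_Mapping.lookup (Poly_Mapping.map \<rho> f) k = Poly_Mapping.lookup (ev (\<lambda>x. Poly_Mapping.single 0 (\<rho> x)) (\<lambda>i. Poly_Mapping.single i 1) f) k" ..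
qed

lemma map_hom:
  assumes "is_ring_hom (\<rho> :: 'r::field \<Rightarrow> 'r)" shows "is_ring_hom (Poly_Mapping.map \<rho> :: ('s::comm_monoid_add \<Rightarrow>\<^sub>0 'r) \<Rightarrow> _)"
proof -
  have "is_ring_hom (ev (\<lambda>x. Poly_Mapping.single (0::'s) (\<rho> x)) (\<lambda>i. Poly_Mapping.single i 1))"
    using ring_hom_comp[OF single0_hom assms] by (intro ev_hom) (auto simp: comp_def mult_single)
  moreover have "Poly_Mapping.map \<rho> = ev (\<lambda>x. Poly_Mapping.single (0::'s) (\<rho> x)) (\<lambda>i. Poly_Mapping.single i 1)"
    by (rule ext) (rule map_eq_ev[OF assms])
  ultimately show ?thesis by simp
qed

context torus_splitting
begin

abbreviation "j0 \<equiv> Poly_Mapping.single (0::int) :: 'k alg_closure \<Rightarrow> _"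

text \<open>The one-parameter subgroup on which the character \<open>e\<close> becomes the monomial
  of degree \<open>b e\<close>.\<close>

definition cochar :: "((nat \<Rightarrow>\<^sub>0 int) \<Rightarrow> int) \<Rightarrow> 'a \<Rightarrow> (int \<Rightarrow>\<^sub>0 'k alg_closure)" where
  "cochar b = pt j0 (\<lambda>e. Poly_Mapping.single (b e) 1)"

lemma thom_single: assumes "lattice_hom b" shows "thom n (\<lambda>e. Poly_Mapping.single (b e) (1 :: 'k alg_closure))"
proof -
  have "b 0 = 0" using lattice_hom_add[OF assms, of 0 0] by simp
  then show ?thesis using assms by (simp add: thom_def lattice_hom_def mult_single)
qed

lemma chi_cochar: "lattice_hom b \<Longrightarrow> chi j0 (cochar b) e = Poly_Mapping.single (b e) 1"
  by (simp add: cochar_def chi_pt[OF single0_hom thom_single])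

lemma cochar_pts: "lattice_hom b \<Longrightarrow> cochar b \<in> pts j0"
  unfolding cochar_def by (intro pt_in single0_hom thom_single)

lemma cochar_inj:
  assumes "lattice_hom b" "lattice_hom b'" "cochar b = cochar b'" shows "b = b'"
proof
  fix e
  have "Poly_Mapping.single (b e) (1 :: 'k alg_closure) = Poly_Mapping.single (b' e) 1"
    using chi_cochar[OF assms(1), of e] chi_cochar[OF assms(2), of e] assms(3) by simp
  then have "Poly_Mapping.lookup (Poly_Mapping.single (b e) (1 :: 'k alg_closure)) (b e) = Poly_Mapping.lookup (Poly_Mapping.single (b' e) 1) (b e)" by simp
  then show "b e = b' e" by (simp add: lookup_single when_def split: if_splits)
qed

lemma pts_eq_cochar:
  assumes b: "lattice_hom b" and \<gamma>: "\<gamma> \<in> pts j0" and eq: "\<And>e. chi j0 \<gamma> e = Poly_Mapping.single (b e) 1"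
  shows "\<gamma> = cochar b"
proof -
  have "chi j0 \<gamma> = (\<lambda>e. Poly_Mapping.single (b e) 1)" using eq by auto
  then show ?thesis using pt_chi[OF single0_hom \<gamma>] by (simp add: cochar_def)
qed

lemma lookup_cochar: "Poly_Mapping.lookup (cochar b a) d = ev id (\<lambda>e. if b e = d then 1 else 0) (\<Phi> a)"
  by (simp add: cochar_def pt_def ev_def lookup_sum mult_single lookup_single when_def) (auto intro!: sum.cong)

lemma cochar_in: assumes b: "lattice_hom b" shows "cochar b \<in> carrier (cocharacters G L)"
proof -
  have "comul_compatible G (cochar b)"
    unfolding comul_compatible_def lookup_cochar
  proof (intro allI)
    fix a d e
    have "(\<lambda>x. (if b x = d then 1 else 0) * (if b x = e then 1 else 0 :: 'k alg_closure)) =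
        (if d = e then (\<lambda>x. if b x = d then 1 else 0) else (\<lambda>_. 0))" by auto
    moreover have "ev id (\<lambda>_. 0) (\<Phi> a) = 0" by (simp add: ev_def)
    ultimately show "tensor_eval (\<lambda>x y. ev id (\<lambda>e. if b e = d then 1 else 0) (\<Phi> x) * ev id (\<lambda>ea. if b ea = e then 1 else 0) (\<Phi> y)) (comul G a) =
       (if d = e then ev id (\<lambda>e. if b e = d then 1 else 0) (\<Phi> a) else 0)"
      unfolding comul_ev[OF \<Phi>_comul ring_hom_id(1)] by simp
  qed
  moreover have "Poly_Mapping.lookup (cochar b a) d \<in> L" for a d
    unfolding lookup_cochar ev_def
    by (rule intermediate_sum[OF L]) (use \<Phi>_lookup intermediate_0[OF L] in \<open>auto simp: intermediate_mult[OF L]\<close>)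
  moreover have "is_alg_hom (strct G) (\<lambda>c. Poly_Mapping.single 0 (to_ac c)) (cochar b)"
    using cochar_pts[OF b] by (simp add: pts_def comp_def)
  ultimately show ?thesis by (auto simp: cocharacters_def)
qed

text \<open>Specialising the variable to \<open>t\<close> gives points depending multiplicatively on
  \<open>t\<close>. At the powers of 2 a character value thus has power sums that are powers of one
  number, so it is a monomial, and its degree is additive in the exponent.\<close>

lemma cocharacter_cases:
  assumes \<gamma>: "\<gamma> \<in> carrier (cocharacters G L)"
  shows "\<exists>b. lattice_hom b \<and> \<gamma> = cochar b"
proof -
  have \<gamma>p: "\<gamma> \<in> pts j0" and \<gamma>c: "comul_compatible G \<gamma>"
    using \<gamma> by (auto simp: cocharacters_def pts_def comp_def)
  define E where "E t = ev id (\<lambda>i. t powi i)" for t :: "'k alg_closure"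
  have E: "is_ring_hom (E t)" if "t \<noteq> 0" for t
    unfolding E_def using that by (intro ev_hom ring_hom_id) (auto simp: power_int_add)
  have Ej: "E t \<circ> j0 = id" for t by (auto simp: E_def ev_single ring_hom_id)
  have Ep: "E t \<circ> \<gamma> \<in> pts id" if "t \<noteq> 0" for t
  proof (rule hom_point[where \<rho> = id and j = j0])
    show "E t (j0 x) = id (id x)" for x using Ej[of t] by (metis comp_apply id_apply)
  qed (use E[OF that] \<gamma>p in auto)
  have chiE: "chi id (E t \<circ> \<gamma>) e = E t (chi j0 \<gamma> e)" if "t \<noteq> 0" for t e
    using chi_hom[OF E[OF that], of j0 \<gamma> e] by (simp add: Ej)
  have mult: "E (t * t') (chi j0 \<gamma> e) = E t (chi j0 \<gamma> e) * E t' (chi j0 \<gamma> e)" if "t \<noteq> 0" "t' \<noteq> 0" for t t' e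
  proof -
    have "(E t \<circ> \<gamma>) \<otimes>\<^bsub>points G (to_ac \<circ> id)\<^esub> (E t' \<circ> \<gamma>) = E (t * t') \<circ> \<gamma>"
      by (rule ext) (simp add: points_def E_def comul_ev[OF \<gamma>c ring_hom_id(1)] power_int_mult_distrib)
    then show ?thesis
      using chi_mult[OF ac_embedding_id Ep[OF that(1)] Ep[OF that(2)], of e] that by (simp add: chiE)
  qed
  have "\<exists>b. chi j0 \<gamma> e = Poly_Mapping.single b 1" for e
  proof (rule group_like_is_single)
    show "inj_on (\<lambda>i. (2::'k alg_closure) powi i) (Poly_Mapping.keys (chi j0 \<gamma> e))"
      by (auto simp: inj_on_def two_powi_eq_iff)
    have nz: "E 1 (chi j0 \<gamma> e) \<noteq> 0"
      using thom_nonzero[OF chi_thom[OF ring_hom_id(1) Ep[of 1]], of e] by (simp add: chiE)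
    have "E (2 ^ m) (chi j0 \<gamma> e) = E 2 (chi j0 \<gamma> e) ^ m" for m
    proof (induction m)
      case 0
      have "E 1 (chi j0 \<gamma> e) * E 1 (chi j0 \<gamma> e) = E 1 (chi j0 \<gamma> e)" using mult[of 1 1 e] by simp
      then show ?case using nz by simp
    next
      case (Suc m)
      then show ?case using mult[of 2 "2 ^ m" e] by simp
    qed
    moreover have "E (2 ^ m) (chi j0 \<gamma> e) = (\<Sum>i\<in>Poly_Mapping.keys (chi j0 \<gamma> e). Poly_Mapping.lookup (chi j0 \<gamma> e) i * ((2::'k alg_closure) powi i) ^ m)" for m
    proof -
      have "((2::'k alg_closure) ^ m) powi i = (2 powi i) ^ m" for i
        using power_int_power[of "2 :: 'k alg_closure" m i] power_int_power'[of "2 :: 'k alg_closure" i m] by (simp add: mult.commute)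
      then show ?thesis by (simp add: E_def ev_def)
    qed
    ultimately show "(\<Sum>i\<in>Poly_Mapping.keys (chi j0 \<gamma> e). Poly_Mapping.lookup (chi j0 \<gamma> e) i * ((2::'k alg_closure) powi i) ^ m) = E 2 (chi j0 \<gamma> e) ^ m" for m
      by simp
  qed
  then obtain b where b: "\<And>e. chi j0 \<gamma> e = Poly_Mapping.single (b e) 1" by metis
  have t: "thom n (chi j0 \<gamma>)" by (rule chi_thom[OF single0_hom \<gamma>p])
  have s: "Poly_Mapping.single i (1 :: 'k alg_closure) = Poly_Mapping.single i' 1 \<Longrightarrow> i = i'" for i i' :: int
    by (metis keys_single singleton_inject zero_neq_one)
  have "lattice_hom b"
    unfolding lattice_hom_def
  proof (intro conjI allI; rule s)
    show "Poly_Mapping.single (b (d + e)) (1 :: 'k alg_closure) = Poly_Mapping.single (b d + b e) 1" for d e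
      using thom_add[OF t, of d e] by (simp add: b mult_single)
    show "Poly_Mapping.single (b (trunc n e)) (1 :: 'k alg_closure) = Poly_Mapping.single (b e) 1" for e
      using thom_trunc[OF t, of e] by (simp add: b)
  qed
  then show ?thesis using pts_eq_cochar[OF _ \<gamma>p b] by blast
qed

lemma cochar_mult: "lattice_hom b \<Longrightarrow> lattice_hom b' \<Longrightarrow> cochar b \<otimes>\<^bsub>cocharacters G L\<^esub> cochar b' = cochar (\<lambda>e. b e + b' e)"
proof -
  have "cochar b \<otimes>\<^bsub>cocharacters G L\<^esub> cochar b' = cochar b \<otimes>\<^bsub>points G (j0 \<circ> to_ac)\<^esub> cochar b'"
    by (simp add: cocharacters_def points_def)
  also have "\<dots> = cochar (\<lambda>e. b e + b' e)"
    by (simp add: cochar_def points_mult_pt[OF single0_hom] mult_single)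
  finally show ?thesis .
qed

lemma cochar_one: "\<one>\<^bsub>cocharacters G L\<^esub> = cochar (\<lambda>_. 0)"
proof -
  have "\<one>\<^bsub>cocharacters G L\<^esub> = \<one>\<^bsub>points G (j0 \<circ> to_ac)\<^esub>" by (simp add: cocharacters_def points_def)
  then show ?thesis by (simp add: cochar_def one_point[OF single0_hom])
qed

lemma lattice_hom_sum: "lattice_hom b \<Longrightarrow> lattice_hom b' \<Longrightarrow> lattice_hom (\<lambda>e. b e + b' e)"
  and lattice_hom_uminus: "lattice_hom b \<Longrightarrow> lattice_hom (\<lambda>e. - b e)"
  and lattice_hom_0: "lattice_hom (\<lambda>_. 0)"
  by (auto simp: lattice_hom_def)

lemma cocharacters_comm_group: "comm_group (cocharacters G L)"
proof (rule comm_groupI)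
  fix x assume "x \<in> carrier (cocharacters G L)"
  then obtain b where b: "lattice_hom b" "x = cochar b" using cocharacter_cases by blast
  show "\<one>\<^bsub>cocharacters G L\<^esub> \<otimes>\<^bsub>cocharacters G L\<^esub> x = x"
    by (simp add: b cochar_one cochar_mult lattice_hom_0)
  show "\<exists>y\<in>carrier (cocharacters G L). y \<otimes>\<^bsub>cocharacters G L\<^esub> x = \<one>\<^bsub>cocharacters G L\<^esub>"
    by (rule bexI[OF _ cochar_in[OF lattice_hom_uminus[OF b(1)]]])
      (simp add: b cochar_one cochar_mult lattice_hom_uminus)
  fix y assume "y \<in> carrier (cocharacters G L)"
  then obtain b' where b': "lattice_hom b'" "y = cochar b'" using cocharacter_cases by blast
  show "x \<otimes>\<^bsub>cocharacters G L\<^esub> y \<in> carrier (cocharacters G L)"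
    by (simp add: b b' cochar_mult cochar_in lattice_hom_sum)
  show "x \<otimes>\<^bsub>cocharacters G L\<^esub> y = y \<otimes>\<^bsub>cocharacters G L\<^esub> x"
    by (simp add: b b' cochar_mult add.commute)
  fix z assume "z \<in> carrier (cocharacters G L)"
  then obtain b'' where b'': "lattice_hom b''" "z = cochar b''" using cocharacter_cases by blast
  show "x \<otimes>\<^bsub>cocharacters G L\<^esub> y \<otimes>\<^bsub>cocharacters G L\<^esub> z = x \<otimes>\<^bsub>cocharacters G L\<^esub> (y \<otimes>\<^bsub>cocharacters G L\<^esub> z)"
    by (simp add: b b' b'' cochar_mult lattice_hom_sum add.assoc)
qed (simp add: cochar_one cochar_in lattice_hom_0)

lemma cochar_inv: assumes "lattice_hom b" shows "inv\<^bsub>cocharacters G L\<^esub> (cochar b) = cochar (\<lambda>e. - b e)"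
proof (rule group.inv_equality)
  show "group (cocharacters G L)" using cocharacters_comm_group by (simp add: comm_group_def)
qed (simp_all add: assms cochar_mult cochar_one cochar_in lattice_hom_uminus)

lemma cochar_gal:
  assumes \<rho>: "\<rho> \<in> Gal" and b: "lattice_hom b"
  shows "Poly_Mapping.map (restrict \<rho> L) \<circ> cochar b = cochar (\<lambda>e. b (act (inv_into UNIV \<rho>) e))"
proof -
  have r: "is_ring_hom \<rho>" using \<rho> by (rule gal_hom)
  have "Poly_Mapping.lookup (cochar b a) d \<in> L" for a d using cochar_in[OF b] by (auto simp: cocharacters_def)
  \<comment> \<open>Elements of \<open>gal L\<close> are extensional on \<open>L\<close>; the
    coefficients lie in \<open>L\<close>, where the restriction agrees with
    \<open>\<rho>\<close>.\<close>
  then have "Poly_Mapping.map (restrict \<rho> L) (cochar b a) = Poly_Mapping.map \<rho> (cochar b a)" for a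
    by (intro poly_mapping_eqI) (simp add: Poly_Mapping.map.rep_eq)
  then have eq: "Poly_Mapping.map (restrict \<rho> L) \<circ> cochar b = Poly_Mapping.map \<rho> \<circ> cochar b" by auto
  have p: "Poly_Mapping.map \<rho> \<circ> cochar b \<in> pts j0"
    by (rule hom_point[where \<rho> = \<rho> and j = j0]) (auto simp: map_hom r gal_to_ac \<rho> cochar_pts b ring_hom_0)
  show ?thesis unfolding eq
  proof (rule pts_eq_cochar[OF act_lattice_hom[OF gal_inv[OF \<rho>] b] p])
    fix e
    let ?e = "act (inv_into UNIV \<rho>) e"
    have "chi j0 (Poly_Mapping.map \<rho> \<circ> cochar b) (act \<rho> ?e) = Poly_Mapping.map \<rho> (chi j0 (cochar b) ?e)"
      by (rule chi_galois[OF map_hom[OF r] single0_hom single0_hom \<rho> _ cochar_pts[OF b]]) (simp add: ring_hom_0 r)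
    then show "chi j0 (Poly_Mapping.map \<rho> \<circ> cochar b) e = Poly_Mapping.single (b ?e) 1"
      by (simp add: act_inv \<rho> thom_trunc[OF chi_thom[OF single0_hom p]] chi_cochar b ring_hom_0 ring_hom_1 r)
  qed
qed

text \<open>On elements acting trivially on \<open>L\<close> the cocycle is a homomorphism to a
  torsion-free group with finite image, hence zero. It therefore descends to the image of
  \<open>N\<close> in \<open>gal L\<close>, to which the hypothesis applies.\<close>

theorem flasque_stabilizers_acyclic:
  assumes flasque: "\<And>H. subgroup H (gal L) \<Longrightarrow> trivial_group
     (H1 ((gal L)\<lparr>carrier := H\<rparr>) (discrete_topology H) (cocharacters G L) (\<lambda>\<sigma> \<gamma>. Poly_Mapping.map \<sigma> \<circ> \<gamma>))"
  shows stabilizers_acyclic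
  unfolding stabilizers_acyclic_def
proof (intro allI impI)
  fix N :: "('k alg_closure \<Rightarrow> 'k alg_closure) set" and m
  assume NG: "N \<subseteq> Gal" and Nid: "id \<in> N" and Ncomp: "\<forall>\<rho>\<in>N. \<forall>\<rho>'\<in>N. \<rho> \<circ> \<rho>' \<in> N" and Ninv: "\<forall>\<rho>\<in>N. inv_into UNIV \<rho> \<in> N"
    and hom: "\<forall>\<rho>\<in>N. lattice_hom (m \<rho>)" and fin: "finite (m ` N)"
    and coc: "\<forall>\<rho>\<in>N. \<forall>\<rho>'\<in>N. \<forall>e. m (\<rho> \<circ> \<rho>') (act \<rho> e) = m \<rho> (act \<rho> e) + m \<rho>' e"
  have G: "\<rho> \<in> Gal" if "\<rho> \<in> N" for \<rho> using NG that by blast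
  have m_triv: "m \<rho> e = 0" if \<rho>: "\<rho> \<in> N" and fixL: "\<And>x. x \<in> L \<Longrightarrow> \<rho> x = x" for \<rho> e
  proof -
    \<comment> \<open>Powers of \<open>\<rho>\<close> produce all multiples of
      \<open>m \<rho> e\<close>; a finite image forces this value to be 0.\<close>
    have pw: "(\<rho> ^^ i) \<in> N \<and> m (\<rho> ^^ i) e = int i * m \<rho> e" for i
    proof (induction i)
      case 0
      have "m (id \<circ> id) (act id e) = m id (act id e) + m id e" using coc Nid by blast
      then have "m id e = 0" using hom Nid by (simp add: act_id lattice_hom_trunc)
      then show ?case using Nid by (simp only: funpow.simps of_nat_0 mult_zero_left simp_thms)
    next
      case (Suc i)
      have tr: "act \<rho> e = trunc n e" using act_cong[of \<rho> id e] fixL by (simp add: act_id)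
      have N: "\<rho> \<circ> \<rho> ^^ i \<in> N" using Ncomp \<rho> Suc by blast
      have "m (\<rho> \<circ> \<rho> ^^ i) (act \<rho> e) = m \<rho> (act \<rho> e) + m (\<rho> ^^ i) e" using coc \<rho> Suc by blast
      then have "m (\<rho> \<circ> \<rho> ^^ i) e = m \<rho> e + int i * m \<rho> e"
        unfolding tr using Suc by (simp only: lattice_hom_trunc[OF hom[rule_format, OF \<rho>]] lattice_hom_trunc[OF hom[rule_format, OF N]])
      moreover have "m \<rho> e + int i * m \<rho> e = int (Suc i) * m \<rho> e" by (simp add: distrib_right)
      ultimately show ?case using N unfolding funpow.simps(2) by (intro conjI) (assumption, rule trans)
    qed
    have "finite ((\<lambda>i. int i * m \<rho> e) ` UNIV)"
    proof (rule finite_subset)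
      show "(\<lambda>i. int i * m \<rho> e) ` UNIV \<subseteq> (\<lambda>f. f e) ` (m ` N)"
      proof (rule image_subsetI)
        fix i show "int i * m \<rho> e \<in> (\<lambda>f. f e) ` (m ` N)"
          using pw[of i] by (intro image_eqI[of _ _ "m (\<rho> ^^ i)"]) auto
      qed
    qed (use fin in simp)
    then have "\<not> inj (\<lambda>i. int i * m \<rho> e)" using finite_imageD infinite_UNIV_nat by blast
    then show ?thesis by (auto simp: inj_on_def)
  qed
  have m_cong: "m \<rho>' = m \<rho>" if r: "\<rho> \<in> N" "\<rho>' \<in> N" and eq: "\<And>x. x \<in> L \<Longrightarrow> \<rho>' x = \<rho> x" for \<rho> \<rho>'
  proof
    fix e
    let ?u = "inv_into UNIV \<rho> \<circ> \<rho>'"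
    have u: "?u \<in> N" using Ncomp Ninv r by blast
    have "m ?u d = 0" for d by (rule m_triv[OF u]) (simp add: eq gal_inv_apply G r)
    moreover have "\<rho> \<circ> ?u = \<rho>'" using G[OF r(1)] by (simp add: gal_inv_comp flip: comp_assoc)
    ultimately have *: "m \<rho>' (act \<rho> d) = m \<rho> (act \<rho> d)" for d using coc[rule_format, OF r(1) u, of d] by simp
    show "m \<rho>' e = m \<rho> e"
      using *[of "act (inv_into UNIV \<rho>) e"] hom r by (simp add: act_inv G lattice_hom_trunc)
  qed
  have galL: "group (gal L)"
    using intermediate_add[OF L] intermediate_mult[OF L] L by (intro gal_group) (auto simp: intermediate_def)
  have resL: "restrict \<rho> L \<in> carrier (gal L)" if \<rho>: "\<rho> \<in> Gal" for \<rho>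
  proof -
    have "bij_betw \<rho> L L"
    proof (rule bij_betw_byWitness[where f' = "inv_into UNIV \<rho>"])
      show "\<rho> ` L \<subseteq> L" "inv_into UNIV \<rho> ` L \<subseteq> L" using L_gal[OF \<rho>] L_gal[OF gal_inv[OF \<rho>]] by auto
    qed (auto simp: gal_inv_apply \<rho>)
    then have "bij_betw (restrict \<rho> L) L L" by (rule bij_betw_cong[THEN iffD2, rotated]) simp
    moreover have "\<rho> (x + y) = \<rho> x + \<rho> y" "\<rho> (x * y) = \<rho> x * \<rho> y" "\<rho> (to_ac a) = to_ac a" for x y a
      using gal_hom[OF \<rho>] gal_to_ac[OF \<rho>] by (simp_all add: ring_hom_add ring_hom_mult)
    ultimately show ?thesis
      using intermediate_add[OF L] intermediate_mult[OF L] intermediate_to_ac[OF L]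
      unfolding gal_def Bij_def by simp
  qed
  have mem_Bij: "\<sigma> \<in> carrier (gal L) \<Longrightarrow> \<sigma> \<in> Bij L" for \<sigma> by (simp add: gal_def)
  have multL: "restrict \<rho> L \<otimes>\<^bsub>gal L\<^esub> restrict \<rho>' L = restrict (\<rho> \<circ> \<rho>') L" if "\<rho> \<in> Gal" "\<rho>' \<in> Gal" for \<rho> \<rho>'
    using mem_Bij[OF resL[OF that(1)]] mem_Bij[OF resL[OF that(2)]] L_gal[OF that(2)]
    by (auto simp: gal_def BijGroup_def compose_def)
  have oneL: "\<one>\<^bsub>gal L\<^esub> = restrict id L" by (auto simp: gal_def BijGroup_def)
  define H where "H = (\<lambda>\<rho>. restrict \<rho> L) ` N"
  have "subgroup H (gal L)"
  proof
    show "H \<subseteq> carrier (gal L)" using resL G by (auto simp: H_def)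
    show "\<one>\<^bsub>gal L\<^esub> \<in> H" unfolding oneL H_def using Nid by blast
    fix x assume "x \<in> H"
    then obtain \<rho> where \<rho>: "\<rho> \<in> N" "x = restrict \<rho> L" by (auto simp: H_def)
    have "inv\<^bsub>gal L\<^esub> x = restrict (inv_into UNIV \<rho>) L"
      by (rule group.inv_equality[OF galL])
        (use \<rho> G Ninv in \<open>simp_all add: multL resL gal_inv oneL gal_inv_comp\<close>)
    then show "inv\<^bsub>gal L\<^esub> x \<in> H" using \<rho> Ninv by (auto simp: H_def)
    fix y assume "y \<in> H"
    then obtain \<rho>' where \<rho>': "\<rho>' \<in> N" "y = restrict \<rho>' L" by (auto simp: H_def)
    have "x \<otimes>\<^bsub>gal L\<^esub> y = restrict (\<rho> \<circ> \<rho>') L" using \<rho> \<rho>' G by (simp add: multL)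
    then show "x \<otimes>\<^bsub>gal L\<^esub> y \<in> H" using Ncomp \<rho> \<rho>' by (auto simp: H_def)
  qed
  note triv = flasque[OF this]
  \<comment> \<open>A set-theoretic section of restriction; by \<open>m_cong\<close> the values of
    \<open>m\<close> do not depend on it.\<close>
  define rp where "rp g = (SOME \<rho>. \<rho> \<in> N \<and> restrict \<rho> L = g)" for g
  have m_rp: "m (rp (restrict \<rho> L)) = m \<rho>" if "\<rho> \<in> N" for \<rho>
  proof -
    have "rp (restrict \<rho> L) \<in> N \<and> restrict (rp (restrict \<rho> L)) L = restrict \<rho> L"
      unfolding rp_def by (rule someI[of _ \<rho>]) (use that in auto)
    then show ?thesis using that by (intro m_cong) (auto dest: fun_cong simp: restrict_def, metis)
  qed
  let ?\<Gamma> = "(gal L)\<lparr>carrier := H\<rparr>" and ?A = "cocharacters G L" and ?act = "\<lambda>\<sigma> \<gamma>. Poly_Mapping.map \<sigma> \<circ> \<gamma>"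
  define c where "c = (\<lambda>g\<in>H. cochar (m (rp g)))"
  have c_eq: "c (restrict \<rho> L) = cochar (m \<rho>)" if "\<rho> \<in> N" for \<rho>
    using that m_rp[OF that] by (simp add: c_def H_def)
  have rp: "rp g \<in> N" "restrict (rp g) L = g" if "g \<in> H" for g
  proof -
    have "\<exists>\<rho>. \<rho> \<in> N \<and> restrict \<rho> L = g" using that unfolding H_def by blast
    from someI_ex[OF this] show "rp g \<in> N" "restrict (rp g) L = g" unfolding rp_def by simp_all
  qed
  have c_app: "c g = cochar (m (rp g))" if "g \<in> H" for g using that by (simp add: c_def)
  have mh: "lattice_hom (m \<rho>)" if "\<rho> \<in> N" for \<rho> using hom that by blast
  have c_in: "c g \<in> carrier ?A" if "g \<in> H" for g
    unfolding c_app[OF that] by (rule cochar_in[OF mh[OF rp(1)[OF that]]])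
  have "c (g \<otimes>\<^bsub>?\<Gamma>\<^esub> h) = c g \<otimes>\<^bsub>?A\<^esub> ?act g (c h)" if gh: "g \<in> H" "h \<in> H" for g h
  proof -
    define \<rho> \<rho>' where "\<rho> = rp g" and "\<rho>' = rp h"
    have \<rho>: "\<rho> \<in> N" "g = restrict \<rho> L" "\<rho>' \<in> N" "h = restrict \<rho>' L"
      unfolding \<rho>_def \<rho>'_def using rp[OF gh(1)] rp[OF gh(2)] by simp_all
    have "m (\<rho> \<circ> \<rho>') e = m \<rho> e + m \<rho>' (act (inv_into UNIV \<rho>) e)" for e
      using coc[rule_format, OF \<rho>(1,3), of "act (inv_into UNIV \<rho>) e"] hom \<rho> Ncomp
      by (simp add: act_inv G lattice_hom_trunc)
    then have "m (\<rho> \<circ> \<rho>') = (\<lambda>e. m \<rho> e + m \<rho>' (act (inv_into UNIV \<rho>) e))" by auto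
    moreover have "g \<otimes>\<^bsub>?\<Gamma>\<^esub> h = restrict (\<rho> \<circ> \<rho>') L"
      using multL[OF G[OF \<rho>(1)] G[OF \<rho>(3)]] by (simp add: \<rho>(2,4))
    moreover have "\<rho> \<circ> \<rho>' \<in> N" using Ncomp \<rho> by blast
    moreover have "lattice_hom (m \<rho>)" "lattice_hom (m \<rho>')" using hom \<rho> by blast+
    ultimately show ?thesis
      using cochar_mult[OF \<open>lattice_hom (m \<rho>)\<close> act_lattice_hom[OF gal_inv[OF G[OF \<rho>(1)]] \<open>lattice_hom (m \<rho>')\<close>]]
      by (simp only: \<rho>(2,4) c_eq[OF \<rho>(1)] c_eq[OF \<rho>(3)] c_eq[of "\<rho> \<circ> \<rho>'"] cochar_gal[OF G[OF \<rho>(1)]])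
  qed
  then have cZ: "c \<in> carrier (Z1 ?\<Gamma> (discrete_topology H) ?A ?act)"
    using c_in by (auto simp: Z1_def c_def)
  \<comment> \<open>Triviality of the quotient identifies the coset of \<open>c\<close> with
    \<open>B1\<close>. That \<open>c\<close> lies in its own coset is checked next, with the
    coboundary of the neutral element.\<close>
  then have "B1 ?\<Gamma> ?A ?act #>\<^bsub>Z1 ?\<Gamma> (discrete_topology H) ?A ?act\<^esub> c = B1 ?\<Gamma> ?A ?act"
    using triv unfolding trivial_group_def H1_def FactGroup_def RCOSETS_def by auto
  moreover have "c \<in> B1 ?\<Gamma> ?A ?act #>\<^bsub>Z1 ?\<Gamma> (discrete_topology H) ?A ?act\<^esub> c"
  proof -
    define b where "b = (\<lambda>g\<in>carrier ?\<Gamma>. inv\<^bsub>?A\<^esub> \<one>\<^bsub>?A\<^esub> \<otimes>\<^bsub>?A\<^esub> ?act g \<one>\<^bsub>?A\<^esub>)"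
    have "b \<in> B1 ?\<Gamma> ?A ?act" unfolding b_def B1_def by (auto simp: cochar_one cochar_in lattice_hom_0)
    moreover have "b \<otimes>\<^bsub>Z1 ?\<Gamma> (discrete_topology H) ?A ?act\<^esub> c = c"
    proof
      fix g show "(b \<otimes>\<^bsub>Z1 ?\<Gamma> (discrete_topology H) ?A ?act\<^esub> c) g = c g"
      proof (cases "g \<in> H")
        case True
        define \<rho> where "\<rho> = rp g"
        have \<rho>: "\<rho> \<in> N" "g = restrict \<rho> L" unfolding \<rho>_def using rp[OF True] by simp_all
        then have "b g = cochar (\<lambda>_. 0)"
          using True by (simp add: b_def cochar_one cochar_inv cochar_gal G lattice_hom_0 cochar_mult)
        then show ?thesis using True \<rho> hom by (simp add: Z1_def c_eq cochar_mult lattice_hom_0)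
      qed (simp add: Z1_def c_def)
    qed
    ultimately show ?thesis unfolding r_coset_def by force
  qed
  ultimately have "c \<in> B1 ?\<Gamma> ?A ?act" by simp
  then obtain w' where w': "w' \<in> carrier ?A" "c = (\<lambda>g\<in>H. inv\<^bsub>?A\<^esub> w' \<otimes>\<^bsub>?A\<^esub> ?act g w')" by (auto simp: B1_def)
  obtain w where w: "lattice_hom w" "w' = cochar w" using cocharacter_cases[OF w'(1)] by blast
  have "w (act \<rho> e) + m \<rho> (act \<rho> e) = w e" if \<rho>: "\<rho> \<in> N" for \<rho> e
  proof -
    have "restrict \<rho> L \<in> H" using \<rho> by (simp add: H_def)
    note lw = lattice_hom_uminus[OF w(1)] act_lattice_hom[OF gal_inv[OF G[OF \<rho>]] w(1)]
    have "cochar (m \<rho>) = cochar (\<lambda>e. - w e + w (act (inv_into UNIV \<rho>) e))"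
      using fun_cong[OF w'(2), of "restrict \<rho> L"] c_eq[OF \<rho>] \<open>restrict \<rho> L \<in> H\<close>
      by (simp add: w(2) cochar_inv[OF w(1)] cochar_gal[OF G[OF \<rho>] w(1)] cochar_mult[OF lw])
    then have "m \<rho> = (\<lambda>e. - w e + w (act (inv_into UNIV \<rho>) e))"
      by (rule cochar_inj[OF mh[OF \<rho>] lattice_hom_sum[OF lw]])
    then show ?thesis using w(1) G[OF \<rho>] by (simp add: act_inv lattice_hom_trunc)
  qed
  then show "\<exists>b. lattice_hom b \<and> (\<forall>\<rho>\<in>N. \<forall>e. b (act \<rho> e) + m \<rho> (act \<rho> e) = b e)" using w(1) by blast
qed

end

text \<open>The product of \<open>X - y\<close> over the orbit of \<open>x\<close> under
  \<open>gal L\<close> is invariant, so its coefficients lie in the base by the fixed field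
  condition. An automorphism of the whole closure sends \<open>x\<close> to a root of it, and all
  roots lie in \<open>L\<close>.\<close>

lemma finite_galois_normal:
  fixes L :: "'k::field alg_closure set"
  assumes L: "finite_galois L" and \<rho>: "\<rho> \<in> Gal" and x: "x \<in> L"
  shows "\<rho> x \<in> L"
proof -
  have iL: "intermediate L" using L by (auto simp: finite_galois_def intermediate_def)
  have fixd: "{x \<in> L. \<forall>\<sigma>\<in>carrier (gal L). \<sigma> x = x} = range to_ac" using L by (simp add: finite_galois_def)
  have s: "hom_on L \<sigma>" "\<sigma> (to_ac c) = to_ac c" "bij_betw \<sigma> L L" if "\<sigma> \<in> carrier (gal L)" for \<sigma> c
  proof -
    show "\<sigma> (to_ac c) = to_ac c" "bij_betw \<sigma> L L" using that by (auto simp: gal_def Bij_def)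
    have "\<sigma> (to_ac 1) = to_ac 1" "\<forall>x\<in>L. \<forall>y\<in>L. \<sigma> (x + y) = \<sigma> x + \<sigma> y \<and> \<sigma> (x * y) = \<sigma> x * \<sigma> y"
      using that by (simp_all add: gal_def del: to_ac_1)
    then show "hom_on L \<sigma>" unfolding hom_on_def to_ac_1 by blast
  qed
  obtain p where p: "p \<noteq> 0" "poly (map_poly to_ac p) x = 0" by (rule alg_closure_algebraic)
  have pL: "coeffs_in L (map_poly to_ac p)" by (auto simp: coeffs_in_def coeff_map_poly intermediate_to_ac[OF iL])
  define Q where "Q = (\<lambda>\<sigma>. \<sigma> x) ` carrier (gal L)"
  have "Q \<subseteq> {y. poly (map_poly to_ac p) y = 0}"
  proof
    fix y assume "y \<in> Q"
    then obtain \<sigma> where sg: "\<sigma> \<in> carrier (gal L)" "y = \<sigma> x" by (auto simp: Q_def)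
    have hp: "\<sigma> (poly q x) = poly (map_poly \<sigma> q) (\<sigma> x)" if "coeffs_in L q" for q
      using that
    proof (induction q)
      case (pCons a q)
      then have "a \<in> L" "coeffs_in L q"
        unfolding coeffs_in_def by (metis coeff_pCons_0) (metis coeff_pCons_Suc pCons.prems(1) coeffs_in_def)
      then show ?case using pCons.IH s(1)[OF sg(1)] x
        by (simp add: map_poly_pCons hom_on_0[OF iL] hom_on_add[OF iL] hom_on_mult[OF iL] intermediate_poly[OF iL] intermediate_mult[OF iL])
    qed (simp add: hom_on_0[OF iL s(1)[OF sg(1)]])
    have "map_poly \<sigma> (map_poly to_ac p) = map_poly to_ac p"
      using s[OF sg(1)] by (intro poly_eqI) (simp add: coeff_map_poly hom_on_0[OF iL])
    then show "y \<in> {y. poly (map_poly to_ac p) y = 0}"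
      using hp[OF pL] p s(1)[OF sg(1)] by (simp add: sg(2) hom_on_0[OF iL])
  qed
  moreover have "finite {y. poly (map_poly to_ac p) y = 0}"
    using p by (intro poly_roots_finite) (auto simp: map_poly_eq_0_iff)
  ultimately have finQ: "finite Q" by (rule finite_subset)
  have galL: "group (gal L)"
    using intermediate_add[OF iL] intermediate_mult[OF iL] iL by (intro gal_group) (auto simp: intermediate_def)
  have QL: "Q \<subseteq> L" using s(3) x by (auto simp: Q_def bij_betw_def)
  have perm: "\<sigma> ` Q = Q" if sg: "\<sigma> \<in> carrier (gal L)" for \<sigma>
  proof (rule endo_inj_surj[OF finQ])
    show "\<sigma> ` Q \<subseteq> Q"
    proof
      fix y assume "y \<in> \<sigma> ` Q"
      then obtain \<sigma>' where s': "\<sigma>' \<in> carrier (gal L)" "y = \<sigma> (\<sigma>' x)" by (auto simp: Q_def)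
      have "\<sigma> \<otimes>\<^bsub>gal L\<^esub> \<sigma>' \<in> carrier (gal L)" using galL sg s'(1) by (simp add: group.is_monoid monoid.m_closed)
      moreover have "(\<sigma> \<otimes>\<^bsub>gal L\<^esub> \<sigma>') x = y" using sg s' x by (simp add: gal_def BijGroup_def compose_def)
      ultimately show "y \<in> Q" unfolding Q_def by blast
    qed
    show "inj_on \<sigma> Q" using s(3)[OF sg] QL by (meson bij_betw_def inj_on_subset)
  qed
  define q where "q = (\<Prod>y\<in>Q. [:-y, 1:])"
  have lin: "coeffs_in L [:-y, 1:]" if "y \<in> L" for y
    using that by (auto simp: coeffs_in_def coeff_pCons intermediate_uminus[OF iL] intermediate_1[OF iL] intermediate_0[OF iL] split: nat.splits)
  have cp: "coeffs_in L (\<Prod>y\<in>R. [:-y, 1:]) \<and> (\<forall>\<sigma>\<in>carrier (gal L). map_poly \<sigma> (\<Prod>y\<in>R. [:-y, 1:]) = (\<Prod>y\<in>R. [:-\<sigma> y, 1:]))"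
    if "finite R" "R \<subseteq> L" for R
    using that
  proof (induction R)
    case empty
    have "coeffs_in L 1" by (auto simp: coeffs_in_def intermediate_1[OF iL] intermediate_0[OF iL])
    moreover have "map_poly \<sigma> 1 = 1" if "\<sigma> \<in> carrier (gal L)" for \<sigma>
      using s(1)[OF that] by (simp add: map_poly_1 hom_on_1[OF iL])
    ultimately show ?case by simp
  next
    case (insert y R)
    then have y: "y \<in> L" "R \<subseteq> L" by auto
    have "map_poly \<sigma> [:-y, 1:] = [:-\<sigma> y, 1:]" if "\<sigma> \<in> carrier (gal L)" for \<sigma>
      using s(1)[OF that] hom_on_diff[OF iL s(1)[OF that] intermediate_0[OF iL] y(1)]
      by (simp add: map_poly_pCons hom_on_0[OF iL] hom_on_1[OF iL])
    then show ?case
      using insert y s(1) lin by (simp add: map_poly_on(3)[OF iL] coeffs_in_mult[OF iL] del: mult_pCons_left)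
  qed
  have "coeff q i \<in> range to_ac" for i
  proof -
    have "\<sigma> (coeff q i) = coeff q i" if sg: "\<sigma> \<in> carrier (gal L)" for \<sigma>
    proof -
      have "map_poly \<sigma> q = (\<Prod>y\<in>Q. [:-\<sigma> y, 1:])" unfolding q_def using cp[OF finQ QL] sg by blast
      also have "\<dots> = (\<Prod>y\<in>\<sigma> ` Q. [:-y, 1:])"
        using s(3)[OF sg] QL by (subst prod.reindex) (auto simp: bij_betw_def inj_on_def subset_iff)
      finally have "map_poly \<sigma> q = q" by (simp add: perm[OF sg] q_def)
      then show ?thesis using coeff_map_poly[of \<sigma> q i] s(1)[OF sg] by (simp add: hom_on_0[OF iL])
    qed
    moreover have "coeff q i \<in> L" using cp[OF finQ QL] by (simp add: q_def coeffs_in_def)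
    ultimately show ?thesis using fixd by blast
  qed
  then have "map_poly \<rho> q = q"
    by (intro poly_eqI) (metis coeff_map_poly gal_to_ac[OF \<rho>] imageE ring_hom_0[OF gal_hom[OF \<rho>]])
  moreover have "poly q x = 0"
  proof -
    have "restrict id L \<in> carrier (gal L)"
      using group.is_monoid[OF galL] monoid.one_closed[of "gal L"] by (simp add: gal_def BijGroup_def id_def restrict_def)
    then have "x \<in> Q" unfolding Q_def using x by (intro image_eqI[of _ _ "restrict id L"]) auto
    then show ?thesis using finQ by (auto simp: q_def poly_prod intro!: prod_zero)
  qed
  ultimately have "poly q (\<rho> x) = 0" using ring_hom_poly[OF gal_hom[OF \<rho>], of q x] by (simp add: ring_hom_0 gal_hom \<rho>)
  then have "\<rho> x \<in> Q" using finQ by (auto simp: q_def poly_prod prod_zero_iff)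
  then show ?thesis using QL by blast
qed

section \<open>Change of group scheme\<close>

definition push :: "('a \<Rightarrow> 'b) \<Rightarrow> (('e::field alg_closure \<Rightarrow> 'e alg_closure) \<Rightarrow> ('b \<Rightarrow> 'e alg_closure)) \<Rightarrow>
    (('e alg_closure \<Rightarrow> 'e alg_closure) \<Rightarrow> ('a \<Rightarrow> 'e alg_closure))" where
  "push q c = (\<lambda>\<sigma>\<in>Gal. c \<sigma> \<circ> q)"

context
  fixes H :: "('k::field, 'b::comm_ring_1) hopf" and G :: "('k, 'a::comm_ring_1) hopf" and q :: "'a \<Rightarrow> 'b"
  assumes q: "group_scheme_hom H G q"
begin

lemma push_point: "\<phi> \<in> carrier (points H j) \<Longrightarrow> \<phi> \<circ> q \<in> carrier (points G j)"
  using q by (auto simp: carrier_points_iff group_scheme_hom_def is_alg_hom_def ring_hom_comp)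

lemma push_mult:
  assumes "\<phi> \<in> carrier (points H j)" "\<psi> \<in> carrier (points H j)"
  shows "(\<phi> \<otimes>\<^bsub>points H j\<^esub> \<psi>) \<circ> q = (\<phi> \<circ> q) \<otimes>\<^bsub>points G j\<^esub> (\<psi> \<circ> q)"
proof
  fix a
  have h: "is_ring_hom \<phi>" "is_ring_hom \<psi>" "\<And>c. \<phi> (strct H c) = j c" "\<And>c. \<psi> (strct H c) = j c"
    using assms by (auto simp: carrier_points_iff is_alg_hom_def)
  let ?v = "frag_extend (\<lambda>(x, y). frag_of (q x, q y)) (comul G a)"
  have "?v - comul H (q a) \<in> tensor_rel (strct H) (strct H) UNIV"
    using q by (simp add: group_scheme_hom_def)
  then have "tensor_eval (\<lambda>x y. \<phi> x * \<psi> y) (?v - comul H (q a)) = 0"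
    by (rule tensor_eval_rel[rotated 3]) (auto simp: h ring_hom_add ring_hom_mult algebra_simps)
  then have "tensor_eval (\<lambda>x y. \<phi> x * \<psi> y) (comul H (q a)) = tensor_eval (\<lambda>x y. \<phi> x * \<psi> y) ?v"
    by (simp add: tensor_eval_diff)
  also have "\<dots> = tensor_eval (\<lambda>x y. \<phi> (q x) * \<psi> (q y)) (comul G a)"
    unfolding tensor_eval_feval feval_extend by (rule feval_cong) auto
  finally show "((\<phi> \<otimes>\<^bsub>points H j\<^esub> \<psi>) \<circ> q) a = ((\<phi> \<circ> q) \<otimes>\<^bsub>points G j\<^esub> (\<psi> \<circ> q)) a"
    by (simp add: points_def)
qed

end

locale galois_points_hom = H: galois_points \<epsilon> H gens + G: galois_points \<epsilon> G gens'
  for \<epsilon> :: "'k::field \<Rightarrow> 'e::field" and H :: "('k, 'b::comm_ring_1) hopf" and G :: "('k, 'a::comm_ring_1) hopf" and gens gens' +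
  fixes q :: "'a \<Rightarrow> 'b"
  assumes q: "group_scheme_hom H G q"
begin

lemma push_closed_point: "\<phi> \<in> carrier H.Pt \<Longrightarrow> \<phi> \<circ> q \<in> carrier G.Pt"
  by (rule push_point[OF q])

lemma push_Pt_mult: "\<phi> \<in> carrier H.Pt \<Longrightarrow> \<psi> \<in> carrier H.Pt \<Longrightarrow> (\<phi> \<otimes>\<^bsub>H.Pt\<^esub> \<psi>) \<circ> q = (\<phi> \<circ> q) \<otimes>\<^bsub>G.Pt\<^esub> (\<psi> \<circ> q)"
  by (rule push_mult[OF q])

lemma push_one: "\<one>\<^bsub>H.Pt\<^esub> \<circ> q = \<one>\<^bsub>G.Pt\<^esub>"
proof -
  have "(\<one>\<^bsub>H.Pt\<^esub> \<circ> q) \<otimes>\<^bsub>G.Pt\<^esub> (\<one>\<^bsub>H.Pt\<^esub> \<circ> q) = \<one>\<^bsub>H.Pt\<^esub> \<circ> q"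
    by (simp flip: push_Pt_mult)
  then show ?thesis using push_closed_point[OF H.A.one_closed] by (simp add: G.A.r_cancel_one')
qed

lemma push_closed: assumes c: "c \<in> carrier H.Z" shows "push q c \<in> carrier G.Z"
  unfolding G.mem_galZ1
proof (intro conjI ballI)
  note c' = c[unfolded H.mem_galZ1]
  show "push q c \<in> Gal \<rightarrow>\<^sub>E carrier G.Pt" unfolding push_def using H.Z_closed[OF c] push_closed_point by auto
  show "push q c (\<sigma> \<circ> \<tau>) = push q c \<sigma> \<otimes>\<^bsub>G.Pt\<^esub> (\<sigma> \<circ> push q c \<tau>)" if s: "\<sigma> \<in> Gal" "\<tau> \<in> Gal" for \<sigma> \<tau>
  proof -
    have "c (\<sigma> \<circ> \<tau>) = c \<sigma> \<otimes>\<^bsub>H.Pt\<^esub> (\<sigma> \<circ> c \<tau>)" using c' s by blast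
    then show ?thesis
      using s push_Pt_mult[OF H.Z_closed[OF c s(1)] H.act_closed[OF s(1) H.Z_closed[OF c s(2)]]]
      by (simp add: push_def gal_comp comp_assoc)
  qed
  obtain Y where Y: "finite Y" "\<And>\<sigma>. \<sigma> \<in> Gal \<Longrightarrow> (\<forall>x\<in>Y. \<sigma> x = x) \<Longrightarrow> c \<sigma> = \<one>\<^bsub>H.Pt\<^esub>" using c' by blast
  have "push q c \<sigma> = \<one>\<^bsub>G.Pt\<^esub>" if "\<sigma> \<in> Gal" "\<forall>x\<in>Y. \<sigma> x = x" for \<sigma>
    using Y(2)[OF that] that(1) by (simp add: push_def push_one)
  then show "\<exists>Y. finite Y \<and> (\<forall>\<sigma>\<in>Gal. (\<forall>x\<in>Y. \<sigma> x = x) \<longrightarrow> push q c \<sigma> = \<one>\<^bsub>G.Pt\<^esub>)" using Y(1) by blast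
qed

lemma push_Z_mult: "c \<in> carrier H.Z \<Longrightarrow> d \<in> carrier H.Z \<Longrightarrow> push q (c \<otimes>\<^bsub>H.Z\<^esub> d) = push q c \<otimes>\<^bsub>G.Z\<^esub> push q d"
  by (auto simp: push_def H.mult_Z G.mult_Z push_Pt_mult H.Z_closed)

lemma push_cong:
  assumes c: "c \<in> carrier H.Z" and d: "d \<in> carrier H.Z" and eq: "H.cls c = H.cls d"
  shows "G.cls (push q c) = G.cls (push q d)"
proof -
  obtain a where a: "a \<in> carrier H.Pt" "\<And>\<sigma>. \<sigma> \<in> Gal \<Longrightarrow> a \<otimes>\<^bsub>H.Pt\<^esub> c \<sigma> = d \<sigma> \<otimes>\<^bsub>H.Pt\<^esub> (\<sigma> \<circ> a)"
    using eq unfolding H.cls_eq_iff'[OF c d] by blast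
  have "(a \<circ> q) \<otimes>\<^bsub>G.Pt\<^esub> push q c \<sigma> = push q d \<sigma> \<otimes>\<^bsub>G.Pt\<^esub> (\<sigma> \<circ> (a \<circ> q))" if s: "\<sigma> \<in> Gal" for \<sigma>
  proof -
    have "(a \<otimes>\<^bsub>H.Pt\<^esub> c \<sigma>) \<circ> q = (d \<sigma> \<otimes>\<^bsub>H.Pt\<^esub> (\<sigma> \<circ> a)) \<circ> q" using a(2)[OF s] by simp
    then show ?thesis
      unfolding push_Pt_mult[OF a(1) H.Z_closed[OF c s]] push_Pt_mult[OF H.Z_closed[OF d s] H.act_closed[OF s a(1)]]
      using s by (simp add: push_def comp_assoc)
  qed
  then show ?thesis
    unfolding G.cls_eq_iff'[OF push_closed[OF c] push_closed[OF d]] using push_closed_point[OF a(1)] by blast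
qed

end

lemma push_res_along: "ac_embedding e \<tau> \<Longrightarrow> push q (res_along \<tau> c) = res_along \<tau> (push q c)"
  by (auto simp: push_def res_along_def comp_assoc gal_res_in_gal)

lemma res_along_res_along:
  "ac_embedding e \<tau> \<Longrightarrow> ac_embedding e' \<tau>' \<Longrightarrow> res_along \<tau>' (res_along \<tau> c) = res_along (\<tau>' \<circ> \<tau>) c"
  by (auto simp: res_along_def comp_assoc gal_res_in_gal gal_res_gal_res)

lemma point_through_surj:
  assumes i: "group_scheme_hom M G i" and surj: "surj i" and \<phi>: "\<phi> \<circ> i \<in> carrier (points G j)"
  shows "\<phi> \<in> carrier (points M j)"
proof -
  have hi: "is_ring_hom i" "\<And>c. i (strct G c) = strct M c"
    using i by (auto simp: group_scheme_hom_def is_alg_hom_def)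
  have h: "is_ring_hom (\<phi> \<circ> i)" and s: "\<And>c. \<phi> (i (strct G c)) = j c"
    using \<phi> by (auto simp: carrier_points_iff is_alg_hom_def)
  have "\<phi> 1 = 1" using ring_hom_1[OF h] ring_hom_1[OF hi(1)] by simp
  moreover have "\<phi> (x + y) = \<phi> x + \<phi> y \<and> \<phi> (x * y) = \<phi> x * \<phi> y" for x y
  proof -
    obtain a b where "x = i a" "y = i b" using surj by (meson surjD)
    then show ?thesis using ring_hom_add[OF h, of a b] ring_hom_mult[OF h, of a b] hi by (simp add: ring_hom_add ring_hom_mult)
  qed
  ultimately show ?thesis using s hi(2) by (auto simp: carrier_points_iff is_alg_hom_def is_ring_hom_def)
qed

text \<open>Composition with the surjection \<open>i\<close> embeds the points of \<open>M\<close>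
  into those of \<open>G\<close>, compatibly with products. Associativity, commutativity and the
  determining coordinates are inherited; the neutral element and inverses come from counit and
  antipode.\<close>

lemma closed_subgroup_galois_points:
  fixes \<epsilon> :: "'k::field \<Rightarrow> 'e::field" and M :: "('k, 'b::comm_ring_1) hopf" and G :: "('k, 'a::comm_ring_1) hopf"
  assumes \<epsilon>: "is_ring_hom \<epsilon>" and M: "affine_group_scheme M" and G: "galois_points \<epsilon> G gens" and i: "group_scheme_hom M G i" and surj: "surj i"
  shows "galois_points \<epsilon> M (i ` gens)"
proof (rule galois_points.intro)
  interpret G: galois_points \<epsilon> G gens by (rule G)
  let ?P = "points M (to_ac \<circ> \<epsilon>)"
  note cl = push_point[OF i, where j = "to_ac \<circ> \<epsilon>"] and mu = push_mult[OF i, where j = "to_ac \<circ> \<epsilon>"]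
  have inj: "\<phi> = \<psi>" if "\<phi> \<circ> i = \<psi> \<circ> i" for \<phi> \<psi> :: "'b \<Rightarrow> 'e alg_closure"
    proof
    fix x obtain a where "x = i a" using surj by (meson surjD)
    then show "\<phi> x = \<psi> x" using fun_cong[OF that, of a] by simp
  qed
  note alg = point_through_surj[OF i surj, where j = "to_ac \<circ> \<epsilon>"]
  have scheme: "is_ring_hom (strct M)" "is_alg_hom (strct M) id (counit M)" "is_alg_hom (strct M) (strct M) (antip M)"
    "\<And>a. tensor_eval (\<lambda>x y. strct M (counit M x) * y) (comul M a) = a"
    "\<And>a. tensor_eval (\<lambda>x y. antip M x * y) (comul M a) = strct M (counit M a)"
    using M by (auto simp: affine_group_scheme_def Let_def)
  show "comm_group ?P"
  proof (rule comm_groupI)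
    fix x assume x: "x \<in> carrier ?P"
    have xh: "is_ring_hom x" "\<And>c. x (strct M c) = to_ac (\<epsilon> c)" using x by (auto simp: carrier_points_iff is_alg_hom_def)
    show "\<one>\<^bsub>?P\<^esub> \<otimes>\<^bsub>?P\<^esub> x = x"
    proof
      fix a
      have "x a = x (tensor_eval (\<lambda>x y. strct M (counit M x) * y) (comul M a))" by (simp add: scheme(4))
      also have "\<dots> = tensor_eval (\<lambda>u y. to_ac (\<epsilon> (counit M u)) * x y) (comul M a)"
        by (simp add: tensor_eval_feval feval_hom[OF xh(1)] ring_hom_mult xh)
      finally show "(\<one>\<^bsub>?P\<^esub> \<otimes>\<^bsub>?P\<^esub> x) a = x a" by (simp add: points_def)
    qed
    have "x \<circ> antip M \<in> carrier ?P"
      using xh scheme(3) by (auto simp: carrier_points_iff is_alg_hom_def ring_hom_comp)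
    moreover have "(x \<circ> antip M) \<otimes>\<^bsub>?P\<^esub> x = \<one>\<^bsub>?P\<^esub>"
    proof
      fix a
      have "to_ac (\<epsilon> (counit M a)) = x (tensor_eval (\<lambda>x y. antip M x * y) (comul M a))" by (simp add: scheme(5) xh)
      also have "\<dots> = tensor_eval (\<lambda>u y. x (antip M u) * x y) (comul M a)"
        by (simp add: tensor_eval_feval feval_hom[OF xh(1)] ring_hom_mult xh)
      finally show "((x \<circ> antip M) \<otimes>\<^bsub>?P\<^esub> x) a = \<one>\<^bsub>?P\<^esub> a" by (simp add: points_def)
    qed
    ultimately show "\<exists>y\<in>carrier ?P. y \<otimes>\<^bsub>?P\<^esub> x = \<one>\<^bsub>?P\<^esub>" by blast
    fix y assume y: "y \<in> carrier ?P"
    show xy: "x \<otimes>\<^bsub>?P\<^esub> y \<in> carrier ?P" by (rule alg) (simp add: mu x y cl)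
    show "x \<otimes>\<^bsub>?P\<^esub> y = y \<otimes>\<^bsub>?P\<^esub> x" by (rule inj) (simp add: mu x y cl G.A.m_comm)
    fix z assume z: "z \<in> carrier ?P"
    have yz: "y \<otimes>\<^bsub>?P\<^esub> z \<in> carrier ?P" by (rule alg) (simp add: mu z y cl)
    show "x \<otimes>\<^bsub>?P\<^esub> y \<otimes>\<^bsub>?P\<^esub> z = x \<otimes>\<^bsub>?P\<^esub> (y \<otimes>\<^bsub>?P\<^esub> z)"
      by (rule inj) (simp add: mu x y z xy yz cl G.A.m_assoc)
  next
    have e: "is_ring_hom (to_ac \<circ> \<epsilon>)" by (rule ring_hom_comp[OF ring_hom_to_ac \<epsilon>])
    show "\<one>\<^bsub>?P\<^esub> \<in> carrier ?P"
      using scheme(2) ring_hom_comp[OF e, of "counit M"]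
      by (auto simp: points_def is_alg_hom_def comp_def)
  qed
  show "finite (i ` gens)" using G.finite_gens by simp
  fix \<phi> \<psi> assume p: "\<phi> \<in> carrier ?P" "\<psi> \<in> carrier ?P" and eq: "\<And>a. a \<in> i ` gens \<Longrightarrow> \<phi> a = \<psi> a"
  have "\<phi> \<circ> i = \<psi> \<circ> i" by (rule G.gens[OF cl[OF p(1)] cl[OF p(2)]]) (simp add: eq)
  then show "\<phi> = \<psi>" by (rule inj)
qed

section \<open>Characters of a split torus\<close>

lemma group_closure_frag_extend:
  assumes "\<And>p. p \<in> Poly_Mapping.keys u \<Longrightarrow> f p \<in> group_closure S"
  shows "frag_extend f u \<in> group_closure S"
proof -
  have "u \<in> {u. Poly_Mapping.keys u \<subseteq> Poly_Mapping.keys u}" by simp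
  then show ?thesis
    by (induction u rule: frag_induction[OF subset_refl])
       (auto simp: frag_extend_diff intro: group_closure.diff assms)
qed

lemma frag_extend_minus_fun: "frag_extend f u - frag_extend g u = frag_extend (\<lambda>p. f p - g p) u"
  by (induction u rule: frag_induction[OF subset_UNIV]) (simp_all add: frag_extend_diff algebra_simps)

lemma frag_extend_sum_fun: "(\<Sum>e\<in>D. frag_extend (g e) u) = frag_extend (\<lambda>p. \<Sum>e\<in>D. g e p) u"
  by (induction u rule: frag_induction[OF subset_UNIV]) (simp_all add: frag_extend_diff sum_subtractf)

lemma frag_extend_group_closure:
  assumes "\<And>w. w \<in> S \<Longrightarrow> frag_extend f w \<in> group_closure S'" "u \<in> group_closure S"
  shows "frag_extend f u \<in> group_closure S'"
  using assms(2) by induction (auto simp: frag_extend_diff assms(1) intro: group_closure.diff)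

lemma group_closure_trans:
  "u - v \<in> group_closure S \<Longrightarrow> v - w \<in> group_closure S \<Longrightarrow> u - w \<in> group_closure S"
  using group_closure_add[of "u - v" S "v - w"] by simp

lemma lookup_mult_single_0:
  "Poly_Mapping.lookup (f * Poly_Mapping.single (0 :: 's::comm_monoid_add) c) d = Poly_Mapping.lookup f d * (c :: 'r::comm_ring_1)"
proof -
  have "f * Poly_Mapping.single 0 c = (\<Sum>e\<in>Poly_Mapping.keys f. Poly_Mapping.single e (Poly_Mapping.lookup f e)) * Poly_Mapping.single 0 c"
    by (simp only: sum_single)
  also have "\<dots> = (\<Sum>e\<in>Poly_Mapping.keys f. Poly_Mapping.single e (Poly_Mapping.lookup f e * c))"
    by (simp add: sum_distrib_right mult_single)
  finally show ?thesis by (simp add: lookup_sum lookup_single when_def in_keys_iff)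
qed

lemma lookup_feval:
  "Poly_Mapping.lookup (feval g u :: 's::comm_monoid_add \<Rightarrow>\<^sub>0 'r::comm_ring_1) d = feval (\<lambda>p. Poly_Mapping.lookup (g p) d) u"
proof -
  have "Poly_Mapping.lookup (of_int m * f) d = of_int m * Poly_Mapping.lookup f d" for m and f :: "'s \<Rightarrow>\<^sub>0 'r"
    using lookup_mult_single_0[of f "of_int m" d] by (simp add: mult.commute single_of_int)
  then show ?thesis by (simp add: feval_def lookup_sum)
qed

lemma box_left:
  assumes "u \<in> tensor_rel s (to_ac :: 'k::field \<Rightarrow> _) UNIV"
  shows "frag_extend (\<lambda>(x, m). frag_of (x, b, m * l)) u \<in> tensor3_rel s s to_ac"
proof -
  let ?f = "frag_extend (\<lambda>(x, m). frag_of (x, b, m * l))"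
  have g: "frag_of (x, s c * y, z) - frag_of (x, y, to_ac c * z) \<in> tensor3_rel s s to_ac"
    "frag_of (s c * x, y, z) - frag_of (x, s c * y, z) \<in> tensor3_rel s s to_ac"
    "frag_of (x + x', y, z) - frag_of (x, y, z) - frag_of (x', y, z) \<in> tensor3_rel s s to_ac"
    "frag_of (x, y, z + z') - frag_of (x, y, z) - frag_of (x, y, z') \<in> tensor3_rel s s to_ac" for x x' y z z' c
    unfolding tensor3_rel_def by (rule group_closure.base, blast)+
  \<comment> \<open>The generators of \<open>tensor3_rel\<close> move scalars between neighbouring
    factors only, so passing from the first to the third takes two steps.\<close>
  have h: "frag_of (s c * x, y, z) - frag_of (x, y, to_ac c * z) \<in> tensor3_rel s s to_ac" for c x y z
    using group_closure_trans[OF g(2)[unfolded tensor3_rel_def] g(1)[unfolded tensor3_rel_def]] by (simp add: tensor3_rel_def)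
  have "?f w \<in> tensor3_rel s s to_ac" if "w \<in> {frag_of (x + x', y) - frag_of (x, y) - frag_of (x', y) |x x' y. y \<in> UNIV} \<union>
      {frag_of (x, y + y') - frag_of (x, y) - frag_of (x, y') |x y y'. y \<in> UNIV \<and> y' \<in> UNIV} \<union>
      {frag_of (s c * x, y) - frag_of (x, to_ac c * y) |c x y. y \<in> UNIV}" for w
    using that by (elim UnE CollectE exE conjE) (simp_all add: frag_extend_diff g h distrib_right mult.assoc)
  note gen = this[unfolded tensor3_rel_def]
  show ?thesis
    unfolding tensor3_rel_def by (rule frag_extend_group_closure[OF gen assms[unfolded tensor_rel_def]])
qed

lemma box_right:
  assumes "u \<in> tensor_rel s (to_ac :: 'k::field \<Rightarrow> _) UNIV"
  shows "frag_extend (\<lambda>(y, m). frag_of (b, y, l * m)) u \<in> tensor3_rel s s to_ac"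
proof -
  let ?f = "frag_extend (\<lambda>(y, m). frag_of (b, y, l * m))"
  have g: "frag_of (x, s c * y, z) - frag_of (x, y, to_ac c * z) \<in> tensor3_rel s s to_ac"
    "frag_of (x, y + y', z) - frag_of (x, y, z) - frag_of (x, y', z) \<in> tensor3_rel s s to_ac"
    "frag_of (x, y, z + z') - frag_of (x, y, z) - frag_of (x, y, z') \<in> tensor3_rel s s to_ac" for x y y' z z' c
    unfolding tensor3_rel_def by (rule group_closure.base, blast)+
  have lc: "l * (to_ac c * m) = to_ac c * (l * m)" for c :: 'k and m by (simp add: mult_ac)
  have "?f w \<in> tensor3_rel s s to_ac" if "w \<in> {frag_of (x + x', y) - frag_of (x, y) - frag_of (x', y) |x x' y. y \<in> UNIV} \<union>
      {frag_of (x, y + y') - frag_of (x, y) - frag_of (x, y') |x y y'. y \<in> UNIV \<and> y' \<in> UNIV} \<union>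
      {frag_of (s c * x, y) - frag_of (x, to_ac c * y) |c x y. y \<in> UNIV}" for w
    using that by (elim UnE CollectE exE conjE) (simp_all add: frag_extend_diff g distrib_left lc)
  note gen = this[unfolded tensor3_rel_def]
  show ?thesis
    unfolding tensor3_rel_def by (rule frag_extend_group_closure[OF gen assms[unfolded tensor_rel_def]])
qed

locale split_torus = torus_splitting G UNIV n \<Phi>
  for G :: "('k::field_char_0, 'a::comm_ring_1) hopf" and n \<Phi>
begin

lemma \<Phi>_scalar: "\<Phi> (strct G c * x) * Poly_Mapping.single 0 l = \<Phi> x * Poly_Mapping.single 0 (to_ac c * l)"
proof -
  have "\<Phi> (strct G c * x) * Poly_Mapping.single 0 l = \<Phi> x * (Poly_Mapping.single 0 (to_ac c) * Poly_Mapping.single 0 l)"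
    unfolding ring_hom_mult[OF ring_\<Phi>] \<Phi>_strct by (simp only: mult_ac)
  then show ?thesis by (simp add: mult_single)
qed

text \<open>Over the whole closure the relations are exactly the kernel of the splitting, so classes
  of formal sums can be handled as elements of the group algebra.\<close>

lemma tensor_rel_iff: "u \<in> tensor_rel (strct G) to_ac UNIV \<longleftrightarrow> T\<Phi> u = 0"
proof
  show "T\<Phi> u = 0" if "u \<in> tensor_rel (strct G) to_ac UNIV"
    by (rule tensor_eval_rel[OF _ _ _ that])
      (simp_all add: ring_hom_add ring_\<Phi> single_add distrib_left distrib_right \<Phi>_scalar)
qed (rule \<Phi>_inj, simp)

lemma ac_class_iff: "w \<in> ac_class G u \<longleftrightarrow> T\<Phi> w = T\<Phi> u"
  by (simp add: ac_class_def tensor_rel_iff tensor_eval_diff)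

definition char_class :: "(nat \<Rightarrow>\<^sub>0 int) \<Rightarrow> (('a \<times> 'k alg_closure) \<Rightarrow>\<^sub>0 int) set" where
  "char_class d = {w. T\<Phi> w = Poly_Mapping.single (trunc n d) 1}"

lemma uu_char_class: "uu d \<in> char_class d"
  by (simp add: char_class_def uu)

lemma ac_class_uu: "ac_class G (uu d) = char_class d"
  by (auto simp: ac_class_iff char_class_def uu)

lemma char_class_eq_iff: "char_class d = char_class e \<longleftrightarrow> trunc n d = trunc n e"
proof
  assume "char_class d = char_class e"
  then have "T\<Phi> (uu d) = Poly_Mapping.single (trunc n e) 1" using uu_char_class[of d] by (simp add: char_class_def)
  then have "Poly_Mapping.lookup (Poly_Mapping.single (trunc n d) (1 :: 'k alg_closure)) (trunc n d) =
      Poly_Mapping.lookup (Poly_Mapping.single (trunc n e) 1) (trunc n d)" by (simp only: uu)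
  then show "trunc n d = trunc n e" by (simp add: lookup_single when_def split: if_splits)
qed (simp add: char_class_def)

lemma char_class_mult:
  "char_class d \<otimes>\<^bsub>characters G\<^esub> char_class e = char_class (d + e)"
proof -
  have "ac_class G (tensor_mult u v) = char_class (d + e)" if "u \<in> char_class d" "v \<in> char_class e" for u v
    using that by (auto simp: ac_class_iff char_class_def T\<Phi>_mult mult_single trunc_add)
  then have "(\<Union>u\<in>char_class d. \<Union>v\<in>char_class e. ac_class G (tensor_mult u v)) = char_class (d + e)"
    using uu_char_class[of d] uu_char_class[of e] by blast
  then show ?thesis by (simp add: characters_def)
qed

lemma T\<Phi>_twist: assumes \<rho>: "\<rho> \<in> Gal" and eq: "T\<Phi> u = T\<Phi> v" shows "T\<Phi> (twist \<rho> u) = T\<Phi> (twist \<rho> v)"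
proof -
  have r: "T\<Phi> (twist \<rho> w) = tensor_eval (\<lambda>a l. \<Phi> a * Poly_Mapping.single 0 (\<rho> l)) w" for w
    unfolding tensor_eval_feval twist_def feval_extend by (rule feval_cong) auto
  have h: "is_ring_hom \<rho>" using \<rho> by (rule gal_hom)
  have "u - v \<in> tensor_rel (strct G) to_ac UNIV" using eq by (simp add: tensor_rel_iff tensor_eval_diff)
  then have "tensor_eval (\<lambda>a l. \<Phi> a * Poly_Mapping.single 0 (\<rho> l)) (u - v) = 0"
    by (rule tensor_eval_rel[rotated 3])
      (simp_all add: ring_hom_add ring_hom_mult[OF h] ring_\<Phi> h single_add distrib_left distrib_right gal_to_ac[OF \<rho>] \<Phi>_scalar)
  then show ?thesis by (simp add: r tensor_eval_diff)
qed

lemma character_act_class: assumes \<rho>: "\<rho> \<in> Gal" shows "character_act G \<rho> (char_class d) = char_class (act \<rho> d)"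
proof -
  have "ac_class G (twist \<rho> u) = char_class (act \<rho> d)" if "u \<in> char_class d" for u
  proof -
    have "T\<Phi> u = T\<Phi> (uu d)" using that by (simp add: char_class_def uu)
    from T\<Phi>_twist[OF \<rho> this] show ?thesis
      by (auto simp: ac_class_iff char_class_def twist_act[OF \<rho>] trunc_act[OF \<rho>])
  qed
  then show ?thesis using uu_char_class[of d] unfolding character_act_def twist_def by blast
qed

text \<open>Evaluating the defining congruence at a pair of points gives multiplicativity in the
  point, and \<open>multiplicative_is_single\<close> applies.\<close>

lemma group_like_class:
  assumes "group_like G u" shows "\<exists>d. trunc n d = d \<and> ac_class G u = char_class d"
proof -
  note id = ring_hom_id(1)
  have "\<exists>d. trunc n d = d \<and> T\<Phi> u = Poly_Mapping.single d 1"
  proof (rule multiplicative_is_single)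
    have "pt id (\<lambda>_. 1) = (\<lambda>a. to_ac (counit G a))" using one_point[OF id] by (simp add: points_def)
    then show "teval id (pt id (\<lambda>_. 1)) u = 1" using assms by (simp add: group_like_def teval_def)
  next
    fix h h' :: "(nat \<Rightarrow>\<^sub>0 int) \<Rightarrow> 'k alg_closure" assume h: "thom n h" "thom n h'"
    define \<phi> \<psi> where "\<phi> = pt id h" and "\<psi> = pt id h'"
    have r: "is_ring_hom \<phi>" "is_ring_hom \<psi>" "\<And>c. \<phi> (strct G c) = to_ac c" "\<And>c. \<psi> (strct G c) = to_ac c"
      using pt_in[OF id h(1)] pt_in[OF id h(2)] by (auto simp: \<phi>_def \<psi>_def pts_def is_alg_hom_def)
    let ?v = "frag_extend (\<lambda>(a, l). frag_extend (\<lambda>(x, y). frag_of (x, y, l)) (comul G a)) u"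
    let ?w = "frag_extend (\<lambda>(a, l). frag_extend (\<lambda>(b, m). frag_of (a, b, l * m)) u) u"
    let ?g = "\<lambda>(x, y, l). \<phi> x * \<psi> y * l"
    have "feval ?g (?v - ?w) = 0"
      by (rule feval_tensor3_rel[where s = "strct G" and s' = "strct G" and s'' = to_ac])
        (use assms in \<open>auto simp: r ring_hom_add ring_hom_mult algebra_simps group_like_def\<close>)
    moreover have "feval ?g ?v = teval id (pt id (\<lambda>e. h e * h' e)) u"
    proof -
      have "feval ?g ?v = feval (\<lambda>p. feval (\<lambda>q. \<phi> (fst q) * \<psi> (snd q) * snd p) (comul G (fst p))) u"
        unfolding feval_extend by (rule feval_cong) (auto simp: feval_extend intro!: feval_cong)
      also have "\<dots> = feval (\<lambda>p. pt id (\<lambda>e. h e * h' e) (fst p) * snd p) u"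
        using fun_cong[OF points_mult_pt[OF id, of h h']]
        by (simp add: points_def tensor_eval_feval \<phi>_def \<psi>_def flip: feval_mult_right)
      finally show ?thesis by (simp add: teval_feval)
    qed
    moreover have "feval ?g ?w = teval id \<phi> u * teval id \<psi> u"
    proof -
      have "feval ?g ?w = feval (\<lambda>p. (\<phi> (fst p) * snd p) * feval (\<lambda>q. \<psi> (fst q) * snd q) u) u"
        unfolding feval_extend by (rule feval_cong) (auto simp: feval_extend feval_mult_left mult_ac intro!: feval_cong)
      then show ?thesis by (simp add: teval_feval feval_mult_right)
    qed
    ultimately show "teval id (pt id (\<lambda>e. h e * h' e)) u = teval id (pt id h) u * teval id (pt id h') u"
      by (simp add: feval_diff \<phi>_def \<psi>_def)
  qed
  then show ?thesis by (auto simp: ac_class_iff char_class_def)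
qed

section \<open>Normal forms in the triple tensor product\<close>

abbreviation "R3 \<equiv> tensor3_rel (strct G) (strct G) to_ac"

text \<open>A formal representative of the characters \<open>d\<close> and \<open>e\<close> in the
  first two factors, with scalar \<open>c\<close>.\<close>

definition box_uu :: "(nat \<Rightarrow>\<^sub>0 int) \<Rightarrow> (nat \<Rightarrow>\<^sub>0 int) \<Rightarrow> 'k alg_closure \<Rightarrow> (('a \<times> 'a \<times> 'k alg_closure) \<Rightarrow>\<^sub>0 int)" where
  "box_uu d e c = frag_extend (\<lambda>(x, m). frag_extend (\<lambda>(y, m'). frag_of (x, y, c * m * m')) (uu e)) (uu d)"

lemma R3_diff: "u \<in> R3 \<Longrightarrow> v \<in> R3 \<Longrightarrow> u - v \<in> R3"
  unfolding tensor3_rel_def by (rule group_closure.diff)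

lemma R3_trans: "u - v \<in> R3 \<Longrightarrow> v - w \<in> R3 \<Longrightarrow> u - w \<in> R3"
  unfolding tensor3_rel_def by (rule group_closure_trans)

lemma R3_extend: "(\<And>p. p \<in> Poly_Mapping.keys u \<Longrightarrow> f p \<in> R3) \<Longrightarrow> frag_extend f u \<in> R3"
  unfolding tensor3_rel_def by (rule group_closure_frag_extend)

lemma R3_sum: "(\<And>x. x \<in> A \<Longrightarrow> f x \<in> R3) \<Longrightarrow> sum f A \<in> R3"
  unfolding tensor3_rel_def
  by (induction A rule: infinite_finite_induct) (simp_all add: group_closure_add)

lemma R3_add_third: "frag_of (x, y, z + z') - frag_of (x, y, z) - frag_of (x, y, z') \<in> R3"
  unfolding tensor3_rel_def by (rule group_closure.base) blast

lemma box_uu_diff: "box_uu d e (c - c') - (box_uu d e c - box_uu d e c') \<in> R3"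
proof -
  have g: "frag_of (x, y, z - z') - (frag_of (x, y, z) - frag_of (x, y, z')) \<in> R3" for x y z z'
  proof -
    have "0 - (frag_of (x, y, (z - z') + z') - frag_of (x, y, z - z') - frag_of (x, y, z')) \<in> R3"
      by (rule R3_diff[OF _ R3_add_third]) (simp add: tensor3_rel_def)
    then show ?thesis by (simp add: algebra_simps)
  qed
  show ?thesis
    unfolding box_uu_def frag_extend_minus_fun
  proof (intro R3_extend)
    fix p :: "'a \<times> 'k alg_closure"
    obtain x m where p: "p = (x, m)" by (cases p)
    have "frag_extend (\<lambda>(y, m'). frag_of (x, y, (c - c') * m * m')) (uu e) -
      (frag_extend (\<lambda>(y, m'). frag_of (x, y, c * m * m')) (uu e) - frag_extend (\<lambda>(y, m'). frag_of (x, y, c' * m * m')) (uu e)) \<in> R3"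
      unfolding frag_extend_minus_fun
    proof (intro R3_extend)
      fix q :: "'a \<times> 'k alg_closure"
      obtain y m' where q: "q = (y, m')" by (cases q)
      show "(case q of (y, m') \<Rightarrow> frag_of (x, y, (c - c') * m * m')) -
         ((case q of (y, m') \<Rightarrow> frag_of (x, y, c * m * m')) - (case q of (y, m') \<Rightarrow> frag_of (x, y, c' * m * m'))) \<in> R3"
        using g[of x y "c * m * m'" "c' * m * m'"] by (simp add: q left_diff_distrib)
    qed
    then show "(case p of (x, m) \<Rightarrow> frag_extend (\<lambda>(y, m'). frag_of (x, y, (c - c') * m * m')) (uu e)) -
      ((case p of (x, m) \<Rightarrow> frag_extend (\<lambda>(y, m'). frag_of (x, y, c * m * m')) (uu e)) -
       (case p of (x, m) \<Rightarrow> frag_extend (\<lambda>(y, m'). frag_of (x, y, c' * m * m')) (uu e))) \<in> R3"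
      by (simp add: p)
  qed
qed

lemma box_uu_0: "box_uu d e 0 \<in> R3"
  using box_uu_diff[of d e 0 0] by simp

lemma expand_in_uu:
  assumes "finite D" "Poly_Mapping.keys (\<Phi> a) \<subseteq> D"
  shows "frag_of (a, 1) - (\<Sum>d\<in>D. tensor_mult (frag_of (1, Poly_Mapping.lookup (\<Phi> a) d)) (uu d)) \<in> tensor_rel (strct G) to_ac UNIV"
proof -
  have "(\<Sum>d\<in>D. T\<Phi> (tensor_mult (frag_of (1, Poly_Mapping.lookup (\<Phi> a) d)) (uu d))) =
      (\<Sum>d\<in>D. Poly_Mapping.single 0 (Poly_Mapping.lookup (\<Phi> a) d) * Poly_Mapping.single (trunc n d) 1)"
    by (simp add: T\<Phi>_mult uu ring_hom_1 ring_\<Phi>)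
  also have "\<dots> = (\<Sum>d\<in>Poly_Mapping.keys (\<Phi> a). Poly_Mapping.single 0 (Poly_Mapping.lookup (\<Phi> a) d) * Poly_Mapping.single (trunc n d) 1)"
    using assms by (intro sum.mono_neutral_right) (auto simp: in_keys_iff)
  also have "\<dots> = (\<Sum>d\<in>Poly_Mapping.keys (\<Phi> a). Poly_Mapping.single d (Poly_Mapping.lookup (\<Phi> a) d))"
    by (intro sum.cong refl) (simp add: mult_single \<Phi>_keys)
  finally show ?thesis by (simp add: tensor_rel_iff tensor_eval_diff tensor_eval_sum sum_single)
qed

lemma box_expand:
  assumes D: "finite D" "Poly_Mapping.keys (\<Phi> a) \<subseteq> D" "Poly_Mapping.keys (\<Phi> b) \<subseteq> D"
  shows "frag_of (a, b, l) - (\<Sum>d\<in>D. \<Sum>e\<in>D. box_uu d e (Poly_Mapping.lookup (\<Phi> a) d * Poly_Mapping.lookup (\<Phi> b) e * l)) \<in> R3"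
proof -
  let ?a = "Poly_Mapping.lookup (\<Phi> a)" and ?b = "Poly_Mapping.lookup (\<Phi> b)"
  have 1: "frag_of (a, b, l) - (\<Sum>d\<in>D. frag_extend (\<lambda>(x, m). frag_of (x, b, ?a d * m * l)) (uu d)) \<in> R3"
  proof -
    have "frag_extend (\<lambda>(x, m). frag_of (x, b, m * l)) (tensor_mult (frag_of (1, c)) u) =
        frag_extend (\<lambda>(x, m). frag_of (x, b, c * m * l)) u" for c and u :: "('a \<times> 'k alg_closure) \<Rightarrow>\<^sub>0 int"
      by (simp add: tensor_mult_def) (induction u rule: frag_induction[OF subset_UNIV], auto simp: frag_extend_diff)
    then show ?thesis using box_left[OF expand_in_uu[OF D(1,2)], of b l]
      by (simp add: frag_extend_diff frag_extend_sum[OF D(1)] comp_def)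
  qed
  have 2: "frag_of (x, b, c) - (\<Sum>e\<in>D. frag_extend (\<lambda>(y, m'). frag_of (x, y, c * ?b e * m')) (uu e)) \<in> R3" for x c
  proof -
    have "frag_extend (\<lambda>(y, m). frag_of (x, y, c * m)) (tensor_mult (frag_of (1, z)) u) =
        frag_extend (\<lambda>(y, m). frag_of (x, y, c * z * m)) u" for z and u :: "('a \<times> 'k alg_closure) \<Rightarrow>\<^sub>0 int"
      by (simp add: tensor_mult_def) (induction u rule: frag_induction[OF subset_UNIV], auto simp: frag_extend_diff mult.assoc)
    then show ?thesis using box_right[OF expand_in_uu[OF D(1,3)], of x c]
      by (simp add: frag_extend_diff frag_extend_sum[OF D(1)] comp_def)
  qed
  have 3: "frag_extend (\<lambda>(x, m). frag_of (x, b, ?a d * m * l)) (uu d) - (\<Sum>e\<in>D. box_uu d e (?a d * ?b e * l)) \<in> R3" for d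
  proof -
    have s: "(\<Sum>e\<in>D. box_uu d e (?a d * ?b e * l)) = frag_extend (\<lambda>p. \<Sum>e\<in>D. case p of (x, m) \<Rightarrow> frag_extend (\<lambda>(y, m'). frag_of (x, y, ?a d * ?b e * l * m * m')) (uu e)) (uu d)"
      unfolding box_uu_def by (rule frag_extend_sum_fun)
    show ?thesis unfolding s frag_extend_minus_fun
    proof (intro R3_extend)
      fix p :: "'a \<times> 'k alg_closure"
      obtain x m where p: "p = (x, m)" by (cases p)
      show "(case p of (x, m) \<Rightarrow> frag_of (x, b, ?a d * m * l)) -
         (\<Sum>e\<in>D. case p of (x, m) \<Rightarrow> frag_extend (\<lambda>(y, m'). frag_of (x, y, ?a d * ?b e * l * m * m')) (uu e)) \<in> R3"
        using 2[of x "?a d * m * l"] by (simp add: p mult_ac)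
    qed
  qed
  have "(\<Sum>d\<in>D. frag_extend (\<lambda>(x, m). frag_of (x, b, ?a d * m * l)) (uu d)) - (\<Sum>d\<in>D. \<Sum>e\<in>D. box_uu d e (?a d * ?b e * l)) \<in> R3"
    unfolding sum_subtractf[symmetric] by (rule R3_sum) (rule 3)
  with 1 show ?thesis by (rule R3_trans)
qed

definition coef3 :: "(nat \<Rightarrow>\<^sub>0 int) \<Rightarrow> (nat \<Rightarrow>\<^sub>0 int) \<Rightarrow> (('a \<times> 'a \<times> 'k alg_closure) \<Rightarrow>\<^sub>0 int) \<Rightarrow> 'k alg_closure" where
  "coef3 d e = feval (\<lambda>(a, b, l). Poly_Mapping.lookup (\<Phi> a) d * Poly_Mapping.lookup (\<Phi> b) e * l)"

text \<open>Every formal sum is congruent to its normal form \<open>N\<close>, built from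
  \<open>box_uu\<close> by \<open>box_expand\<close>, and all terms of \<open>N v\<close> have
  scalar 0. Congruences such as the one in \<open>group_like_uu\<close> can thus be checked on
  coefficients.\<close>

lemma coef3_zero_imp_R3:
  assumes "\<And>d e. coef3 d e v = 0" shows "v \<in> R3"
proof -
  define D where "D = (\<Union>p\<in>Poly_Mapping.keys v. Poly_Mapping.keys (\<Phi> (fst p)) \<union> Poly_Mapping.keys (\<Phi> (fst (snd p))))"
  have D: "finite D" by (auto simp: D_def)
  define N where "N w = (\<Sum>d\<in>D. \<Sum>e\<in>D. box_uu d e (coef3 d e w))" for w
  have "w - N w \<in> R3" if "Poly_Mapping.keys w \<subseteq> Poly_Mapping.keys v" for w
    using that
  proof (induction w rule: frag_induction)
    case zero
    have "0 - (\<Sum>d\<in>D. \<Sum>e\<in>D. box_uu d e 0) \<in> R3"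
      by (intro R3_diff R3_sum box_uu_0) (simp add: tensor3_rel_def)
    then show ?case by (simp add: N_def coef3_def)
  next
    case (one p)
    obtain a b l where p: "p = (a, b, l)" by (cases p)
    show ?case using box_expand[OF D, of a b l] one unfolding p by (force simp: N_def coef3_def D_def)
  next
    case (diff u w)
    have "N (u - w) - (N u - N w) = (\<Sum>d\<in>D. \<Sum>e\<in>D.
        box_uu d e (coef3 d e u - coef3 d e w) - (box_uu d e (coef3 d e u) - box_uu d e (coef3 d e w)))"
      by (simp add: N_def sum_subtractf coef3_def feval_diff)
    also have "\<dots> \<in> R3" by (intro R3_sum box_uu_diff)
    finally have "(u - N u) - (w - N w) - (N (u - w) - (N u - N w)) \<in> R3"
      by (rule R3_diff[OF R3_diff[OF diff]])
    then show ?case by (simp add: algebra_simps)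
  qed
  from this[OF subset_refl] have "v - (\<Sum>d\<in>D. \<Sum>e\<in>D. box_uu d e 0) \<in> R3" by (simp add: N_def assms)
  moreover have "(\<Sum>d\<in>D. \<Sum>e\<in>D. box_uu d e 0) - 0 \<in> R3" by (simp add: R3_sum box_uu_0)
  ultimately have "v - 0 \<in> R3" by (rule R3_trans)
  then show ?thesis by simp
qed

lemma lookup_T\<Phi>: "Poly_Mapping.lookup (T\<Phi> u) d = feval (\<lambda>p. Poly_Mapping.lookup (\<Phi> (fst p)) d * snd p) u"
  by (simp add: tensor_eval_feval lookup_feval lookup_mult_single_0)

lemma group_like_uu: "group_like G (uu d)"
proof -
  note id = ring_hom_id(1)
  have "pt id (\<lambda>_. 1) = (\<lambda>a. to_ac (counit G a))" using one_point[OF id] by (simp add: points_def)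
  then have "teval id (\<lambda>a. to_ac (counit G a)) (uu d) = 1"
    using chi_pt[OF id thom_one] unfolding chi_def by (metis (no_types, lifting))
  moreover have "frag_extend (\<lambda>(a, l). frag_extend (\<lambda>(x, y). frag_of (x, y, l)) (comul G a)) (uu d) -
      frag_extend (\<lambda>(a, l). frag_extend (\<lambda>(b, m). frag_of (a, b, l * m)) (uu d)) (uu d) \<in> R3" (is "?v - ?w \<in> R3")
  proof (rule coef3_zero_imp_R3)
    fix d' e'
    have "coef3 d' e' ?v = feval (\<lambda>p. tensor_eval (\<lambda>x y. Poly_Mapping.lookup (\<Phi> x) d' * Poly_Mapping.lookup (\<Phi> y) e') (comul G (fst p)) * snd p) (uu d)"
      unfolding coef3_def feval_extend
      by (rule feval_cong) (auto simp: feval_extend tensor_eval_feval feval_mult_right intro!: feval_cong)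
    also have "\<dots> = (if d' = e' then Poly_Mapping.lookup (T\<Phi> (uu d)) d' else 0)"
      using \<Phi>_comul by (auto simp: comul_compatible_def lookup_T\<Phi> feval_def)
    finally have v: "coef3 d' e' ?v = (if d' = e' then Poly_Mapping.lookup (T\<Phi> (uu d)) d' else 0)" .
    have "coef3 d' e' ?w = feval (\<lambda>p. Poly_Mapping.lookup (\<Phi> (fst p)) d' * snd p * feval (\<lambda>q. Poly_Mapping.lookup (\<Phi> (fst q)) e' * snd q) (uu d)) (uu d)"
      unfolding coef3_def feval_extend
      by (rule feval_cong) (auto simp: feval_extend feval_mult_left mult_ac intro!: feval_cong)
    then have "coef3 d' e' ?w = Poly_Mapping.lookup (T\<Phi> (uu d)) d' * Poly_Mapping.lookup (T\<Phi> (uu d)) e'"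
      by (simp add: lookup_T\<Phi> feval_mult_right)
    then show "coef3 d' e' (?v - ?w) = 0" using v by (simp add: coef3_def feval_diff uu lookup_single when_def)
  qed
  ultimately show ?thesis by (simp add: group_like_def teval_def)
qed

lemma carrier_characters: "carrier (characters G) = range char_class"
  using group_like_class group_like_uu by (force simp: characters_def simp flip: ac_class_uu)


text \<open>A Galois-stable basis of the character lattice in multiplicative form: the values of a
  point on it can be prescribed and determine the point.\<close>

definition perm_basis :: "(nat \<Rightarrow>\<^sub>0 int) set \<Rightarrow> bool" where
  "perm_basis S \<longleftrightarrow> (\<forall>d\<in>S. trunc n d = d) \<and> (\<forall>\<rho>\<in>Gal. \<forall>d\<in>S. act \<rho> d \<in> S) \<and>
    (\<forall>f :: _ \<Rightarrow> 'k alg_closure. (\<forall>d\<in>S. f d \<noteq> 0) \<longrightarrow> (\<exists>w. thom n w \<and> (\<forall>d\<in>S. w d = f d))) \<and>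
    (\<forall>h h' :: _ \<Rightarrow> 'k alg_closure. thom n h \<longrightarrow> thom n h' \<longrightarrow> (\<forall>d\<in>S. h d = h' d) \<longrightarrow> h = h')"

text \<open>\<open>g\<close> gives the coordinates of a character with respect to the basis
  \<open>B\<close> of character classes, and \<open>S\<close> consists of the truncated exponents of
  the members of \<open>B\<close>. Prescribed values are extended by a product formula in these
  coordinates.\<close>

lemma quasi_trivial_perm_basis:
  assumes "quasi_trivial_torus G" shows "\<exists>S. perm_basis S"
proof -
  have "\<exists>B. B \<subseteq> carrier (characters G) \<and> (\<exists>h \<in> iso (free_Abelian_group B) (characters G). \<forall>b\<in>B. h (frag_of b) = b) \<and>
        (\<forall>\<sigma>\<in>Gal. character_act G \<sigma> ` B = B)"
    using assms unfolding quasi_trivial_torus_def by (elim conjE)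
  then obtain B where B: "B \<subseteq> carrier (characters G)" and ex: "\<exists>h \<in> iso (free_Abelian_group B) (characters G). \<forall>b\<in>B. h (frag_of b) = b"
    and st: "\<forall>\<sigma>\<in>Gal. character_act G \<sigma> ` B = B" by (elim exE conjE) (rule that)
  from ex obtain h where h: "h \<in> iso (free_Abelian_group B) (characters G)" and hB': "\<forall>b\<in>B. h (frag_of b) = b"
    by (elim bexE) (rule that)
  have hB: "h (frag_of b) = b" if "b \<in> B" for b using hB' that by simp
  have stable: "character_act G \<sigma> ` B = B" if "\<sigma> \<in> Gal" for \<sigma> using st that by simp
  have hm: "h (x + y) = h x \<otimes>\<^bsub>characters G\<^esub> h y" if "Poly_Mapping.keys x \<subseteq> B" "Poly_Mapping.keys y \<subseteq> B" for x y
    using h that by (auto simp: iso_def hom_def)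
  have bij: "bij_betw h {x. Poly_Mapping.keys x \<subseteq> B} (range char_class)"
    using h unfolding iso_def carrier_characters by (simp add: free_Abelian_group_def)
  then have inj: "\<And>x y. Poly_Mapping.keys x \<subseteq> B \<Longrightarrow> Poly_Mapping.keys y \<subseteq> B \<Longrightarrow> h x = h y \<Longrightarrow> x = y"
    by (auto simp: bij_betw_def dest: inj_onD)
  have "\<exists>x. Poly_Mapping.keys x \<subseteq> B \<and> h x = char_class d" for d
  proof -
    have "char_class d \<in> h ` {x. Poly_Mapping.keys x \<subseteq> B}" using bij by (simp add: bij_betw_def)
    then show ?thesis by auto
  qed
  then obtain g where g: "\<And>d. Poly_Mapping.keys (g d) \<subseteq> B" "\<And>d. h (g d) = char_class d" by metis
  have g_add: "g (d + e) = g d + g e" for d e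
  proof (rule inj[OF g(1)])
    show "Poly_Mapping.keys (g d + g e) \<subseteq> B" using keys_add[of "g d" "g e"] g(1)[of d] g(1)[of e] by (meson Un_least order_trans)
    show "h (g (d + e)) = h (g d + g e)" by (simp add: g(2) hm g(1) char_class_mult)
  qed
  have g_trunc: "g (trunc n d) = g d" for d by (rule inj[OF g(1) g(1)]) (simp add: g(2) char_class_eq_iff)
  have g0: "g 0 = 0" using g_add[of 0 0] by simp
  define S where "S = {d. trunc n d = d \<and> char_class d \<in> B}"
  have gS: "g d = frag_of (char_class d)" if "d \<in> S" for d
    using that by (intro inj[OF g(1)]) (auto simp: g(2) S_def hB)
  have repr: "\<exists>d\<in>S. char_class d = b" if bB: "b \<in> B" for b
  proof -
    obtain d where "b = char_class d" using bB B unfolding carrier_characters by blast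
    then have "char_class (trunc n d) = b" by (simp add: char_class_eq_iff)
    then show ?thesis using bB by (intro bexI[of _ "trunc n d"]) (simp_all add: S_def)
  qed
  have "perm_basis S"
    unfolding perm_basis_def
  proof (intro conjI ballI allI impI)
    show "trunc n d = d" if "d \<in> S" for d using that by (simp add: S_def)
    show "act \<rho> d \<in> S" if r: "\<rho> \<in> Gal" and d: "d \<in> S" for \<rho> d
    proof -
      have "character_act G \<rho> (char_class d) \<in> B" using stable[OF r] d unfolding S_def by blast
      then show ?thesis by (simp add: S_def trunc_act r character_act_class)
    qed
  next
    fix f :: "_ \<Rightarrow> 'k alg_closure" assume f: "\<forall>d\<in>S. f d \<noteq> 0"
    define F where "F b = f (SOME d. d \<in> S \<and> char_class d = b)" for b
    have F: "F (char_class d) = f d" if "d \<in> S" for d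
    proof -
      have "(SOME d'. d' \<in> S \<and> char_class d' = char_class d) = d"
        using that by (intro some_equality) (auto simp: S_def char_class_eq_iff)
      then show ?thesis by (simp add: F_def)
    qed
    have F0: "F b \<noteq> 0" if "b \<in> B" for b using repr[OF that] F f by auto
    define w where "w d = (\<Prod>b\<in>Poly_Mapping.keys (g d). F b powi Poly_Mapping.lookup (g d) b)" for d
    have wD: "w d = (\<Prod>b\<in>D. F b powi Poly_Mapping.lookup (g d) b)" if "finite D" "Poly_Mapping.keys (g d) \<subseteq> D" for d D
      unfolding w_def using that by (intro prod.mono_neutral_left) (auto simp: in_keys_iff)
    have "w (d + e) = w d * w e" for d e
    proof -
      let ?D = "Poly_Mapping.keys (g d) \<union> Poly_Mapping.keys (g e)"
      have DB: "?D \<subseteq> B" using g(1) by blast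
      have "w (d + e) = (\<Prod>b\<in>?D. F b powi Poly_Mapping.lookup (g (d + e)) b)"
        using keys_add[of "g d" "g e"] by (intro wD) (simp_all add: g_add)
      also have "\<dots> = (\<Prod>b\<in>?D. F b powi Poly_Mapping.lookup (g d) b * F b powi Poly_Mapping.lookup (g e) b)"
        using DB F0 by (intro prod.cong refl) (auto simp: g_add lookup_add power_int_add)
      also have "\<dots> = w d * w e"
        unfolding prod.distrib by (simp add: wD[of ?D d] wD[of ?D e])
      finally show ?thesis .
    qed
    moreover have "w 0 = 1" by (simp add: w_def g0)
    moreover have "w (trunc n d) = w d" for d by (simp add: w_def g_trunc)
    moreover have "w d = f d" if "d \<in> S" for d using that by (simp add: w_def gS F)
    ultimately show "\<exists>w. thom n w \<and> (\<forall>d\<in>S. w d = f d)" by (intro exI[of _ w]) (simp add: thom_def)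
  next
    fix h1 h2 :: "_ \<Rightarrow> 'k alg_closure" assume t: "thom n h1" "thom n h2" and eq: "\<forall>d\<in>S. h1 d = h2 d"
    \<comment> \<open>The support condition is part of the claim, because the difference step needs
      it to write the subtracted element as some \<open>g d2\<close>.\<close>
    have "Poly_Mapping.keys x \<subseteq> B \<and> (\<forall>d. x = g d \<longrightarrow> h1 d = h2 d)" if "Poly_Mapping.keys x \<subseteq> B" for x
      using that
    proof (induction x rule: frag_induction)
      case zero
      have "h1 d = h2 d" if "g d = 0" for d
      proof -
        have "char_class d = char_class 0" using g(2)[of d] g(2)[of 0] by (simp add: that g0)
        then have "trunc n d = 0" by (simp add: char_class_eq_iff)
        then show ?thesis using thom_trunc[OF t(1), of d] thom_trunc[OF t(2), of d] by (simp add: thom_0[OF t(1)] thom_0[OF t(2)])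
      qed
      then show ?case by (metis empty_subsetI keys_zero)
    next
      case (one b)
      have "h1 d = h2 d" if "frag_of b = g d" for d
      proof -
        obtain d' where d': "d' \<in> S" "char_class d' = b" using repr[OF one] by blast
        have "char_class d = char_class d'" using g(2)[of d] g(2)[of d'] gS[OF d'(1)] d'(2) that by metis
        then have "trunc n d = d'" using d'(1) by (simp add: char_class_eq_iff S_def)
        then show ?thesis using thom_trunc[OF t(1), of d] thom_trunc[OF t(2), of d] eq d'(1) by auto
      qed
      then show ?case using one by auto
    next
      case (diff x y)
      have "h1 d = h2 d" if d: "x - y = g d" for d
      proof -
        have ky: "Poly_Mapping.keys y \<subseteq> B" and kx: "\<And>d. x = g d \<Longrightarrow> h1 d = h2 d" and ky': "\<And>d. y = g d \<Longrightarrow> h1 d = h2 d"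
          using diff by simp_all
        have "h y \<in> range char_class" using bij_betw_apply[OF bij, of y] ky by simp
        then obtain d2 where "h y = char_class d2" by (elim rangeE)
        then have y: "y = g d2" using inj[OF ky g(1), of d2] by (simp add: g(2))
        then have "x = g (d + d2)" using d by (simp add: g_add algebra_simps)
        then have "h1 (d + d2) = h2 (d + d2)" "h1 d2 = h2 d2" using kx ky' y by simp_all
        then show ?thesis using thom_nonzero[OF t(2), of d2] by (simp add: thom_add[OF t(1)] thom_add[OF t(2)])
      qed
      moreover have "Poly_Mapping.keys (x - y) \<subseteq> B" using diff by (intro order_trans[OF keys_diff]) simp
      ultimately show ?case by simp
    qed
    then have "h1 d = h2 d" for d using g(1) by blast
    then show "h1 = h2" by auto
  qed
  then show ?thesis ..
qed

text \<open>On a permutation basis the cocycle is induced: \<open>shapiro\<close> reduces the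
  splitting to stabilizers of basis characters, where it is Hilbert 90, and
  \<open>perm_basis\<close> extends the resulting values to a point.\<close>

lemma torus_hilbert90:
  assumes qt: "quasi_trivial_torus G" and b: "b \<in> carrier (galZ1 id G)"
  shows "\<exists>h. thom n h \<and> (\<forall>\<sigma>\<in>Gal. \<forall>e. h (act \<sigma> e) * chi id (b \<sigma>) (act \<sigma> e) = \<sigma> (h e))"
proof -
  interpret E: galois_points id G torus_gens by (rule torus_galois_points[OF ac_embedding_id])
  have bZ: "b \<in> carrier E.Z" using b by (simp add: E.galZ1_eq)
  define \<beta> where "\<beta> \<sigma> = chi id (b \<sigma>)" for \<sigma>
  have "lattice_cocycle id \<beta>" unfolding \<beta>_def by (rule cocycle_lattice[OF ac_embedding_id bZ])
  then have th: "\<And>\<sigma>. \<sigma> \<in> Gal \<Longrightarrow> thom n (\<beta> \<sigma>)"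
    and coc: "\<And>\<sigma> \<sigma>' e. \<sigma> \<in> Gal \<Longrightarrow> \<sigma>' \<in> Gal \<Longrightarrow> \<beta> (\<sigma> \<circ> \<sigma>') (act \<sigma> e) = \<beta> \<sigma> (act \<sigma> e) * \<sigma> (\<beta> \<sigma>' e)"
    and fin: "\<exists>Y. finite Y \<and> (\<forall>\<sigma>\<in>Gal. (\<forall>x\<in>Y. \<sigma> x = x) \<longrightarrow> (\<forall>e. \<beta> \<sigma> e = 1))"
    unfolding lattice_cocycle_def[OF ac_embedding_id] gal_res_id_embedding by blast+
  obtain Y where Y: "finite Y" "\<And>\<sigma> e. \<sigma> \<in> Gal \<Longrightarrow> (\<forall>x\<in>Y. \<sigma> x = x) \<Longrightarrow> \<beta> \<sigma> e = 1" using fin by blast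
  obtain S where S: "perm_basis S" using quasi_trivial_perm_basis[OF qt] by blast
  note S' = S[unfolded perm_basis_def]
  have St: "trunc n d = d" if "d \<in> S" for d using S' that by (elim conjE) (rule bspec)
  have Sa: "act \<rho> d \<in> S" if "\<rho> \<in> Gal" "d \<in> S" for \<rho> d
  proof -
    from S' have "\<forall>\<rho>\<in>Gal. \<forall>d\<in>S. act \<rho> d \<in> S" by (elim conjE)
    then show ?thesis using that by simp
  qed
  have Se: "\<exists>w. thom n w \<and> (\<forall>d\<in>S. w d = f d)" if "\<forall>d\<in>S. f d \<noteq> 0" for f :: "_ \<Rightarrow> 'k alg_closure"
  proof -
    from S' have "\<forall>f :: _ \<Rightarrow> 'k alg_closure. (\<forall>d\<in>S. f d \<noteq> 0) \<longrightarrow> (\<exists>w. thom n w \<and> (\<forall>d\<in>S. w d = f d))" by (elim conjE)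
    then have "(\<forall>d\<in>S. f d \<noteq> 0) \<longrightarrow> (\<exists>w. thom n w \<and> (\<forall>d\<in>S. w d = f d))" by (rule spec)
    then show ?thesis using that by (rule mp)
  qed
  have Su: "h = h'" if "thom n h" "thom n h'" "\<forall>d\<in>S. h d = h' d" for h h' :: "_ \<Rightarrow> 'k alg_closure"
  proof -
    from S' have "\<forall>h h' :: _ \<Rightarrow> 'k alg_closure. thom n h \<longrightarrow> thom n h' \<longrightarrow> (\<forall>d\<in>S. h d = h' d) \<longrightarrow> h = h'" by (elim conjE)
    then have "\<forall>h'. thom n h \<longrightarrow> thom n h' \<longrightarrow> (\<forall>d\<in>S. h d = h' d) \<longrightarrow> h = h'" by (rule spec)
    then have "thom n h \<longrightarrow> thom n h' \<longrightarrow> (\<forall>d\<in>S. h d = h' d) \<longrightarrow> h = h'" by (rule spec)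
    then show ?thesis using that by (elim impE) simp_all
  qed
  define M :: "'k alg_closure monoid" where "M = \<lparr>carrier = UNIV - {0}, monoid.mult = (*), one = 1\<rparr>"
  have M: "comm_group M"
  proof (rule comm_groupI)
    fix x assume "x \<in> carrier M"
    then show "\<exists>y\<in>carrier M. y \<otimes>\<^bsub>M\<^esub> x = \<one>\<^bsub>M\<^esub>" by (intro bexI[of _ "inverse x"]) (auto simp: M_def)
  qed (auto simp: M_def mult.assoc mult.commute)
  have nz: "\<beta> g s \<noteq> 0" if "g \<in> Gal" for g s using thom_nonzero[OF th[OF that]] by simp
  have "\<exists>W. (\<forall>s\<in>S. W s \<in> carrier M) \<and> (\<forall>g\<in>carrier (gal UNIV). \<forall>s\<in>S. W (act g s) \<otimes>\<^bsub>M\<^esub> \<beta> g (act g s) = g (W s))"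
  proof (rule shapiro[where \<Gamma> = "gal UNIV" and Y = M and mv = act and act = "\<lambda>\<sigma> x. \<sigma> x" and f = \<beta> and S = S])
    show "group (gal (UNIV :: 'k alg_closure set))" by (rule group_gal_UNIV)
    show "act \<one>\<^bsub>gal UNIV\<^esub> s = s" if "s \<in> S" for s using that by (simp add: gal_one act_id St)
    show "\<exists>w\<in>carrier M. \<forall>g\<in>Gal. act g s = s \<longrightarrow> w \<otimes>\<^bsub>M\<^esub> \<beta> g s = g w" if s: "s \<in> S" for s
    proof -
      have "\<exists>y. y \<noteq> 0 \<and> (\<forall>\<sigma>\<in>{\<sigma> \<in> Gal. act \<sigma> s = s}. \<beta> \<sigma> s * \<sigma> y = y)"
      proof (rule hilbert90[where Y = Y])
        show "\<sigma> \<circ> \<tau> \<in> {\<sigma> \<in> Gal. act \<sigma> s = s}" if "\<sigma> \<in> {\<sigma> \<in> Gal. act \<sigma> s = s}" "\<tau> \<in> {\<sigma> \<in> Gal. act \<sigma> s = s}" for \<sigma> \<tau>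
          using that by (simp add: gal_comp act_comp)
        show "inv_into UNIV \<sigma> \<in> {\<sigma> \<in> Gal. act \<sigma> s = s}" if "\<sigma> \<in> {\<sigma> \<in> Gal. act \<sigma> s = s}" for \<sigma>
          using that act_inv(2)[of \<sigma> s] by (simp add: gal_inv St s)
        show "\<beta> (\<sigma> \<circ> \<tau>) s = \<beta> \<sigma> s * \<sigma> (\<beta> \<tau> s)" if "\<sigma> \<in> {\<sigma> \<in> Gal. act \<sigma> s = s}" "\<tau> \<in> {\<sigma> \<in> Gal. act \<sigma> s = s}" for \<sigma> \<tau>
          using coc[of \<sigma> \<tau> s] that by simp
      qed (use Y nz id_in_gal St[OF s] in \<open>auto simp: act_id\<close>)
      then obtain y where y: "y \<noteq> 0" "\<And>\<sigma>. \<sigma> \<in> Gal \<Longrightarrow> act \<sigma> s = s \<Longrightarrow> \<beta> \<sigma> s * \<sigma> y = y" by blast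
      \<comment> \<open>\<open>hilbert90\<close> splits in the form
        \<open>\<beta> * \<sigma> y = y\<close>, while \<open>shapiro\<close> asks for
        \<open>w * \<beta> = \<sigma> w\<close>; the inverse converts one into the other.\<close>
      have "inverse y * \<beta> \<sigma> s = \<sigma> (inverse y)" if g: "\<sigma> \<in> Gal" "act \<sigma> s = s" for \<sigma>
      proof -
        have 1: "\<sigma> (inverse y) * \<sigma> y = 1"
          using y(1) ring_hom_1[OF gal_hom[OF g(1)]] by (simp flip: ring_hom_mult[OF gal_hom[OF g(1)]])
        then have "\<sigma> y \<noteq> 0" by auto
        moreover have "inverse y * \<beta> \<sigma> s * \<sigma> y = \<sigma> (inverse y) * \<sigma> y"
          using y(2)[OF g] y(1) 1 by (simp add: mult.assoc)
        ultimately show ?thesis by simp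
      qed
      then show ?thesis using y(1) by (intro bexI[of _ "inverse y"]) (auto simp: M_def)
    qed
    show "\<beta> (g \<otimes>\<^bsub>gal UNIV\<^esub> h) (act g s) = \<beta> g (act g s) \<otimes>\<^bsub>M\<^esub> g (\<beta> h s)"
      if "g \<in> Gal" "h \<in> Gal" "s \<in> S" for g h s using that coc by (simp add: gal_mult M_def)
    show "g x \<in> carrier M" if "g \<in> Gal" "x \<in> carrier M" for g x
      using that ring_hom_inj[OF gal_hom[OF that(1)]] ring_hom_0[OF gal_hom[OF that(1)]] by (auto simp: M_def dest: injD[of g x 0])
  qed (use M nz in \<open>auto simp: Sa gal_mult act_comp M_def gal_hom ring_hom_mult\<close>)
  then obtain f where f: "\<forall>s\<in>S. f s \<noteq> 0" "\<And>g s. g \<in> Gal \<Longrightarrow> s \<in> S \<Longrightarrow> f (act g s) * \<beta> g (act g s) = g (f s)"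
    by (auto simp: M_def)
  obtain w where w: "thom n w" "\<forall>d\<in>S. w d = f d" using Se[OF f(1)] by blast
  have "w (act \<sigma> e) * \<beta> \<sigma> (act \<sigma> e) = \<sigma> (w e)" if s: "\<sigma> \<in> Gal" for \<sigma> e
  proof -
    have "(\<lambda>e. w (act \<sigma> e) * \<beta> \<sigma> (act \<sigma> e)) = (\<lambda>e. \<sigma> (w e))"
    proof (rule Su)
      show "thom n (\<lambda>e. w (act \<sigma> e) * \<beta> \<sigma> (act \<sigma> e))"
        using w(1) th[OF s] by (simp add: thom_def act_0 act_add act_trunc s)
      show "thom n (\<lambda>e. \<sigma> (w e))" by (rule thom_hom[OF gal_hom[OF s] w(1)])
      show "\<forall>d\<in>S. w (act \<sigma> d) * \<beta> \<sigma> (act \<sigma> d) = \<sigma> (w d)" using w(2) f(2)[OF s] Sa[OF s] by simp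
    qed
    then show ?thesis by (rule fun_cong)
  qed
  then show ?thesis using w(1) unfolding \<beta>_def by blast
qed

end

section \<open>Divisibility of the multiplicative group\<close>

definition subgrp :: "'x::ab_group_add set \<Rightarrow> bool" where
  "subgrp S \<longleftrightarrow> 0 \<in> S \<and> (\<forall>x\<in>S. \<forall>y\<in>S. x - y \<in> S)"

lemma subgrp_0: "subgrp S \<Longrightarrow> 0 \<in> S"
  and subgrp_diff: "subgrp S \<Longrightarrow> x \<in> S \<Longrightarrow> y \<in> S \<Longrightarrow> x - y \<in> S"
  by (simp_all add: subgrp_def)

lemma subgrp_add: assumes "subgrp S" "x \<in> S" "y \<in> S" shows "x + y \<in> S"
  using subgrp_diff[OF assms(1,2) subgrp_diff[OF assms(1) subgrp_0[OF assms(1)] assms(3)]] by simp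

definition mhom :: "'x::ab_group_add set \<Rightarrow> ('x \<Rightarrow> 'w::field) \<Rightarrow> bool" where
  "mhom S g \<longleftrightarrow> (\<forall>x\<in>S. g x \<noteq> 0) \<and> (\<forall>x\<in>S. \<forall>y\<in>S. g (x + y) = g x * g y)"

text \<open>The value \<open>y\<close> at \<open>x\<close> must fit the multiples of
  \<open>x\<close> that lie in \<open>S\<close>. If \<open>m\<close> is the least positive factor
  with \<open>m x\<close> in \<open>S\<close>, an \<open>m\<close>-th root of \<open>g (m x)\<close>
  fits; if only the zero multiple occurs, the value 1 is taken.\<close>

lemma mhom_extend:
  fixes g :: "('s \<Rightarrow>\<^sub>0 int) \<Rightarrow> 'k::field_char_0 alg_closure"
  assumes S: "subgrp S" and g: "mhom S g"
  shows "\<exists>S' g'. subgrp S' \<and> mhom S' g' \<and> S \<subseteq> S' \<and> x \<in> S' \<and> (\<forall>s\<in>S. g' s = g s)"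
proof -
  have g_add: "g (a + b) = g a * g b" if "a \<in> S" "b \<in> S" for a b using g that by (simp add: mhom_def)
  have gnz: "g a \<noteq> 0" if "a \<in> S" for a using g that by (simp add: mhom_def)
  have g0: "g 0 = 1" using g_add[OF subgrp_0[OF S] subgrp_0[OF S]] gnz[OF subgrp_0[OF S]] by simp
  have "\<exists>y. y \<noteq> 0 \<and> (\<forall>j. frag_cmul j x \<in> S \<longrightarrow> g (frag_cmul j x) = y powi j)"
  proof (cases "\<exists>m>0. frag_cmul (int m) x \<in> S")
    case True
    define m where "m = (LEAST m. 0 < m \<and> frag_cmul (int m) x \<in> S)"
    have m: "0 < m" "frag_cmul (int m) x \<in> S" using LeastI_ex[OF True] by (simp_all add: m_def)
    have least: "m \<le> l" if "0 < l" "frag_cmul (int l) x \<in> S" for l unfolding m_def using that by (intro Least_le) simp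
    have mult: "frag_cmul (int q * int m) x \<in> S \<and> g (frag_cmul (int q * int m) x) = g (frag_cmul (int m) x) ^ q" for q
    proof (induction q)
      case (Suc q)
      have "frag_cmul (int (Suc q) * int m) x = frag_cmul (int m) x + frag_cmul (int q * int m) x"
        by (simp add: algebra_simps frag_cmul_distrib)
      then show ?case using Suc m(2) by (simp add: subgrp_add[OF S] g_add)
    qed (simp add: g0 subgrp_0[OF S])
    obtain y where y: "y ^ m = g (frag_cmul (int m) x)" using nth_root_exists[OF m(1)] by blast
    have y0: "y \<noteq> 0" using y gnz[OF m(2)] m(1) by (auto simp: power_0_left)
    have nat: "g (frag_cmul (int j) x) = y ^ j" if j: "frag_cmul (int j) x \<in> S" for j
    proof -
      define q r where "q = j div m" and "r = j mod m"
      have jqr: "int j = int q * int m + int r" by (simp add: q_def r_def flip: of_nat_mult of_nat_add)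
      have "frag_cmul (int j) x - frag_cmul (int q * int m) x = frag_cmul (int r) x"
        unfolding jqr by (simp add: frag_cmul_distrib)
      then have "frag_cmul (int r) x \<in> S" using subgrp_diff[OF S j] mult[of q] by metis
      then have "r = 0" using least[of r] m(1) by (metis mod_less_divisor not_gr_zero not_le r_def)
      then have jq: "j = q * m" using jqr by (simp add: flip: of_nat_mult)
      have ij: "int j = int q * int m" by (simp add: jq)
      have "y ^ j = (y ^ m) ^ q" by (simp add: jq mult.commute[of q] power_mult)
      then show ?thesis unfolding ij using mult[of q] y by simp
    qed
    have "g (frag_cmul j x) = y powi j" if j: "frag_cmul j x \<in> S" for j
    proof (cases "j \<ge> 0")
      case True
      then show ?thesis using nat[of "nat j"] j by (simp add: power_int_def)
    next
      case False
      have "frag_cmul (- j) x = 0 - frag_cmul j x" by simp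
      then have mj: "frag_cmul (- j) x \<in> S" using subgrp_diff[OF S subgrp_0[OF S] j] by metis
      then have "g (frag_cmul (- j) x) = y ^ nat (- j)" using nat[of "nat (- j)"] False by simp
      moreover have "g (frag_cmul (- j) x) * g (frag_cmul j x) = 1"
      proof -
        have "frag_cmul (- j) x + frag_cmul j x = 0" by (simp flip: frag_cmul_distrib)
        then show ?thesis using g_add[OF mj j] g0 by metis
      qed
      ultimately have "y ^ nat (- j) * g (frag_cmul j x) = 1" by metis
      then have "g (frag_cmul j x) = inverse (y ^ nat (- j))" by (metis inverse_unique)
      then show ?thesis using False by (simp add: power_int_def power_inverse)
    qed
    then show ?thesis using y0 by blast
  next
    case False
    have "j = 0" if j: "frag_cmul j x \<in> S" for j
    proof (rule ccontr)
      assume "j \<noteq> 0"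
      have "0 - frag_cmul j x \<in> S" by (rule subgrp_diff[OF S subgrp_0[OF S] j])
      then have "frag_cmul (- j) x \<in> S" by simp
      then have "frag_cmul (int (nat \<bar>j\<bar>)) x \<in> S" using j by (cases "j \<ge> 0") auto
      moreover have "0 < nat \<bar>j\<bar>" using \<open>j \<noteq> 0\<close> by simp
      ultimately show False using False by blast
    qed
    then have "g (frag_cmul j x) = 1 powi j" if "frag_cmul j x \<in> S" for j
    proof -
      have "j = 0" using \<open>\<And>j. frag_cmul j x \<in> S \<Longrightarrow> j = 0\<close> that .
      then show ?thesis by (simp add: g0)
    qed
    then show ?thesis by (intro exI[of _ 1]) simp
  qed
  then obtain y where y0: "y \<noteq> 0" and y: "\<And>j. frag_cmul j x \<in> S \<Longrightarrow> g (frag_cmul j x) = y powi j" by blast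
  define S' where "S' = {s + frag_cmul j x |s j. s \<in> S}"
  \<comment> \<open>Two decompositions of \<open>z\<close> differ by a multiple of \<open>x\<close>
    in \<open>S\<close>, where \<open>y\<close> fits, so the choice does not matter.\<close>
  define g' where "g' z = (SOME w. \<exists>s j. s \<in> S \<and> z = s + frag_cmul j x \<and> w = g s * y powi j)" for z
  have g': "g' (s + frag_cmul j x) = g s * y powi j" if s: "s \<in> S" for s j
    unfolding g'_def
  proof (rule some_equality)
    show "\<exists>s' j'. s' \<in> S \<and> s + frag_cmul j x = s' + frag_cmul j' x \<and> g s * y powi j = g s' * y powi j'" using s by blast
    fix w assume "\<exists>s' j'. s' \<in> S \<and> s + frag_cmul j x = s' + frag_cmul j' x \<and> w = g s' * y powi j'"
    then obtain s' j' where s': "s' \<in> S" "s + frag_cmul j x = s' + frag_cmul j' x" "w = g s' * y powi j'" by blast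
    have d: "s' - s = frag_cmul (j - j') x" using s'(2) by (simp add: frag_cmul_diff_distrib algebra_simps)
    then have dS: "frag_cmul (j - j') x \<in> S" using subgrp_diff[OF S s'(1) s] by simp
    have "g s' = g (s + frag_cmul (j - j') x)" by (simp flip: d)
    also have "\<dots> = g s * y powi (j - j')" by (simp add: g_add s dS y)
    finally show "w = g s * y powi j" using y0 by (simp add: s'(3) power_int_diff)
  qed
  have "subgrp S'"
    unfolding subgrp_def
  proof (intro conjI ballI)
    show "0 \<in> S'" unfolding S'_def using subgrp_0[OF S] by (intro CollectI exI[of _ 0]) simp
    fix a b assume "a \<in> S'" "b \<in> S'"
    then obtain s j s' j' where "s \<in> S" "a = s + frag_cmul j x" "s' \<in> S" "b = s' + frag_cmul j' x" by (auto simp: S'_def)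
    then show "a - b \<in> S'" unfolding S'_def using subgrp_diff[OF S]
      by (intro CollectI exI[of _ "s - s'"] exI[of _ "j - j'"]) (simp add: frag_cmul_diff_distrib algebra_simps)
  qed
  moreover have "mhom S' g'"
    unfolding mhom_def
  proof (intro conjI ballI)
    fix a assume "a \<in> S'"
    then obtain s j where a: "s \<in> S" "a = s + frag_cmul j x" by (auto simp: S'_def)
    then show "g' a \<noteq> 0" using g' gnz y0 by simp
    fix b assume "b \<in> S'"
    then obtain s' j' where b: "s' \<in> S" "b = s' + frag_cmul j' x" by (auto simp: S'_def)
    have ab: "a + b = (s + s') + frag_cmul (j + j') x" by (simp add: a b frag_cmul_distrib algebra_simps)
    have "g' (a + b) = g (s + s') * y powi (j + j')" unfolding ab by (rule g'[OF subgrp_add[OF S a(1) b(1)]])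
    also have "\<dots> = (g s * y powi j) * (g s' * y powi j')" using y0 by (simp add: g_add a(1) b(1) power_int_add)
    also have "\<dots> = g' a * g' b" unfolding a(2) b(2) g'[OF a(1)] g'[OF b(1)] ..
    finally show "g' (a + b) = g' a * g' b" .
  qed
  moreover have "s \<in> S'" if "s \<in> S" for s
    unfolding S'_def using that by (intro CollectI exI[of _ s] exI[of _ 0]) simp
  moreover have "x \<in> S'"
    unfolding S'_def using subgrp_0[OF S] by (intro CollectI exI[of _ 0] exI[of _ 1]) simp
  moreover have "g' s = g s" if "s \<in> S" for s using g'[OF that, of 0] by simp
  ultimately show ?thesis by blast
qed

text \<open>The lattice is finitely generated, so the \<open>n\<close> basis vectors are adjoined
  one after the other; precomposition with \<open>trunc\<close> then yields invariance.\<close>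

lemma mhom_extend_thom:
  fixes g :: "(nat \<Rightarrow>\<^sub>0 int) \<Rightarrow> 'k::field_char_0 alg_closure"
  assumes S: "subgrp S" "mhom S g" and tr: "\<And>s. s \<in> S \<Longrightarrow> trunc n s = s"
  shows "\<exists>h. thom n h \<and> (\<forall>s\<in>S. h s = g s)"
proof -
  have "\<exists>S' g'. subgrp S' \<and> mhom S' g' \<and> S \<subseteq> S' \<and> (\<forall>i<m. Poly_Mapping.single i 1 \<in> S') \<and> (\<forall>s\<in>S. g' s = g s)" for m
  proof (induction m)
    case 0
    then show ?case using S by blast
  next
    case (Suc m)
    then obtain S' g' where 1: "subgrp S'" "mhom S' g'" "S \<subseteq> S'" "\<forall>i<m. Poly_Mapping.single i 1 \<in> S'" "\<forall>s\<in>S. g' s = g s" by blast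
    obtain S'' g'' where 2: "subgrp S''" "mhom S'' g''" "S' \<subseteq> S''" "Poly_Mapping.single m 1 \<in> S''" "\<forall>s\<in>S'. g'' s = g' s"
      using mhom_extend[OF 1(1,2), of "Poly_Mapping.single m 1"] by blast
    show ?case using 1 2 by (intro exI[of _ S''] exI[of _ g'']) (auto simp: less_Suc_eq)
  qed
  then obtain S' g' where S': "subgrp S'" "mhom S' g'" "S \<subseteq> S'" "\<forall>i<n. Poly_Mapping.single i 1 \<in> S'" "\<forall>s\<in>S. g' s = g s" by blast
  have cm: "frag_cmul c x \<in> S'" if "x \<in> S'" for c x
  proof -
    have n: "frag_cmul (int k) x \<in> S'" for k
      by (induction k) (use that in \<open>auto simp: subgrp_0 S'(1) frag_cmul_distrib subgrp_add\<close>)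
    show ?thesis
    proof (cases "c \<ge> 0")
      case True then show ?thesis using n[of "nat c"] by simp
    next
      case False
      then show ?thesis using subgrp_diff[OF S'(1) subgrp_0[OF S'(1)] n[of "nat (- c)"]] by simp
    qed
  qed
  have "trunc n e \<in> S'" for e
  proof -
    have "(\<Sum>i\<in>A. Poly_Mapping.single i (Poly_Mapping.lookup e i)) \<in> S'" if "finite A" "A \<subseteq> {..<n}" for A
      using that
    proof (induction A rule: finite_induct)
      case (insert i A)
      have "Poly_Mapping.single i (Poly_Mapping.lookup e i) = frag_cmul (Poly_Mapping.lookup e i) (Poly_Mapping.single i 1)"
        by (rule poly_mapping_eqI) (simp add: lookup_single when_def)
      then show ?case using insert S'(4) cm by (simp add: subgrp_add[OF S'(1)])
    qed (simp add: subgrp_0[OF S'(1)])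
    then show ?thesis unfolding trunc_def by blast
  qed
  note tS = this
  have nz: "g' z \<noteq> 0" if "z \<in> S'" for z using S'(2) that by (simp add: mhom_def)
  have add: "g' (a + b) = g' a * g' b" if "a \<in> S'" "b \<in> S'" for a b using S'(2) that by (simp add: mhom_def)
  have "g' 0 = 1" using add[OF subgrp_0[OF S'(1)] subgrp_0[OF S'(1)]] nz[OF subgrp_0[OF S'(1)]] by simp
  then have "thom n (\<lambda>e. g' (trunc n e))"
    by (simp add: thom_def trunc_add add tS)
  moreover have "\<forall>s\<in>S. g' (trunc n s) = g s" using S'(5) tr by simp
  ultimately show ?thesis by blast
qed

section \<open>Surjectivity on geometric points\<close>

locale split_torus_hom = F: split_torus F n \<Phi> + P: split_torus P m \<Psi>
  for F :: "('k::field_char_0, 'f::comm_ring_1) hopf" and n \<Phi> and P :: "('k, 'p::comm_ring_1) hopf" and m \<Psi> +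
  fixes p :: "'p \<Rightarrow> 'f"
  assumes p: "group_scheme_hom F P p" and inj_p: "inj p"
begin

text \<open>Otherwise the simplifier rewrites \<open>to_ac \<circ> id\<close>, and the facts about \<open>points _ (to_ac \<circ> id)\<close> no longer match.\<close>

declare comp_id [simp del]

lemma p_hom: "is_ring_hom p" and p_strct: "p (strct P c) = strct F c"
  using p by (auto simp: group_scheme_hom_def is_alg_hom_def)

definition pm :: "(('p \<times> 'k alg_closure) \<Rightarrow>\<^sub>0 int) \<Rightarrow> (('f \<times> 'k alg_closure) \<Rightarrow>\<^sub>0 int)" where
  "pm u = frag_extend (\<lambda>(a, l). frag_of (p a, l)) u"

lemma teval_pm: "F.teval j \<phi> (pm u) = P.teval j (\<phi> \<circ> p) u"
  unfolding pm_def F.teval_feval P.teval_feval feval_extend by (rule feval_cong) auto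

sublocale points_hom: galois_points_hom "id :: 'k \<Rightarrow> 'k" F P F.torus_gens P.torus_gens p
  by (intro galois_points_hom.intro galois_points_hom_axioms.intro F.torus_galois_points[OF ac_embedding_id]
      P.torus_galois_points[OF ac_embedding_id] p)

lemma F_carrier: "carrier points_hom.H.Pt = F.pts id" and P_carrier: "carrier points_hom.G.Pt = P.pts id"
  by (rule F.Pt_carrier[OF ac_embedding_id] P.Pt_carrier[OF ac_embedding_id])+

lemma comp_p_pts: "\<phi> \<in> F.pts id \<Longrightarrow> \<phi> \<circ> p \<in> P.pts id"
  using points_hom.push_closed_point[of \<phi>] by (simp only: F_carrier P_carrier)

lemma ex_ps: "\<exists>d. trunc n d = d \<and> F.T\<Phi> (pm (P.uu e)) = Poly_Mapping.single d 1"
proof (rule F.multiplicative_is_single; unfold teval_pm P.chi_def[symmetric])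
  note id = ring_hom_id(1)
  have "F.pt id (\<lambda>_. 1) \<circ> p = P.pt id (\<lambda>_. 1)"
    using points_hom.push_one by (simp only: F.Pt_one[OF ac_embedding_id] P.Pt_one[OF ac_embedding_id])
  then show "P.chi id (F.pt id (\<lambda>_. 1) \<circ> p) e = 1" by (simp add: P.chi_pt[OF id thom_one])
  fix h h' :: "(nat \<Rightarrow>\<^sub>0 int) \<Rightarrow> 'k alg_closure" assume h: "thom n h" "thom n h'"
  note c = F.pt_in[OF id h(1)] F.pt_in[OF id h(2)]
  have "F.pt id (\<lambda>e. h e * h' e) \<circ> p = (F.pt id h \<circ> p) \<otimes>\<^bsub>points_hom.G.Pt\<^esub> (F.pt id h' \<circ> p)"
    using points_hom.push_Pt_mult[unfolded F_carrier, OF c] by (simp only: F.Pt_mult[OF ac_embedding_id])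
  then show "P.chi id (F.pt id (\<lambda>e. h e * h' e) \<circ> p) e = P.chi id (F.pt id h \<circ> p) e * P.chi id (F.pt id h' \<circ> p) e"
    by (simp only: P.chi_mult[OF ac_embedding_id comp_p_pts[OF c(1)] comp_p_pts[OF c(2)]])
qed

text \<open>The map of character lattices induced by \<open>F \<rightarrow> P\<close>, from the
  exponents of \<open>P\<close> to those of \<open>F\<close>.\<close>

definition ps :: "(nat \<Rightarrow>\<^sub>0 int) \<Rightarrow> (nat \<Rightarrow>\<^sub>0 int)" where
  "ps e = (SOME d. trunc n d = d \<and> F.T\<Phi> (pm (P.uu e)) = Poly_Mapping.single d 1)"

lemma trunc_ps: "trunc n (ps e) = ps e" and T_ps: "F.T\<Phi> (pm (P.uu e)) = Poly_Mapping.single (ps e) 1"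
  using someI_ex[OF ex_ps[of e]] by (simp_all add: ps_def)

lemma chi_ps: assumes "\<phi> \<in> F.pts id" shows "F.chi id \<phi> (ps e) = P.chi id (\<phi> \<circ> p) e"
proof -
  have "F.teval id \<phi> (F.uu (ps e)) = F.teval id \<phi> (pm (P.uu e))"
    by (rule F.teval_cong[OF ring_hom_id(1) assms]) (simp_all add: F.uu T_ps trunc_ps)
  then show ?thesis by (simp add: F.chi_def P.chi_def teval_pm)
qed

lemma thom_ps: assumes h: "thom n h" shows "thom m (\<lambda>e. h (ps e) :: 'k alg_closure)"
proof -
  note id = ring_hom_id(1)
  have "h (ps e) = P.chi id (F.pt id h \<circ> p) e" for e
    using chi_ps[OF F.pt_in[OF id h]] by (simp only: F.chi_pt[OF id h])
  then show ?thesis using P.chi_thom[OF id comp_p_pts[OF F.pt_in[OF id h]]] by simp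
qed

lemma ps_add: "ps (d + e) = ps d + ps e"
  by (rule F.lattice_eqI) (simp_all add: trunc_ps trunc_add thom_add thom_add[OF thom_ps])

text \<open>Injectivity of \<open>p\<close> survives extension of scalars: with respect to a
  \<open>k\<close>-basis of the closure, each coordinate of the tensor lies in the coordinate ring
  of \<open>P\<close> and is sent to 0 by \<open>p\<close>.\<close>

lemma pm_inj:
  assumes "F.T\<Phi> (pm w) = 0" shows "P.T\<Phi> w = 0"
proof -
  interpret V: vector_space "\<lambda>(c::'k) (x::'k alg_closure). to_ac c * x"
    by standard (simp_all add: algebra_simps)
  define B where "B = V.extend_basis {}"
  have ind: "V.independent B" and span: "V.span B = UNIV"
    unfolding B_def using V.independent_extend_basis[OF V.independent_empty] V.span_extend_basis[OF V.independent_empty] by simp_all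
  define rp where "rp x b = V.representation B x b" for x b
  have rp_add: "rp (x + y) b = rp x b + rp y b" and rp_scale: "rp (to_ac c * x) b = c * rp x b" for x y b c
    unfolding rp_def using ind span by (simp_all add: V.representation_add V.representation_scale)
  have pw: "pm w \<in> tensor_rel (strct F) to_ac UNIV" using assms by (simp add: F.tensor_rel_iff)
  have sF: "is_ring_hom (strct F)" and sP: "is_ring_hom (strct P)"
    using F.scheme P.scheme by (simp_all add: affine_group_scheme_def Let_def)
  have zero: "feval (\<lambda>q. strct P (rp (snd q) b) * fst q) w = 0" for b
  proof -
    have scale: "strct F (rp l b) * (strct F c * a) = strct F (rp (to_ac c * l) b) * a" for a c l
      unfolding rp_scale ring_hom_mult[OF sF] by (simp only: mult_ac)
    have "tensor_eval (\<lambda>a l. strct F (rp l b) * a) (pm w) = 0"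
      by (rule tensor_eval_rel[OF _ _ _ pw])
        (simp_all add: rp_add scale ring_hom_add sF distrib_left distrib_right)
    also have "tensor_eval (\<lambda>a l. strct F (rp l b) * a) (pm w) = p (feval (\<lambda>q. strct P (rp (snd q) b) * fst q) w)"
      unfolding tensor_eval_feval pm_def feval_extend feval_hom[OF p_hom]
      by (rule feval_cong) (auto simp: ring_hom_mult[OF p_hom] p_strct)
    finally show ?thesis using inj_p ring_hom_0[OF p_hom] by (metis injD)
  qed
  define D where "D = (\<Union>q\<in>Poly_Mapping.keys w. {b. rp (snd q) b \<noteq> 0})"
  have D: "finite D" unfolding D_def rp_def by (intro finite_UN_I) (simp_all add: V.finite_representation)
  have rep: "snd q = (\<Sum>b\<in>D. to_ac (rp (snd q) b) * b)" if "q \<in> Poly_Mapping.keys w" for q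
  proof -
    have "snd q = (\<Sum>b | rp (snd q) b \<noteq> 0. to_ac (rp (snd q) b) * b)"
      unfolding rp_def using V.sum_nonzero_representation_eq[OF ind, of "snd q"] span by simp
    also have "\<dots> = (\<Sum>b\<in>D. to_ac (rp (snd q) b) * b)"
      using that D by (intro sum.mono_neutral_left) (auto simp: D_def)
    finally show ?thesis .
  qed
  have "P.T\<Phi> w = feval (\<lambda>q. \<Sum>b\<in>D. \<Psi> (strct P (rp (snd q) b) * fst q) * Poly_Mapping.single 0 b) w"
    unfolding tensor_eval_feval
  proof (rule feval_cong)
    fix q assume q: "q \<in> Poly_Mapping.keys w"
    have "\<Psi> (fst q) * Poly_Mapping.single 0 (snd q) = \<Psi> (fst q) * Poly_Mapping.single 0 (\<Sum>b\<in>D. to_ac (rp (snd q) b) * b)"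
      using rep[OF q] by simp
    also have "\<dots> = (\<Sum>b\<in>D. \<Psi> (fst q) * Poly_Mapping.single 0 (to_ac (rp (snd q) b) * b))"
      by (simp only: ring_hom_sum[OF single0_hom] sum_distrib_left)
    finally show "\<Psi> (fst q) * Poly_Mapping.single 0 (snd q) = (\<Sum>b\<in>D. \<Psi> (strct P (rp (snd q) b) * fst q) * Poly_Mapping.single 0 b)"
      by (simp only: P.\<Phi>_scalar)
  qed
  also have "\<dots> = (\<Sum>b\<in>D. \<Psi> (feval (\<lambda>q. strct P (rp (snd q) b) * fst q) w) * Poly_Mapping.single 0 b)"
    by (simp only: feval_sum_fun feval_mult_right[symmetric] feval_hom[OF P.ring_\<Phi>])
  also have "\<dots> = 0" by (simp add: zero ring_hom_0 P.ring_\<Phi>)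
  finally show ?thesis .
qed

lemma ps_inj: assumes "ps d = ps e" shows "trunc m d = trunc m e"
proof -
  have "F.T\<Phi> (pm (P.uu d - P.uu e)) = 0"
    using assms by (simp add: pm_def frag_extend_diff tensor_eval_diff T_ps[unfolded pm_def])
  then have "P.T\<Phi> (P.uu d) = P.T\<Phi> (P.uu e)" using pm_inj[of "P.uu d - P.uu e"] by (simp add: tensor_eval_diff)
  then have "P.uu d \<in> P.char_class e" by (simp add: P.char_class_def P.uu)
  then have "P.char_class d = P.char_class e" by (simp add: P.char_class_def P.uu)
  then show ?thesis by (simp add: P.char_class_eq_iff)
qed

text \<open>Since \<open>ps\<close> is injective on the lattice, a point of \<open>P\<close> is a
  homomorphism on the subgroup \<open>range ps\<close>; divisibility of the multiplicative group of
  the closure extends it to a point of \<open>F\<close>.\<close>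

lemma pts_surj: assumes \<psi>: "\<psi> \<in> P.pts id" shows "\<exists>\<phi>\<in>F.pts id. \<phi> \<circ> p = \<psi>"
proof -
  note id = ring_hom_id(1)
  define h' where "h' = P.chi id \<psi>"
  have h': "thom m h'" unfolding h'_def by (rule P.chi_thom[OF id \<psi>])
  define g where "g z = h' (SOME e. ps e = z)" for z
  have g: "g (ps e) = h' e" for e
  proof -
    have "ps (SOME e'. ps e' = ps e) = ps e" by (rule someI) (rule refl)
    then have "trunc m (SOME e'. ps e' = ps e) = trunc m e" by (rule ps_inj)
    then show ?thesis unfolding g_def using thom_trunc[OF h'] by metis
  qed
  have ps0: "ps 0 = 0" using ps_add[of 0 0] by simp
  have ps_diff: "ps d - ps e = ps (d - e)" for d e using ps_add[of "d - e" e] by simp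
  have "\<exists>h. thom n h \<and> (\<forall>s\<in>range ps. h s = g s)"
  proof (rule mhom_extend_thom)
    show "subgrp (range ps)" unfolding subgrp_def using ps0 by (auto simp: ps_diff)
    show "mhom (range ps) g"
      unfolding mhom_def using thom_nonzero[OF h'] by (auto simp: g thom_add[OF h'] simp flip: ps_add)
  qed (auto simp: trunc_ps)
  then obtain h where h: "thom n h" "\<And>e. h (ps e) = h' e" using g by auto
  have "P.chi id (F.pt id h \<circ> p) = P.chi id \<psi>"
    using chi_ps[OF F.pt_in[OF id h(1)]] h(2) unfolding F.chi_pt[OF id h(1)] h'_def[symmetric] by auto
  then have "F.pt id h \<circ> p = \<psi>"
    by (rule P.chi_inj[OF ac_embedding_id comp_p_pts[OF F.pt_in[OF id h(1)]] \<psi>])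
  then show ?thesis using F.pt_in[OF id h(1)] by blast
qed

text \<open>The image of \<open>a\<close> in \<open>P\<close> is split by a point
  \<open>\<psi>\<close>, which lifts to a point \<open>z\<close> of \<open>F\<close>. A coboundary
  made from this lift corrects \<open>a\<close> so that its image becomes neutral.\<close>

lemma cocycle_into_kernel:
  assumes qt: "quasi_trivial_torus P" and a: "a \<in> carrier points_hom.H.Z"
  shows "\<exists>a'\<in>carrier points_hom.H.Z. points_hom.H.cls a' = points_hom.H.cls a \<and>
    (\<forall>\<sigma>\<in>Gal. a' \<sigma> \<circ> p = \<one>\<^bsub>points_hom.G.Pt\<^esub>)"
proof -
  note id = ring_hom_id(1)
  let ?F = points_hom.H.Pt and ?P = points_hom.G.Pt
  define b where "b = push p a"
  have b: "b \<in> carrier points_hom.G.Z" unfolding b_def by (rule points_hom.push_closed[OF a])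
  have bp: "b \<sigma> \<in> P.pts id" if "\<sigma> \<in> Gal" for \<sigma> using points_hom.G.Z_closed[OF b that] by (simp only: P_carrier)
  obtain h where h: "thom m h" "\<And>\<sigma> e. \<sigma> \<in> Gal \<Longrightarrow> h (P.act \<sigma> e) * P.chi id (b \<sigma>) (P.act \<sigma> e) = \<sigma> (h e)"
    using P.torus_hilbert90[OF qt, of b] b unfolding points_hom.G.galZ1_eq by blast
  define \<psi> where "\<psi> = P.pt id h"
  have \<psi>: "\<psi> \<in> P.pts id" unfolding \<psi>_def by (rule P.pt_in[OF id h(1)])
  have split: "\<psi> \<otimes>\<^bsub>?P\<^esub> b \<sigma> = \<sigma> \<circ> \<psi>" if s: "\<sigma> \<in> Gal" for \<sigma>
  proof -
    have "P.chi id (\<psi> \<otimes>\<^bsub>?P\<^esub> b \<sigma>) e = h e * P.chi id (b \<sigma>) e" for e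
      unfolding P.chi_mult[OF ac_embedding_id \<psi> bp[OF s]] by (simp add: \<psi>_def P.chi_pt[OF id h(1)])
    moreover have "P.chi id (\<sigma> \<circ> \<psi>) (P.act \<sigma> e) = \<sigma> (h e)" for e
      using P.chi_gal[OF ac_embedding_id s \<psi>, of e] by (simp add: gal_res_id_embedding \<psi>_def P.chi_pt[OF id h(1)])
    ultimately show ?thesis
    unfolding P.act_eq_iff_chi[OF ac_embedding_id s P.mult_pts[OF ac_embedding_id \<psi> bp[OF s]] P.gal_pts[OF ac_embedding_id s \<psi>]]
    using h(2)[OF s] by (simp add: gal_res_id_embedding)
  qed
  obtain z where z: "z \<in> carrier ?F" "z \<circ> p = \<psi>" using pts_surj[OF \<psi>] unfolding F_carrier by blast
  \<comment> \<open>A coboundary is inverse times conjugate, so the one of the inverse of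
    \<open>z\<close> is what cancels the splitting.\<close>
  define q where "q = inv\<^bsub>?F\<^esub> z"
  have q: "q \<in> carrier ?F" and qz: "q \<otimes>\<^bsub>?F\<^esub> z = \<one>\<^bsub>?F\<^esub>" and iq: "inv\<^bsub>?F\<^esub> q = z"
    using z(1) by (simp_all add: q_def)
  define a' where "a' = (\<lambda>g\<in>Gal. inv\<^bsub>?F\<^esub> q \<otimes>\<^bsub>?F\<^esub> (g \<circ> q)) \<otimes>\<^bsub>points_hom.H.Z\<^esub> a"
  have a'Z: "a' \<in> carrier points_hom.H.Z"
    unfolding a'_def by (rule points_hom.H.Z_mult_closed[OF points_hom.H.coboundary_Z[OF q] a])
  have as: "a \<sigma> \<in> carrier ?F" and sq: "\<sigma> \<circ> q \<in> carrier ?F" if "\<sigma> \<in> Gal" for \<sigma>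
    using points_hom.H.Z_closed[OF a that] points_hom.H.act_closed[OF that q] by simp_all
  have a': "a' \<sigma> = z \<otimes>\<^bsub>?F\<^esub> (\<sigma> \<circ> q) \<otimes>\<^bsub>?F\<^esub> a \<sigma>" if "\<sigma> \<in> Gal" for \<sigma>
    using that by (simp add: a'_def points_hom.H.mult_Z iq)
  have "q \<otimes>\<^bsub>?F\<^esub> a' \<sigma> = a \<sigma> \<otimes>\<^bsub>?F\<^esub> (\<sigma> \<circ> q)" if s: "\<sigma> \<in> Gal" for \<sigma>
  proof -
    have "q \<otimes>\<^bsub>?F\<^esub> a' \<sigma> = (q \<otimes>\<^bsub>?F\<^esub> z) \<otimes>\<^bsub>?F\<^esub> ((\<sigma> \<circ> q) \<otimes>\<^bsub>?F\<^esub> a \<sigma>)"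
      unfolding a'[OF s] using q z(1) as[OF s] sq[OF s] by (simp only: points_hom.H.A.m_assoc points_hom.H.A.m_closed)
    then show ?thesis using as[OF s] sq[OF s] by (simp add: qz points_hom.H.A.m_comm)
  qed
  then have "points_hom.H.cls a' = points_hom.H.cls a"
    unfolding points_hom.H.cls_eq_iff'[OF a'Z a] using q by blast
  moreover have "a' \<sigma> \<circ> p = \<one>\<^bsub>?P\<^esub>" if s: "\<sigma> \<in> Gal" for \<sigma>
  proof -
    have qp: "q \<circ> p \<in> carrier ?P" by (rule points_hom.push_closed_point[OF q])
    have \<psi>P: "\<psi> \<in> carrier ?P" using \<psi> by (simp only: P_carrier)
    have bP: "b \<sigma> \<in> carrier ?P" using bp[OF s] by (simp only: P_carrier)
    have sqp: "\<sigma> \<circ> (q \<circ> p) \<in> carrier ?P" by (rule points_hom.G.act_closed[OF s qp])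
    have "a' \<sigma> \<circ> p = \<psi> \<otimes>\<^bsub>?P\<^esub> (\<sigma> \<circ> (q \<circ> p)) \<otimes>\<^bsub>?P\<^esub> b \<sigma>"
      unfolding a'[OF s] using z s q as[OF s] sq[OF s]
      by (simp add: points_hom.push_Pt_mult b_def push_def comp_assoc)
    also have "\<dots> = (\<sigma> \<circ> (q \<circ> p)) \<otimes>\<^bsub>?P\<^esub> (\<psi> \<otimes>\<^bsub>?P\<^esub> b \<sigma>)"
      using sqp \<psi>P bP by (simp add: points_hom.G.A.m_ac)
    also have "\<dots> = (\<sigma> \<circ> (q \<circ> p)) \<otimes>\<^bsub>?P\<^esub> (\<sigma> \<circ> \<psi>)" by (simp add: split[OF s])
    also have "\<dots> = \<sigma> \<circ> ((q \<circ> p) \<otimes>\<^bsub>?P\<^esub> (z \<circ> p))"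
      unfolding z(2) by (rule points_hom.G.act_mult[OF s qp \<psi>P, symmetric])
    also have "(q \<circ> p) \<otimes>\<^bsub>?P\<^esub> (z \<circ> p) = \<one>\<^bsub>?P\<^esub>"
      using points_hom.push_Pt_mult[OF q z(1)] by (simp add: qz points_hom.push_one)
    finally show ?thesis unfolding points_hom.G.point_one_fixed[OF s] .
  qed
  ultimately show ?thesis using a'Z by blast
qed

text \<open>A point whose image in \<open>P\<close> is neutral kills the image of the augmentation
  ideal, hence the ideal it generates. That ideal is the kernel of the surjection \<open>i\<close>,
  so the point factors through \<open>i\<close>.\<close>

lemma kernel_point:
  fixes M :: "('k, 'm::comm_ring_1) hopf"
  assumes ex: "short_exact M F P i p" and \<phi>: "\<phi> \<in> carrier points_hom.H.Pt" "\<phi> \<circ> p = \<one>\<^bsub>points_hom.G.Pt\<^esub>"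
  shows "\<exists>\<chi>\<in>carrier (points M (to_ac \<circ> id)). \<chi> \<circ> i = \<phi>"
proof -
  have i: "group_scheme_hom M F i" "surj i" and ker: "{a. i a = 0} = module.span (*) (p ` {b. counit P b = 0})"
    using ex by (simp_all add: short_exact_def)
  interpret R: Modules.module "(*) :: 'f \<Rightarrow> 'f \<Rightarrow> 'f" by standard (simp_all add: algebra_simps)
  have h: "is_ring_hom \<phi>" using \<phi>(1) by (simp add: carrier_points_iff is_alg_hom_def)
  have "R.subspace {x. \<phi> x = 0}"
    by (rule R.subspaceI) (simp_all add: ring_hom_0[OF h] ring_hom_add[OF h] ring_hom_mult[OF h])
  moreover have "p ` {b. counit P b = 0} \<subseteq> {x. \<phi> x = 0}"
    using fun_cong[OF \<phi>(2)] by (auto simp: points_def)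
  ultimately have "R.span (p ` {b. counit P b = 0}) \<subseteq> {x. \<phi> x = 0}" by (rule R.span_minimal[rotated])
  then have k: "\<phi> x = 0" if "i x = 0" for x using that ker by blast
  have ri: "is_ring_hom i" using i(1) by (simp add: group_scheme_hom_def is_alg_hom_def)
  have eq: "\<phi> x = \<phi> y" if "i x = i y" for x y
    using k[of "x - y"] that by (simp add: ring_hom_diff[OF ri] ring_hom_diff[OF h])
  define \<chi> where "\<chi> y = \<phi> (inv_into UNIV i y)" for y
  have "\<chi> \<circ> i = \<phi>"
  proof
    fix x show "(\<chi> \<circ> i) x = \<phi> x" unfolding comp_apply \<chi>_def by (rule eq) (simp add: f_inv_into_f)
  qed
  moreover from this have "\<chi> \<in> carrier (points M (to_ac \<circ> id))" using \<phi>(1) by (intro point_through_surj[OF i]) simp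
  ultimately show ?thesis by blast
qed

lemma class_from_kernel:
  fixes M :: "('k, 'm::comm_ring_1) hopf"
  assumes ex: "short_exact M F P i p" and M: "affine_group_scheme M" and qt: "quasi_trivial_torus P"
    and a: "a \<in> carrier (galZ1 id F)"
  shows "\<exists>c\<in>carrier (galZ1 id M). galB1 id F #>\<^bsub>galZ1 id F\<^esub> push i c = galB1 id F #>\<^bsub>galZ1 id F\<^esub> a"
proof -
  have i: "group_scheme_hom M F i" "surj i" using ex by (simp_all add: short_exact_def)
  interpret m: galois_points_hom "id :: 'k \<Rightarrow> 'k" M F "i ` F.torus_gens" F.torus_gens i
    by (intro galois_points_hom.intro galois_points_hom_axioms.intro F.torus_galois_points[OF ac_embedding_id] i
        closed_subgroup_galois_points[OF ring_hom_id(1) M F.torus_galois_points[OF ac_embedding_id]])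
  obtain a' where a': "a' \<in> carrier points_hom.H.Z" "points_hom.H.cls a' = points_hom.H.cls a" "\<And>\<sigma>. \<sigma> \<in> Gal \<Longrightarrow> a' \<sigma> \<circ> p = \<one>\<^bsub>points_hom.G.Pt\<^esub>"
    using cocycle_into_kernel[OF qt, of a] a by (auto simp: points_hom.H.galZ1_eq)
  have "\<exists>\<chi>\<in>carrier m.H.Pt. \<chi> \<circ> i = a' \<sigma>" if "\<sigma> \<in> Gal" for \<sigma>
    by (rule kernel_point[OF ex points_hom.H.Z_closed[OF a'(1) that] a'(3)[OF that]])
  then obtain c0 where c0: "\<And>\<sigma>. \<sigma> \<in> Gal \<Longrightarrow> c0 \<sigma> \<in> carrier m.H.Pt" "\<And>\<sigma>. \<sigma> \<in> Gal \<Longrightarrow> c0 \<sigma> \<circ> i = a' \<sigma>" by metis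
  have inj: "\<phi> = \<psi>" if "\<phi> \<circ> i = \<psi> \<circ> i" for \<phi> \<psi> :: "'m \<Rightarrow> 'k alg_closure"
  proof
    fix x obtain a where "x = i a" using i(2) by (meson surjD)
    then show "\<phi> x = \<psi> x" using fun_cong[OF that, of a] by simp
  qed
  define c where "c = (\<lambda>\<sigma>\<in>Gal. c0 \<sigma>)"
  note a'Z = a'(1)[unfolded points_hom.H.mem_galZ1]
  have "c \<in> carrier m.H.Z"
    unfolding m.H.mem_galZ1
  proof (intro conjI ballI)
    show "c \<in> Gal \<rightarrow>\<^sub>E carrier m.H.Pt" using c0(1) by (simp add: c_def)
    show "c (\<sigma> \<circ> \<tau>) = c \<sigma> \<otimes>\<^bsub>m.H.Pt\<^esub> (\<sigma> \<circ> c \<tau>)" if s: "\<sigma> \<in> Gal" "\<tau> \<in> Gal" for \<sigma> \<tau>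
    proof -
      have "a' (\<sigma> \<circ> \<tau>) = a' \<sigma> \<otimes>\<^bsub>points_hom.H.Pt\<^esub> (\<sigma> \<circ> a' \<tau>)" using a'Z s by blast
      then have "c0 (\<sigma> \<circ> \<tau>) \<circ> i = (c0 \<sigma> \<otimes>\<^bsub>m.H.Pt\<^esub> (\<sigma> \<circ> c0 \<tau>)) \<circ> i"
        using m.push_Pt_mult[OF c0(1)[OF s(1)] m.H.act_closed[OF s(1) c0(1)[OF s(2)]]] s
        by (simp add: c0(2) gal_comp comp_assoc)
      then show ?thesis using s by (simp add: c_def gal_comp inj)
    qed
    obtain Y where Y: "finite Y" "\<And>\<sigma>. \<sigma> \<in> Gal \<Longrightarrow> (\<forall>x\<in>Y. \<sigma> x = x) \<Longrightarrow> a' \<sigma> = \<one>\<^bsub>points_hom.H.Pt\<^esub>" using a'Z by blast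
    have "c \<sigma> = \<one>\<^bsub>m.H.Pt\<^esub>" if "\<sigma> \<in> Gal" "\<forall>x\<in>Y. \<sigma> x = x" for \<sigma>
      using Y(2)[OF that] that(1) c0(2)[OF that(1)] by (simp add: c_def inj m.push_one)
    then show "\<exists>Y. finite Y \<and> (\<forall>\<sigma>\<in>Gal. (\<forall>x\<in>Y. \<sigma> x = x) \<longrightarrow> c \<sigma> = \<one>\<^bsub>m.H.Pt\<^esub>)" using Y(1) by blast
  qed
  moreover have "push i c = a'"
  proof
    fix \<sigma> show "push i c \<sigma> = a' \<sigma>"
      using a'(1) c0(2) by (cases "\<sigma> \<in> Gal") (auto simp: push_def c_def points_hom.H.mem_Z PiE_def extensional_def)
  qed
  ultimately show ?thesis using a'(2) by (auto simp: m.H.galZ1_eq points_hom.H.galZ1_eq points_hom.H.galB1_eq)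
qed

end

section \<open>Local classes and the cohomology of the flasque torus\<close>

abbreviation (input) gclass ::
  "('k::field \<Rightarrow> 'e::field) \<Rightarrow> ('k, 'a::comm_ring_1) hopf \<Rightarrow>
   (('e alg_closure \<Rightarrow> 'e alg_closure) \<Rightarrow> ('a \<Rightarrow> 'e alg_closure)) \<Rightarrow> _ set" where
  "gclass \<epsilon> G c \<equiv> galB1 \<epsilon> G #>\<^bsub>galZ1 \<epsilon> G\<^esub> c"

lemma completion_map_ratfun_const: "completion_map v \<circ> ratfun_const = fls_const"
  by (auto simp: completion_map_def ratfun_const_def laurent_expansion_const)

lemma local_H1_eq: "local_H1 M v = galH1 fls_const M"
  by (simp add: local_H1_def completion_map_ratfun_const)

lemma completion_map_hom: "is_ring_hom (completion_map v)"
  by (simp add: completion_map_def laurent_expansion_ring_hom)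

text \<open>The extension built into \<open>res_cocycle\<close> for the completion at
  \<open>v\<close>. Composed with \<open>\<tau>0\<close> it embeds the constants through the closure
  of \<open>k(t)\<close>, so restriction from \<open>k\<close> agrees with restriction in two
  stages.\<close>

definition \<theta> :: "('k::field_char_0 poly fract \<Rightarrow> int) \<Rightarrow> 'k poly fract alg_closure \<Rightarrow> 'k fls alg_closure" where
  "\<theta> v = ac_extension (completion_map v)"

definition \<tau>0 :: "'k::field_char_0 alg_closure \<Rightarrow> 'k poly fract alg_closure" where
  "\<tau>0 = ac_extension ratfun_const"

lemma \<theta>: "ac_embedding (completion_map v) (\<theta> v)"
  unfolding \<theta>_def by (rule ac_extension_embedding[OF completion_map_hom])

lemma \<tau>0: "ac_embedding ratfun_const \<tau>0"
  unfolding \<tau>0_def by (rule ac_extension_embedding[OF ratfun_const_hom])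

lemma \<theta>_\<tau>0: "ac_embedding fls_const (\<theta> v \<circ> \<tau>0)"
  using ac_embedding_comp[OF \<tau>0 \<theta>[of v]] by (simp only: completion_map_ratfun_const)

text \<open>\<open>F\<close> carries two splittings: over the whole closure for the comparison with
  \<open>P\<close>, and over \<open>L\<close> for flasqueness, which is recorded as
  \<open>acyclic\<close>.\<close>

locale flasque_resolution = split_torus_hom F n \<Phi> P m \<Psi> p + S: torus_splitting F L n' \<Phi>'
  for F :: "('k::field_char_0, 'f::comm_ring_1) hopf" and n \<Phi> and P :: "('k, 'p::comm_ring_1) hopf" and m \<Psi> p L n' \<Phi>' +
  fixes M :: "('k, 'm::comm_ring_1) hopf" and i :: "'f \<Rightarrow> 'm"
  assumes M: "affine_group_scheme M" and qt: "quasi_trivial_torus P" and ex: "short_exact M F P i p"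
    and acyclic: "S.stabilizers_acyclic"
begin

lemma i: "group_scheme_hom M F i" "surj i"
  using ex by (simp_all add: short_exact_def)

lemma hom_points:
  assumes "is_ring_hom \<epsilon>" "ac_embedding \<epsilon> \<tau>"
  shows "galois_points_hom \<epsilon> M F (i ` F.torus_gens) F.torus_gens i"
  by (intro galois_points_hom.intro galois_points_hom_axioms.intro F.torus_galois_points[OF assms(2)] i
      closed_subgroup_galois_points[OF assms(1) M F.torus_galois_points[OF assms(2)]])

text \<open>A relation and not a map, since a partner \<open>h\<close> is established for
  localizations of global classes and for classes restricted from \<open>k\<close>.\<close>

definition rel where
  "rel v g h \<longleftrightarrow> (\<exists>c\<in>carrier (galZ1 fls_const M). \<exists>a\<in>carrier (galZ1 id F).
     g = gclass fls_const M c \<and> h = gclass id F a \<and>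
     gclass fls_const F (push i c) = gclass fls_const F (res_along (\<theta> v \<circ> \<tau>0) a))"

lemma rel_functional: assumes "rel v g h" "rel v g h'" shows "h = h'"
proof -
  interpret E: galois_points_hom fls_const M F "i ` F.torus_gens" F.torus_gens i
    by (rule hom_points[OF fls_const_hom \<theta>_\<tau>0])
  obtain c a where 1: "c \<in> carrier (galZ1 fls_const M)" "a \<in> carrier (galZ1 id F)" "g = gclass fls_const M c" "h = gclass id F a"
     "gclass fls_const F (push i c) = gclass fls_const F (res_along (\<theta> v \<circ> \<tau>0) a)"
    using assms(1) unfolding rel_def by blast
  obtain c' a' where 2: "c' \<in> carrier (galZ1 fls_const M)" "a' \<in> carrier (galZ1 id F)" "g = gclass fls_const M c'" "h' = gclass id F a'"
     "gclass fls_const F (push i c') = gclass fls_const F (res_along (\<theta> v \<circ> \<tau>0) a')"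
    using assms(2) unfolding rel_def by blast
  have "gclass fls_const F (push i c) = gclass fls_const F (push i c')"
    using E.push_cong[of c c'] 1(1,3) 2(1,3) by (simp only: E.H.galZ1_eq E.H.galB1_eq E.G.galZ1_eq E.G.galB1_eq)
  then have "gclass fls_const F (res_along (\<theta> v \<circ> \<tau>0) a) = gclass fls_const F (res_along (\<theta> v \<circ> \<tau>0) a')"
    unfolding 1(5) 2(5) .
  then show ?thesis unfolding 1(4) 2(4) by (rule F.inflation_injective[OF \<theta>_\<tau>0 1(2) 2(2)])
qed

lemma rel_mult:
  assumes "rel v g h" "rel v g' h'"
  shows "rel v (g \<otimes>\<^bsub>galH1 fls_const M\<^esub> g') (h \<otimes>\<^bsub>galH1 id F\<^esub> h')"
proof -
  interpret E: galois_points_hom fls_const M F "i ` F.torus_gens" F.torus_gens i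
    by (rule hom_points[OF fls_const_hom \<theta>_\<tau>0])
  interpret r: galois_points_res id fls_const F F.torus_gens F.torus_gens fls_const "\<theta> v \<circ> \<tau>0"
    by (intro galois_points_res.intro galois_points_res_axioms.intro F.torus_galois_points[OF ac_embedding_id]
        F.torus_galois_points[OF \<theta>_\<tau>0] \<theta>_\<tau>0) (rule comp_id[symmetric])
  note eqs = E.H.galZ1_eq E.H.galB1_eq E.G.galZ1_eq E.G.galB1_eq E.H.galH1_eq points_hom.H.galZ1_eq points_hom.H.galB1_eq points_hom.H.galH1_eq
  note rd = rel_def[unfolded eqs]
  obtain c a where 1: "c \<in> carrier E.H.Z" "a \<in> carrier points_hom.H.Z" "g = E.H.cls c" "h = points_hom.H.cls a"
     "E.G.cls (push i c) = E.G.cls (res_along (\<theta> v \<circ> \<tau>0) a)"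
    using assms(1) unfolding rd by blast
  obtain c' a' where 2: "c' \<in> carrier E.H.Z" "a' \<in> carrier points_hom.H.Z" "g' = E.H.cls c'" "h' = points_hom.H.cls a'"
     "E.G.cls (push i c') = E.G.cls (res_along (\<theta> v \<circ> \<tau>0) a')"
    using assms(2) unfolding rd by blast
  have "E.G.cls (push i (c \<otimes>\<^bsub>E.H.Z\<^esub> c')) = E.G.cls (res_along (\<theta> v \<circ> \<tau>0) (a \<otimes>\<^bsub>points_hom.H.Z\<^esub> a'))"
    unfolding r.res_along_mult E.push_Z_mult[OF 1(1) 2(1)]
      E.G.cls_mult[OF E.push_closed[OF 1(1)] E.push_closed[OF 2(1)], symmetric]
      E.G.cls_mult[OF r.res_along_closed[OF 1(2)] r.res_along_closed[OF 2(2)], symmetric]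
    by (simp only: 1(5) 2(5))
  then show ?thesis
    unfolding rd eqs 1(3,4) 2(3,4) E.H.cls_mult[OF 1(1) 2(1)] points_hom.H.cls_mult[OF 1(2) 2(2)]
    using E.H.Z_mult_closed[OF 1(1) 2(1)] points_hom.H.Z_mult_closed[OF 1(2) 2(2)] by blast
qed

lemma global_rel:
  assumes "\<alpha> \<in> carrier (galH1 ratfun_const M)"
  shows "\<exists>h\<in>carrier (galH1 id F). \<forall>v. res_H1 (completion_map v) ratfun_const M \<alpha> \<in> carrier (galH1 fls_const M) \<and>
    rel v (res_H1 (completion_map v) ratfun_const M \<alpha>) h"
proof -
  interpret R: galois_points_hom ratfun_const M F "i ` F.torus_gens" F.torus_gens i
    by (rule hom_points[OF ratfun_const_hom \<tau>0])
  interpret E: galois_points_hom fls_const M F "i ` F.torus_gens" F.torus_gens i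
    by (rule hom_points[OF fls_const_hom \<theta>_\<tau>0])
  obtain c where c: "c \<in> carrier R.H.Z" "\<alpha> = R.H.cls c" using assms unfolding R.H.galH1_eq by (rule R.H.H1_cases)
  have "push i c \<in> carrier (galZ1 ratfun_const F)" unfolding R.G.galZ1_eq by (rule R.push_closed[OF c(1)])
  \<comment> \<open>The constant class is obtained over \<open>k(t)\<close>, before a place is
    considered; hence one \<open>h\<close> serves all \<open>v\<close>.\<close>
  from S.ratfun_class_constant[OF \<tau>0 acyclic this] obtain a where a: "a \<in> carrier points_hom.H.Z"
    "R.G.cls (push i c) = R.G.cls (res_along \<tau>0 a)" unfolding R.G.galZ1_eq R.G.galB1_eq points_hom.H.galZ1_eq by blast
  have "res_H1 (completion_map v) ratfun_const M \<alpha> \<in> carrier (galH1 fls_const M) \<and>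
    rel v (res_H1 (completion_map v) ratfun_const M \<alpha>) (points_hom.H.cls a)" for v
  proof -
    interpret rM: galois_points_res ratfun_const fls_const M "i ` F.torus_gens" "i ` F.torus_gens" "completion_map v" "\<theta> v"
      by (intro galois_points_res.intro galois_points_res_axioms.intro R.H.galois_points_axioms E.H.galois_points_axioms \<theta>)
        (rule completion_map_ratfun_const[symmetric])
    interpret rF: galois_points_res ratfun_const fls_const F F.torus_gens F.torus_gens "completion_map v" "\<theta> v"
      by (intro galois_points_res.intro galois_points_res_axioms.intro R.G.galois_points_axioms E.G.galois_points_axioms \<theta>)
        (rule completion_map_ratfun_const[symmetric])
    interpret r0: galois_points_res id ratfun_const F F.torus_gens F.torus_gens ratfun_const \<tau>0
      by (intro galois_points_res.intro galois_points_res_axioms.intro points_hom.H.galois_points_axioms R.G.galois_points_axioms \<tau>0) (rule comp_id[symmetric])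
    have cv: "res_along (\<theta> v) c \<in> carrier E.H.Z" by (rule rM.res_along_closed[OF c(1)])
    \<comment> \<open>\<open>res_H1\<close> is a union over all representatives of the class; their
      restrictions are cohomologous, so the union is a single coset.\<close>
    have "E.H.cls (res_along (\<theta> v) d) = E.H.cls (res_along (\<theta> v) c)" if "d \<in> \<alpha>" for d
    proof -
      have d: "d \<in> carrier R.H.Z" "R.H.cls d = R.H.cls c" using R.H.cls_mem[of d c] that c by simp_all
      show ?thesis by (rule rM.res_along_cong[OF d(1) c(1) d(2)])
    qed
    moreover have "c \<in> \<alpha>" using R.H.cls_self[OF c(1)] c(2) by simp
    ultimately have res: "res_H1 (completion_map v) ratfun_const M \<alpha> = E.H.cls (res_along (\<theta> v) c)"
      unfolding res_H1_def completion_map_ratfun_const E.H.galB1_eq E.H.galZ1_eq res_cocycle_eq \<theta>_def[symmetric] by blast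
    have "E.G.cls (push i (res_along (\<theta> v) c)) = E.G.cls (res_along (\<theta> v) (push i c))"
      by (simp only: push_res_along[OF \<theta>])
    also have "\<dots> = E.G.cls (res_along (\<theta> v) (res_along \<tau>0 a))"
      by (rule rF.res_along_cong[OF R.push_closed[OF c(1)] r0.res_along_closed[OF a(1)] a(2)])
    also have "\<dots> = E.G.cls (res_along (\<theta> v \<circ> \<tau>0) a)" by (simp only: res_along_res_along[OF \<tau>0 \<theta>])
    finally have "rel v (res_H1 (completion_map v) ratfun_const M \<alpha>) (points_hom.H.cls a)"
      unfolding rel_def res E.H.galZ1_eq E.H.galB1_eq E.G.galZ1_eq E.G.galB1_eq points_hom.H.galZ1_eq points_hom.H.galB1_eq
      using cv a(1) by blast
    then show ?thesis unfolding res E.H.galH1_eq using E.H.cls_closed[OF cv] by blast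
  qed
  then show ?thesis using points_hom.H.cls_closed[OF a(1)] unfolding points_hom.H.galH1_eq by blast
qed

lemma rel_surj:
  assumes "h \<in> carrier (galH1 id F)"
  shows "\<exists>g\<in>carrier (galH1 fls_const M). rel v g h"
proof -
  interpret K: galois_points_hom "id :: 'k \<Rightarrow> 'k" M F "i ` F.torus_gens" F.torus_gens i
    by (rule hom_points[OF ring_hom_id(1) ac_embedding_id])
  interpret E: galois_points_hom fls_const M F "i ` F.torus_gens" F.torus_gens i
    by (rule hom_points[OF fls_const_hom \<theta>_\<tau>0])
  interpret rF: galois_points_res id fls_const F F.torus_gens F.torus_gens fls_const "\<theta> v \<circ> \<tau>0"
    by (intro galois_points_res.intro galois_points_res_axioms.intro points_hom.H.galois_points_axioms E.G.galois_points_axioms \<theta>_\<tau>0) (rule comp_id[symmetric])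
  interpret rM: galois_points_res id fls_const M "i ` F.torus_gens" "i ` F.torus_gens" fls_const "\<theta> v \<circ> \<tau>0"
    by (intro galois_points_res.intro galois_points_res_axioms.intro K.H.galois_points_axioms E.H.galois_points_axioms \<theta>_\<tau>0) (rule comp_id[symmetric])
  obtain a where a: "a \<in> carrier points_hom.H.Z" "h = points_hom.H.cls a"
    using assms unfolding points_hom.H.galH1_eq by (rule points_hom.H.H1_cases)
  obtain c where c: "c \<in> carrier K.H.Z" "points_hom.H.cls (push i c) = points_hom.H.cls a"
    using class_from_kernel[OF ex M qt, of a] a(1)
    unfolding K.H.galZ1_eq points_hom.H.galZ1_eq points_hom.H.galB1_eq by blast
  have cv: "res_along (\<theta> v \<circ> \<tau>0) c \<in> carrier E.H.Z" by (rule rM.res_along_closed[OF c(1)])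
  have "E.G.cls (push i (res_along (\<theta> v \<circ> \<tau>0) c)) = E.G.cls (res_along (\<theta> v \<circ> \<tau>0) (push i c))"
    by (simp only: push_res_along[OF \<theta>_\<tau>0])
  also have "\<dots> = E.G.cls (res_along (\<theta> v \<circ> \<tau>0) a)"
    by (rule rF.res_along_cong[OF K.push_closed[OF c(1)] a(1) c(2)])
  finally have "rel v (E.H.cls (res_along (\<theta> v \<circ> \<tau>0) c)) h"
    unfolding rel_def a(2) E.H.galZ1_eq E.H.galB1_eq E.G.galZ1_eq E.G.galB1_eq points_hom.H.galZ1_eq points_hom.H.galB1_eq
    using cv a(1) by blast
  then show ?thesis unfolding E.H.galH1_eq using E.H.cls_closed[OF cv] by blast
qed

end

section \<open>The quotient by the closure of the global classes\<close>

text \<open>Prescribing two coordinates is an open condition, since the factors are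
  discrete.\<close>

lemma closure_of_two_coordinates:
  assumes x: "x \<in> product_topology (\<lambda>v. discrete_topology (C v)) T closure_of S" and v: "v \<in> T" "w \<in> T"
  shows "\<exists>y\<in>S. y v = x v \<and> y w = x w"
proof -
  let ?Y = "product_topology (\<lambda>v. discrete_topology (C v)) T"
  have xt: "x \<in> topspace ?Y" using x by (simp add: in_closure_of)
  have op: "openin ?Y {y \<in> topspace ?Y. y u \<in> {x u}}" if "u \<in> T" for u
  proof (rule openin_continuous_map_preimage)
    show "continuous_map ?Y (discrete_topology (C u)) (\<lambda>y. y u)"
      using continuous_map_product_projection[OF that, of "\<lambda>v. discrete_topology (C v)"] .
    show "openin (discrete_topology (C u)) {x u}" using xt that by (auto simp: topspace_product_topology PiE_iff)
  qed
  let ?U = "{y \<in> topspace ?Y. y v \<in> {x v}} \<inter> {y \<in> topspace ?Y. y w \<in> {x w}}"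
  have U: "openin ?Y ?U" by (rule openin_Int[OF op[OF v(1)] op[OF v(2)]])
  have xU: "x \<in> ?U" using xt by simp
  have "\<forall>U. x \<in> U \<and> openin ?Y U \<longrightarrow> (\<exists>y. y \<in> S \<and> y \<in> U)"
    using x unfolding in_closure_of by (rule conjunct2)
  then have "x \<in> ?U \<and> openin ?Y ?U \<longrightarrow> (\<exists>y. y \<in> S \<and> y \<in> ?U)" by (rule spec)
  from mp[OF this conjI[OF xU U]] show ?thesis by auto
qed

context flasque_resolution
begin

lemma closure_rel:
  assumes "\<nu> \<in> global_closure M T" "v \<in> T" "w \<in> T"
  shows "\<exists>h\<in>carrier (galH1 id F). rel v (\<nu> v) h \<and> rel w (\<nu> w) h"
proof -
  obtain \<alpha> where \<alpha>: "\<alpha> \<in> carrier (galH1 ratfun_const M)" "res_H1 (completion_map v) ratfun_const M \<alpha> = \<nu> v"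
    "res_H1 (completion_map w) ratfun_const M \<alpha> = \<nu> w"
    using closure_of_two_coordinates[OF assms(1)[unfolded global_closure_def] assms(2,3)] assms(2,3) by auto
  from global_rel[OF \<alpha>(1)] obtain h where h: "h \<in> carrier (galH1 id F)"
    "\<And>v. rel v (res_H1 (completion_map v) ratfun_const M \<alpha>) h" by blast
  show ?thesis using h(1) h(2)[of v] h(2)[of w] unfolding \<alpha>(2,3) by blast
qed

text \<open>\<open>coset_eq_cross\<close> multiplies by an element of the closure to unpack an
  equality of cosets.\<close>

lemma global_closure_nonempty: "\<exists>\<nu>. \<nu> \<in> global_closure M T"
proof -
  interpret R: galois_points_hom ratfun_const M F "i ` F.torus_gens" F.torus_gens i
    by (rule hom_points[OF ratfun_const_hom \<tau>0])
  let ?Y = "product_topology (\<lambda>v. discrete_topology (carrier (local_H1 M v))) T"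
  let ?S = "(\<lambda>\<alpha>. \<lambda>v\<in>T. res_H1 (completion_map v) ratfun_const M \<alpha>) ` carrier (galH1 ratfun_const M)"
  have "?S \<subseteq> topspace ?Y"
    using global_rel by (fastforce simp: topspace_product_topology local_H1_eq)
  then have "?S \<subseteq> global_closure M T" unfolding global_closure_def by (rule closure_of_subset)
  moreover have "R.H.cls \<one>\<^bsub>R.H.Z\<^esub> \<in> carrier (galH1 ratfun_const M)"
    unfolding R.H.galH1_eq by (rule R.H.cls_closed[OF R.H.Z_one_closed])
  ultimately show ?thesis by blast
qed

text \<open>Equal cosets give \<open>\<nu> x = \<nu>' y\<close> with \<open>\<nu>\<close> and
  \<open>\<nu>'\<close> in the closure, corresponding at both places to some \<open>h\<close> and
  \<open>h'\<close>. Then \<open>h a(v) = h' b(v)\<close> and \<open>h a(w) = h' b(w)\<close>; the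
  claim is that \<open>a / b\<close> takes the same value at both places, written without
  inverses.\<close>

lemma coset_eq_cross:
  assumes eq: "global_closure M T #>\<^bsub>product_group T (local_H1 M)\<^esub> x = global_closure M T #>\<^bsub>product_group T (local_H1 M)\<^esub> y"
    and x: "\<And>v. v \<in> T \<Longrightarrow> a v \<in> carrier (galH1 id F) \<and> rel v (x v) (a v)"
    and y: "\<And>v. v \<in> T \<Longrightarrow> b v \<in> carrier (galH1 id F) \<and> rel v (y v) (b v)"
    and vw: "v \<in> T" "w \<in> T"
  shows "a v \<otimes>\<^bsub>galH1 id F\<^esub> b w = a w \<otimes>\<^bsub>galH1 id F\<^esub> b v"
proof -
  interpret H: comm_group "galH1 (id :: 'k \<Rightarrow> 'k) F"
    unfolding points_hom.H.galH1_eq by (rule points_hom.H.H1_comm_group)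
  let ?H = "galH1 (id :: 'k \<Rightarrow> 'k) F" and ?G = "product_group T (local_H1 M)"
  obtain \<nu> where \<nu>: "\<nu> \<in> global_closure M T" using global_closure_nonempty by blast
  then have "\<nu> \<otimes>\<^bsub>?G\<^esub> x \<in> global_closure M T #>\<^bsub>?G\<^esub> y" unfolding eq[symmetric] by (auto simp: r_coset_def)
  then obtain \<nu>' where \<nu>': "\<nu>' \<in> global_closure M T" "\<nu> \<otimes>\<^bsub>?G\<^esub> x = \<nu>' \<otimes>\<^bsub>?G\<^esub> y" by (auto simp: r_coset_def)
  have coord: "\<nu> u \<otimes>\<^bsub>galH1 fls_const M\<^esub> x u = \<nu>' u \<otimes>\<^bsub>galH1 fls_const M\<^esub> y u" if "u \<in> T" for u
    using fun_cong[OF \<nu>'(2), of u] that by (simp add: local_H1_eq)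
  obtain h where h: "h \<in> carrier ?H" "rel v (\<nu> v) h" "rel w (\<nu> w) h" using closure_rel[OF \<nu> vw] by blast
  obtain h' where h': "h' \<in> carrier ?H" "rel v (\<nu>' v) h'" "rel w (\<nu>' w) h'" using closure_rel[OF \<nu>'(1) vw] by blast
  note x' = x[OF vw(1)] x[OF vw(2)] and y' = y[OF vw(1)] y[OF vw(2)]
  have 1: "h \<otimes>\<^bsub>?H\<^esub> a v = h' \<otimes>\<^bsub>?H\<^esub> b v"
    using rel_mult[OF h(2), of "x v" "a v"] rel_mult[OF h'(2), of "y v" "b v"] x' y' coord[OF vw(1)] rel_functional by metis
  have 2: "h \<otimes>\<^bsub>?H\<^esub> a w = h' \<otimes>\<^bsub>?H\<^esub> b w"
    using rel_mult[OF h(3), of "x w" "a w"] rel_mult[OF h'(3), of "y w" "b w"] x' y' coord[OF vw(2)] rel_functional by metis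
  have cl: "a v \<in> carrier ?H" "a w \<in> carrier ?H" "b v \<in> carrier ?H" "b w \<in> carrier ?H" using x' y' by simp_all
  have "(h \<otimes>\<^bsub>?H\<^esub> h') \<otimes>\<^bsub>?H\<^esub> (a v \<otimes>\<^bsub>?H\<^esub> b w) = (h \<otimes>\<^bsub>?H\<^esub> a v) \<otimes>\<^bsub>?H\<^esub> (h' \<otimes>\<^bsub>?H\<^esub> b w)"
    using h(1) h'(1) cl by (simp only: H.m_ac H.m_closed)
  also have "\<dots> = (h' \<otimes>\<^bsub>?H\<^esub> b v) \<otimes>\<^bsub>?H\<^esub> (h \<otimes>\<^bsub>?H\<^esub> a w)" by (simp only: 1 2)
  also have "\<dots> = (h \<otimes>\<^bsub>?H\<^esub> h') \<otimes>\<^bsub>?H\<^esub> (a w \<otimes>\<^bsub>?H\<^esub> b v)"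
    using h(1) h'(1) cl by (simp only: H.m_ac H.m_closed)
  finally show ?thesis using h(1) h'(1) cl by (simp only: H.l_cancel H.m_closed)
qed

lemma quotient_infinite:
  assumes cond: "(infinite (carrier (galH1 (id :: 'k \<Rightarrow> 'k) F)) \<and> (\<exists>v\<in>T. \<exists>w\<in>T. v \<noteq> w)) \<or>
         (\<not> trivial_group (galH1 (id :: 'k \<Rightarrow> 'k) F) \<and> infinite T)"
  shows "infinite (carrier (product_group T (local_H1 M) Mod global_closure M T))"
proof -
  interpret H: comm_group "galH1 (id :: 'k \<Rightarrow> 'k) F"
    unfolding points_hom.H.galH1_eq by (rule points_hom.H.H1_comm_group)
  let ?H = "galH1 (id :: 'k \<Rightarrow> 'k) F" and ?G = "product_group T (local_H1 M)"
  let ?Q = "carrier (?G Mod global_closure M T)"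
  have "\<forall>v. \<forall>h\<in>carrier ?H. \<exists>g. g \<in> carrier (galH1 fls_const M) \<and> rel v g h" using rel_surj by blast
  then obtain \<gamma> where \<gamma>: "\<And>v h. h \<in> carrier ?H \<Longrightarrow> \<gamma> v h \<in> carrier (galH1 fls_const M) \<and> rel v (\<gamma> v h) h" by metis
  define x where "x a = (\<lambda>v\<in>T. \<gamma> v (a v))" for a
  define q where "q a = global_closure M T #>\<^bsub>?G\<^esub> x a" for a
  have q: "q a \<in> ?Q" if "\<And>v. v \<in> T \<Longrightarrow> a v \<in> carrier ?H" for a
  proof -
    have "x a \<in> carrier ?G" using \<gamma> that by (simp add: x_def local_H1_eq)
    then show ?thesis by (auto simp: q_def FactGroup_def RCOSETS_def)
  qed
  have cross: "a v \<otimes>\<^bsub>?H\<^esub> b w = a w \<otimes>\<^bsub>?H\<^esub> b v"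
    if "q a = q b" "\<And>v. v \<in> T \<Longrightarrow> a v \<in> carrier ?H" "\<And>v. v \<in> T \<Longrightarrow> b v \<in> carrier ?H" "v \<in> T" "w \<in> T" for a b v w
    using that \<gamma> by (intro coset_eq_cross[of T "x a" "x b"]) (simp_all add: q_def x_def)
  from cond show ?thesis
  proof (elim disjE conjE bexE)
    fix v w assume inf: "infinite (carrier ?H)" and vw: "v \<in> T" "w \<in> T" "v \<noteq> w"
    \<comment> \<open>Neutral at \<open>v\<close> and \<open>h\<close> elsewhere: the ratio of the
      values at \<open>w\<close> and \<open>v\<close> is \<open>h\<close>, so different
      \<open>h\<close> give different cosets.\<close>
    define a where "a h = (\<lambda>u. if u = v then \<one>\<^bsub>?H\<^esub> else h)" for h
    have a: "a h u \<in> carrier ?H" if "h \<in> carrier ?H" for h u using that by (simp add: a_def)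
    have "inj_on (\<lambda>h. q (a h)) (carrier ?H)"
    proof (rule inj_onI)
      fix h h' assume h: "h \<in> carrier ?H" "h' \<in> carrier ?H" and "q (a h) = q (a h')"
      then have "a h v \<otimes>\<^bsub>?H\<^esub> a h' w = a h w \<otimes>\<^bsub>?H\<^esub> a h' v" using vw a by (intro cross) simp_all
      then show "h = h'" using h vw(3) by (simp add: a_def)
    qed
    then have "infinite ((\<lambda>h. q (a h)) ` carrier ?H)" using inf finite_imageD by blast
    moreover have "(\<lambda>h. q (a h)) ` carrier ?H \<subseteq> ?Q" using q a by (intro image_subsetI) simp
    ultimately show ?thesis using finite_subset by blast
  next
    assume nt: "\<not> trivial_group ?H" and inf: "infinite T"
    have "\<exists>h0\<in>carrier ?H. h0 \<noteq> \<one>\<^bsub>?H\<^esub>"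
    proof (rule ccontr)
      assume "\<not> (\<exists>h0\<in>carrier ?H. h0 \<noteq> \<one>\<^bsub>?H\<^esub>)"
      then have "carrier ?H = {\<one>\<^bsub>?H\<^esub>}" using H.one_closed by blast
      then show False using nt H.is_group by (simp add: trivial_group_def)
    qed
    then obtain h0 where h0: "h0 \<in> carrier ?H" "h0 \<noteq> \<one>\<^bsub>?H\<^esub>" by blast
    \<comment> \<open>Families supported at a single place \<open>u\<close>. Two of them are told
      apart by comparing \<open>u\<close> with a third place, where both are neutral.\<close>
    define a where "a u = (\<lambda>v. if v = u then h0 else \<one>\<^bsub>?H\<^esub>)" for u :: "'k poly fract \<Rightarrow> int"
    have a: "a u v \<in> carrier ?H" for u v using h0 by (simp add: a_def)
    have "inj_on (\<lambda>u. q (a u)) T"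
    proof (rule inj_onI, rule ccontr)
      fix u u' assume u: "u \<in> T" "u' \<in> T" and eq: "q (a u) = q (a u')" and ne: "u \<noteq> u'"
      have "infinite (T - {u, u'})" using inf by simp
      then obtain w where w: "w \<in> T" "w \<noteq> u" "w \<noteq> u'" using infinite_imp_nonempty by blast
      have "a u u \<otimes>\<^bsub>?H\<^esub> a u' w = a u w \<otimes>\<^bsub>?H\<^esub> a u' u" using eq u w a by (intro cross) simp_all
      then show False using h0 w ne by (simp add: a_def)
    qed
    then have "infinite ((\<lambda>u. q (a u)) ` T)" using inf finite_imageD by blast
    moreover have "(\<lambda>u. q (a u)) ` T \<subseteq> ?Q" using q a by (intro image_subsetI) simp
    ultimately show ?thesis using finite_subset by blast
  qed
qed

end

lemma splits_over_splitting:
  assumes "affine_group_scheme G" "splits_over G L" "intermediate L" "\<And>\<rho> x. \<rho> \<in> Gal \<Longrightarrow> x \<in> L \<Longrightarrow> \<rho> x \<in> L"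
  shows "\<exists>n \<Phi>. torus_splitting G L n \<Phi>"
proof -
  obtain n \<Phi> where "is_alg_hom (strct G) (\<lambda>c. Poly_Mapping.single 0 (to_ac c)) \<Phi>" "comul_compatible G \<Phi>"
    "range \<Phi> \<subseteq> split_torus_ring n L"
    "\<forall>u. Poly_Mapping.keys u \<subseteq> UNIV \<times> L \<and> tensor_eval (\<lambda>a l. \<Phi> a * Poly_Mapping.single 0 l) u = 0 \<longrightarrow>
             u \<in> tensor_rel (strct G) to_ac L"
    "\<forall>f\<in>split_torus_ring n L. \<exists>u. Poly_Mapping.keys u \<subseteq> UNIV \<times> L \<and>
             tensor_eval (\<lambda>a l. \<Phi> a * Poly_Mapping.single 0 l) u = f"
    using assms(2) unfolding splits_over_def by (elim exE conjE) (rule that)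
  then have "torus_splitting G L n \<Phi>" using assms(1,3,4) by unfold_locales blast+
  then show ?thesis by blast
qed

lemma torus_split:
  assumes "torus G" shows "\<exists>n \<Phi>. split_torus G n \<Phi>"
proof -
  have "\<exists>n \<Phi>. torus_splitting G UNIV n \<Phi>"
    using assms by (intro splits_over_splitting) (auto simp: torus_def intermediate_def)
  then show ?thesis by (simp add: split_torus_def)
qed

theorem theorem3p1:
  fixes M :: "('k::field_char_0, 'm::comm_ring_1) hopf"
    and F :: "('k, 'f::comm_ring_1) hopf"
    and P :: "('k, 'p::comm_ring_1) hopf"
    and i :: "'f \<Rightarrow> 'm"
    and p :: "'p \<Rightarrow> 'f"
    and T :: "('k poly fract \<Rightarrow> int) set"
  assumes "commutative_group_scheme M"
    and "finite_etale M"
    and "flasque_torus F"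
    and "quasi_trivial_torus P"
    and "short_exact M F P i p"
    and "T \<subseteq> range rational_val"
    and "(infinite (carrier (galH1 (id :: 'k \<Rightarrow> 'k) F)) \<and> (\<exists>v\<in>T. \<exists>w\<in>T. v \<noteq> w)) \<or>
         (\<not> trivial_group (galH1 (id :: 'k \<Rightarrow> 'k) F) \<and> infinite T)"
  shows "infinite (carrier (product_group T (local_H1 M) Mod global_closure M T))"
proof -
  have M: "affine_group_scheme M" using assms(1) by (simp add: commutative_group_scheme_def)
  have tF: "torus F" and tP: "torus P" using assms(3,4) by (simp_all add: flasque_torus_def quasi_trivial_torus_def)
  then have aF: "affine_group_scheme F" by (simp add: torus_def)
  obtain n \<Phi> where F: "split_torus F n \<Phi>" using torus_split[OF tF] by blast
  obtain m \<Psi> where P: "split_torus P m \<Psi>" using torus_split[OF tP] by blast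
  obtain L where L: "finite_galois L" "splits_over F L" and flasque: "\<forall>H. subgroup H (gal L) \<longrightarrow> trivial_group
      (H1 ((gal L)\<lparr>carrier := H\<rparr>) (discrete_topology H) (cocharacters F L) (\<lambda>\<sigma> \<gamma>. Poly_Mapping.map \<sigma> \<circ> \<gamma>))"
    using assms(3) unfolding flasque_torus_def by (elim exE conjE) (rule that)
  have iL: "intermediate L" using L(1) by (auto simp: finite_galois_def intermediate_def)
  have "\<exists>n' \<Phi>'. torus_splitting F L n' \<Phi>'"
    by (rule splits_over_splitting[OF aF L(2) iL]) (rule finite_galois_normal[OF L(1)])
  then obtain n' \<Phi>' where S: "torus_splitting F L n' \<Phi>'" by blast
  have acyclic: "torus_splitting.stabilizers_acyclic L n' \<Phi>'"
    by (rule torus_splitting.flasque_stabilizers_acyclic[OF S]) (use flasque in simp)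
  have p: "group_scheme_hom F P p" "inj p" using assms(5) by (simp_all add: short_exact_def)
  have "flasque_resolution F n \<Phi> P m \<Psi> p L n' \<Phi>' M i"
    by (intro flasque_resolution.intro flasque_resolution_axioms.intro split_torus_hom.intro split_torus_hom_axioms.intro
        F P S p M assms(4,5) acyclic)
  then show ?thesis by (rule flasque_resolution.quotient_infinite) (rule assms(7))
qed

end
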